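(* The algebra $U_\zeta$ is the smash product $\mathbf u_\zeta\# U$ of $\mathbf u_\zeta$ and $U=U(\mathfrak{sl}_2)$. That is, with $U$ acting on $\mathbf u_\zeta$ by $v\cdot a=\gamma(v_1)\,a\,\gamma^{-1}(v_2)$ ($v\in U$, $a\in\mathbf u_\zeta$), $\mathbf u_\zeta$ is a $U$-module algebra and the map $\mathbf u_\zeta\# U\to U_\zeta$, $a\# v\mapsto a\,\gamma(v)$, is an isomorphism of algebras.
   Context: $\Bbbk$ is a field of characteristic $0$ containing a primitive $\ell$-th root of unity $\zeta$, where $\ell>1$ is odd. $U_q$ is the generic quantum algebra of $\mathfrak{sl}_2$: the $\mathbb Q(q)$-algebra generated by $E,F,K^{\pm1}$ with $KEK^{-1}=q^2E$, $KFK^{-1}=q^{-2}F$, $EF-FE=\frac{K-K^{-1}}{q-q^{-1}}$. Put $[n]=\frac{q^n-q^{-n}}{q-q^{-1}}$, $[n]!=[1]\cdots[n]$, $E^{(n)}=E^n/[n]!$, $F^{(n)}=F^n/[n]!$. Let $U_{\mathcal A}$ be the $\mathcal A=\mathbb Z[q,q^{-1}]$-subalgebra generated by all $E^{(n)},F^{(n)},K^{\pm1}$ (Lusztig's integral form), $\hat U_\zeta=U_{\mathcal A}\otimes_{\mathcal A}\Bbbk$ with $q\mapsto\zeta$, and $U_\zeta=\hat U_\zeta/(K^\ell-1)$, the quotient by the two-sided ideal generated by $K^\ell-1$. $\mathbf u_\zeta$ is the subalgebra of $U_\zeta$ generated by $E,F,K$. $U=U(\mathfrak{sl}_2)$ is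 the ordinary enveloping algebra over $\Bbbk$ with standard basis $e,h,f$ of $\mathfrak{sl}_2$ and usual comultiplication $\Delta v=v_1\otimes v_2$ (summation suppressed). $\gamma:U\to U_\zeta$ is the algebra homomorphism with $\gamma(e)=E^{(\ell)}$, $\gamma(f)=F^{(\ell)}$, and $\gamma^{-1}$ is its convolution inverse ($\gamma^{-1}=\gamma\circ S$, $S$ the antipode of $U$). *)

theory Defs
  imports
    "HOL-Algebra.Algebraic_Closure_Type"
    "HOL-Algebra.Free_Abelian_Groups"
    "HOL-Computational_Algebra.Fraction_Field"
    "HOL-Library.Poly_Mapping"
begin

section \<open>Associative algebras over a commutative ring\<close>

text \<open>
  An algebra is a \<^typ>\<open>('r, 'a) module\<close> record whose underlying ring need not be
  commutative (the library locale \<^locale>\<open>algebra\<close> is restricted to commutative rings).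
\<close>

locale assoc_algebra = module R A + ring A for R (structure) and A (structure) +
  assumes smult_mult_left:
      "\<lbrakk>r \<in> carrier R; x \<in> carrier A; y \<in> carrier A\<rbrakk> \<Longrightarrow>
         (r \<odot>\<^bsub>A\<^esub> x) \<otimes>\<^bsub>A\<^esub> y = r \<odot>\<^bsub>A\<^esub> (x \<otimes>\<^bsub>A\<^esub> y)"
    and smult_mult_right:
      "\<lbrakk>r \<in> carrier R; x \<in> carrier A; y \<in> carrier A\<rbrakk> \<Longrightarrow>
         x \<otimes>\<^bsub>A\<^esub> (r \<odot>\<^bsub>A\<^esub> y) = r \<odot>\<^bsub>A\<^esub> (x \<otimes>\<^bsub>A\<^esub> y)"

definition with_smult :: "('a, 'm) ring_scheme \<Rightarrow> ('r \<Rightarrow> 'a \<Rightarrow> 'a) \<Rightarrow> ('r, 'a) module" where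
  "with_smult A s =
     \<lparr>carrier = carrier A, monoid.mult = monoid.mult A, one = one A,
      ring.zero = ring.zero A, add = add A, module.smult = s\<rparr>"

definition alg_hom ::
  "('r, 'p) ring_scheme \<Rightarrow> ('r, 'a, 'm) module_scheme \<Rightarrow> ('r, 'b, 'n) module_scheme \<Rightarrow> ('a \<Rightarrow> 'b) set"
where
  "alg_hom R A B =
     {f \<in> ring_hom A B. \<forall>r \<in> carrier R. \<forall>x \<in> carrier A. f (r \<odot>\<^bsub>A\<^esub> x) = r \<odot>\<^bsub>B\<^esub> f x}"

definition alg_iso ::
  "('r, 'p) ring_scheme \<Rightarrow> ('r, 'a, 'm) module_scheme \<Rightarrow> ('r, 'b, 'n) module_scheme \<Rightarrow> ('a \<Rightarrow> 'b) set"
where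
  "alg_iso R A B = {f \<in> alg_hom R A B. bij_betw f (carrier A) (carrier B)}"

inductive_set subalg_gen ::
  "('r, 'p) ring_scheme \<Rightarrow> ('r, 'a, 'm) module_scheme \<Rightarrow> 'a set \<Rightarrow> 'a set"
  for R and A and S
where
  one: "\<one>\<^bsub>A\<^esub> \<in> subalg_gen R A S"
| incl: "x \<in> S \<Longrightarrow> x \<in> subalg_gen R A S"
| smult: "\<lbrakk>r \<in> carrier R; x \<in> subalg_gen R A S\<rbrakk> \<Longrightarrow> r \<odot>\<^bsub>A\<^esub> x \<in> subalg_gen R A S"
| add: "\<lbrakk>x \<in> subalg_gen R A S; y \<in> subalg_gen R A S\<rbrakk> \<Longrightarrow> x \<oplus>\<^bsub>A\<^esub> y \<in> subalg_gen R A S"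
| mult: "\<lbrakk>x \<in> subalg_gen R A S; y \<in> subalg_gen R A S\<rbrakk> \<Longrightarrow> x \<otimes>\<^bsub>A\<^esub> y \<in> subalg_gen R A S"

definition opposite_alg :: "('r, 'a) module \<Rightarrow> ('r, 'a) module" where
  "opposite_alg A = A\<lparr>monoid.mult := \<lambda>x y. y \<otimes>\<^bsub>A\<^esub> x\<rparr>"

text \<open>Quotients by two-sided ideals (\<^const>\<open>genideal\<close> generates two-sided ideals).\<close>

definition alg_quot :: "('r, 'a) module \<Rightarrow> 'a set \<Rightarrow> ('r, 'a set) module" where
  "alg_quot A I = with_smult (A Quot I) (\<lambda>r C. \<Union>x\<in>C. I +>\<^bsub>A\<^esub> (r \<odot>\<^bsub>A\<^esub> x))"


section \<open>Algebras given by generators and relations\<close>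

datatype 'g word = Word (letters: "'g list")

text \<open>
  Words form a monoid under concatenation, written additively so that the convolution product of
  \<^typ>\<open>'g word \<Rightarrow>\<^sub>0 'k\<close> is the product of the free algebra.
\<close>

instantiation word :: (type) monoid_add
begin
definition zero_word :: "'a word" where "0 = Word []"
definition plus_word :: "'a word \<Rightarrow> 'a word \<Rightarrow> 'a word" where
  "u + v = Word (letters u @ letters v)"
instance by standard (auto simp: zero_word_def plus_word_def)
end

type_synonym ('g, 'k) free_alg = "'g word \<Rightarrow>\<^sub>0 'k"

definition gen :: "'g \<Rightarrow> ('g, 'k::comm_ring_1) free_alg" where
  "gen x = Poly_Mapping.single (Word [x]) 1"

definition scal :: "'k \<Rightarrow> ('g, 'k::comm_ring_1) free_alg" where
  "scal c = Poly_Mapping.single 0 c"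

definition free_algebra :: "('k::comm_ring_1, ('g, 'k) free_alg) module" where
  "free_algebra = with_smult ring_of_type_algebra (\<lambda>c p. scal c * p)"

definition presented :: "('g, 'k::comm_ring_1) free_alg set \<Rightarrow> ('k, ('g, 'k) free_alg set) module" where
  "presented rels = alg_quot free_algebra (Idl\<^bsub>free_algebra\<^esub> rels)"

definition presented_class ::
  "('g, 'k::comm_ring_1) free_alg set \<Rightarrow> ('g, 'k) free_alg \<Rightarrow> ('g, 'k) free_alg set" where
  "presented_class rels p = (Idl\<^bsub>free_algebra\<^esub> rels) +>\<^bsub>free_algebra\<^esub> p"

text \<open>Evaluation by substituting \<open>\<phi> x\<close> for each generator \<open>x\<close>.\<close>

definition free_eval ::
  "('k::comm_ring_1, 'b) module \<Rightarrow> ('g \<Rightarrow> 'b) \<Rightarrow> ('g, 'k) free_alg \<Rightarrow> 'b" where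
  "free_eval B \<phi> p =
     (\<Oplus>\<^bsub>B\<^esub>w \<in> Poly_Mapping.keys p.
        Poly_Mapping.lookup p w \<odot>\<^bsub>B\<^esub> foldr (\<lambda>x b. \<phi> x \<otimes>\<^bsub>B\<^esub> b) (letters w) \<one>\<^bsub>B\<^esub>)"

text \<open>
  The homomorphism induced on a presented algebra by an assignment of the generators; the choice of
  the representative is irrelevant when the assignment respects the relations.
\<close>

definition presented_lift ::
  "('k::comm_ring_1, 'b) module \<Rightarrow> ('g \<Rightarrow> 'b) \<Rightarrow> ('g, 'k) free_alg set \<Rightarrow> 'b" where
  "presented_lift B \<phi> C = free_eval B \<phi> (SOME p. p \<in> C)"


section \<open>Tensor products\<close>

text \<open>
  \<open>M \<otimes>\<^sub>R N\<close> is the free abelian group on \<open>M \<times> N\<close> modulo the relations that make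
  \<open>(x, y) \<mapsto> x \<otimes> y\<close> biadditive and \<open>R\<close>-balanced.  As for the library's free abelian groups,
  its group structure is a multiplicatively written monoid record.
\<close>

definition tensor_rels ::
  "('r, 'p) ring_scheme \<Rightarrow> ('r, 'a, 'm) module_scheme \<Rightarrow> ('r, 'b, 'n) module_scheme \<Rightarrow> ('a \<times> 'b \<Rightarrow>\<^sub>0 int) set"
where
  "tensor_rels R M N =
     {frag_of (x \<oplus>\<^bsub>M\<^esub> x', y) - frag_of (x, y) - frag_of (x', y) | x x' y.
        x \<in> carrier M \<and> x' \<in> carrier M \<and> y \<in> carrier N} \<union>
     {frag_of (x, y \<oplus>\<^bsub>N\<^esub> y') - frag_of (x, y) - frag_of (x, y') | x y y'.
        x \<in> carrier M \<and> y \<in> carrier N \<and> y' \<in> carrier N} \<union>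
     {frag_of (r \<odot>\<^bsub>M\<^esub> x, y) - frag_of (x, r \<odot>\<^bsub>N\<^esub> y) | r x y.
        r \<in> carrier R \<and> x \<in> carrier M \<and> y \<in> carrier N}"

definition tensor_null ::
  "('r, 'p) ring_scheme \<Rightarrow> ('r, 'a, 'm) module_scheme \<Rightarrow> ('r, 'b, 'n) module_scheme \<Rightarrow> ('a \<times> 'b \<Rightarrow>\<^sub>0 int) set"
where
  "tensor_null R M N =
     generate (free_Abelian_group (carrier M \<times> carrier N)) (tensor_rels R M N)"

definition tensor_group ::
  "('r, 'p) ring_scheme \<Rightarrow> ('r, 'a, 'm) module_scheme \<Rightarrow> ('r, 'b, 'n) module_scheme
     \<Rightarrow> ('a \<times> 'b \<Rightarrow>\<^sub>0 int) set monoid"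
where
  "tensor_group R M N =
     free_Abelian_group (carrier M \<times> carrier N) Mod tensor_null R M N"

definition tensor ::
  "('r, 'p) ring_scheme \<Rightarrow> ('r, 'a, 'm) module_scheme \<Rightarrow> ('r, 'b, 'n) module_scheme
     \<Rightarrow> 'a \<Rightarrow> 'b \<Rightarrow> ('a \<times> 'b \<Rightarrow>\<^sub>0 int) set"
where
  "tensor R M N x y =
     tensor_null R M N #>\<^bsub>free_Abelian_group (carrier M \<times> carrier N)\<^esub> frag_of (x, y)"

text \<open>
  The map \<open>\<Sum> x\<^sub>i \<otimes> y\<^sub>i \<mapsto> \<Sum> \<beta> x\<^sub>i y\<^sub>i\<close> into an abelian group \<open>G\<close> (written multiplicatively) induced by a
  balanced biadditive \<open>\<beta>\<close>; for such \<open>\<beta>\<close> the choice of the representative is irrelevant.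
  In particular \<open>tensor_lift G \<beta> (\<Delta> v)\<close> is the Sweedler sum \<open>\<beta> v\<^sub>1 v\<^sub>2\<close>.
\<close>

definition tensor_lift ::
  "('c, 'm) monoid_scheme \<Rightarrow> ('a \<Rightarrow> 'b \<Rightarrow> 'c) \<Rightarrow> ('a \<times> 'b \<Rightarrow>\<^sub>0 int) set \<Rightarrow> 'c" where
  "tensor_lift G \<beta> T =
     (let t = (SOME t. t \<in> T)
      in finprod G (\<lambda>(x, y). \<beta> x y [^]\<^bsub>G\<^esub> Poly_Mapping.lookup t (x, y)) (Poly_Mapping.keys t))"

definition tensor_alg ::
  "('r, 'p) ring_scheme \<Rightarrow> ('r, 'a, 'm) module_scheme \<Rightarrow> ('r, 'b, 'n) module_scheme
     \<Rightarrow> ('r, ('a \<times> 'b \<Rightarrow>\<^sub>0 int) set) module"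
where
  "tensor_alg R A B =
     (let G = tensor_group R A B; t = tensor R A B in
      \<lparr>carrier = carrier G,
       monoid.mult = (\<lambda>S T.
         tensor_lift G (\<lambda>a b. tensor_lift G (\<lambda>a' b'. t (a \<otimes>\<^bsub>A\<^esub> a') (b \<otimes>\<^bsub>B\<^esub> b')) T) S),
       one = t \<one>\<^bsub>A\<^esub> \<one>\<^bsub>B\<^esub>,
       ring.zero = one G,
       add = monoid.mult G,
       module.smult = (\<lambda>r. tensor_lift G (\<lambda>a b. t (r \<odot>\<^bsub>A\<^esub> a) b))\<rparr>)"

text \<open>
  Extension of scalars: \<open>A \<otimes>\<^sub>R k\<close> as a \<open>k\<close>-algebra, where \<open>k\<close> is a commutative \<open>R\<close>-algebra.
\<close>

definition base_change ::
  "('r, 'p) ring_scheme \<Rightarrow> ('r, 'a) module \<Rightarrow> ('r, 'k) module \<Rightarrow> ('k, ('a \<times> 'k \<Rightarrow>\<^sub>0 int) set) module"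
where
  "base_change R A k =
     with_smult (tensor_alg R A k)
       (\<lambda>c T. tensor R A k \<one>\<^bsub>A\<^esub> c \<otimes>\<^bsub>tensor_alg R A k\<^esub> T)"


section \<open>Module algebras and smash products\<close>

text \<open>Here \<open>\<Delta>\<close> and \<open>\<epsilon>\<close> are the comultiplication and counit of the bialgebra \<open>H\<close>.\<close>

locale module_algebra =
  A: assoc_algebra R A + H: assoc_algebra R H
  for R :: "('r, 'p) ring_scheme" and A :: "('r, 'a) module" and H :: "('r, 'h) module" +
  fixes \<Delta> :: "'h \<Rightarrow> ('h \<times> 'h \<Rightarrow>\<^sub>0 int) set" and \<epsilon> :: "'h \<Rightarrow> 'r" and act :: "'h \<Rightarrow> 'a \<Rightarrow> 'a"
  assumes act_closed: "\<lbrakk>v \<in> carrier H; a \<in> carrier A\<rbrakk> \<Longrightarrow> act v a \<in> carrier A"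
    and act_add_left:
      "\<lbrakk>v \<in> carrier H; w \<in> carrier H; a \<in> carrier A\<rbrakk> \<Longrightarrow>
         act (v \<oplus>\<^bsub>H\<^esub> w) a = act v a \<oplus>\<^bsub>A\<^esub> act w a"
    and act_smult_left:
      "\<lbrakk>r \<in> carrier R; v \<in> carrier H; a \<in> carrier A\<rbrakk> \<Longrightarrow> act (r \<odot>\<^bsub>H\<^esub> v) a = r \<odot>\<^bsub>A\<^esub> act v a"
    and act_add_right:
      "\<lbrakk>v \<in> carrier H; a \<in> carrier A; b \<in> carrier A\<rbrakk> \<Longrightarrow>
         act v (a \<oplus>\<^bsub>A\<^esub> b) = act v a \<oplus>\<^bsub>A\<^esub> act v b"
    and act_smult_right:
      "\<lbrakk>r \<in> carrier R; v \<in> carrier H; a \<in> carrier A\<rbrakk> \<Longrightarrow> act v (r \<odot>\<^bsub>A\<^esub> a) = r \<odot>\<^bsub>A\<^esub> act v a"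
    and act_one_left: "a \<in> carrier A \<Longrightarrow> act \<one>\<^bsub>H\<^esub> a = a"
    and act_mult_left:
      "\<lbrakk>v \<in> carrier H; w \<in> carrier H; a \<in> carrier A\<rbrakk> \<Longrightarrow> act (v \<otimes>\<^bsub>H\<^esub> w) a = act v (act w a)"
    and act_one_right: "v \<in> carrier H \<Longrightarrow> act v \<one>\<^bsub>A\<^esub> = \<epsilon> v \<odot>\<^bsub>A\<^esub> \<one>\<^bsub>A\<^esub>"
    and act_mult_right:
      "\<lbrakk>v \<in> carrier H; a \<in> carrier A; b \<in> carrier A\<rbrakk> \<Longrightarrow>
         act v (a \<otimes>\<^bsub>A\<^esub> b) = tensor_lift (add_monoid A) (\<lambda>v1 v2. act v1 a \<otimes>\<^bsub>A\<^esub> act v2 b) (\<Delta> v)"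

text \<open>The smash product \<open>A # H\<close>: the module \<open>A \<otimes> H\<close> with \<open>(a # v) (b # w) = a (v\<^sub>1 \<cdot> b) # v\<^sub>2 w\<close>.\<close>

definition smash ::
  "('r, 'p) ring_scheme \<Rightarrow> ('r, 'a) module \<Rightarrow> ('r, 'h) module \<Rightarrow> ('h \<Rightarrow> ('h \<times> 'h \<Rightarrow>\<^sub>0 int) set)
     \<Rightarrow> ('h \<Rightarrow> 'a \<Rightarrow> 'a) \<Rightarrow> ('r, ('a \<times> 'h \<Rightarrow>\<^sub>0 int) set) module"
where
  "smash R A H \<Delta> act =
     (let G = tensor_group R A H; t = tensor R A H in
      (tensor_alg R A H)\<lparr>monoid.mult := (\<lambda>S T.
         tensor_lift G (\<lambda>a v.
           tensor_lift G (\<lambda>b w.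
             tensor_lift G (\<lambda>v1 v2. t (a \<otimes>\<^bsub>A\<^esub> act v1 b) (v2 \<otimes>\<^bsub>H\<^esub> w)) (\<Delta> v)) T) S)\<rparr>)"


section \<open>The generic quantum algebra and Lusztig's integral form\<close>

type_synonym ratfun = "rat poly fract"

definition q :: ratfun where "q = Fract [:0, 1:] 1"

definition qint :: "nat \<Rightarrow> ratfun" where
  "qint n = (q ^ n - inverse q ^ n) / (q - inverse q)"

definition qfact :: "nat \<Rightarrow> ratfun" where
  "qfact n = (\<Prod>i = 1..n. qint i)"

datatype uq_gen = gE | gF | gK | gKinv

definition Uq_rels :: "(uq_gen, ratfun) free_alg set" where
  "Uq_rels =
     {gen gK * gen gKinv - 1,
      gen gKinv * gen gK - 1,
      gen gK * gen gE * gen gKinv - scal (q ^ 2) * gen gE,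
      gen gK * gen gF * gen gKinv - scal (inverse q ^ 2) * gen gF,
      gen gE * gen gF - gen gF * gen gE - scal (inverse (q - inverse q)) * (gen gK - gen gKinv)}"

type_synonym uq = "(uq_gen, ratfun) free_alg set"

definition Uq :: "(ratfun, uq) module" where
  "Uq = presented Uq_rels"

definition Uq_gen :: "uq_gen \<Rightarrow> uq" where
  "Uq_gen x = presented_class Uq_rels (gen x)"

definition divpow :: "uq_gen \<Rightarrow> nat \<Rightarrow> uq" where
  "divpow x n = inverse (qfact n) \<odot>\<^bsub>Uq\<^esub> (Uq_gen x [^]\<^bsub>Uq\<^esub> n)"

text \<open>
  \<open>\<A> = \<int>[q, q\<^sup>-\<^sup>1]\<close> is the group ring of \<open>\<int>\<close>; it acts on objects over a field through evaluation at
  \<open>q\<close> or at \<open>\<zeta>\<close>.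
\<close>

type_synonym laurent = "int \<Rightarrow>\<^sub>0 int"

abbreviation laurent_ring :: "laurent ring" where
  "laurent_ring \<equiv> ring_of_type_algebra"

definition laurent_eval :: "'k::field \<Rightarrow> laurent \<Rightarrow> 'k" where
  "laurent_eval x p = (\<Sum>i\<in>Poly_Mapping.keys p. of_int (Poly_Mapping.lookup p i) * x powi i)"

definition Uq_over_A :: "(laurent, uq) module" where
  "Uq_over_A = with_smult Uq (\<lambda>p u. laurent_eval q p \<odot>\<^bsub>Uq\<^esub> u)"

definition U_A :: "(laurent, uq) module" where
  "U_A = Uq_over_A\<lparr>carrier := subalg_gen laurent_ring Uq_over_A
     (range (divpow gE) \<union> range (divpow gF) \<union> {Uq_gen gK, Uq_gen gKinv})\<rparr>"


section \<open>Specialization at a root of unity\<close>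

definition primitive_root_of_unity :: "nat \<Rightarrow> 'k::field \<Rightarrow> bool" where
  "primitive_root_of_unity l z \<longleftrightarrow> 0 < l \<and> z ^ l = 1 \<and> (\<forall>j. 0 < j \<and> j < l \<longrightarrow> z ^ j \<noteq> 1)"

abbreviation base_field :: "'k::field ring" where
  "base_field \<equiv> ring_of_type_algebra"

definition field_at :: "'k::field \<Rightarrow> (laurent, 'k) module" where
  "field_at \<zeta> = with_smult base_field (\<lambda>p c. laurent_eval \<zeta> p * c)"

type_synonym 'k uhat = "(uq \<times> 'k \<Rightarrow>\<^sub>0 int) set"
type_synonym 'k uzeta = "'k uhat set"

definition Uhat :: "'k::field \<Rightarrow> ('k, 'k uhat) module" where
  "Uhat \<zeta> = base_change laurent_ring U_A (field_at \<zeta>)"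

definition Uhat_of :: "'k::field \<Rightarrow> uq \<Rightarrow> 'k uhat" where
  "Uhat_of \<zeta> u = tensor laurent_ring U_A (field_at \<zeta>) u 1"

definition Uzeta_ideal :: "nat \<Rightarrow> 'k::field \<Rightarrow> 'k uhat set" where
  "Uzeta_ideal l \<zeta> =
     Idl\<^bsub>Uhat \<zeta>\<^esub> {(Uhat_of \<zeta> (Uq_gen gK) [^]\<^bsub>Uhat \<zeta>\<^esub> l) \<ominus>\<^bsub>Uhat \<zeta>\<^esub> \<one>\<^bsub>Uhat \<zeta>\<^esub>}"

definition Uzeta :: "nat \<Rightarrow> 'k::field \<Rightarrow> ('k, 'k uzeta) module" where
  "Uzeta l \<zeta> = alg_quot (Uhat \<zeta>) (Uzeta_ideal l \<zeta>)"

definition Uzeta_of :: "nat \<Rightarrow> 'k::field \<Rightarrow> uq \<Rightarrow> 'k uzeta" where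
  "Uzeta_of l \<zeta> u = Uzeta_ideal l \<zeta> +>\<^bsub>Uhat \<zeta>\<^esub> Uhat_of \<zeta> u"

definition small_uzeta :: "nat \<Rightarrow> 'k::field \<Rightarrow> ('k, 'k uzeta) module" where
  "small_uzeta l \<zeta> = (Uzeta l \<zeta>)\<lparr>carrier := subalg_gen base_field (Uzeta l \<zeta>)
     {Uzeta_of l \<zeta> (Uq_gen gE), Uzeta_of l \<zeta> (Uq_gen gF), Uzeta_of l \<zeta> (Uq_gen gK)}\<rparr>"


section \<open>The enveloping algebra of sl2\<close>

datatype sl2_basis = e_sl2 | h_sl2 | f_sl2

fun sl2_bracket :: "sl2_basis \<Rightarrow> sl2_basis \<Rightarrow> (sl2_basis, 'k::field) free_alg" where
  "sl2_bracket e_sl2 f_sl2 = gen h_sl2"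
| "sl2_bracket f_sl2 e_sl2 = - gen h_sl2"
| "sl2_bracket h_sl2 e_sl2 = 2 * gen e_sl2"
| "sl2_bracket e_sl2 h_sl2 = - 2 * gen e_sl2"
| "sl2_bracket h_sl2 f_sl2 = - 2 * gen f_sl2"
| "sl2_bracket f_sl2 h_sl2 = 2 * gen f_sl2"
| "sl2_bracket _ _ = 0"

type_synonym 'k usl2 = "(sl2_basis, 'k) free_alg set"

definition Usl2_rels :: "(sl2_basis, 'k::field) free_alg set" where
  "Usl2_rels = {gen x * gen y - gen y * gen x - sl2_bracket x y | x y. True}"

definition Usl2 :: "('k::field, 'k usl2) module" where
  "Usl2 = presented Usl2_rels"

definition Usl2_gen :: "sl2_basis \<Rightarrow> 'k::field usl2" where
  "Usl2_gen x = presented_class Usl2_rels (gen x)"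

definition Usl2_comult :: "'k::field usl2 \<Rightarrow> ('k usl2 \<times> 'k usl2 \<Rightarrow>\<^sub>0 int) set" where
  "Usl2_comult =
     (let T = tensor_alg base_field Usl2 Usl2; t = tensor base_field Usl2 Usl2 in
      presented_lift T (\<lambda>x. t (Usl2_gen x) \<one>\<^bsub>Usl2\<^esub> \<oplus>\<^bsub>T\<^esub> t \<one>\<^bsub>Usl2\<^esub> (Usl2_gen x)))"

definition Usl2_counit :: "'k::field usl2 \<Rightarrow> 'k" where
  "Usl2_counit = presented_lift (with_smult base_field (*)) (\<lambda>x. 0)"

definition Usl2_antipode :: "'k::field usl2 \<Rightarrow> 'k usl2" where
  "Usl2_antipode = presented_lift (opposite_alg Usl2) (\<lambda>x. \<ominus>\<^bsub>Usl2\<^esub> Usl2_gen x)"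


section \<open>The action on the small quantum group\<close>

text \<open>\<open>v \<cdot> a = \<gamma> v\<^sub>1 a \<gamma> (S v\<^sub>2)\<close>; note that \<open>\<gamma> \<circ> S\<close> is the convolution inverse of \<open>\<gamma>\<close>.\<close>

definition gamma_action ::
  "nat \<Rightarrow> 'k::field \<Rightarrow> ('k usl2 \<Rightarrow> 'k uzeta) \<Rightarrow> 'k usl2 \<Rightarrow> 'k uzeta \<Rightarrow> 'k uzeta" where
  "gamma_action l \<zeta> \<gamma> v a =
     tensor_lift (add_monoid (Uzeta l \<zeta>))
       (\<lambda>v1 v2. \<gamma> v1 \<otimes>\<^bsub>Uzeta l \<zeta>\<^esub> a \<otimes>\<^bsub>Uzeta l \<zeta>\<^esub> \<gamma> (Usl2_antipode v2)) (Usl2_comult v)"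

definition uzeta_smash ::
  "nat \<Rightarrow> 'k::field \<Rightarrow> ('k usl2 \<Rightarrow> 'k uzeta) \<Rightarrow> ('k, ('k uzeta \<times> 'k usl2 \<Rightarrow>\<^sub>0 int) set) module" where
  "uzeta_smash l \<zeta> \<gamma> =
     smash base_field (small_uzeta l \<zeta>) Usl2 Usl2_comult (gamma_action l \<zeta> \<gamma>)"

definition smash_map ::
  "nat \<Rightarrow> 'k::field \<Rightarrow> ('k usl2 \<Rightarrow> 'k uzeta) \<Rightarrow> ('k uzeta \<times> 'k usl2 \<Rightarrow>\<^sub>0 int) set \<Rightarrow> 'k uzeta" where
  "smash_map l \<zeta> \<gamma> =
     tensor_lift (add_monoid (Uzeta l \<zeta>)) (\<lambda>a v. a \<otimes>\<^bsub>Uzeta l \<zeta>\<^esub> \<gamma> v)"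

end

theory Submission
  imports Defs
begin

text \<open>
  The generators of \<open>U\<close> are primitive, so they act on \<open>u\<^sub>\<zeta>\<close> by commutators with their images under \<open>\<gamma>\<close>,
  which makes \<open>a # v \<mapsto> a \<gamma>(v)\<close> multiplicative.  That the commutators stay in \<open>u\<^sub>\<zeta>\<close> follows
  from the commutation rule of \<open>E\<^sup>(\<^sup>l\<^sup>)\<close> with \<open>F\<close>, in which only divided powers of order less than \<open>l\<close> occur.
  The map is onto because the Gaussian binomials at \<open>\<zeta>\<close> express all divided powers
  through those of orders 1 and \<open>l\<close>.

  For injectivity, no basis of Lusztig's form is needed.  The generic algebra acts on families of
  coefficient vectors in the modules \<open>U 1\<^sub>m = U / U (K - q\<^sup>m)\<close>, \<open>m \<in> \<int>\<close>, and all divided powers act with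
  matrix entries in \<open>\<int>[q, q\<^sup>-\<^sup>1]\<close>; so \<open>U\<^sub>\<zeta>\<close> acts on the specialization.  Applied to the vectors \<open>1\<^sub>m\<close>,
  a monomial \<open>F\<^sup>i K\<^sup>j E\<^sup>k \<gamma>(f\<^sup>a h\<^sup>b e\<^sup>c)\<close> with \<open>i, j, k < l\<close> has a leading term which is a multiple of
  \<open>\<zeta>\<^sup>j\<^sup>(\<^sup>m\<^sup>+\<^sup>2\<^sup>k\<^sup>) \<lfloor>m / l\<rfloor>\<^sup>b F\<^sup>(\<^sup>l\<^sup>a\<^sup>+\<^sup>i\<^sup>) E\<^sup>(\<^sup>l\<^sup>c\<^sup>+\<^sup>k\<^sup>) 1\<^sub>m\<close>.  The dependence on \<open>\<lfloor>m / l\<rfloor>\<close> and on \<open>m\<close>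
  modulo \<open>l\<close> (a Vandermonde determinant) separates these terms.
\<close>

section \<open>Associative algebras\<close>

text \<open>Neither the tensor product nor the quotient by \<open>K^l - 1\<close> has a normal form,
  so a nonzero element of \<open>Uzeta\<close> can only be recognized through an action. Integer
  weights are the right labels for it: m and m + l give K the same eigenvalue at \<zeta>, so
  \<open>K^l - 1\<close> acts by zero, yet they differ in \<lfloor>m / l\<rfloor>. That floor is the
  value at \<zeta> of the Gaussian binomial of m over l, because Pascal's rule makes the binomial
  jump by one exactly at the multiples of l. The image of h is the commutator of
  \<open>E^(l)\<close> and \<open>F^(l)\<close>, whose leading coefficient is such a binomial;
  powers of h thus become powers of a variable running through all integers, and in characteristic 0
  polynomials in it and the factorials of a and c can be detected. Quantum factorials vanish at
  \<zeta>, so identities for divided powers are proved over Q(q), and their integral coefficients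
  are carried to \<zeta> by a relation between an element of Q(q) and its value. Associativity of
  the smash product is not computed from the Hopf structure but brought back from
  \<open>Uzeta\<close> along the bijection.\<close>

lemma with_smult_simps [simp]:
  "carrier (with_smult A s) = carrier A" "monoid.mult (with_smult A s) = monoid.mult A"
  "one (with_smult A s) = one A" "ring.zero (with_smult A s) = ring.zero A"
  "add (with_smult A s) = add A" "module.smult (with_smult A s) = s"
  by (simp_all add: with_smult_def)

lemma ring_of_type_simps [simp]:
  "carrier (ring_of_type_algebra :: 'a::ring_1 ring) = UNIV"
  "monoid.mult (ring_of_type_algebra :: 'a::ring_1 ring) = (*)"
  "one (ring_of_type_algebra :: 'a::ring_1 ring) = 1"
  "ring.zero (ring_of_type_algebra :: 'a::ring_1 ring) = 0"
  "add (ring_of_type_algebra :: 'a::ring_1 ring) = (+)"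
  by (simp_all add: ring_of_type_algebra_def)

lemma assoc_algebraI:
  fixes R (structure) and A (structure)
  assumes "module R A" "ring A"
    and "\<And>r x y. \<lbrakk>r \<in> carrier R; x \<in> carrier A; y \<in> carrier A\<rbrakk> \<Longrightarrow>
         (r \<odot>\<^bsub>A\<^esub> x) \<otimes>\<^bsub>A\<^esub> y = r \<odot>\<^bsub>A\<^esub> (x \<otimes>\<^bsub>A\<^esub> y)"
    and "\<And>r x y. \<lbrakk>r \<in> carrier R; x \<in> carrier A; y \<in> carrier A\<rbrakk> \<Longrightarrow>
         x \<otimes>\<^bsub>A\<^esub> (r \<odot>\<^bsub>A\<^esub> y) = r \<odot>\<^bsub>A\<^esub> (x \<otimes>\<^bsub>A\<^esub> y)"
  shows "assoc_algebra R A"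
  using assms by (simp add: assoc_algebra_def assoc_algebra_axioms_def)

text \<open>Every axiom for \<open>B\<close> is the image of the same axiom for \<open>A\<close>; no
  structure on \<open>B\<close> is presupposed. It yields quotient algebras from the coset map, and
  the algebra laws of the smash product from the inverse of the smash map, where a direct proof
  would be a long Sweedler computation.\<close>

lemma assoc_algebra_of_image:
  fixes R (structure) and A (structure) and B (structure)
  assumes A: "assoc_algebra R A"
    and im: "f ` carrier A = carrier B"
    and one: "f \<one>\<^bsub>A\<^esub> = \<one>\<^bsub>B\<^esub>" and zero: "f \<zero>\<^bsub>A\<^esub> = \<zero>\<^bsub>B\<^esub>"
    and add: "\<And>x y. \<lbrakk>x \<in> carrier A; y \<in> carrier A\<rbrakk> \<Longrightarrow> f (x \<oplus>\<^bsub>A\<^esub> y) = f x \<oplus>\<^bsub>B\<^esub> f y"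
    and mult: "\<And>x y. \<lbrakk>x \<in> carrier A; y \<in> carrier A\<rbrakk> \<Longrightarrow> f (x \<otimes>\<^bsub>A\<^esub> y) = f x \<otimes>\<^bsub>B\<^esub> f y"
    and smult: "\<And>r x. \<lbrakk>r \<in> carrier R; x \<in> carrier A\<rbrakk> \<Longrightarrow> f (r \<odot>\<^bsub>A\<^esub> x) = r \<odot>\<^bsub>B\<^esub> f x"
  shows "assoc_algebra R B"
proof -
  interpret A: assoc_algebra R A by (fact A)
  have R: "cring R" ..
  have ex: "\<exists>x'\<in>carrier A. x = f x'" if "x \<in> carrier B" for x
    using that im by auto
  have cl: "f x \<in> carrier B" if "x \<in> carrier A" for x
    using that im by auto
  have ab: "abelian_group B"
  proof (rule abelian_groupI)
    show "\<zero>\<^bsub>B\<^esub> \<in> carrier B" using cl[OF A.zero_closed] zero by simp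
  next
    fix x y assume "x \<in> carrier B" "y \<in> carrier B"
    then obtain x' y' where *: "x = f x'" "x' \<in> carrier A" "y = f y'" "y' \<in> carrier A"
      using ex by meson
    then show "x \<oplus>\<^bsub>B\<^esub> y \<in> carrier B" "x \<oplus>\<^bsub>B\<^esub> y = y \<oplus>\<^bsub>B\<^esub> x"
      by (simp_all add: add[symmetric] cl A.a_comm)
    fix z assume "z \<in> carrier B"
    then obtain z' where "z = f z'" "z' \<in> carrier A" using ex by meson
    with * show "(x \<oplus>\<^bsub>B\<^esub> y) \<oplus>\<^bsub>B\<^esub> z = x \<oplus>\<^bsub>B\<^esub> (y \<oplus>\<^bsub>B\<^esub> z)"
      by (simp add: add[symmetric] A.a_assoc)
  next
    fix x assume "x \<in> carrier B"
    then obtain x' where *: "x = f x'" "x' \<in> carrier A" using ex by meson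
    then show "\<zero>\<^bsub>B\<^esub> \<oplus>\<^bsub>B\<^esub> x = x"
      by (simp add: add[symmetric] zero[symmetric])
    have "f (\<ominus>\<^bsub>A\<^esub> x') \<oplus>\<^bsub>B\<^esub> x = \<zero>\<^bsub>B\<^esub>"
      using * by (simp add: add[symmetric] zero[symmetric] A.l_neg)
    then show "\<exists>y\<in>carrier B. y \<oplus>\<^bsub>B\<^esub> x = \<zero>\<^bsub>B\<^esub>"
      using * cl by blast
  qed
  have mon: "monoid B"
  proof (rule monoidI)
    show "\<one>\<^bsub>B\<^esub> \<in> carrier B" using cl[OF A.one_closed] one by simp
  next
    fix x y assume "x \<in> carrier B" "y \<in> carrier B"
    then obtain x' y' where *: "x = f x'" "x' \<in> carrier A" "y = f y'" "y' \<in> carrier A"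
      using ex by meson
    then show "x \<otimes>\<^bsub>B\<^esub> y \<in> carrier B"
      by (simp add: mult[symmetric] cl)
    fix z assume "z \<in> carrier B"
    then obtain z' where "z = f z'" "z' \<in> carrier A" using ex by meson
    with * show "(x \<otimes>\<^bsub>B\<^esub> y) \<otimes>\<^bsub>B\<^esub> z = x \<otimes>\<^bsub>B\<^esub> (y \<otimes>\<^bsub>B\<^esub> z)"
      by (simp add: mult[symmetric] A.m_assoc)
  next
    fix x assume "x \<in> carrier B"
    then obtain x' where *: "x = f x'" "x' \<in> carrier A" using ex by meson
    then show "\<one>\<^bsub>B\<^esub> \<otimes>\<^bsub>B\<^esub> x = x" "x \<otimes>\<^bsub>B\<^esub> \<one>\<^bsub>B\<^esub> = x"
      by (simp_all add: mult[symmetric] one[symmetric])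
  qed
  have ring: "ring B"
  proof (rule ringI[OF ab mon])
    fix x y z assume "x \<in> carrier B" "y \<in> carrier B" "z \<in> carrier B"
    then obtain x' y' z' where "x = f x'" "x' \<in> carrier A" "y = f y'" "y' \<in> carrier A"
      "z = f z'" "z' \<in> carrier A" using ex by meson
    then show "(x \<oplus>\<^bsub>B\<^esub> y) \<otimes>\<^bsub>B\<^esub> z = x \<otimes>\<^bsub>B\<^esub> z \<oplus>\<^bsub>B\<^esub> y \<otimes>\<^bsub>B\<^esub> z"
      "z \<otimes>\<^bsub>B\<^esub> (x \<oplus>\<^bsub>B\<^esub> y) = z \<otimes>\<^bsub>B\<^esub> x \<oplus>\<^bsub>B\<^esub> z \<otimes>\<^bsub>B\<^esub> y"
      by (simp_all add: mult[symmetric] add[symmetric] A.l_distr A.r_distr)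
  qed
  have mod: "module R B"
  proof (rule moduleI[OF R ab])
    fix a b x y assume ab: "a \<in> carrier R" "b \<in> carrier R" and "x \<in> carrier B" "y \<in> carrier B"
    then obtain x' y' where *: "x = f x'" "x' \<in> carrier A" "y = f y'" "y' \<in> carrier A"
      using ex by meson
    show "a \<odot>\<^bsub>B\<^esub> (x \<oplus>\<^bsub>B\<^esub> y) = a \<odot>\<^bsub>B\<^esub> x \<oplus>\<^bsub>B\<^esub> a \<odot>\<^bsub>B\<^esub> y"
      using ab * by (simp add: smult[symmetric] add[symmetric] A.smult_r_distr)
  next
    fix a b x assume ab: "a \<in> carrier R" "b \<in> carrier R" and "x \<in> carrier B"
    then obtain x' where *: "x = f x'" "x' \<in> carrier A" using ex by meson
    show "(a \<oplus>\<^bsub>R\<^esub> b) \<odot>\<^bsub>B\<^esub> x = a \<odot>\<^bsub>B\<^esub> x \<oplus>\<^bsub>B\<^esub> b \<odot>\<^bsub>B\<^esub> x"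
      "(a \<otimes>\<^bsub>R\<^esub> b) \<odot>\<^bsub>B\<^esub> x = a \<odot>\<^bsub>B\<^esub> (b \<odot>\<^bsub>B\<^esub> x)"
      using ab * by (simp_all add: smult[symmetric] add[symmetric] A.smult_l_distr A.smult_assoc1)
  next
    fix a x assume ab: "a \<in> carrier R" and "x \<in> carrier B"
    then obtain x' where *: "x = f x'" "x' \<in> carrier A" using ex by meson
    show "a \<odot>\<^bsub>B\<^esub> x \<in> carrier B" using ab * by (simp add: smult[symmetric] cl)
  next
    fix x assume "x \<in> carrier B"
    then obtain x' where *: "x = f x'" "x' \<in> carrier A" using ex by meson
    then show "\<one>\<^bsub>R\<^esub> \<odot>\<^bsub>B\<^esub> x = x" by (simp add: smult[symmetric])
  qed
  show ?thesis
  proof (rule assoc_algebraI[OF mod ring])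
    fix r x y assume r: "r \<in> carrier R" and "x \<in> carrier B" "y \<in> carrier B"
    then obtain x' y' where *: "x = f x'" "x' \<in> carrier A" "y = f y'" "y' \<in> carrier A"
      using ex by meson
    then show "(r \<odot>\<^bsub>B\<^esub> x) \<otimes>\<^bsub>B\<^esub> y = r \<odot>\<^bsub>B\<^esub> (x \<otimes>\<^bsub>B\<^esub> y)"
      "x \<otimes>\<^bsub>B\<^esub> (r \<odot>\<^bsub>B\<^esub> y) = r \<odot>\<^bsub>B\<^esub> (x \<otimes>\<^bsub>B\<^esub> y)"
      using r by (simp_all add: smult[symmetric] mult[symmetric] A.smult_mult_left A.smult_mult_right)
  qed
qed

lemma alg_homI:
  fixes R (structure) and A (structure) and B (structure)
  assumes "\<And>x. x \<in> carrier A \<Longrightarrow> f x \<in> carrier B" "f \<one>\<^bsub>A\<^esub> = \<one>\<^bsub>B\<^esub>"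
    and "\<And>x y. \<lbrakk>x \<in> carrier A; y \<in> carrier A\<rbrakk> \<Longrightarrow> f (x \<oplus>\<^bsub>A\<^esub> y) = f x \<oplus>\<^bsub>B\<^esub> f y"
    and "\<And>x y. \<lbrakk>x \<in> carrier A; y \<in> carrier A\<rbrakk> \<Longrightarrow> f (x \<otimes>\<^bsub>A\<^esub> y) = f x \<otimes>\<^bsub>B\<^esub> f y"
    and "\<And>r x. \<lbrakk>r \<in> carrier R; x \<in> carrier A\<rbrakk> \<Longrightarrow> f (r \<odot>\<^bsub>A\<^esub> x) = r \<odot>\<^bsub>B\<^esub> f x"
  shows "f \<in> alg_hom R A B"
  using assms by (simp add: alg_hom_def ring_hom_memI)

locale alg_morphism = A: assoc_algebra R A + B: assoc_algebra R B
  for R (structure) and A (structure) and B (structure) +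
  fixes f
  assumes morphism: "f \<in> alg_hom R A B"
begin

lemma closed [simp, intro]: "x \<in> carrier A \<Longrightarrow> f x \<in> carrier B"
  using morphism by (auto simp: alg_hom_def ring_hom_def)

lemma one [simp]: "f \<one>\<^bsub>A\<^esub> = \<one>\<^bsub>B\<^esub>"
  using morphism by (simp add: alg_hom_def ring_hom_def)

lemma add: "\<lbrakk>x \<in> carrier A; y \<in> carrier A\<rbrakk> \<Longrightarrow> f (x \<oplus>\<^bsub>A\<^esub> y) = f x \<oplus>\<^bsub>B\<^esub> f y"
  using morphism by (simp add: alg_hom_def ring_hom_def)

lemma mult: "\<lbrakk>x \<in> carrier A; y \<in> carrier A\<rbrakk> \<Longrightarrow> f (x \<otimes>\<^bsub>A\<^esub> y) = f x \<otimes>\<^bsub>B\<^esub> f y"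
  using morphism by (simp add: alg_hom_def ring_hom_def)

lemma smult: "\<lbrakk>r \<in> carrier R; x \<in> carrier A\<rbrakk> \<Longrightarrow> f (r \<odot>\<^bsub>A\<^esub> x) = r \<odot>\<^bsub>B\<^esub> f x"
  using morphism by (simp add: alg_hom_def)

lemma zero [simp]: "f \<zero>\<^bsub>A\<^esub> = \<zero>\<^bsub>B\<^esub>"
proof -
  have "f (\<zero>\<^bsub>R\<^esub> \<odot>\<^bsub>A\<^esub> \<one>\<^bsub>A\<^esub>) = \<zero>\<^bsub>R\<^esub> \<odot>\<^bsub>B\<^esub> f \<one>\<^bsub>A\<^esub>" by (rule smult) auto
  then show ?thesis by simp
qed

lemma a_inv: "x \<in> carrier A \<Longrightarrow> f (\<ominus>\<^bsub>A\<^esub> x) = \<ominus>\<^bsub>B\<^esub> f x"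
  by (metis A.add.inv_closed A.l_neg B.minus_equality add closed zero)

lemma minus: "\<lbrakk>x \<in> carrier A; y \<in> carrier A\<rbrakk> \<Longrightarrow> f (x \<ominus>\<^bsub>A\<^esub> y) = f x \<ominus>\<^bsub>B\<^esub> f y"
  by (simp add: A.minus_eq B.minus_eq add a_inv)

lemma pow: "x \<in> carrier A \<Longrightarrow> f (x [^]\<^bsub>A\<^esub> (n::nat)) = f x [^]\<^bsub>B\<^esub> n"
  by (induction n) (simp_all add: mult)

lemma kernel_ideal: "ideal {x \<in> carrier A. f x = \<zero>\<^bsub>B\<^esub>} A"
  by (rule idealI) (auto simp: A.ring_axioms add mult a_inv a_inv_def[symmetric]
      intro!: group.subgroupI[OF A.a_group] A.zero_closed)

end

section \<open>Quotients, subalgebras and restriction of scalars\<close>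

lemma alg_quot:
  assumes A: "assoc_algebra R A" and I: "ideal I A"
  shows "assoc_algebra R (alg_quot A I)"
    and "a_r_coset A I \<in> alg_hom R A (alg_quot A I)"
    and "carrier (alg_quot A I) = a_r_coset A I ` carrier A"
proof -
  interpret A: assoc_algebra R A by (fact A)
  interpret I: ideal I A by (fact I)
  have car: "carrier (alg_quot A I) = a_r_coset A I ` carrier A"
    by (auto simp: alg_quot_def FactRing_def A_RCOSETS_defs a_r_coset_def)
  have sm: "r \<odot>\<^bsub>alg_quot A I\<^esub> (I +>\<^bsub>A\<^esub> x) = I +>\<^bsub>A\<^esub> (r \<odot>\<^bsub>A\<^esub> x)" if "r \<in> carrier R" "x \<in> carrier A" for r x
  proof -
    have "I +>\<^bsub>A\<^esub> (r \<odot>\<^bsub>A\<^esub> y) = I +>\<^bsub>A\<^esub> (r \<odot>\<^bsub>A\<^esub> x)" if y: "y \<in> I +>\<^bsub>A\<^esub> x" for y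
    proof -
      have yc: "y \<in> carrier A"
        using y \<open>x \<in> carrier A\<close> I.a_subset A.a_r_coset_subset_G by blast
      have "I +>\<^bsub>A\<^esub> y = I +>\<^bsub>A\<^esub> x"
        using A.a_repr_independence[OF y \<open>x \<in> carrier A\<close> I.a_subgroup] by simp
      then have "y \<ominus>\<^bsub>A\<^esub> x \<in> I"
        using \<open>x \<in> carrier A\<close> yc A.quotient_eq_iff_same_a_r_cos[OF I] by blast
      \<comment> \<open>Ideals absorb products; they absorb scalars as well because r z = (r 1)
        z.\<close>
      then have "(r \<odot>\<^bsub>A\<^esub> \<one>\<^bsub>A\<^esub>) \<otimes>\<^bsub>A\<^esub> (y \<ominus>\<^bsub>A\<^esub> x) \<in> I"
        using that \<open>r \<in> carrier R\<close> by (intro I.I_l_closed) auto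
      then have "r \<odot>\<^bsub>A\<^esub> (y \<ominus>\<^bsub>A\<^esub> x) \<in> I"
        using \<open>r \<in> carrier R\<close> \<open>x \<in> carrier A\<close> yc by (simp add: A.smult_mult_left)
      then have "r \<odot>\<^bsub>A\<^esub> y \<ominus>\<^bsub>A\<^esub> r \<odot>\<^bsub>A\<^esub> x \<in> I"
        using \<open>r \<in> carrier R\<close> \<open>x \<in> carrier A\<close> yc by (simp add: A.minus_eq A.smult_r_distr A.smult_r_minus)
      then show ?thesis
        using \<open>r \<in> carrier R\<close> \<open>x \<in> carrier A\<close> yc by (subst A.quotient_eq_iff_same_a_r_cos[OF I, symmetric]) auto
    qed
    then have "(\<Union>y\<in>I +>\<^bsub>A\<^esub> x. I +>\<^bsub>A\<^esub> (r \<odot>\<^bsub>A\<^esub> y)) = (\<Union>y\<in>I +>\<^bsub>A\<^esub> x. I +>\<^bsub>A\<^esub> (r \<odot>\<^bsub>A\<^esub> x))"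
      by (intro SUP_cong refl)
    moreover have "I +>\<^bsub>A\<^esub> x \<noteq> {}" using I.a_rcos_self[OF \<open>x \<in> carrier A\<close>] by blast
    ultimately show ?thesis by (simp add: alg_quot_def)
  qed
  note defs = alg_quot_def FactRing_def
  have add: "I +>\<^bsub>A\<^esub> (x \<oplus>\<^bsub>A\<^esub> y) = (I +>\<^bsub>A\<^esub> x) \<oplus>\<^bsub>alg_quot A I\<^esub> (I +>\<^bsub>A\<^esub> y)" if "x \<in> carrier A" "y \<in> carrier A" for x y
    using that by (simp add: defs I.a_rcos_sum)
  have mult: "I +>\<^bsub>A\<^esub> (x \<otimes>\<^bsub>A\<^esub> y) = (I +>\<^bsub>A\<^esub> x) \<otimes>\<^bsub>alg_quot A I\<^esub> (I +>\<^bsub>A\<^esub> y)" if "x \<in> carrier A" "y \<in> carrier A" for x y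
    using that by (simp add: defs I.rcoset_mult_add)
  have one: "I +>\<^bsub>A\<^esub> \<one>\<^bsub>A\<^esub> = \<one>\<^bsub>alg_quot A I\<^esub>" by (simp add: defs)
  have zero: "I +>\<^bsub>A\<^esub> \<zero>\<^bsub>A\<^esub> = \<zero>\<^bsub>alg_quot A I\<^esub>" by (simp add: defs I.a_rcos_const)
  show "assoc_algebra R (alg_quot A I)"
    by (rule assoc_algebra_of_image[OF A, of "a_r_coset A I"]) (auto simp: car one zero add mult sm)
  show "a_r_coset A I \<in> alg_hom R A (alg_quot A I)"
    by (rule alg_homI) (auto simp: car one add mult sm)
  show "carrier (alg_quot A I) = a_r_coset A I ` carrier A" by (fact car)
qed

text \<open>Mirrors the closure rules of \<open>subalg_gen\<close>; zero and additive inverses come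
  from the scalars 0 and -1.\<close>

definition is_subalg where
  "is_subalg R A H \<longleftrightarrow> H \<subseteq> carrier A \<and> \<one>\<^bsub>A\<^esub> \<in> H \<and>
     (\<forall>x\<in>H. \<forall>y\<in>H. x \<oplus>\<^bsub>A\<^esub> y \<in> H \<and> x \<otimes>\<^bsub>A\<^esub> y \<in> H) \<and> (\<forall>r\<in>carrier R. \<forall>x\<in>H. r \<odot>\<^bsub>A\<^esub> x \<in> H)"

context assoc_algebra
begin

lemma smult_neg_one: "x \<in> carrier A \<Longrightarrow> (\<ominus> \<one>) \<odot>\<^bsub>A\<^esub> x = \<ominus>\<^bsub>A\<^esub> x"
  by (simp add: smult_l_minus)

lemma is_subalg_zero: "is_subalg R A H \<Longrightarrow> \<zero>\<^bsub>A\<^esub> \<in> H"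
  by (metis R.zero_closed is_subalg_def one_closed smult_l_null)

lemma is_subalg_a_inv: "is_subalg R A H \<Longrightarrow> x \<in> H \<Longrightarrow> \<ominus>\<^bsub>A\<^esub> x \<in> H"
  unfolding is_subalg_def
  by (metis (no_types, lifting) R.add.inv_closed R.one_closed smult_neg_one subsetD)

lemma is_subalg_minus: "is_subalg R A H \<Longrightarrow> x \<in> H \<Longrightarrow> y \<in> H \<Longrightarrow> x \<ominus>\<^bsub>A\<^esub> y \<in> H"
  by (metis is_subalg_a_inv is_subalg_def minus_eq)

lemma subalg_gen_is_subalg:
  assumes "S \<subseteq> carrier A" shows "is_subalg R A (subalg_gen R A S)"
proof -
  have "x \<in> carrier A" if "x \<in> subalg_gen R A S" for x
    using that by induction (use assms in auto)
  then show ?thesis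
    by (auto simp: is_subalg_def intro: subalg_gen.intros)
qed

lemma subalg_gen_minimal:
  assumes "is_subalg R A H" "S \<subseteq> H" shows "subalg_gen R A S \<subseteq> H"
proof
  fix x assume "x \<in> subalg_gen R A S"
  then show "x \<in> H" by induction (use assms in \<open>auto simp: is_subalg_def\<close>)
qed

lemma subalg_assoc_algebra:
  assumes H: "is_subalg R A H" shows "assoc_algebra R (A\<lparr>carrier := H\<rparr>)"
proof -
  have sub: "x \<in> carrier A" if "x \<in> H" for x using H that by (auto simp: is_subalg_def)
  have cl: "\<And>x y. x \<in> H \<Longrightarrow> y \<in> H \<Longrightarrow> x \<oplus>\<^bsub>A\<^esub> y \<in> H" "\<And>x y. x \<in> H \<Longrightarrow> y \<in> H \<Longrightarrow> x \<otimes>\<^bsub>A\<^esub> y \<in> H"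
    "\<And>r x. r \<in> carrier R \<Longrightarrow> x \<in> H \<Longrightarrow> r \<odot>\<^bsub>A\<^esub> x \<in> H" "\<one>\<^bsub>A\<^esub> \<in> H"
    using H by (auto simp: is_subalg_def)
  have ab: "abelian_group (A\<lparr>carrier := H\<rparr>)"
    by (rule abelian_groupI)
      (auto simp: sub cl is_subalg_zero[OF H] a_ac r_neg intro!: bexI[OF _ is_subalg_a_inv[OF H]])
  have mon: "Group.monoid (A\<lparr>carrier := H\<rparr>)"
    by (rule monoidI) (auto simp: sub cl m_assoc)
  show ?thesis
    by (intro assoc_algebraI moduleI ringI ab mon R.is_cring)
      (auto simp: sub cl l_distr r_distr smult_l_distr smult_r_distr smult_assoc1 smult_mult_left smult_mult_right)
qed

text \<open>The module laws are pulled back along the ring homomorphism \<open>h\<close>. With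
  \<open>laurent_eval\<close> for \<open>h\<close>, both \<open>Uq\<close> (evaluation at q) and the
  field (evaluation at \<zeta>) become algebras over the Laurent polynomials.\<close>

lemma restrict_scalars:
  assumes R': "cring R'" and h: "h \<in> ring_hom R' R"
    and s: "\<And>r x. r \<in> carrier R' \<Longrightarrow> x \<in> carrier A \<Longrightarrow> s r x = h r \<odot>\<^bsub>A\<^esub> x"
  shows "assoc_algebra R' (with_smult A s)"
proof -
  note ab = is_abelian_group and mon = monoid_axioms
  have hc: "h r \<in> carrier R" if "r \<in> carrier R'" for r using h that by (rule ring_hom_closed)
  have ab': "abelian_group (with_smult A s)"
    by (rule abelian_groupI) (auto simp: a_ac r_neg intro!: bexI[where x = "\<ominus>\<^bsub>A\<^esub> _"])
  have mon': "Group.monoid (with_smult A s)"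
    by (rule monoidI) (auto simp: m_assoc)
  interpret R': cring R' by (fact R')
  show ?thesis
    by (intro assoc_algebraI moduleI ringI ab' mon' R')
      (auto simp: s hc l_distr r_distr smult_l_distr smult_r_distr smult_assoc1 smult_mult_left smult_mult_right
        ring_hom_add[OF h] ring_hom_mult[OF h] ring_hom_one[OF h])
qed

end

lemma cring_ring_of_type: "cring (ring_of_type_algebra :: 'a::comm_ring_1 ring)"
  by (rule cring_from_type_algebra)

lemma assoc_algebra_of_type:
  assumes s: "\<And>r x y. s r (x + y) = s r x + s r y" "\<And>r t x. s (r + t) x = s r x + s t x"
    "\<And>r t x. s (r * t) x = s r (s t x)" "\<And>x. s 1 x = x"
    "\<And>r x y. s r x * y = s r (x * y)" "\<And>r x y. x * s r y = s r (x * y)"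
  shows "assoc_algebra (ring_of_type_algebra :: 'r::comm_ring_1 ring)
    (with_smult (ring_of_type_algebra :: 'a::ring_1 ring) s)"
proof -
  have ab: "abelian_group (with_smult (ring_of_type_algebra :: 'a::ring_1 ring) s)"
    by (rule abelian_groupI) (auto simp: algebra_simps intro!: exI[where x = "- _"])
  have mon: "Group.monoid (with_smult (ring_of_type_algebra :: 'a::ring_1 ring) s)"
    by (rule monoidI) (auto simp: algebra_simps)
  show ?thesis
    by (intro assoc_algebraI moduleI ringI ab mon cring_ring_of_type) (auto simp: s algebra_simps)
qed

section \<open>Tensor products\<close>

text \<open>The conditions under which \<open>tensor_lift\<close> is independent of the chosen
  representative: beyond closure, one clause for each of the three families in
  \<open>tensor_rels\<close>. The target is only an abelian group, so linearity over
  \<open>R\<close> is a separate matter, see \<open>tensor_lift_smult\<close>.\<close>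

definition balanced where
  "balanced R M N B \<beta> \<longleftrightarrow>
     (\<forall>x\<in>carrier M. \<forall>y\<in>carrier N. \<beta> x y \<in> carrier B) \<and>
     (\<forall>x\<in>carrier M. \<forall>x'\<in>carrier M. \<forall>y\<in>carrier N. \<beta> (x \<oplus>\<^bsub>M\<^esub> x') y = \<beta> x y \<oplus>\<^bsub>B\<^esub> \<beta> x' y) \<and>
     (\<forall>x\<in>carrier M. \<forall>y\<in>carrier N. \<forall>y'\<in>carrier N. \<beta> x (y \<oplus>\<^bsub>N\<^esub> y') = \<beta> x y \<oplus>\<^bsub>B\<^esub> \<beta> x y') \<and>
     (\<forall>r\<in>carrier R. \<forall>x\<in>carrier M. \<forall>y\<in>carrier N. \<beta> (r \<odot>\<^bsub>M\<^esub> x) y = \<beta> x (r \<odot>\<^bsub>N\<^esub> y))"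

lemma balancedI:
  assumes "\<And>x y. \<lbrakk>x \<in> carrier M; y \<in> carrier N\<rbrakk> \<Longrightarrow> \<beta> x y \<in> carrier B"
    and "\<And>x x' y. \<lbrakk>x \<in> carrier M; x' \<in> carrier M; y \<in> carrier N\<rbrakk> \<Longrightarrow> \<beta> (x \<oplus>\<^bsub>M\<^esub> x') y = \<beta> x y \<oplus>\<^bsub>B\<^esub> \<beta> x' y"
    and "\<And>x y y'. \<lbrakk>x \<in> carrier M; y \<in> carrier N; y' \<in> carrier N\<rbrakk> \<Longrightarrow> \<beta> x (y \<oplus>\<^bsub>N\<^esub> y') = \<beta> x y \<oplus>\<^bsub>B\<^esub> \<beta> x y'"
    and "\<And>r x y. \<lbrakk>r \<in> carrier R; x \<in> carrier M; y \<in> carrier N\<rbrakk> \<Longrightarrow> \<beta> (r \<odot>\<^bsub>M\<^esub> x) y = \<beta> x (r \<odot>\<^bsub>N\<^esub> y)"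
  shows "balanced R M N B \<beta>"
  using assms by (simp add: balanced_def)

text \<open>\<open>t\<close> is the integral combination of its keys, and \<open>h\<close> respects
  sums and integer multiples. The left side is the expression in \<open>tensor_lift\<close>, which
  thereby becomes the value of a homomorphism at a representative.\<close>

lemma hom_eq_finprod:
  assumes G: "comm_group G" and h: "h \<in> hom (free_Abelian_group S) G" and t: "Poly_Mapping.keys t \<subseteq> S"
  shows "finprod G (\<lambda>a. h (frag_of a) [^]\<^bsub>G\<^esub> Poly_Mapping.lookup t a) (Poly_Mapping.keys t) = h t"
proof -
  interpret G: comm_group G by (fact G)
  interpret h: group_hom "free_Abelian_group S" G h
    using h by (simp add: group_hom_def group_hom_axioms_def G.is_group)
  have fin: "finprod G (\<lambda>a. h (frag_of a) [^]\<^bsub>G\<^esub> c a) K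
      = h (\<Sum>a\<in>K. frag_cmul (c a) (frag_of a)) \<and> Poly_Mapping.keys (\<Sum>a\<in>K. frag_cmul (c a) (frag_of a)) \<subseteq> S"
    if "finite K" "K \<subseteq> S" for K :: "_ set" and c
    using that
  proof induction
    case empty
    then show ?case using h.hom_one by simp
  next
    case (insert a K)
    let ?s = "\<Sum>a\<in>K. frag_cmul (c a) (frag_of a)"
    have s: "Poly_Mapping.keys ?s \<subseteq> S" using insert by simp
    have a: "Poly_Mapping.keys (frag_cmul (c a) (frag_of a)) \<subseteq> S"
      using insert.prems keys_cmul[of "c a" "frag_of a"] by auto
    have hc: "h (frag_of b) \<in> carrier G" if "b \<in> S" for b
      using that by (intro h.hom_closed) simp
    have "h (frag_cmul (c a) (frag_of a)) = h (frag_of a) [^]\<^bsub>G\<^esub> c a"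
      using h.hom_int_pow[of "frag_of a" "c a"] insert.prems by simp
    moreover have "h (frag_cmul (c a) (frag_of a) + ?s) = h (frag_cmul (c a) (frag_of a)) \<otimes>\<^bsub>G\<^esub> h ?s"
      using h.hom_mult[of "frag_cmul (c a) (frag_of a)" ?s] a s by simp
    moreover have "finprod G (\<lambda>a. h (frag_of a) [^]\<^bsub>G\<^esub> c a) (insert a K)
      = h (frag_of a) [^]\<^bsub>G\<^esub> c a \<otimes>\<^bsub>G\<^esub> finprod G (\<lambda>a. h (frag_of a) [^]\<^bsub>G\<^esub> c a) K"
      using insert hc by (intro G.finprod_insert) auto
    moreover have "Poly_Mapping.keys (frag_cmul (c a) (frag_of a) + ?s) \<subseteq> S"
      using a s Poly_Mapping.keys_add[of "frag_cmul (c a) (frag_of a)" ?s] by blast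
    ultimately show ?case using insert by simp
  qed
  have "t = (\<Sum>a\<in>Poly_Mapping.keys t. frag_cmul (Poly_Mapping.lookup t a) (frag_of a))"
    using frag_expansion[of t] by (simp add: frag_extend_def)
  with fin[OF finite_keys t, of "Poly_Mapping.lookup t"] show ?thesis by simp
qed

locale tensor_modules = M: module R M + N: module R N
  for R (structure) and M (structure) and N (structure)
begin

abbreviation "F \<equiv> free_Abelian_group (carrier M \<times> carrier N)"
abbreviation "T \<equiv> tensor_alg R M N"
abbreviation "t \<equiv> tensor R M N"

lemma rels_closed: "tensor_rels R M N \<subseteq> carrier F"
proof -
  have k: "a - b \<in> carrier F" if "a \<in> carrier F" "b \<in> carrier F" for a b
    using that keys_diff[of a b] by auto
  show ?thesis
    unfolding tensor_rels_def by (auto simp del: carrier_free_Abelian_group_iff intro!: k)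
qed

lemma null_subgroup: "subgroup (tensor_null R M N) F"
  unfolding tensor_null_def by (rule group.generate_is_subgroup) (use rels_closed in auto)

lemma null_normal: "normal (tensor_null R M N) F"
  by (rule comm_group.subgroup_imp_normal[OF abelian_free_Abelian_group null_subgroup])

lemma tensor_alg_simps:
  "carrier T = carrier (tensor_group R M N)" "add T = monoid.mult (tensor_group R M N)"
  "ring.zero T = one (tensor_group R M N)"
  by (simp_all add: tensor_alg_def Let_def)

text \<open>Products in \<open>tensor_alg\<close> and \<open>smash\<close> are defined with the
  multiplicative record \<open>tensor_group\<close>, while the theory below uses the additive monoid
  of \<open>T\<close>. The two agree in their operations but differ as records, so powers and
  products are unfolded to compare them.\<close>

lemma tensor_lift_tensor_group: "tensor_lift (tensor_group R M N) = tensor_lift (add_monoid T)"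
  unfolding tensor_lift_def finprod_def int_pow_def nat_pow_def m_inv_def
  by (simp add: tensor_alg_simps cong: if_cong)

lemma tensor_comm_group: "comm_group (tensor_group R M N)"
  unfolding tensor_group_def
  by (rule comm_group.abelian_FactGroup[OF abelian_free_Abelian_group null_subgroup])

lemma abelian_group_tensor: "abelian_group T"
proof -
  interpret G: comm_group "tensor_group R M N" by (rule tensor_comm_group)
  show ?thesis
    by (rule abelian_groupI)
      (simp_all add: tensor_alg_simps G.m_ac G.l_inv_ex)
qed

sublocale T: abelian_group T by (rule abelian_group_tensor)

lemma carrier_tensor: "carrier T = (\<lambda>p. tensor_null R M N #>\<^bsub>F\<^esub> p) ` carrier F"
  by (auto simp: tensor_alg_def Let_def tensor_group_def FactGroup_def RCOSETS_def)

lemma coset_add: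
  assumes "p \<in> carrier F" "p' \<in> carrier F"
  shows "(tensor_null R M N #>\<^bsub>F\<^esub> p) \<oplus>\<^bsub>T\<^esub> (tensor_null R M N #>\<^bsub>F\<^esub> p') = tensor_null R M N #>\<^bsub>F\<^esub> (p + p')"
  using normal.rcos_sum[OF null_normal assms]
  by (simp add: tensor_alg_def Let_def tensor_group_def FactGroup_def)

lemma coset_zero: "tensor_null R M N #>\<^bsub>F\<^esub> 0 = \<zero>\<^bsub>T\<^esub>"
  using group.coset_mult_one[OF group_free_Abelian_group subgroup.subset[OF null_subgroup]]
  by (simp add: tensor_alg_simps tensor_group_def FactGroup_def)

lemma coset_closed: "p \<in> carrier F \<Longrightarrow> tensor_null R M N #>\<^bsub>F\<^esub> p \<in> carrier T"
  unfolding carrier_tensor by (rule imageI)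

lemma coset_eq:
  assumes "p \<in> carrier F" "p' \<in> carrier F" "p - p' \<in> tensor_null R M N"
  shows "tensor_null R M N #>\<^bsub>F\<^esub> p = tensor_null R M N #>\<^bsub>F\<^esub> p'"
proof -
  interpret F: group F by simp
  have "p \<in> tensor_null R M N #>\<^bsub>F\<^esub> p'"
    using assms by (auto simp: r_coset_def intro!: bexI[where x = "p - p'"])
  from F.repr_independence[OF this _ null_subgroup] assms show ?thesis by simp
qed

lemma tensor_closed [simp, intro]: "x \<in> carrier M \<Longrightarrow> y \<in> carrier N \<Longrightarrow> t x y \<in> carrier T"
  by (auto simp: carrier_tensor tensor_def)

lemma null_incl: "p \<in> tensor_rels R M N \<Longrightarrow> p \<in> tensor_null R M N"
  by (auto simp: tensor_null_def intro: generate.incl)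

lemma tensor_add_left:
  assumes "x \<in> carrier M" "x' \<in> carrier M" "y \<in> carrier N"
  shows "t (x \<oplus>\<^bsub>M\<^esub> x') y = t x y \<oplus>\<^bsub>T\<^esub> t x' y"
proof -
  have k: "frag_of (x, y) + frag_of (x', y) \<in> carrier F"
    using Poly_Mapping.keys_add[of "frag_of (x, y)" "frag_of (x', y)"] assms by auto
  have "frag_of (x \<oplus>\<^bsub>M\<^esub> x', y) - frag_of (x, y) - frag_of (x', y) \<in> tensor_rels R M N"
    using assms by (auto simp: tensor_rels_def)
  then have "frag_of (x \<oplus>\<^bsub>M\<^esub> x', y) - (frag_of (x, y) + frag_of (x', y)) \<in> tensor_null R M N"
    by (auto simp: diff_diff_eq dest: null_incl)
  from coset_eq[OF _ k this] show ?thesis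
    using assms by (simp add: tensor_def coset_add)
qed

lemma tensor_add_right:
  assumes "x \<in> carrier M" "y \<in> carrier N" "y' \<in> carrier N"
  shows "t x (y \<oplus>\<^bsub>N\<^esub> y') = t x y \<oplus>\<^bsub>T\<^esub> t x y'"
proof -
  have k: "frag_of (x, y) + frag_of (x, y') \<in> carrier F"
    using Poly_Mapping.keys_add[of "frag_of (x, y)" "frag_of (x, y')"] assms by auto
  have "frag_of (x, y \<oplus>\<^bsub>N\<^esub> y') - frag_of (x, y) - frag_of (x, y') \<in> tensor_rels R M N"
    using assms by (auto simp: tensor_rels_def)
  then have "frag_of (x, y \<oplus>\<^bsub>N\<^esub> y') - (frag_of (x, y) + frag_of (x, y')) \<in> tensor_null R M N"
    by (auto simp: diff_diff_eq dest: null_incl)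
  from coset_eq[OF _ k this] show ?thesis
    using assms by (simp add: tensor_def coset_add)
qed

lemma tensor_balanced:
  assumes "r \<in> carrier R" "x \<in> carrier M" "y \<in> carrier N"
  shows "t (r \<odot>\<^bsub>M\<^esub> x) y = t x (r \<odot>\<^bsub>N\<^esub> y)"
proof -
  have "frag_of (r \<odot>\<^bsub>M\<^esub> x, y) - frag_of (x, r \<odot>\<^bsub>N\<^esub> y) \<in> tensor_rels R M N"
    using assms by (auto simp: tensor_rels_def)
  from coset_eq[OF _ _ null_incl[OF this]] show ?thesis
    using assms by (simp add: tensor_def)
qed

lemma tensor_zero_left: "y \<in> carrier N \<Longrightarrow> t \<zero>\<^bsub>M\<^esub> y = \<zero>\<^bsub>T\<^esub>"
  using tensor_add_left[of "\<zero>\<^bsub>M\<^esub>" "\<zero>\<^bsub>M\<^esub>" y] tensor_closed[of "\<zero>\<^bsub>M\<^esub>" y] by simp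

text \<open>Pure tensors generate even as a monoid: a negative is absorbed into the left factor, -(x
  \<otimes> y) = (-x) \<otimes> y. Hence there is no case for negatives.\<close>

lemma tensor_induct [consumes 1, case_names tensor add]:
  assumes S: "S \<in> carrier T"
    and pure: "\<And>x y. \<lbrakk>x \<in> carrier M; y \<in> carrier N\<rbrakk> \<Longrightarrow> P (t x y)"
    and add: "\<And>U V. \<lbrakk>U \<in> carrier T; V \<in> carrier T; P U; P V\<rbrakk> \<Longrightarrow> P (U \<oplus>\<^bsub>T\<^esub> V)"
  shows "P S"
proof -
  let ?c = "\<lambda>p. tensor_null R M N #>\<^bsub>F\<^esub> p"
  obtain p where p: "p \<in> carrier F" "S = ?c p" using S by (auto simp: carrier_tensor)
  have neg: "?c (- frag_of (x, y)) = t (\<ominus>\<^bsub>M\<^esub> x) y" if "x \<in> carrier M" "y \<in> carrier N" for x y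
  proof -
    have "?c (- frag_of (x, y)) \<oplus>\<^bsub>T\<^esub> t x y = ?c 0"
      using that by (simp add: tensor_def coset_add)
    moreover have "?c (- frag_of (x, y)) \<in> carrier T" using that by (intro coset_closed) simp
    ultimately have "?c (- frag_of (x, y)) = \<ominus>\<^bsub>T\<^esub> t x y"
      using that by (intro T.minus_equality[symmetric]) (simp_all add: coset_zero)
    moreover have "t (\<ominus>\<^bsub>M\<^esub> x) y \<oplus>\<^bsub>T\<^esub> t x y = \<zero>\<^bsub>T\<^esub>"
      using that by (simp add: tensor_add_left[symmetric] M.l_neg tensor_zero_left)
    then have "\<ominus>\<^bsub>T\<^esub> t x y = t (\<ominus>\<^bsub>M\<^esub> x) y"
      using that by (intro T.minus_equality) simp_all
    ultimately show ?thesis by simp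
  qed
  \<comment> \<open>\<open>frag_induction\<close> builds elements by differences, so the claim is
    carried for \<open>p\<close> and \<open>- p\<close> together.\<close>
  have "Poly_Mapping.keys p \<subseteq> carrier M \<times> carrier N \<and> P (?c p) \<and> P (?c (- p))"
    using p(1)[unfolded carrier_free_Abelian_group_iff]
  proof (induction p rule: frag_induction)
    case zero
    have "?c 0 = t \<zero>\<^bsub>M\<^esub> \<zero>\<^bsub>N\<^esub>" by (simp add: tensor_zero_left coset_zero)
    then show ?case using pure by simp
  next
    case (one x)
    then show ?case using pure[of "fst x" "snd x"] pure[of "\<ominus>\<^bsub>M\<^esub> fst x" "snd x"] neg[of "fst x" "snd x"]
      by (auto simp: tensor_def)
  next
    case (diff a b)
    have k: "a \<in> carrier F" "b \<in> carrier F" "- a \<in> carrier F" "- b \<in> carrier F" using diff by auto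
    have "P (?c a \<oplus>\<^bsub>T\<^esub> ?c (- b))" "P (?c (- a) \<oplus>\<^bsub>T\<^esub> ?c b)"
      using diff k by (auto intro!: add coset_closed)
    then show ?case
      using k diff keys_diff[of a b] by (auto simp: coset_add)
  qed
  with p show ?thesis by simp
qed

text \<open>Freeness extends \<beta> to a homomorphism \<open>h\<close>; balancedness makes
  \<open>h\<close> kill \<open>tensor_rels\<close>, hence \<open>tensor_null\<close>. The
  representative picked by the choice operator differs from \<open>p\<close> by a null element, so
  it has the same value under \<open>h\<close>.\<close>

lemma tensor_lift_cosets:
  assumes B: "abelian_group B" and \<beta>: "balanced R M N B \<beta>"
  shows "\<exists>h \<in> hom F (add_monoid B). (\<forall>x\<in>carrier M. \<forall>y\<in>carrier N. h (frag_of (x, y)) = \<beta> x y) \<and>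
    (\<forall>p\<in>carrier F. tensor_lift (add_monoid B) \<beta> (tensor_null R M N #>\<^bsub>F\<^esub> p) = h p)"
proof -
  interpret B: abelian_group B by (fact B)
  interpret F: group F by simp
  obtain h where h: "h \<in> hom F (add_monoid B)"
    and hf: "\<And>x. x \<in> carrier M \<times> carrier N \<Longrightarrow> h (frag_of x) = (case x of (x, y) \<Rightarrow> \<beta> x y)"
    by (rule comm_group.free_Abelian_group_universal[OF B.a_comm_group, of "\<lambda>(x, y). \<beta> x y" "carrier M \<times> carrier N"])
      (use \<beta> in \<open>auto simp: balanced_def\<close>)
  interpret h: group_hom F "add_monoid B" h
    using h by (simp add: group_hom_def group_hom_axioms_def B.a_group)
  have hd: "h (a - b) = h a \<ominus>\<^bsub>B\<^esub> h b" if "a \<in> carrier F" "b \<in> carrier F" for a b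
    using h.hom_mult[of a "- b"] h.hom_inv[of b] that
    by (simp add: a_minus_def a_inv_def)
  have car: "frag_of x \<in> carrier F" if "x \<in> carrier M \<times> carrier N" for x using that by simp
  have cd: "a - b \<in> carrier F" if "a \<in> carrier F" "b \<in> carrier F" for a b
    using that keys_diff[of a b] by auto
  have hc: "\<beta> x y \<in> carrier B" if "x \<in> carrier M" "y \<in> carrier N" for x y using \<beta> that by (auto simp: balanced_def)
  have sub: "subgroup (kernel F (add_monoid B) h) F" by (rule h.subgroup_kernel)
  have rel0: "h p = \<zero>\<^bsub>B\<^esub>" if "p \<in> tensor_rels R M N" for p
  proof -
    have e1: "x \<oplus>\<^bsub>B\<^esub> y \<ominus>\<^bsub>B\<^esub> x \<ominus>\<^bsub>B\<^esub> y = \<zero>\<^bsub>B\<^esub>" if "x \<in> carrier B" "y \<in> carrier B" for x y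
      using that by (simp add: B.minus_eq B.a_ac B.r_neg B.r_neg1 B.r_neg2)
        (metis B.a_inv_closed B.a_lcomm B.r_neg B.r_zero)
    have e2: "x \<ominus>\<^bsub>B\<^esub> x = \<zero>\<^bsub>B\<^esub>" if "x \<in> carrier B" for x
      using that by (simp add: B.minus_eq B.r_neg)
    show ?thesis
      using that \<beta> unfolding tensor_rels_def
      by (auto simp: hd car cd hf hc e1 e2 balanced_def simp del: carrier_free_Abelian_group_iff)
  qed
  then have "tensor_null R M N \<subseteq> kernel F (add_monoid B) h"
    unfolding tensor_null_def using rels_closed
    by (intro F.generate_subgroup_incl[OF _ sub]) (auto simp: kernel_def simp del: carrier_free_Abelian_group_iff)
  then have null: "h p = \<zero>\<^bsub>B\<^esub>" if "p \<in> tensor_null R M N" for p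
    using that by (auto simp: kernel_def)
  have "tensor_lift (add_monoid B) \<beta> (tensor_null R M N #>\<^bsub>F\<^esub> p) = h p" if p: "p \<in> carrier F" for p
  proof -
    let ?C = "tensor_null R M N #>\<^bsub>F\<^esub> p"
    define t where "t = (SOME t. t \<in> ?C)"
    have "p \<in> ?C" using F.rcos_self[OF p null_subgroup] .
    then have "t \<in> ?C" unfolding t_def by (rule someI)
    then obtain n where n: "n \<in> tensor_null R M N" "t = n + p" by (auto simp: r_coset_def)
    have nF: "n \<in> carrier F" using n(1) subgroup.subset[OF null_subgroup] by blast
    have tF: "t \<in> carrier F" using n(2) nF p Poly_Mapping.keys_add[of n p] by auto
    have "h t = h n \<oplus>\<^bsub>B\<^esub> h p" using h.hom_mult[OF nF p] n by simp
    also have "\<dots> = h p" using null[OF n(1)] h.hom_closed[OF p] by simp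
    finally have ht: "h t = h p" .
    have tk: "Poly_Mapping.keys t \<subseteq> carrier M \<times> carrier N" using tF by simp
    have "tensor_lift (add_monoid B) \<beta> ?C
        = finprod (add_monoid B) (\<lambda>(x, y). \<beta> x y [^]\<^bsub>add_monoid B\<^esub> Poly_Mapping.lookup t (x, y)) (Poly_Mapping.keys t)"
      by (simp add: tensor_lift_def t_def[symmetric] Let_def)
    also have "\<dots> = finprod (add_monoid B) (\<lambda>a. h (frag_of a) [^]\<^bsub>add_monoid B\<^esub> Poly_Mapping.lookup t a) (Poly_Mapping.keys t)"
    proof (rule comm_monoid.finprod_cong'[OF comm_group.axioms(1)[OF B.a_comm_group]])
      show "(\<lambda>a. h (frag_of a) [^]\<^bsub>add_monoid B\<^esub> Poly_Mapping.lookup t a)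
        \<in> Poly_Mapping.keys t \<rightarrow> carrier (add_monoid B)"
      proof
        fix a assume "a \<in> Poly_Mapping.keys t"
        then have "h (frag_of a) \<in> carrier (add_monoid B)" using tk by (intro h.hom_closed) auto
        then show "h (frag_of a) [^]\<^bsub>add_monoid B\<^esub> Poly_Mapping.lookup t a \<in> carrier (add_monoid B)"
          by (rule group.int_pow_closed[OF B.a_group])
      qed
      fix a assume "a \<in> Poly_Mapping.keys t"
      then show "(case a of (x, y) \<Rightarrow> \<beta> x y [^]\<^bsub>add_monoid B\<^esub> Poly_Mapping.lookup t (x, y))
        = h (frag_of a) [^]\<^bsub>add_monoid B\<^esub> Poly_Mapping.lookup t a"
        using hf[of a] tk by (auto split: prod.splits)
    qed simp
    also have "\<dots> = h t" by (rule hom_eq_finprod[OF B.a_comm_group h tk])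
    finally show ?thesis using ht by simp
  qed
  with h hf show ?thesis by (intro bexI[of _ h]) auto
qed

context
  fixes B :: "('z, 'zz) ring_scheme" and \<beta>
  assumes B: "abelian_group B" and \<beta>: "balanced R M N B \<beta>"
begin

lemma tensor_lift_tensor:
  "x \<in> carrier M \<Longrightarrow> y \<in> carrier N \<Longrightarrow> tensor_lift (add_monoid B) \<beta> (t x y) = \<beta> x y"
  using tensor_lift_cosets[OF B \<beta>] by (auto simp: tensor_def)

lemma tensor_lift_closed: "S \<in> carrier T \<Longrightarrow> tensor_lift (add_monoid B) \<beta> S \<in> carrier B"
  using tensor_lift_cosets[OF B \<beta>] by (auto simp: carrier_tensor hom_def Pi_def)

lemma tensor_lift_add:
  "S \<in> carrier T \<Longrightarrow> U \<in> carrier T \<Longrightarrow>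
     tensor_lift (add_monoid B) \<beta> (S \<oplus>\<^bsub>T\<^esub> U) = tensor_lift (add_monoid B) \<beta> S \<oplus>\<^bsub>B\<^esub> tensor_lift (add_monoid B) \<beta> U"
proof -
  assume "S \<in> carrier T" "U \<in> carrier T"
  then obtain p p' where p: "p \<in> carrier F" "p' \<in> carrier F" "S = tensor_null R M N #>\<^bsub>F\<^esub> p" "U = tensor_null R M N #>\<^bsub>F\<^esub> p'"
    by (auto simp: carrier_tensor)
  have "p + p' \<in> carrier F" using p Poly_Mapping.keys_add[of p p'] by auto
  moreover obtain h where h: "h \<in> hom F (add_monoid B)"
    "\<forall>p\<in>carrier F. tensor_lift (add_monoid B) \<beta> (tensor_null R M N #>\<^bsub>F\<^esub> p) = h p"
    using tensor_lift_cosets[OF B \<beta>] by blast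
  moreover have "h (p + p') = h p \<oplus>\<^bsub>B\<^esub> h p'"
    using h(1) p by (auto simp: hom_def simp del: carrier_free_Abelian_group_iff)
  ultimately show ?thesis using p by (simp add: coset_add del: carrier_free_Abelian_group_iff)
qed

end

lemma tensor_smult:
  assumes r: "r \<in> carrier R"
  shows "S \<in> carrier T \<Longrightarrow> r \<odot>\<^bsub>T\<^esub> S \<in> carrier T"
    and "S \<in> carrier T \<Longrightarrow> U \<in> carrier T \<Longrightarrow> r \<odot>\<^bsub>T\<^esub> (S \<oplus>\<^bsub>T\<^esub> U) = r \<odot>\<^bsub>T\<^esub> S \<oplus>\<^bsub>T\<^esub> r \<odot>\<^bsub>T\<^esub> U"
    and "x \<in> carrier M \<Longrightarrow> y \<in> carrier N \<Longrightarrow> r \<odot>\<^bsub>T\<^esub> t x y = t (r \<odot>\<^bsub>M\<^esub> x) y"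
proof -
  have sm: "r \<odot>\<^bsub>T\<^esub> S = tensor_lift (add_monoid T) (\<lambda>a b. t (r \<odot>\<^bsub>M\<^esub> a) b) S" for S
    by (simp add: tensor_lift_tensor_group[symmetric]) (simp add: tensor_alg_def Let_def)
  have bal: "balanced R M N T (\<lambda>a b. t (r \<odot>\<^bsub>M\<^esub> a) b)"
    by (rule balancedI)
      (auto simp: r M.smult_r_distr tensor_add_left tensor_add_right tensor_balanced[symmetric]
        M.smult_assoc1[symmetric] M.m_comm)
  note * = abelian_group_tensor bal
  show "S \<in> carrier T \<Longrightarrow> r \<odot>\<^bsub>T\<^esub> S \<in> carrier T"
    unfolding sm by (rule tensor_lift_closed[OF *])
  show "S \<in> carrier T \<Longrightarrow> U \<in> carrier T \<Longrightarrow> r \<odot>\<^bsub>T\<^esub> (S \<oplus>\<^bsub>T\<^esub> U) = r \<odot>\<^bsub>T\<^esub> S \<oplus>\<^bsub>T\<^esub> r \<odot>\<^bsub>T\<^esub> U"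
    unfolding sm by (rule tensor_lift_add[OF *])
  show "x \<in> carrier M \<Longrightarrow> y \<in> carrier N \<Longrightarrow> r \<odot>\<^bsub>T\<^esub> t x y = t (r \<odot>\<^bsub>M\<^esub> x) y"
    unfolding sm by (rule tensor_lift_tensor[OF *])
qed

lemma module_tensor: "module R T"
proof (rule moduleI[OF M.R.is_cring abelian_group_tensor])
  fix a b S assume ab: "a \<in> carrier R" "b \<in> carrier R" and S: "S \<in> carrier T"
  show "(a \<oplus> b) \<odot>\<^bsub>T\<^esub> S = a \<odot>\<^bsub>T\<^esub> S \<oplus>\<^bsub>T\<^esub> b \<odot>\<^bsub>T\<^esub> S"
    using S by (induction rule: tensor_induct)
      (auto simp: ab tensor_smult M.smult_l_distr tensor_add_left T.a_ac)
  show "(a \<otimes> b) \<odot>\<^bsub>T\<^esub> S = a \<odot>\<^bsub>T\<^esub> (b \<odot>\<^bsub>T\<^esub> S)"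
    using S by (induction rule: tensor_induct)
      (auto simp: ab tensor_smult M.smult_assoc1)
next
  fix S assume S: "S \<in> carrier T"
  show "\<one> \<odot>\<^bsub>T\<^esub> S = S"
    using S by (induction rule: tensor_induct) (auto simp: tensor_smult)
qed (auto simp: tensor_smult)

sublocale T: module R T by (rule module_tensor)

lemma tensor_lift_smult:
  assumes B: "module R B" and \<beta>: "balanced R M N B \<beta>"
    and lin: "\<And>r x y. \<lbrakk>r \<in> carrier R; x \<in> carrier M; y \<in> carrier N\<rbrakk> \<Longrightarrow> \<beta> (r \<odot>\<^bsub>M\<^esub> x) y = r \<odot>\<^bsub>B\<^esub> \<beta> x y"
    and r: "r \<in> carrier R" and S: "S \<in> carrier T"
  shows "tensor_lift (add_monoid B) \<beta> (r \<odot>\<^bsub>T\<^esub> S) = r \<odot>\<^bsub>B\<^esub> tensor_lift (add_monoid B) \<beta> S"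
proof -
  interpret B: module R B by (fact B)
  note l = tensor_lift_tensor[OF B.abelian_group_axioms \<beta>] tensor_lift_add[OF B.abelian_group_axioms \<beta>]
    tensor_lift_closed[OF B.abelian_group_axioms \<beta>]
  show ?thesis
    using S by (induction rule: tensor_induct) (auto simp: tensor_smult r l lin B.smult_r_distr)
qed

end

section \<open>Tensor products of algebras\<close>

locale tensor_algebras = A: assoc_algebra R A + B: assoc_algebra R B
  for R (structure) and A (structure) and B (structure)
begin

sublocale tensor_modules R A B ..

text \<open>The product (a \<otimes> b) S, the inner of the two nested lifts in
  \<open>tensor_alg\<close>. Well-definedness is checked in two stages: for fixed a and b the
  integrand is balanced in the factors of \<open>S\<close>, and then \<open>right_factor S\<close>
  is itself balanced in a and b.\<close>

definition right_factor where
  "right_factor S a b = tensor_lift (add_monoid T) (\<lambda>a' b'. t (a \<otimes>\<^bsub>A\<^esub> a') (b \<otimes>\<^bsub>B\<^esub> b')) S"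

lemma right_factor_balanced:
  assumes "a \<in> carrier A" "b \<in> carrier B"
  shows "balanced R A B T (\<lambda>a' b'. t (a \<otimes>\<^bsub>A\<^esub> a') (b \<otimes>\<^bsub>B\<^esub> b'))"
  by (rule balancedI)
    (auto simp: assms A.r_distr B.r_distr tensor_add_left tensor_add_right A.smult_mult_right B.smult_mult_right
      tensor_balanced)

lemma right_factor:
  assumes "a \<in> carrier A" "b \<in> carrier B"
  shows "S \<in> carrier T \<Longrightarrow> right_factor S a b \<in> carrier T"
    and "S \<in> carrier T \<Longrightarrow> U \<in> carrier T \<Longrightarrow> right_factor (S \<oplus>\<^bsub>T\<^esub> U) a b = right_factor S a b \<oplus>\<^bsub>T\<^esub> right_factor U a b"
    and "a' \<in> carrier A \<Longrightarrow> b' \<in> carrier B \<Longrightarrow> right_factor (t a' b') a b = t (a \<otimes>\<^bsub>A\<^esub> a') (b \<otimes>\<^bsub>B\<^esub> b')"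
  unfolding right_factor_def
  by (simp_all add: tensor_lift_closed tensor_lift_add tensor_lift_tensor abelian_group_tensor
    right_factor_balanced assms)

lemma right_factor_balanced2:
  assumes S: "S \<in> carrier T"
  shows "balanced R A B T (right_factor S)"
proof (rule balancedI)
  show "right_factor S x y \<in> carrier T" if "x \<in> carrier A" "y \<in> carrier B" for x y
    using that S by (simp add: right_factor)
  show "right_factor S (x \<oplus>\<^bsub>A\<^esub> x') y = right_factor S x y \<oplus>\<^bsub>T\<^esub> right_factor S x' y"
    if "x \<in> carrier A" "x' \<in> carrier A" "y \<in> carrier B" for x x' y
    using S by (induction rule: tensor_induct)
      (simp_all add: that right_factor A.l_distr tensor_add_left T.a_ac)
  show "right_factor S x (y \<oplus>\<^bsub>B\<^esub> y') = right_factor S x y \<oplus>\<^bsub>T\<^esub> right_factor S x y'"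
    if "x \<in> carrier A" "y \<in> carrier B" "y' \<in> carrier B" for x y y'
    using S by (induction rule: tensor_induct)
      (simp_all add: that right_factor B.l_distr tensor_add_right T.a_ac)
  show "right_factor S (r \<odot>\<^bsub>A\<^esub> x) y = right_factor S x (r \<odot>\<^bsub>B\<^esub> y)"
    if "r \<in> carrier R" "x \<in> carrier A" "y \<in> carrier B" for r x y
    using S by (induction rule: tensor_induct)
      (simp_all add: that right_factor A.smult_mult_left B.smult_mult_left tensor_balanced)
qed

lemma tensor_mult:
  shows "S \<in> carrier T \<Longrightarrow> U \<in> carrier T \<Longrightarrow> S \<otimes>\<^bsub>T\<^esub> U \<in> carrier T"
    and "S \<in> carrier T \<Longrightarrow> S' \<in> carrier T \<Longrightarrow> U \<in> carrier T \<Longrightarrow>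
        (S \<oplus>\<^bsub>T\<^esub> S') \<otimes>\<^bsub>T\<^esub> U = S \<otimes>\<^bsub>T\<^esub> U \<oplus>\<^bsub>T\<^esub> S' \<otimes>\<^bsub>T\<^esub> U"
    and "S \<in> carrier T \<Longrightarrow> U \<in> carrier T \<Longrightarrow> U' \<in> carrier T \<Longrightarrow>
        S \<otimes>\<^bsub>T\<^esub> (U \<oplus>\<^bsub>T\<^esub> U') = S \<otimes>\<^bsub>T\<^esub> U \<oplus>\<^bsub>T\<^esub> S \<otimes>\<^bsub>T\<^esub> U'"
    and "\<lbrakk>a \<in> carrier A; b \<in> carrier B; a' \<in> carrier A; b' \<in> carrier B\<rbrakk> \<Longrightarrow>
        t a b \<otimes>\<^bsub>T\<^esub> t a' b' = t (a \<otimes>\<^bsub>A\<^esub> a') (b \<otimes>\<^bsub>B\<^esub> b')"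
proof -
  have m: "S \<otimes>\<^bsub>T\<^esub> U = tensor_lift (add_monoid T) (right_factor U) S" for S U
    unfolding right_factor_def by (simp add: tensor_lift_tensor_group[symmetric]) (simp add: tensor_alg_def Let_def)
  note l = tensor_lift_closed tensor_lift_add tensor_lift_tensor abelian_group_tensor right_factor_balanced2
  show "S \<in> carrier T \<Longrightarrow> U \<in> carrier T \<Longrightarrow> S \<otimes>\<^bsub>T\<^esub> U \<in> carrier T"
    "S \<in> carrier T \<Longrightarrow> S' \<in> carrier T \<Longrightarrow> U \<in> carrier T \<Longrightarrow>
        (S \<oplus>\<^bsub>T\<^esub> S') \<otimes>\<^bsub>T\<^esub> U = S \<otimes>\<^bsub>T\<^esub> U \<oplus>\<^bsub>T\<^esub> S' \<otimes>\<^bsub>T\<^esub> U"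
    "\<lbrakk>a \<in> carrier A; b \<in> carrier B; a' \<in> carrier A; b' \<in> carrier B\<rbrakk> \<Longrightarrow>
        t a b \<otimes>\<^bsub>T\<^esub> t a' b' = t (a \<otimes>\<^bsub>A\<^esub> a') (b \<otimes>\<^bsub>B\<^esub> b')"
    by (simp_all add: m l right_factor)
  assume S: "S \<in> carrier T" and U: "U \<in> carrier T" "U' \<in> carrier T"
  show "S \<otimes>\<^bsub>T\<^esub> (U \<oplus>\<^bsub>T\<^esub> U') = S \<otimes>\<^bsub>T\<^esub> U \<oplus>\<^bsub>T\<^esub> S \<otimes>\<^bsub>T\<^esub> U'"
    using S by (induction rule: tensor_induct) (simp_all add: m l U right_factor T.a_ac)
qed

lemma one_tensor: "\<one>\<^bsub>T\<^esub> = t \<one>\<^bsub>A\<^esub> \<one>\<^bsub>B\<^esub>"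
  by (simp add: tensor_alg_def Let_def)

lemma assoc_algebra_tensor: "assoc_algebra R T"
proof (rule assoc_algebraI[OF module_tensor ringI[OF abelian_group_tensor monoidI]])
  fix S U V assume S: "S \<in> carrier T" and U: "U \<in> carrier T" and V: "V \<in> carrier T"
  show "S \<otimes>\<^bsub>T\<^esub> U \<otimes>\<^bsub>T\<^esub> V = S \<otimes>\<^bsub>T\<^esub> (U \<otimes>\<^bsub>T\<^esub> V)"
    using S
  proof (induction rule: tensor_induct)
    case (tensor x y)
    show ?case using U
    proof (induction rule: tensor_induct)
      case (tensor x' y')
      show ?case using V by (induction rule: tensor_induct)
          (simp_all add: tensor_mult tensor \<open>x \<in> carrier A\<close> \<open>y \<in> carrier B\<close> A.m_assoc B.m_assoc)
    qed (simp_all add: tensor_mult tensor V)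
  qed (simp_all add: tensor_mult U V)
next
  fix S assume S: "S \<in> carrier T"
  show "\<one>\<^bsub>T\<^esub> \<otimes>\<^bsub>T\<^esub> S = S" "S \<otimes>\<^bsub>T\<^esub> \<one>\<^bsub>T\<^esub> = S"
    using S by (induction rule: tensor_induct) (simp_all add: one_tensor tensor_mult)
next
  fix r S U assume r: "r \<in> carrier R" and S: "S \<in> carrier T" and U: "U \<in> carrier T"
  show "r \<odot>\<^bsub>T\<^esub> S \<otimes>\<^bsub>T\<^esub> U = r \<odot>\<^bsub>T\<^esub> (S \<otimes>\<^bsub>T\<^esub> U)"
    using S
  proof (induction rule: tensor_induct)
    case (tensor x y)
    show ?case using U by (induction rule: tensor_induct)
        (simp_all add: tensor_mult tensor r tensor_smult A.smult_mult_left)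
  qed (simp_all add: tensor_mult U r tensor_smult)
  show "S \<otimes>\<^bsub>T\<^esub> (r \<odot>\<^bsub>T\<^esub> U) = r \<odot>\<^bsub>T\<^esub> (S \<otimes>\<^bsub>T\<^esub> U)"
    using S
  proof (induction rule: tensor_induct)
    case (tensor x y)
    show ?case using U by (induction rule: tensor_induct)
        (simp_all add: tensor_mult tensor r tensor_smult A.smult_mult_right)
  qed (simp_all add: tensor_mult U r tensor_smult)
qed (auto simp: tensor_mult one_tensor)

sublocale T: assoc_algebra R T by (rule assoc_algebra_tensor)

end

section \<open>Algebras given by generators and relations\<close>

lemma poly_mapping_sum_single: "p = (\<Sum>w\<in>Poly_Mapping.keys p. Poly_Mapping.single w (Poly_Mapping.lookup p w))"
  by (rule poly_mapping_eqI) (simp add: lookup_sum lookup_single when_def in_keys_iff)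

lemma poly_mapping_single_induct:
  assumes single: "\<And>w c. P (Poly_Mapping.single w c)" and add: "\<And>p p'. P p \<Longrightarrow> P p' \<Longrightarrow> P (p + p')"
  shows "P (p :: 'a \<Rightarrow>\<^sub>0 'b::comm_monoid_add)"
proof -
  have "P (\<Sum>w\<in>K. Poly_Mapping.single w (c w))" if "finite K" for K and c :: "'a \<Rightarrow> 'b"
    using that by induction (use single[of undefined 0] in \<open>auto intro: single add\<close>)
  from this[of "Poly_Mapping.keys p" "Poly_Mapping.lookup p"] show ?thesis
    by (simp flip: poly_mapping_sum_single)
qed

lemma scal_simps:
  "scal (a + b) = scal a + scal b" "scal (a * b) = scal a * scal b" "scal 1 = 1" "scal 0 = 0"
  "scal (- a) = - scal a"
  by (simp_all add: scal_def single_add mult_single single_uminus)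

lemma scal_single: "scal a * Poly_Mapping.single w b = Poly_Mapping.single w (a * b)"
  "Poly_Mapping.single w b * scal a = Poly_Mapping.single w (b * a)"
  by (simp_all add: scal_def mult_single)

lemma scal_commute: "p * scal a = scal a * p"
  by (induction p rule: poly_mapping_single_induct) (simp_all add: scal_single mult.commute distrib_left distrib_right)

lemma assoc_algebra_free: "assoc_algebra base_field (free_algebra :: ('k::field, ('g, 'k) free_alg) module)"
  unfolding free_algebra_def
proof (rule assoc_algebra_of_type)
  show "x * (scal r * y) = scal r * (x * y)" for r and x y :: "('g, 'k) free_alg"
    by (metis mult.assoc scal_commute)
qed (simp_all add: scal_simps algebra_simps)

lemma free_algebra_simps [simp]:
  "carrier (free_algebra :: ('k::comm_ring_1, ('g, 'k) free_alg) module) = UNIV"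
  "monoid.mult (free_algebra :: ('k::comm_ring_1, ('g, 'k) free_alg) module) = (*)"
  "one (free_algebra :: ('k::comm_ring_1, ('g, 'k) free_alg) module) = 1"
  "ring.zero (free_algebra :: ('k::comm_ring_1, ('g, 'k) free_alg) module) = 0"
  "add (free_algebra :: ('k::comm_ring_1, ('g, 'k) free_alg) module) = (+)"
  "module.smult (free_algebra :: ('k::comm_ring_1, ('g, 'k) free_alg) module) = (\<lambda>c p. scal c * p)"
  by (simp_all add: free_algebra_def)

lemma free_algebra_a_inv [simp]: "a_inv (free_algebra :: ('k::field, ('g, 'k) free_alg) module) p = - p"
proof -
  interpret assoc_algebra base_field "free_algebra :: ('k, ('g, 'k) free_alg) module"
    by (rule assoc_algebra_free)
  show ?thesis using minus_equality[of "- p" p] by simp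
qed

lemma free_algebra_minus [simp]: "a_minus (free_algebra :: ('k::field, ('g, 'k) free_alg) module) p p' = p - p'"
  by (simp add: a_minus_def)

locale free_evaluation = assoc_algebra base_field B
  for B :: "('k::field, 'b) module" (structure) +
  fixes \<phi> :: "'g \<Rightarrow> 'b"
  assumes gens_closed [simp, intro]: "\<phi> x \<in> carrier B"
begin

abbreviation "ev \<equiv> free_eval B \<phi>"

definition mono :: "'g word \<Rightarrow> 'b" where
  "mono w = foldr (\<lambda>x b. \<phi> x \<otimes> b) (letters w) \<one>"

lemma mono_closed [simp, intro]: "mono w \<in> carrier B"
proof -
  have "foldr (\<lambda>x b. \<phi> x \<otimes> b) xs \<one> \<in> carrier B" for xs by (induction xs) auto
  then show ?thesis by (simp add: mono_def)
qed

lemma mono_zero: "mono 0 = \<one>"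
  by (simp add: mono_def zero_word_def)

lemma mono_add: "mono (u + v) = mono u \<otimes> mono v"
proof -
  have "foldr (\<lambda>x b. \<phi> x \<otimes> b) (xs @ ys) \<one> = foldr (\<lambda>x b. \<phi> x \<otimes> b) xs \<one> \<otimes> foldr (\<lambda>x b. \<phi> x \<otimes> b) ys \<one>" for xs ys
  proof (induction xs)
    case Nil
    have "foldr (\<lambda>x b. \<phi> x \<otimes> b) ys \<one> \<in> carrier B" by (induction ys) auto
    then show ?case by simp
  next
    case (Cons x xs)
    have "foldr (\<lambda>x b. \<phi> x \<otimes> b) zs \<one> \<in> carrier B" for zs by (induction zs) auto
    then show ?case using Cons by (simp add: m_assoc)
  qed
  then show ?thesis by (simp add: mono_def plus_word_def)
qed

text \<open>Words with coefficient 0 contribute nothing. The freedom in the index set lets two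
  evaluations be compared on the union of their supports.\<close>

lemma ev_superset:
  assumes "finite S" "Poly_Mapping.keys p \<subseteq> S"
  shows "ev p = (\<Oplus>w\<in>S. Poly_Mapping.lookup p w \<odot> mono w)"
  unfolding free_eval_def mono_def[symmetric]
proof (rule add.finprod_mono_neutral_cong_left[OF assms])
  show "Poly_Mapping.lookup p w \<odot> mono w = \<zero>" if "w \<in> S - Poly_Mapping.keys p" for w
    using that smult_l_null[OF mono_closed, of w] by (simp add: in_keys_iff)
qed auto

lemma ev_closed [simp, intro]: "ev p \<in> carrier B"
  by (subst ev_superset[OF finite_keys order_refl]) (auto intro!: finsum_closed)

lemma ev_add: "ev (p + p') = ev p \<oplus> ev p'"
proof -
  let ?S = "Poly_Mapping.keys p \<union> Poly_Mapping.keys p'"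
  have e: "ev r = (\<Oplus>w\<in>?S. Poly_Mapping.lookup r w \<odot> mono w)" if "r \<in> {p, p', p + p'}" for r
    using that Poly_Mapping.keys_add[of p p'] by (intro ev_superset) auto
  have "ev (p + p') = (\<Oplus>w\<in>?S. Poly_Mapping.lookup p w \<odot> mono w \<oplus> Poly_Mapping.lookup p' w \<odot> mono w)"
    unfolding e[of "p + p'", simplified]
    by (intro finsum_cong') (auto simp: lookup_add smult_l_distr[of "Poly_Mapping.lookup p _" "Poly_Mapping.lookup p' _", simplified])
  also have "\<dots> = ev p \<oplus> ev p'"
    unfolding e[of p, simplified] e[of p', simplified] by (intro finsum_addf) auto
  finally show ?thesis .
qed

lemma ev_single: "ev (Poly_Mapping.single w c) = c \<odot> mono w"
  by (subst ev_superset[of "{w}"]) auto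

lemma ev_scal: "ev (scal c) = c \<odot> \<one>"
  by (simp add: scal_def ev_single mono_zero)

lemma ev_gen: "ev (gen x) = \<phi> x"
  using smult_one[of "\<phi> x"] by (simp add: gen_def ev_single) (simp add: mono_def)

lemma ev_mult: "ev (p * p') = ev p \<otimes> ev p'"
proof (induction p rule: poly_mapping_single_induct)
  case (1 w c)
  show ?case
  proof (induction p' rule: poly_mapping_single_induct)
    case (1 v d)
    show ?case
      using smult_assoc1[of c d "mono w \<otimes> mono v"] smult_assoc1[of d c "mono w \<otimes> mono v"]
      by (simp add: mult.commute[of d c] mult_single ev_single mono_add smult_mult_left smult_mult_right)
  qed (simp add: distrib_left ev_add r_distr)
qed (simp add: distrib_right ev_add l_distr)

lemma ev_one: "ev 1 = \<one>"
  using ev_single[of 0 1] smult_one[of \<one>] by (simp add: mono_zero)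

lemma ev_hom: "ev \<in> alg_hom base_field free_algebra B"
  using smult_mult_left[of _ \<one>]
  by (intro alg_homI) (auto simp: ev_one ev_add ev_mult ev_scal)

sublocale ev: alg_morphism base_field free_algebra B ev
  by (intro alg_morphism.intro assoc_algebra_free assoc_algebra_axioms alg_morphism_axioms.intro ev_hom)

lemma ev_diff: "ev (p - p') = ev p \<ominus> ev p'"
  using ev.minus[of p p'] by simp

end

context
  fixes rels :: "('g, 'k::field) free_alg set"
begin

lemma ideal_rels: "ideal (Idl\<^bsub>free_algebra\<^esub> rels) free_algebra"
proof -
  interpret assoc_algebra base_field "free_algebra :: ('k, ('g, 'k) free_alg) module"
    by (rule assoc_algebra_free)
  show ?thesis by (rule genideal_ideal) simp
qed

lemma assoc_algebra_presented: "assoc_algebra base_field (presented rels)"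
  unfolding presented_def by (rule alg_quot[OF assoc_algebra_free ideal_rels])

lemma presented_class_hom: "presented_class rels \<in> alg_hom base_field free_algebra (presented rels)"
  unfolding presented_def using alg_quot(2)[OF assoc_algebra_free ideal_rels]
  by (simp add: presented_class_def[abs_def])

lemma carrier_presented: "carrier (presented rels) = range (presented_class rels)"
  unfolding presented_def using alg_quot(3)[OF assoc_algebra_free ideal_rels]
  by (simp add: presented_class_def[abs_def])

interpretation P: assoc_algebra base_field "presented rels" by (rule assoc_algebra_presented)

interpretation cls: alg_morphism base_field free_algebra "presented rels" "presented_class rels"
  by (intro alg_morphism.intro assoc_algebra_free assoc_algebra_presented alg_morphism_axioms.intro
      presented_class_hom)

lemma presented_class_simps:
  "presented_class rels p \<in> carrier (presented rels)" "presented_class rels (p + p') = presented_class rels p \<oplus>\<^bsub>presented rels\<^esub> presented_class rels p'" "presented_class rels (p * p') = presented_class rels p \<otimes>\<^bsub>presented rels\<^esub> presented_class rels p'"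
  "presented_class rels (p - p') = presented_class rels p \<ominus>\<^bsub>presented rels\<^esub> presented_class rels p'" "presented_class rels (- p) = \<ominus>\<^bsub>presented rels\<^esub> presented_class rels p" "presented_class rels 1 = \<one>\<^bsub>presented rels\<^esub>" "presented_class rels 0 = \<zero>\<^bsub>presented rels\<^esub>"
  "presented_class rels (scal c * p) = c \<odot>\<^bsub>presented rels\<^esub> presented_class rels p"
  using cls.closed[of p] cls.add[of p p'] cls.mult[of p p'] cls.minus[of p p'] cls.a_inv[of p]
    cls.one cls.zero cls.smult[of c p]
  by simp_all

lemma presented_class_rel: "p \<in> rels \<Longrightarrow> presented_class rels p = \<zero>\<^bsub>presented rels\<^esub>"
proof -
  assume p: "p \<in> rels"
  interpret F: assoc_algebra base_field "free_algebra :: ('k, ('g, 'k) free_alg) module"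
    by (rule assoc_algebra_free)
  interpret I: ideal "Idl\<^bsub>free_algebra\<^esub> rels" free_algebra by (rule ideal_rels)
  have "p \<in> Idl\<^bsub>free_algebra\<^esub> rels" using cls.A.genideal_self[of rels] p by auto
  then have "presented_class rels p = Idl\<^bsub>free_algebra\<^esub> rels"
    unfolding presented_class_def by (rule I.a_rcos_const)
  then show ?thesis by (simp add: presented_def alg_quot_def FactRing_def)
qed

text \<open>Words are built from the left, one generator at a time, so a property only has to
  survive left multiplication by a generator. The inductions over the enveloping algebra thereby
  involve only the comultiplication, counit and action of primitive elements.\<close>

lemma presented_induct [consumes 1, case_names one add smult mult]:
  assumes z: "z \<in> carrier (presented rels)"
    and one: "Q \<one>\<^bsub>presented rels\<^esub>"
    and add: "\<And>x y. \<lbrakk>x \<in> carrier (presented rels); y \<in> carrier (presented rels); Q x; Q y\<rbrakk> \<Longrightarrow> Q (x \<oplus>\<^bsub>presented rels\<^esub> y)"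
    and smult: "\<And>c x. \<lbrakk>x \<in> carrier (presented rels); Q x\<rbrakk> \<Longrightarrow> Q (c \<odot>\<^bsub>presented rels\<^esub> x)"
    and mult: "\<And>g x. \<lbrakk>x \<in> carrier (presented rels); Q x\<rbrakk> \<Longrightarrow> Q (presented_class rels (gen g) \<otimes>\<^bsub>presented rels\<^esub> x)"
  shows "Q z"
proof -
  have word: "Q (presented_class rels (Poly_Mapping.single (Word xs) 1))" for xs
  proof (induction xs)
    case Nil
    have "Poly_Mapping.single (Word []) (1::'k) = (1 :: ('g, 'k) free_alg)" by (metis zero_word_def single_one)
    then show ?case using one by (simp add: presented_class_simps)
  next
    case (Cons x xs)
    have "Poly_Mapping.single (Word (x # xs)) (1::'k) = gen x * Poly_Mapping.single (Word xs) 1"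
      by (simp add: gen_def mult_single plus_word_def)
    then show ?case using Cons mult by (simp add: presented_class_simps)
  qed
  have "Q (presented_class rels p)" for p
  proof (induction p rule: poly_mapping_single_induct)
    case (1 w c)
    have "Poly_Mapping.single w c = scal c * Poly_Mapping.single (Word (letters w)) 1"
      by (simp add: scal_single)
    then show ?case
      using smult[OF presented_class_simps(1) word[of "letters w"], of c]
      by (simp only: presented_class_simps(8))
  qed (simp add: presented_class_simps add)
  then show ?thesis using z by (auto simp: carrier_presented)
qed

context
  fixes B :: "('k, 'b) module" and \<phi> :: "'g \<Rightarrow> 'b"
  assumes B: "assoc_algebra base_field B" and \<phi>: "\<And>x. \<phi> x \<in> carrier B"
    and rels0: "\<And>p. p \<in> rels \<Longrightarrow> free_eval B \<phi> p = \<zero>\<^bsub>B\<^esub>"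
begin

interpretation B: free_evaluation B \<phi>
  by (intro free_evaluation.intro B free_evaluation_axioms.intro \<phi>)

text \<open>The kernel of evaluation is an ideal containing the relations, hence also the ideal they
  generate; the representative chosen in \<open>presented_lift\<close> differs from \<open>p\<close>
  by an element of it.\<close>

lemma presented_lift_class: "presented_lift B \<phi> (presented_class rels p) = free_eval B \<phi> p"
proof -
  interpret F: assoc_algebra base_field "free_algebra :: ('k, ('g, 'k) free_alg) module"
    by (rule assoc_algebra_free)
  interpret I: ideal "Idl\<^bsub>free_algebra\<^esub> rels" free_algebra by (rule ideal_rels)
  define p' where "p' = (SOME p'. p' \<in> presented_class rels p)"
  have "p \<in> presented_class rels p" unfolding presented_class_def by (rule I.a_rcos_self) simp
  then have "p' \<in> presented_class rels p" unfolding p'_def by (rule someI)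
  then have "p' - p \<in> Idl\<^bsub>free_algebra\<^esub> rels"
    using I.a_rcos_module[of p p'] by (simp add: presented_class_def)
  moreover have "Idl\<^bsub>free_algebra\<^esub> rels \<subseteq> {x \<in> carrier free_algebra. free_eval B \<phi> x = \<zero>\<^bsub>B\<^esub>}"
    by (rule cls.A.genideal_minimal[OF B.ev.kernel_ideal]) (use rels0 in auto)
  ultimately have "free_eval B \<phi> (p' - p) = \<zero>\<^bsub>B\<^esub>" by blast
  then have "free_eval B \<phi> p' = free_eval B \<phi> p"
    by (metis B.ev_diff B.ev_closed B.r_right_minus_eq)
  then show ?thesis by (simp add: presented_lift_def p'_def)
qed

lemma presented_lift_hom: "presented_lift B \<phi> \<in> alg_hom base_field (presented rels) B"
proof (rule alg_homI)
  show "presented_lift B \<phi> \<one>\<^bsub>presented rels\<^esub> = \<one>\<^bsub>B\<^esub>"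
    by (simp add: presented_class_simps(6)[symmetric] presented_lift_class B.ev_one)
  show "presented_lift B \<phi> x \<in> carrier B" if "x \<in> carrier (presented rels)" for x
    using that by (auto simp: carrier_presented presented_lift_class)
  show "presented_lift B \<phi> (x \<oplus>\<^bsub>presented rels\<^esub> y) = presented_lift B \<phi> x \<oplus>\<^bsub>B\<^esub> presented_lift B \<phi> y"
    "presented_lift B \<phi> (x \<otimes>\<^bsub>presented rels\<^esub> y) = presented_lift B \<phi> x \<otimes>\<^bsub>B\<^esub> presented_lift B \<phi> y"
    if xy: "x \<in> carrier (presented rels)" "y \<in> carrier (presented rels)" for x y
  proof -
    obtain p p' where "x = presented_class rels p" "y = presented_class rels p'" using xy by (auto simp: carrier_presented)
    then show "presented_lift B \<phi> (x \<oplus>\<^bsub>presented rels\<^esub> y) = presented_lift B \<phi> x \<oplus>\<^bsub>B\<^esub> presented_lift B \<phi> y"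
      "presented_lift B \<phi> (x \<otimes>\<^bsub>presented rels\<^esub> y) = presented_lift B \<phi> x \<otimes>\<^bsub>B\<^esub> presented_lift B \<phi> y"
      by (simp_all add: presented_class_simps(2,3)[symmetric] presented_lift_class B.ev_add B.ev_mult)
  qed
  show "presented_lift B \<phi> (r \<odot>\<^bsub>presented rels\<^esub> x) = r \<odot>\<^bsub>B\<^esub> presented_lift B \<phi> x" if x: "x \<in> carrier (presented rels)" for r x
  proof -
    obtain p where "x = presented_class rels p" using x unfolding carrier_presented by blast
    then show ?thesis
      using B.ev.smult[of r p] by (simp add: presented_class_simps(8)[symmetric] presented_lift_class)
  qed
qed

lemma presented_lift_gen: "presented_lift B \<phi> (presented_class rels (gen x)) = \<phi> x"
  by (simp add: presented_lift_class B.ev_gen)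

end

end

section \<open>The Hopf algebra structure of the enveloping algebra of sl2\<close>

text \<open>Structure constants in the standard basis. \<open>sl2_bracket\<close> lives in the free
  algebra; with the constants, \<open>sl2_comb\<close> forms the same bracket in any target algebra,
  where the relations for comultiplication, counit and antipode have to be checked.\<close>

fun sl2_const :: "sl2_basis \<Rightarrow> sl2_basis \<Rightarrow> sl2_basis \<Rightarrow> 'k::field" where
  "sl2_const e_sl2 f_sl2 h_sl2 = 1"
| "sl2_const f_sl2 e_sl2 h_sl2 = - 1"
| "sl2_const h_sl2 e_sl2 e_sl2 = 2"
| "sl2_const e_sl2 h_sl2 e_sl2 = - 2"
| "sl2_const h_sl2 f_sl2 f_sl2 = - 2"
| "sl2_const f_sl2 h_sl2 f_sl2 = 2"
| "sl2_const _ _ _ = 0"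

definition sl2_comb where
  "sl2_comb A x y \<phi> = sl2_const x y e_sl2 \<odot>\<^bsub>A\<^esub> \<phi> e_sl2 \<oplus>\<^bsub>A\<^esub>
     (sl2_const x y h_sl2 \<odot>\<^bsub>A\<^esub> \<phi> h_sl2 \<oplus>\<^bsub>A\<^esub> sl2_const x y f_sl2 \<odot>\<^bsub>A\<^esub> \<phi> f_sl2)"

lemma sl2_bracket_const:
  "(sl2_bracket x y :: (sl2_basis, 'k::field) free_alg) = scal (sl2_const x y e_sl2) * gen e_sl2 +
     (scal (sl2_const x y h_sl2) * gen h_sl2 + scal (sl2_const x y f_sl2) * gen f_sl2)"
proof -
  have "scal (2::'k) = (2 :: (sl2_basis, 'k) free_alg)"
    by (simp add: scal_def)
  then show ?thesis
    by (cases x; cases y) (simp_all add: scal_simps)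
qed


lemma sl2_rel_ev:
  assumes "free_evaluation B \<phi>"
  shows "free_eval B \<phi> (gen x * gen y - gen y * gen x - sl2_bracket x y)
    = \<phi> x \<otimes>\<^bsub>B\<^esub> \<phi> y \<ominus>\<^bsub>B\<^esub> \<phi> y \<otimes>\<^bsub>B\<^esub> \<phi> x \<ominus>\<^bsub>B\<^esub> sl2_comb B x y \<phi>"
proof -
  interpret free_evaluation B \<phi> by (fact assms)
  show ?thesis
    using ev.smult
    by (simp add: ev_diff ev_mult ev_gen sl2_bracket_const ev_add sl2_comb_def ev_scal smult_mult_left)
qed

lemma Usl2_lift:
  fixes B :: "('k::field, 'b) module"
  assumes B: "assoc_algebra base_field B" and \<phi>: "\<And>x. \<phi> x \<in> carrier B"
    and rel: "\<And>x y. \<phi> x \<otimes>\<^bsub>B\<^esub> \<phi> y = \<phi> y \<otimes>\<^bsub>B\<^esub> \<phi> x \<oplus>\<^bsub>B\<^esub> sl2_comb B x y \<phi>"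
  shows "presented_lift B \<phi> \<in> alg_hom base_field Usl2 B"
    and "presented_lift B \<phi> (Usl2_gen x) = \<phi> x"
proof -
  interpret free_evaluation B \<phi> by (intro free_evaluation.intro B free_evaluation_axioms.intro \<phi>)
  have c: "sl2_comb B x y \<phi> \<in> carrier B" for x y
    by (simp add: sl2_comb_def)
  have 0: "free_eval B \<phi> p = \<zero>\<^bsub>B\<^esub>" if p0: "p \<in> Usl2_rels" for p
  proof -
    obtain x y where p: "p = gen x * gen y - gen y * gen x - sl2_bracket x y"
      using p0 by (auto simp: Usl2_rels_def)
    have "\<phi> x \<otimes>\<^bsub>B\<^esub> \<phi> y \<ominus>\<^bsub>B\<^esub> \<phi> y \<otimes>\<^bsub>B\<^esub> \<phi> x = sl2_comb B x y \<phi>"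
      using rel[of x y] c[of x y] by (simp add: minus_eq a_assoc r_neg1 a_comm[of "\<ominus>\<^bsub>B\<^esub> _"] a_lcomm r_neg)
    then show ?thesis
      unfolding p sl2_rel_ev[OF free_evaluation_axioms] using c[of x y] by (simp add: minus_eq r_neg)
  qed
  show "presented_lift B \<phi> \<in> alg_hom base_field Usl2 B"
    unfolding Usl2_def by (rule presented_lift_hom[OF B \<phi> 0])
  show "presented_lift B \<phi> (Usl2_gen x) = \<phi> x"
    unfolding Usl2_gen_def by (rule presented_lift_gen[OF B \<phi> 0])
qed

lemma assoc_algebra_Usl2: "assoc_algebra base_field Usl2"
  unfolding Usl2_def by (rule assoc_algebra_presented)

interpretation U: assoc_algebra base_field Usl2 by (rule assoc_algebra_Usl2)

lemma Usl2_gen_closed [simp, intro]: "Usl2_gen x \<in> carrier Usl2"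
  by (simp add: Usl2_def Usl2_gen_def presented_class_simps)

lemma Usl2_gen_comm:
  "(Usl2_gen x :: 'k::field usl2) \<otimes>\<^bsub>Usl2\<^esub> Usl2_gen y = Usl2_gen y \<otimes>\<^bsub>Usl2\<^esub> Usl2_gen x \<oplus>\<^bsub>Usl2\<^esub> sl2_comb Usl2 x y Usl2_gen"
proof -
  let ?p = "gen x * gen y - gen y * gen x - sl2_bracket x y :: (sl2_basis, 'k) free_alg"
  have "presented_class Usl2_rels ?p = \<zero>\<^bsub>Usl2\<^esub>"
    unfolding Usl2_def by (rule presented_class_rel) (auto simp: Usl2_rels_def)
  moreover have "presented_class Usl2_rels ?p = Usl2_gen x \<otimes>\<^bsub>Usl2\<^esub> Usl2_gen y
      \<ominus>\<^bsub>Usl2\<^esub> Usl2_gen y \<otimes>\<^bsub>Usl2\<^esub> Usl2_gen x \<ominus>\<^bsub>Usl2\<^esub> sl2_comb Usl2 x y Usl2_gen"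
    unfolding sl2_bracket_const sl2_comb_def Usl2_gen_def Usl2_def
    by (simp only: presented_class_simps(2,4,8)) (simp only: presented_class_simps(3))
  moreover have "sl2_comb Usl2 x y Usl2_gen \<in> carrier (Usl2 :: ('k, 'k usl2) module)"
    by (simp add: sl2_comb_def)
  ultimately show ?thesis
    using U.add.inv_solve_right U.r_right_minus_eq
    by (metis (no_types, lifting) U.m_closed U.minus_closed U.minus_eq Usl2_gen_closed U.a_comm U.add.inv_solve_right' )
qed

lemmas Usl2_induct [consumes 1, case_names one add smult mult] =
  presented_induct[of _ Usl2_rels, folded Usl2_def Usl2_gen_def]

abbreviation "UU \<equiv> tensor_alg base_field Usl2 Usl2"
abbreviation "tU \<equiv> tensor base_field Usl2 Usl2"

interpretation UU: tensor_algebras base_field Usl2 Usl2 ..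

text \<open>In a product of the primitive elements of x and y the mixed terms are x \<otimes> y and
  y \<otimes> x, the same for both orders. They cancel in the commutator, so primitive elements
  satisfy the bracket relations.\<close>

lemma Usl2_comult:
  shows "Usl2_comult \<in> alg_hom base_field (Usl2 :: ('k::field, 'k usl2) module) UU"
    and "Usl2_comult (Usl2_gen x :: 'k usl2) = tU (Usl2_gen x) \<one>\<^bsub>Usl2\<^esub> \<oplus>\<^bsub>UU\<^esub> tU \<one>\<^bsub>Usl2\<^esub> (Usl2_gen x)"
proof -
  let ?\<phi> = "\<lambda>x. tU (Usl2_gen x :: 'k usl2) \<one>\<^bsub>Usl2\<^esub> \<oplus>\<^bsub>UU\<^esub> tU \<one>\<^bsub>Usl2\<^esub> (Usl2_gen x)"
  have D: "Usl2_comult = presented_lift UU ?\<phi>" by (simp add: Usl2_comult_def Let_def)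
  have sm: "tU \<one>\<^bsub>Usl2\<^esub> (r \<odot>\<^bsub>Usl2\<^esub> y) = r \<odot>\<^bsub>UU\<^esub> tU \<one>\<^bsub>Usl2\<^esub> y" if "y \<in> carrier Usl2" for r y
    using that UU.tensor_balanced[of r "\<one>\<^bsub>Usl2\<^esub>" y] UU.tensor_smult(3)[of r "\<one>\<^bsub>Usl2\<^esub>" y] by simp
  have sm': "tU (r \<odot>\<^bsub>Usl2\<^esub> y) \<one>\<^bsub>Usl2\<^esub> = r \<odot>\<^bsub>UU\<^esub> tU y \<one>\<^bsub>Usl2\<^esub>" if "y \<in> carrier Usl2" for r y
    using that UU.tensor_smult(3)[of r y "\<one>\<^bsub>Usl2\<^esub>"] by simp
  have comb: "sl2_comb UU x y ?\<phi> = tU (sl2_comb Usl2 x y Usl2_gen) \<one>\<^bsub>Usl2\<^esub> \<oplus>\<^bsub>UU\<^esub> tU \<one>\<^bsub>Usl2\<^esub> (sl2_comb Usl2 x y Usl2_gen)" for x y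
    by (simp add: sl2_comb_def UU.tensor_add_left UU.tensor_add_right sm sm' UU.T.smult_r_distr UU.T.a_ac)
  have rel: "?\<phi> x \<otimes>\<^bsub>UU\<^esub> ?\<phi> y = ?\<phi> y \<otimes>\<^bsub>UU\<^esub> ?\<phi> x \<oplus>\<^bsub>UU\<^esub> sl2_comb UU x y ?\<phi>" for x y
  proof -
    have c: "sl2_comb Usl2 x y Usl2_gen \<in> carrier (Usl2 :: ('k, 'k usl2) module)" by (simp add: sl2_comb_def)
    show ?thesis
      unfolding comb using c
      by (simp add: UU.tensor_mult UU.T.l_distr UU.T.r_distr Usl2_gen_comm[of x y]
          UU.tensor_add_left UU.tensor_add_right UU.T.a_ac)
  qed
  show "Usl2_comult \<in> alg_hom base_field (Usl2 :: ('k, 'k usl2) module) UU"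
    unfolding D by (rule Usl2_lift(1)[where \<phi> = ?\<phi>, OF UU.assoc_algebra_tensor _ rel]) simp
  show "Usl2_comult (Usl2_gen x) = ?\<phi> x"
    unfolding D by (rule Usl2_lift(2)[where \<phi> = ?\<phi>, OF UU.assoc_algebra_tensor _ rel]) simp
qed

lemma assoc_algebra_base: "assoc_algebra base_field (with_smult base_field (*) :: ('k::field, 'k) module)"
  by (rule assoc_algebra_of_type) (simp_all add: algebra_simps)

lemma Usl2_counit:
  shows "Usl2_counit \<in> alg_hom base_field Usl2 (with_smult base_field (*))"
    and "Usl2_counit (Usl2_gen x) = 0"
  unfolding Usl2_counit_def
  by (intro Usl2_lift[OF assoc_algebra_base]; simp add: sl2_comb_def)+

lemma opposite_alg_simps [simp]:
  "carrier (opposite_alg A) = carrier A" "monoid.mult (opposite_alg A) x y = y \<otimes>\<^bsub>A\<^esub> x"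
  "one (opposite_alg A) = one A" "ring.zero (opposite_alg A) = ring.zero A"
  "add (opposite_alg A) = add A" "module.smult (opposite_alg A) = module.smult A"
  by (simp_all add: opposite_alg_def)

lemma assoc_algebra_opposite:
  fixes A :: "('r, 'a) module"
  assumes "assoc_algebra R A" shows "assoc_algebra R (opposite_alg A)"
proof -
  interpret assoc_algebra R A by (fact assms)
  have ab: "abelian_group (opposite_alg A)"
    by (rule abelian_groupI) (auto simp: a_ac r_neg intro!: bexI[where x = "\<ominus>\<^bsub>A\<^esub> _"])
  have mon: "Group.monoid (opposite_alg A)"
    by (rule monoidI) (auto simp: m_assoc)
  show ?thesis
    by (intro assoc_algebraI moduleI ringI ab mon R.is_cring)
      (auto simp: l_distr r_distr smult_l_distr smult_r_distr smult_assoc1 smult_mult_left smult_mult_right)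
qed

text \<open>The two signs cancel in a product, and the order is reversed in the opposite algebra; so
  the commutator of -x and -y there is minus the bracket of x and y, which is what the relation asks
  for.\<close>

lemma Usl2_antipode:
  shows "Usl2_antipode \<in> alg_hom base_field (Usl2 :: ('k::field, 'k usl2) module) (opposite_alg Usl2)"
    and "Usl2_antipode (Usl2_gen x :: 'k usl2) = \<ominus>\<^bsub>Usl2\<^esub> Usl2_gen x"
proof -
  let ?\<phi> = "\<lambda>x. \<ominus>\<^bsub>Usl2\<^esub> (Usl2_gen x :: 'k usl2)"
  have c: "sl2_comb Usl2 x y Usl2_gen \<in> carrier (Usl2 :: ('k, 'k usl2) module)" for x y by (simp add: sl2_comb_def)
  have comb: "sl2_comb (opposite_alg Usl2) x y ?\<phi> = \<ominus>\<^bsub>Usl2\<^esub> sl2_comb Usl2 x y Usl2_gen" for x y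
    by (simp add: sl2_comb_def U.smult_r_minus U.minus_add)
  have rel: "?\<phi> x \<otimes>\<^bsub>opposite_alg Usl2\<^esub> ?\<phi> y
      = ?\<phi> y \<otimes>\<^bsub>opposite_alg Usl2\<^esub> ?\<phi> x \<oplus>\<^bsub>opposite_alg Usl2\<^esub> sl2_comb (opposite_alg Usl2) x y ?\<phi>" for x y
    unfolding comb using c[of x y]
    by (simp add: U.l_minus U.r_minus Usl2_gen_comm[of x y] U.a_assoc U.r_neg)
  show "Usl2_antipode \<in> alg_hom base_field (Usl2 :: ('k, 'k usl2) module) (opposite_alg Usl2)"
    unfolding Usl2_antipode_def by (rule Usl2_lift(1)[where \<phi> = ?\<phi>, OF assoc_algebra_opposite[OF assoc_algebra_Usl2] _ rel]) simp
  show "Usl2_antipode (Usl2_gen x) = ?\<phi> x"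
    unfolding Usl2_antipode_def by (rule Usl2_lift(2)[where \<phi> = ?\<phi>, OF assoc_algebra_opposite[OF assoc_algebra_Usl2] _ rel]) simp
qed

section \<open>The smash product attached to a homomorphism from the enveloping algebra\<close>

text \<open>\<open>gamma_action\<close> with an arbitrary algebra in place of \<open>Uzeta\<close>;
  the whole smash product argument is carried out at this level.\<close>

definition adjoint_action ::
  "('k::field, 'b) module \<Rightarrow> ('k usl2 \<Rightarrow> 'b) \<Rightarrow> 'k usl2 \<Rightarrow> 'b \<Rightarrow> 'b" where
  "adjoint_action B \<gamma> v a =
     tensor_lift (add_monoid B)
       (\<lambda>v1 v2. \<gamma> v1 \<otimes>\<^bsub>B\<^esub> a \<otimes>\<^bsub>B\<^esub> \<gamma> (Usl2_antipode v2)) (Usl2_comult v)"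

text \<open>\<open>B\<close> and \<open>H\<close> stand for \<open>Uzeta\<close> and the small
  quantum group. Stability of \<open>H\<close> under the action is demanded in the form that can be
  verified: commutators with the images of the generators.\<close>

locale sl2_smash = g: alg_morphism base_field Usl2 B \<gamma>
  for B :: "('k::field, 'b) module" and \<gamma> :: "'k usl2 \<Rightarrow> 'b" +
  fixes H :: "'b set"
  assumes subalg: "is_subalg base_field B H"
    and comm_closed: "a \<in> H \<Longrightarrow>
      \<gamma> (Usl2_gen x) \<otimes>\<^bsub>B\<^esub> a \<ominus>\<^bsub>B\<^esub> a \<otimes>\<^bsub>B\<^esub> \<gamma> (Usl2_gen x) \<in> H"
begin

abbreviation "U \<equiv> Usl2 :: ('k, 'k usl2) module"
abbreviation "\<Delta> \<equiv> Usl2_comult :: 'k usl2 \<Rightarrow> ('k usl2 \<times> 'k usl2 \<Rightarrow>\<^sub>0 int) set"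
abbreviation "S \<equiv> Usl2_antipode :: 'k usl2 \<Rightarrow> 'k usl2"

sublocale UU: tensor_algebras base_field U U ..

sublocale D: alg_morphism base_field U UU.T \<Delta>
  by (intro alg_morphism.intro g.A.assoc_algebra_axioms UU.assoc_algebra_tensor alg_morphism_axioms.intro Usl2_comult(1))

sublocale E: alg_morphism base_field U "with_smult base_field (*)" "Usl2_counit :: 'k usl2 \<Rightarrow> 'k"
  by (intro alg_morphism.intro g.A.assoc_algebra_axioms assoc_algebra_base alg_morphism_axioms.intro Usl2_counit(1))

sublocale S: alg_morphism base_field U "opposite_alg U" S
  by (intro alg_morphism.intro g.A.assoc_algebra_axioms assoc_algebra_opposite alg_morphism_axioms.intro Usl2_antipode(1))

lemma S_simps:
  "v \<in> carrier U \<Longrightarrow> S v \<in> carrier U" "S \<one>\<^bsub>U\<^esub> = \<one>\<^bsub>U\<^esub>"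
  "v \<in> carrier U \<Longrightarrow> w \<in> carrier U \<Longrightarrow> S (v \<oplus>\<^bsub>U\<^esub> w) = S v \<oplus>\<^bsub>U\<^esub> S w"
  "v \<in> carrier U \<Longrightarrow> w \<in> carrier U \<Longrightarrow> S (v \<otimes>\<^bsub>U\<^esub> w) = S w \<otimes>\<^bsub>U\<^esub> S v"
  "v \<in> carrier U \<Longrightarrow> S (r \<odot>\<^bsub>U\<^esub> v) = r \<odot>\<^bsub>U\<^esub> S v"
  using S.closed[of v] S.one S.add[of v w] S.mult[of v w] S.smult[of r v] by simp_all

abbreviation "T \<equiv> UU.T"
abbreviation "t \<equiv> UU.t"

text \<open>The action before composition with the comultiplication: v \<otimes> w sends a to
  \<gamma>(v) a \<gamma>(S w), which makes \<open>B\<close> a module over the tensor square of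
  U.\<close>

definition ad_tensor where
  "ad_tensor Q a = tensor_lift (add_monoid B) (\<lambda>v1 v2. \<gamma> v1 \<otimes>\<^bsub>B\<^esub> a \<otimes>\<^bsub>B\<^esub> \<gamma> (S v2)) Q"

lemma ad_tensor_balanced:
  "a \<in> carrier B \<Longrightarrow> balanced base_field U U B (\<lambda>v1 v2. \<gamma> v1 \<otimes>\<^bsub>B\<^esub> a \<otimes>\<^bsub>B\<^esub> \<gamma> (S v2))"
  by (rule balancedI)
    (auto simp: S_simps g.add g.mult g.smult g.B.l_distr g.B.r_distr g.B.smult_mult_left g.B.smult_mult_right)

lemma ad_tensor:
  assumes a: "a \<in> carrier B"
  shows "Q \<in> carrier T \<Longrightarrow> ad_tensor Q a \<in> carrier B"
    and "Q \<in> carrier T \<Longrightarrow> Y \<in> carrier T \<Longrightarrow> ad_tensor (Q \<oplus>\<^bsub>T\<^esub> Y) a = ad_tensor Q a \<oplus>\<^bsub>B\<^esub> ad_tensor Y a"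
    and "v \<in> carrier U \<Longrightarrow> w \<in> carrier U \<Longrightarrow> ad_tensor (t v w) a = \<gamma> v \<otimes>\<^bsub>B\<^esub> a \<otimes>\<^bsub>B\<^esub> \<gamma> (S w)"
    and "Q \<in> carrier T \<Longrightarrow> ad_tensor (r \<odot>\<^bsub>T\<^esub> Q) a = r \<odot>\<^bsub>B\<^esub> ad_tensor Q a"
proof -
  note * = g.B.abelian_group_axioms ad_tensor_balanced[OF a]
  show "Q \<in> carrier T \<Longrightarrow> ad_tensor Q a \<in> carrier B"
    "Q \<in> carrier T \<Longrightarrow> Y \<in> carrier T \<Longrightarrow> ad_tensor (Q \<oplus>\<^bsub>T\<^esub> Y) a = ad_tensor Q a \<oplus>\<^bsub>B\<^esub> ad_tensor Y a"
    "v \<in> carrier U \<Longrightarrow> w \<in> carrier U \<Longrightarrow> ad_tensor (t v w) a = \<gamma> v \<otimes>\<^bsub>B\<^esub> a \<otimes>\<^bsub>B\<^esub> \<gamma> (S w)"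
    unfolding ad_tensor_def
    by (simp_all add: UU.tensor_lift_closed[OF *] UU.tensor_lift_add[OF *] UU.tensor_lift_tensor[OF *])
  show "Q \<in> carrier T \<Longrightarrow> ad_tensor (r \<odot>\<^bsub>T\<^esub> Q) a = r \<odot>\<^bsub>B\<^esub> ad_tensor Q a"
    unfolding ad_tensor_def
    by (rule UU.tensor_lift_smult[OF g.B.module_axioms *(2)])
      (auto simp: a g.smult g.B.smult_mult_left S_simps)
qed

lemma ad_tensor_linear:
  assumes Q: "Q \<in> carrier T"
  shows "a \<in> carrier B \<Longrightarrow> b \<in> carrier B \<Longrightarrow> ad_tensor Q (a \<oplus>\<^bsub>B\<^esub> b) = ad_tensor Q a \<oplus>\<^bsub>B\<^esub> ad_tensor Q b"
    and "a \<in> carrier B \<Longrightarrow> ad_tensor Q (r \<odot>\<^bsub>B\<^esub> a) = r \<odot>\<^bsub>B\<^esub> ad_tensor Q a"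
  using Q
  by (induction rule: UU.tensor_induct)
    (simp_all add: ad_tensor g.B.l_distr g.B.r_distr S_simps g.B.a_ac g.B.smult_mult_left g.B.smult_mult_right
      g.B.smult_r_distr)

text \<open>S reverses products, so \<gamma>(v v') a \<gamma>(S (w w')) is the nesting of two such
  operations. As the comultiplication is multiplicative, \<open>act\<close> becomes a module
  structure over U.\<close>

lemma ad_tensor_mult:
  assumes Q: "Q \<in> carrier T" and Y: "Y \<in> carrier T" and a: "a \<in> carrier B"
  shows "ad_tensor (Q \<otimes>\<^bsub>T\<^esub> Y) a = ad_tensor Q (ad_tensor Y a)"
  using Q
proof (induction rule: UU.tensor_induct)
  case (tensor v w)
  show ?case using Y
  proof (induction rule: UU.tensor_induct)
    case (tensor v' w')
    with \<open>v \<in> carrier U\<close> \<open>w \<in> carrier U\<close> a show ?case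
      by (simp add: UU.tensor_mult ad_tensor g.mult S_simps g.B.m_assoc)
  next
    case (add Y Z)
    with tensor a show ?case
      by (simp add: UU.tensor_mult ad_tensor ad_tensor_linear)
  qed
next
  case (add Q Z)
  with Y a show ?case by (simp add: UU.tensor_mult ad_tensor)
qed

abbreviation "act \<equiv> adjoint_action B \<gamma>"
abbreviation "gn \<equiv> Usl2_gen :: _ \<Rightarrow> 'k usl2"

lemma act_ad_tensor: "act v a = ad_tensor (\<Delta> v) a"
  by (simp add: adjoint_action_def ad_tensor_def)

lemma H_sub: "a \<in> H \<Longrightarrow> a \<in> carrier B"
  using subalg by (auto simp: is_subalg_def)

lemma H_closed:
  "a \<in> H \<Longrightarrow> b \<in> H \<Longrightarrow> a \<oplus>\<^bsub>B\<^esub> b \<in> H" "a \<in> H \<Longrightarrow> b \<in> H \<Longrightarrow> a \<otimes>\<^bsub>B\<^esub> b \<in> H" "a \<in> H \<Longrightarrow> r \<odot>\<^bsub>B\<^esub> a \<in> H" "\<one>\<^bsub>B\<^esub> \<in> H"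
  using subalg by (auto simp: is_subalg_def)

lemma act_simps:
  "v \<in> carrier U \<Longrightarrow> a \<in> carrier B \<Longrightarrow> act v a \<in> carrier B"
  "v \<in> carrier U \<Longrightarrow> w \<in> carrier U \<Longrightarrow> a \<in> carrier B \<Longrightarrow> act (v \<oplus>\<^bsub>U\<^esub> w) a = act v a \<oplus>\<^bsub>B\<^esub> act w a"
  "v \<in> carrier U \<Longrightarrow> a \<in> carrier B \<Longrightarrow> act (r \<odot>\<^bsub>U\<^esub> v) a = r \<odot>\<^bsub>B\<^esub> act v a"
  "v \<in> carrier U \<Longrightarrow> a \<in> carrier B \<Longrightarrow> b \<in> carrier B \<Longrightarrow> act v (a \<oplus>\<^bsub>B\<^esub> b) = act v a \<oplus>\<^bsub>B\<^esub> act v b"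
  "v \<in> carrier U \<Longrightarrow> a \<in> carrier B \<Longrightarrow> act v (r \<odot>\<^bsub>B\<^esub> a) = r \<odot>\<^bsub>B\<^esub> act v a"
  "v \<in> carrier U \<Longrightarrow> w \<in> carrier U \<Longrightarrow> a \<in> carrier B \<Longrightarrow> act (v \<otimes>\<^bsub>U\<^esub> w) a = act v (act w a)"
  unfolding act_ad_tensor
  by (simp_all add: D.add D.mult D.smult ad_tensor ad_tensor_linear ad_tensor_mult)

lemma act_one: "a \<in> carrier B \<Longrightarrow> act \<one>\<^bsub>U\<^esub> a = a"
  unfolding act_ad_tensor by (simp add: UU.one_tensor ad_tensor S_simps)

text \<open>S x = -x turns the two terms x \<otimes> 1 and 1 \<otimes> x of the comultiplication
  into a commutator.\<close>

lemma act_gen: "a \<in> carrier B \<Longrightarrow> act (gn x) a = \<gamma> (gn x) \<otimes>\<^bsub>B\<^esub> a \<ominus>\<^bsub>B\<^esub> a \<otimes>\<^bsub>B\<^esub> \<gamma> (gn x)"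
  unfolding act_ad_tensor
  by (simp add: Usl2_comult ad_tensor S_simps Usl2_antipode g.a_inv g.B.minus_eq g.B.r_minus)

lemma act_H: "v \<in> carrier U \<Longrightarrow> a \<in> H \<Longrightarrow> act v a \<in> H"
proof (induction v rule: Usl2_induct)
  case (mult x v)
  then show ?case by (simp add: act_simps H_sub act_gen comm_closed)
qed (simp_all add: act_simps H_sub act_one H_closed)

text \<open>Commutators kill 1 and generators have counit 0, so both sides vanish once a generator
  is split off.\<close>

lemma act_one_right: "v \<in> carrier U \<Longrightarrow> act v \<one>\<^bsub>B\<^esub> = Usl2_counit v \<odot>\<^bsub>B\<^esub> \<one>\<^bsub>B\<^esub>"
proof (induction v rule: Usl2_induct)
  case one
  then show ?case using g.B.smult_one[of "\<one>\<^bsub>B\<^esub>"] E.one by (simp add: act_one)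
next
  case (add x y)
  then show ?case using g.B.smult_l_distr[of "Usl2_counit x" "Usl2_counit y"] E.add by (simp add: act_simps)
next
  case (smult c x)
  then show ?case using g.B.smult_assoc1[of c "Usl2_counit x"] E.smult by (simp add: act_simps)
next
  case (mult x v)
  then show ?case
    using E.mult[of "gn x" v] g.B.smult_l_null[of "\<one>\<^bsub>B\<^esub>"] g.B.smult_r_null[of "Usl2_counit v"]
    by (simp add: act_simps act_gen Usl2_counit g.B.smult_mult_left g.B.smult_mult_right g.B.minus_eq g.B.r_neg)
qed

lemma comult_gen_mult:
  assumes "v \<in> carrier U" "w \<in> carrier U"
  shows "\<Delta> (gn x) \<otimes>\<^bsub>T\<^esub> t v w = t (gn x \<otimes>\<^bsub>U\<^esub> v) w \<oplus>\<^bsub>T\<^esub> t v (gn x \<otimes>\<^bsub>U\<^esub> w)"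
  using assms by (simp add: Usl2_comult UU.tensor_mult)

lemma derivation:
  assumes "a \<in> carrier B" "b \<in> carrier B" "c \<in> carrier B"
  shows "c \<otimes>\<^bsub>B\<^esub> (a \<otimes>\<^bsub>B\<^esub> b) \<ominus>\<^bsub>B\<^esub> a \<otimes>\<^bsub>B\<^esub> b \<otimes>\<^bsub>B\<^esub> c
    = (c \<otimes>\<^bsub>B\<^esub> a \<ominus>\<^bsub>B\<^esub> a \<otimes>\<^bsub>B\<^esub> c) \<otimes>\<^bsub>B\<^esub> b \<oplus>\<^bsub>B\<^esub> a \<otimes>\<^bsub>B\<^esub> (c \<otimes>\<^bsub>B\<^esub> b \<ominus>\<^bsub>B\<^esub> b \<otimes>\<^bsub>B\<^esub> c)"
proof -
  have "x \<oplus>\<^bsub>B\<^esub> \<ominus>\<^bsub>B\<^esub> y \<oplus>\<^bsub>B\<^esub> (y \<oplus>\<^bsub>B\<^esub> \<ominus>\<^bsub>B\<^esub> z) = x \<oplus>\<^bsub>B\<^esub> \<ominus>\<^bsub>B\<^esub> z" if "x \<in> carrier B" "y \<in> carrier B" "z \<in> carrier B" for x y z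
    using that by (simp add: g.B.a_assoc g.B.r_neg1)
  then show ?thesis using assms
    by (simp add: g.B.minus_eq g.B.l_distr g.B.r_distr g.B.l_minus g.B.r_minus g.B.m_assoc)
qed

abbreviation "A \<equiv> B\<lparr>carrier := H\<rparr>"

sublocale A: assoc_algebra base_field A by (rule g.B.subalg_assoc_algebra[OF subalg])

definition act2 where
  "act2 a b Q = tensor_lift (add_monoid A) (\<lambda>v1 v2. act v1 a \<otimes>\<^bsub>A\<^esub> act v2 b) Q"

lemma act2:
  assumes ab: "a \<in> H" "b \<in> H"
  shows "Q \<in> carrier T \<Longrightarrow> act2 a b Q \<in> H"
    and "Q \<in> carrier T \<Longrightarrow> Y \<in> carrier T \<Longrightarrow> act2 a b (Q \<oplus>\<^bsub>T\<^esub> Y) = act2 a b Q \<oplus>\<^bsub>B\<^esub> act2 a b Y"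
    and "v \<in> carrier U \<Longrightarrow> w \<in> carrier U \<Longrightarrow> act2 a b (t v w) = act v a \<otimes>\<^bsub>B\<^esub> act w b"
    and "Q \<in> carrier T \<Longrightarrow> act2 a b (r \<odot>\<^bsub>T\<^esub> Q) = r \<odot>\<^bsub>B\<^esub> act2 a b Q"
proof -
  have bal: "balanced base_field U U A (\<lambda>v1 v2. act v1 a \<otimes>\<^bsub>A\<^esub> act v2 b)"
    by (rule balancedI)
      (simp_all add: ab act_H H_closed act_simps H_sub g.B.l_distr g.B.r_distr g.B.smult_mult_left g.B.smult_mult_right)
  note * = A.abelian_group_axioms bal
  show "Q \<in> carrier T \<Longrightarrow> act2 a b Q \<in> H"
    "Q \<in> carrier T \<Longrightarrow> Y \<in> carrier T \<Longrightarrow> act2 a b (Q \<oplus>\<^bsub>T\<^esub> Y) = act2 a b Q \<oplus>\<^bsub>B\<^esub> act2 a b Y"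
    "v \<in> carrier U \<Longrightarrow> w \<in> carrier U \<Longrightarrow> act2 a b (t v w) = act v a \<otimes>\<^bsub>B\<^esub> act w b"
    unfolding act2_def
    using UU.tensor_lift_closed[OF *, of Q] UU.tensor_lift_add[OF *, of Q Y] UU.tensor_lift_tensor[OF *, of v w]
    by simp_all
  show "Q \<in> carrier T \<Longrightarrow> act2 a b (r \<odot>\<^bsub>T\<^esub> Q) = r \<odot>\<^bsub>B\<^esub> act2 a b Q"
    unfolding act2_def
    using UU.tensor_lift_smult[OF A.module_axioms bal _ _, of r Q]
    by (simp add: ab act_H H_closed act_simps H_sub g.B.smult_mult_left)
qed

text \<open>The Leibniz rule for the commutator with \<gamma>(x), matched against x \<otimes> 1 + 1
  \<otimes> x. This is the induction step for the module algebra law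
  \<open>act_mult_right\<close>.\<close>

lemma act2_gen_mult:
  assumes Q: "Q \<in> carrier T" and ab: "a \<in> H" "b \<in> H"
  shows "act2 a b (\<Delta> (gn x) \<otimes>\<^bsub>T\<^esub> Q) = act (gn x) (act2 a b Q)"
  using Q
proof (induction rule: UU.tensor_induct)
  case (tensor v w)
  then show ?case
    by (simp add: comult_gen_mult act2 ab act_simps H_sub act_gen derivation)
next
  case (add Q Y)
  then show ?case
    by (simp add: UU.tensor_mult act2 ab act_simps H_sub)
qed

lemma act_mult_right:
  assumes ab: "a \<in> H" "b \<in> H"
  shows "v \<in> carrier U \<Longrightarrow> act v (a \<otimes>\<^bsub>B\<^esub> b) = act2 a b (\<Delta> v)"
  by (induction v rule: Usl2_induct)
    (simp_all add: ab H_sub act_simps D.add D.smult D.mult act2 act2_gen_mult UU.one_tensor act_one)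

lemma module_algebra: "module_algebra base_field A U \<Delta> Usl2_counit act"
proof (intro module_algebra.intro module_algebra_axioms.intro)
  show "act v (a \<otimes>\<^bsub>A\<^esub> b) = tensor_lift (add_monoid A) (\<lambda>v1 v2. act v1 a \<otimes>\<^bsub>A\<^esub> act v2 b) (\<Delta> v)"
    if "v \<in> carrier U" "a \<in> carrier A" "b \<in> carrier A" for v a b
    using act_mult_right[of a b v] that by (simp add: act2_def)
qed (simp_all add: A.assoc_algebra_axioms g.A.assoc_algebra_axioms act_H act_simps H_sub act_one act_one_right)

definition act_\<gamma> where
  "act_\<gamma> b Q = tensor_lift (add_monoid B) (\<lambda>v1 v2. act v1 b \<otimes>\<^bsub>B\<^esub> \<gamma> v2) Q"

lemma act_\<gamma>:
  assumes b: "b \<in> carrier B"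
  shows "Q \<in> carrier T \<Longrightarrow> act_\<gamma> b Q \<in> carrier B"
    and "Q \<in> carrier T \<Longrightarrow> Y \<in> carrier T \<Longrightarrow> act_\<gamma> b (Q \<oplus>\<^bsub>T\<^esub> Y) = act_\<gamma> b Q \<oplus>\<^bsub>B\<^esub> act_\<gamma> b Y"
    and "v \<in> carrier U \<Longrightarrow> w \<in> carrier U \<Longrightarrow> act_\<gamma> b (t v w) = act v b \<otimes>\<^bsub>B\<^esub> \<gamma> w"
    and "Q \<in> carrier T \<Longrightarrow> act_\<gamma> b (r \<odot>\<^bsub>T\<^esub> Q) = r \<odot>\<^bsub>B\<^esub> act_\<gamma> b Q"
proof -
  have bal: "balanced base_field U U B (\<lambda>v1 v2. act v1 b \<otimes>\<^bsub>B\<^esub> \<gamma> v2)"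
    by (rule balancedI)
      (simp_all add: b act_simps g.B.l_distr g.B.r_distr g.add g.smult g.B.smult_mult_left g.B.smult_mult_right)
  note * = g.B.abelian_group_axioms bal
  show "Q \<in> carrier T \<Longrightarrow> act_\<gamma> b Q \<in> carrier B"
    "Q \<in> carrier T \<Longrightarrow> Y \<in> carrier T \<Longrightarrow> act_\<gamma> b (Q \<oplus>\<^bsub>T\<^esub> Y) = act_\<gamma> b Q \<oplus>\<^bsub>B\<^esub> act_\<gamma> b Y"
    "v \<in> carrier U \<Longrightarrow> w \<in> carrier U \<Longrightarrow> act_\<gamma> b (t v w) = act v b \<otimes>\<^bsub>B\<^esub> \<gamma> w"
    unfolding act_\<gamma>_def
    using UU.tensor_lift_closed[OF *, of Q] UU.tensor_lift_add[OF *, of Q Y] UU.tensor_lift_tensor[OF *, of v w]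
    by simp_all
  show "Q \<in> carrier T \<Longrightarrow> act_\<gamma> b (r \<odot>\<^bsub>T\<^esub> Q) = r \<odot>\<^bsub>B\<^esub> act_\<gamma> b Q"
    unfolding act_\<gamma>_def
    using UU.tensor_lift_smult[OF g.B.module_axioms bal _ _, of r Q]
    by (simp add: b act_simps g.B.smult_mult_left)
qed

text \<open>Write c for the result of v acting on b. Then (\<gamma>(x) c - c \<gamma>(x))
  \<gamma>(w) + c \<gamma>(x w) collapses to \<gamma>(x) c \<gamma>(w).\<close>

lemma act_\<gamma>_gen_mult:
  assumes Q: "Q \<in> carrier T" and b: "b \<in> carrier B"
  shows "act_\<gamma> b (\<Delta> (gn x) \<otimes>\<^bsub>T\<^esub> Q) = \<gamma> (gn x) \<otimes>\<^bsub>B\<^esub> act_\<gamma> b Q"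
  using Q
proof (induction rule: UU.tensor_induct)
  case (tensor v w)
  have "a \<oplus>\<^bsub>B\<^esub> \<ominus>\<^bsub>B\<^esub> c \<oplus>\<^bsub>B\<^esub> c = a" if "a \<in> carrier B" "c \<in> carrier B" for a c
    using that by (simp add: g.B.a_assoc g.B.l_neg)
  with tensor show ?case
    by (simp add: comult_gen_mult act_\<gamma> b act_simps act_gen g.mult g.B.minus_eq g.B.l_distr g.B.l_minus g.B.m_assoc)
next
  case (add Q Y)
  then show ?case
    by (simp add: UU.tensor_mult act_\<gamma> b g.B.r_distr)
qed

text \<open>The straightening rule \<gamma>(v) b = (v_1 . b) \<gamma>(v_2). It turns a product of
  two images under the smash map into the image of the smash product.\<close>

lemma \<gamma>_mult:
  assumes b: "b \<in> carrier B"
  shows "v \<in> carrier U \<Longrightarrow> \<gamma> v \<otimes>\<^bsub>B\<^esub> b = act_\<gamma> b (\<Delta> v)"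
  by (induction v rule: Usl2_induct)
    (simp_all add: b D.add D.smult D.mult act_\<gamma> act_\<gamma>_gen_mult UU.one_tensor act_one g.add g.mult g.smult
      g.B.l_distr g.B.smult_mult_left g.B.m_assoc)

section \<open>The smash product and its comparison map to the ambient algebra\<close>

sublocale AU: tensor_algebras base_field A U ..

abbreviation "W \<equiv> smash base_field A U \<Delta> act"

text \<open>\<open>smash\<close> nests three lifts, unwound here from the inside:
  \<open>inner\<close> is the Sweedler sum with \<open>Q\<close> in place of
  \<open>\<Delta> v\<close>, and \<open>middle Y a v\<close> below is the product of a # v with
  \<open>Y\<close>.\<close>

definition inner where
  "inner a b w Q = tensor_lift (add_monoid AU.T) (\<lambda>v1 v2. AU.t (a \<otimes>\<^bsub>A\<^esub> act v1 b) (v2 \<otimes>\<^bsub>U\<^esub> w)) Q"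

lemma inner:
  assumes ab: "a \<in> H" "b \<in> H" "w \<in> carrier U"
  shows "Q \<in> carrier T \<Longrightarrow> inner a b w Q \<in> carrier AU.T"
    and "Q \<in> carrier T \<Longrightarrow> Y \<in> carrier T \<Longrightarrow> inner a b w (Q \<oplus>\<^bsub>T\<^esub> Y) = inner a b w Q \<oplus>\<^bsub>AU.T\<^esub> inner a b w Y"
    and "v1 \<in> carrier U \<Longrightarrow> v2 \<in> carrier U \<Longrightarrow> inner a b w (t v1 v2) = AU.t (a \<otimes>\<^bsub>B\<^esub> act v1 b) (v2 \<otimes>\<^bsub>U\<^esub> w)"
    and "Q \<in> carrier T \<Longrightarrow> inner a b w (r \<odot>\<^bsub>T\<^esub> Q) = r \<odot>\<^bsub>AU.T\<^esub> inner a b w Q"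
proof -
  have add: "AU.t (x \<oplus>\<^bsub>B\<^esub> y) z = AU.t x z \<oplus>\<^bsub>AU.T\<^esub> AU.t y z" if "x \<in> H" "y \<in> H" "z \<in> carrier U" for x y z
    using AU.tensor_add_left[of x y z] that by simp
  have sm: "AU.t (r \<odot>\<^bsub>B\<^esub> x) z = AU.t x (r \<odot>\<^bsub>U\<^esub> z)" if "x \<in> H" "z \<in> carrier U" for x z r
    using AU.tensor_balanced[of r x z] that by simp
  have sm': "AU.t (r \<odot>\<^bsub>B\<^esub> x) z = r \<odot>\<^bsub>AU.T\<^esub> AU.t x z" if "x \<in> H" "z \<in> carrier U" for x z r
    using AU.tensor_smult(3)[of r x z] that by simp
  have bal: "balanced base_field U U AU.T (\<lambda>v1 v2. AU.t (a \<otimes>\<^bsub>A\<^esub> act v1 b) (v2 \<otimes>\<^bsub>U\<^esub> w))"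
    by (rule balancedI)
      (simp_all add: ab act_H H_closed act_simps H_sub g.B.r_distr g.B.smult_mult_right add sm
        AU.tensor_add_right g.A.l_distr g.A.smult_mult_left)
  note * = AU.abelian_group_tensor bal
  show "Q \<in> carrier T \<Longrightarrow> inner a b w Q \<in> carrier AU.T"
    "Q \<in> carrier T \<Longrightarrow> Y \<in> carrier T \<Longrightarrow> inner a b w (Q \<oplus>\<^bsub>T\<^esub> Y) = inner a b w Q \<oplus>\<^bsub>AU.T\<^esub> inner a b w Y"
    "v1 \<in> carrier U \<Longrightarrow> v2 \<in> carrier U \<Longrightarrow> inner a b w (t v1 v2) = AU.t (a \<otimes>\<^bsub>B\<^esub> act v1 b) (v2 \<otimes>\<^bsub>U\<^esub> w)"
    unfolding inner_def
    using UU.tensor_lift_closed[OF *, of Q] UU.tensor_lift_add[OF *, of Q Y] UU.tensor_lift_tensor[OF *, of v1 v2]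
    by simp_all
  show "Q \<in> carrier T \<Longrightarrow> inner a b w (r \<odot>\<^bsub>T\<^esub> Q) = r \<odot>\<^bsub>AU.T\<^esub> inner a b w Q"
    unfolding inner_def
    using UU.tensor_lift_smult[OF AU.module_tensor bal _ _, of r Q]
    by (simp add: ab act_H H_closed act_simps H_sub g.B.smult_mult_right sm')
qed

lemma inner_add:
  assumes Q: "Q \<in> carrier T"
  shows "a \<in> H \<Longrightarrow> a' \<in> H \<Longrightarrow> b \<in> H \<Longrightarrow> w \<in> carrier U \<Longrightarrow>
      inner (a \<oplus>\<^bsub>B\<^esub> a') b w Q = inner a b w Q \<oplus>\<^bsub>AU.T\<^esub> inner a' b w Q"
    and "a \<in> H \<Longrightarrow> b \<in> H \<Longrightarrow> b' \<in> H \<Longrightarrow> w \<in> carrier U \<Longrightarrow>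
      inner a (b \<oplus>\<^bsub>B\<^esub> b') w Q = inner a b w Q \<oplus>\<^bsub>AU.T\<^esub> inner a b' w Q"
    and "a \<in> H \<Longrightarrow> b \<in> H \<Longrightarrow> w \<in> carrier U \<Longrightarrow> w' \<in> carrier U \<Longrightarrow>
      inner a b (w \<oplus>\<^bsub>U\<^esub> w') Q = inner a b w Q \<oplus>\<^bsub>AU.T\<^esub> inner a b w' Q"
    and "a \<in> H \<Longrightarrow> b \<in> H \<Longrightarrow> w \<in> carrier U \<Longrightarrow> inner (r \<odot>\<^bsub>B\<^esub> a) b w Q = r \<odot>\<^bsub>AU.T\<^esub> inner a b w Q"
    and "a \<in> H \<Longrightarrow> b \<in> H \<Longrightarrow> w \<in> carrier U \<Longrightarrow> inner a (r \<odot>\<^bsub>B\<^esub> b) w Q = r \<odot>\<^bsub>AU.T\<^esub> inner a b w Q"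
    and "a \<in> H \<Longrightarrow> b \<in> H \<Longrightarrow> w \<in> carrier U \<Longrightarrow> inner a b (r \<odot>\<^bsub>U\<^esub> w) Q = r \<odot>\<^bsub>AU.T\<^esub> inner a b w Q"
proof -
  have add: "AU.t (x \<oplus>\<^bsub>B\<^esub> y) z = AU.t x z \<oplus>\<^bsub>AU.T\<^esub> AU.t y z" if "x \<in> H" "y \<in> H" "z \<in> carrier U" for x y z
    using AU.tensor_add_left[of x y z] that by simp
  have sm: "AU.t (r \<odot>\<^bsub>B\<^esub> x) z = r \<odot>\<^bsub>AU.T\<^esub> AU.t x z" if "x \<in> H" "z \<in> carrier U" for x z r
    using AU.tensor_smult(3)[of r x z] that by simp
  have sm': "AU.t x (r \<odot>\<^bsub>U\<^esub> z) = r \<odot>\<^bsub>AU.T\<^esub> AU.t x z" if "x \<in> H" "z \<in> carrier U" for x z r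
    using AU.tensor_balanced[of r x z] AU.tensor_smult(3)[of r x z] that by simp
  note s = inner add sm sm' act_H H_closed act_simps H_sub g.B.r_distr g.B.l_distr g.A.r_distr
    g.B.smult_mult_right g.B.smult_mult_left g.A.smult_mult_right AU.tensor_add_right AU.T.a_ac AU.T.smult_r_distr
  show "a \<in> H \<Longrightarrow> a' \<in> H \<Longrightarrow> b \<in> H \<Longrightarrow> w \<in> carrier U \<Longrightarrow>
      inner (a \<oplus>\<^bsub>B\<^esub> a') b w Q = inner a b w Q \<oplus>\<^bsub>AU.T\<^esub> inner a' b w Q"
    using Q by (induction rule: UU.tensor_induct) (simp_all add: s)
  show "a \<in> H \<Longrightarrow> b \<in> H \<Longrightarrow> b' \<in> H \<Longrightarrow> w \<in> carrier U \<Longrightarrow>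
      inner a (b \<oplus>\<^bsub>B\<^esub> b') w Q = inner a b w Q \<oplus>\<^bsub>AU.T\<^esub> inner a b' w Q"
    using Q by (induction rule: UU.tensor_induct) (simp_all add: s)
  show "a \<in> H \<Longrightarrow> b \<in> H \<Longrightarrow> w \<in> carrier U \<Longrightarrow> w' \<in> carrier U \<Longrightarrow>
      inner a b (w \<oplus>\<^bsub>U\<^esub> w') Q = inner a b w Q \<oplus>\<^bsub>AU.T\<^esub> inner a b w' Q"
    using Q by (induction rule: UU.tensor_induct) (simp_all add: s)
  show "a \<in> H \<Longrightarrow> b \<in> H \<Longrightarrow> w \<in> carrier U \<Longrightarrow> inner (r \<odot>\<^bsub>B\<^esub> a) b w Q = r \<odot>\<^bsub>AU.T\<^esub> inner a b w Q"
    using Q by (induction rule: UU.tensor_induct) (simp_all add: s)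
  show "a \<in> H \<Longrightarrow> b \<in> H \<Longrightarrow> w \<in> carrier U \<Longrightarrow> inner a (r \<odot>\<^bsub>B\<^esub> b) w Q = r \<odot>\<^bsub>AU.T\<^esub> inner a b w Q"
    using Q by (induction rule: UU.tensor_induct) (simp_all add: s)
  show "a \<in> H \<Longrightarrow> b \<in> H \<Longrightarrow> w \<in> carrier U \<Longrightarrow> inner a b (r \<odot>\<^bsub>U\<^esub> w) Q = r \<odot>\<^bsub>AU.T\<^esub> inner a b w Q"
    using Q by (induction rule: UU.tensor_induct) (simp_all add: s)
qed

definition middle where
  "middle Y a v = tensor_lift (add_monoid AU.T) (\<lambda>b w. inner a b w (\<Delta> v)) Y"

lemma middle:
  assumes av: "a \<in> H" "v \<in> carrier U"
  shows "Y \<in> carrier AU.T \<Longrightarrow> middle Y a v \<in> carrier AU.T"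
    and "Y \<in> carrier AU.T \<Longrightarrow> Z \<in> carrier AU.T \<Longrightarrow> middle (Y \<oplus>\<^bsub>AU.T\<^esub> Z) a v = middle Y a v \<oplus>\<^bsub>AU.T\<^esub> middle Z a v"
    and "b \<in> H \<Longrightarrow> w \<in> carrier U \<Longrightarrow> middle (AU.t b w) a v = inner a b w (\<Delta> v)"
proof -
  have bal: "balanced base_field A U AU.T (\<lambda>b w. inner a b w (\<Delta> v))"
    by (rule balancedI) (simp_all add: av inner inner_add)
  note * = AU.abelian_group_tensor bal
  show "Y \<in> carrier AU.T \<Longrightarrow> middle Y a v \<in> carrier AU.T"
    "Y \<in> carrier AU.T \<Longrightarrow> Z \<in> carrier AU.T \<Longrightarrow> middle (Y \<oplus>\<^bsub>AU.T\<^esub> Z) a v = middle Y a v \<oplus>\<^bsub>AU.T\<^esub> middle Z a v"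
    "b \<in> H \<Longrightarrow> w \<in> carrier U \<Longrightarrow> middle (AU.t b w) a v = inner a b w (\<Delta> v)"
    unfolding middle_def
    using AU.tensor_lift_closed[OF *, of Y] AU.tensor_lift_add[OF *, of Y Z] AU.tensor_lift_tensor[OF *, of b w]
    by simp_all
qed

lemma middle_balanced:
  assumes Y: "Y \<in> carrier AU.T"
  shows "balanced base_field A U AU.T (middle Y)"
proof (rule balancedI)
  show "middle Y x y \<in> carrier AU.T" if "x \<in> carrier A" "y \<in> carrier U" for x y
    using that Y by (simp add: middle)
  show "middle Y (x \<oplus>\<^bsub>A\<^esub> x') y = middle Y x y \<oplus>\<^bsub>AU.T\<^esub> middle Y x' y"
    if "x \<in> carrier A" "x' \<in> carrier A" "y \<in> carrier U" for x x' y
    using Y by (induction rule: AU.tensor_induct)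
      (use that in \<open>simp_all add: middle H_closed inner inner_add AU.T.a_ac\<close>)
  show "middle Y x (y \<oplus>\<^bsub>U\<^esub> y') = middle Y x y \<oplus>\<^bsub>AU.T\<^esub> middle Y x y'"
    if "x \<in> carrier A" "y \<in> carrier U" "y' \<in> carrier U" for x y y'
    using Y by (induction rule: AU.tensor_induct)
      (use that in \<open>simp_all add: middle H_closed inner inner_add AU.T.a_ac D.add\<close>)
  show "middle Y (r \<odot>\<^bsub>A\<^esub> x) y = middle Y x (r \<odot>\<^bsub>U\<^esub> y)"
    if "x \<in> carrier A" "y \<in> carrier U" for r x y
    using Y by (induction rule: AU.tensor_induct)
      (use that in \<open>simp_all add: middle H_closed inner inner_add AU.T.a_ac D.smult\<close>)
qed

lemma smash_simps:
  "carrier W = carrier AU.T" "add W = add AU.T" "ring.zero W = ring.zero AU.T"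
  "module.smult W = module.smult AU.T" "one W = AU.t \<one>\<^bsub>B\<^esub> \<one>\<^bsub>U\<^esub>"
  "Q \<otimes>\<^bsub>W\<^esub> Y = tensor_lift (add_monoid AU.T) (middle Y) Q"
  using AU.one_tensor
  by (simp_all add: smash_def Let_def)
    (simp add: middle_def[abs_def] inner_def AU.tensor_lift_tensor_group)

lemma smash_mult:
  shows "Q \<in> carrier AU.T \<Longrightarrow> Y \<in> carrier AU.T \<Longrightarrow> Q \<otimes>\<^bsub>W\<^esub> Y \<in> carrier AU.T"
    and "Q \<in> carrier AU.T \<Longrightarrow> Q' \<in> carrier AU.T \<Longrightarrow> Y \<in> carrier AU.T \<Longrightarrow>
      (Q \<oplus>\<^bsub>AU.T\<^esub> Q') \<otimes>\<^bsub>W\<^esub> Y = Q \<otimes>\<^bsub>W\<^esub> Y \<oplus>\<^bsub>AU.T\<^esub> Q' \<otimes>\<^bsub>W\<^esub> Y"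
    and "a \<in> H \<Longrightarrow> v \<in> carrier U \<Longrightarrow> Y \<in> carrier AU.T \<Longrightarrow> AU.t a v \<otimes>\<^bsub>W\<^esub> Y = middle Y a v"
proof -
  note * = AU.abelian_group_tensor middle_balanced
  show "Q \<in> carrier AU.T \<Longrightarrow> Y \<in> carrier AU.T \<Longrightarrow> Q \<otimes>\<^bsub>W\<^esub> Y \<in> carrier AU.T"
    unfolding smash_simps by (rule AU.tensor_lift_closed[OF *])
  show "Q \<in> carrier AU.T \<Longrightarrow> Q' \<in> carrier AU.T \<Longrightarrow> Y \<in> carrier AU.T \<Longrightarrow>
      (Q \<oplus>\<^bsub>AU.T\<^esub> Q') \<otimes>\<^bsub>W\<^esub> Y = Q \<otimes>\<^bsub>W\<^esub> Y \<oplus>\<^bsub>AU.T\<^esub> Q' \<otimes>\<^bsub>W\<^esub> Y"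
    unfolding smash_simps by (rule AU.tensor_lift_add[OF *])
  show "a \<in> H \<Longrightarrow> v \<in> carrier U \<Longrightarrow> Y \<in> carrier AU.T \<Longrightarrow> AU.t a v \<otimes>\<^bsub>W\<^esub> Y = middle Y a v"
    unfolding smash_simps by (rule AU.tensor_lift_tensor[OF *]) auto
qed

definition smap where
  "smap = tensor_lift (add_monoid B) (\<lambda>a v. a \<otimes>\<^bsub>B\<^esub> \<gamma> v)"

lemma smap:
  shows "Q \<in> carrier AU.T \<Longrightarrow> smap Q \<in> carrier B"
    and "Q \<in> carrier AU.T \<Longrightarrow> Y \<in> carrier AU.T \<Longrightarrow> smap (Q \<oplus>\<^bsub>AU.T\<^esub> Y) = smap Q \<oplus>\<^bsub>B\<^esub> smap Y"
    and "a \<in> H \<Longrightarrow> v \<in> carrier U \<Longrightarrow> smap (AU.t a v) = a \<otimes>\<^bsub>B\<^esub> \<gamma> v"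
    and "Q \<in> carrier AU.T \<Longrightarrow> smap (r \<odot>\<^bsub>AU.T\<^esub> Q) = r \<odot>\<^bsub>B\<^esub> smap Q"
proof -
  have bal: "balanced base_field A U B (\<lambda>a v. a \<otimes>\<^bsub>B\<^esub> \<gamma> v)"
    by (rule balancedI)
      (simp_all add: H_sub g.B.l_distr g.B.r_distr g.add g.smult g.B.smult_mult_left g.B.smult_mult_right)
  note * = g.B.abelian_group_axioms bal
  show "Q \<in> carrier AU.T \<Longrightarrow> smap Q \<in> carrier B"
    "Q \<in> carrier AU.T \<Longrightarrow> Y \<in> carrier AU.T \<Longrightarrow> smap (Q \<oplus>\<^bsub>AU.T\<^esub> Y) = smap Q \<oplus>\<^bsub>B\<^esub> smap Y"
    "a \<in> H \<Longrightarrow> v \<in> carrier U \<Longrightarrow> smap (AU.t a v) = a \<otimes>\<^bsub>B\<^esub> \<gamma> v"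
    unfolding smap_def
    using AU.tensor_lift_closed[OF *, of Q] AU.tensor_lift_add[OF *, of Q Y] AU.tensor_lift_tensor[OF *, of a v]
    by simp_all
  show "Q \<in> carrier AU.T \<Longrightarrow> smap (r \<odot>\<^bsub>AU.T\<^esub> Q) = r \<odot>\<^bsub>B\<^esub> smap Q"
    unfolding smap_def
    using AU.tensor_lift_smult[OF g.B.module_axioms bal _ _, of r Q]
    by (simp add: H_sub g.B.smult_mult_left)
qed

lemma smap_inner:
  assumes Q: "Q \<in> carrier T" and a: "a \<in> H" "b \<in> H" "w \<in> carrier U"
  shows "smap (inner a b w Q) = a \<otimes>\<^bsub>B\<^esub> act_\<gamma> b Q \<otimes>\<^bsub>B\<^esub> \<gamma> w"
  using Q
  by (induction rule: UU.tensor_induct)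
    (simp_all add: inner a smap act_\<gamma> H_sub H_closed act_H act_simps g.mult g.B.m_assoc g.B.l_distr g.B.r_distr)

text \<open>On pure tensors the image of the product is a (v_1 . b) \<gamma>(v_2) \<gamma>(w), and
  \<open>\<gamma>_mult\<close> read backwards gives a \<gamma>(v) b \<gamma>(w).\<close>

lemma smap_mult:
  assumes Q: "Q \<in> carrier AU.T" and Y: "Y \<in> carrier AU.T"
  shows "smap (Q \<otimes>\<^bsub>W\<^esub> Y) = smap Q \<otimes>\<^bsub>B\<^esub> smap Y"
  using Q
proof (induction rule: AU.tensor_induct)
  case (tensor a v)
  then have av: "a \<in> H" "v \<in> carrier U" by simp_all
  have "smap (middle Y a v) = a \<otimes>\<^bsub>B\<^esub> \<gamma> v \<otimes>\<^bsub>B\<^esub> smap Y" using Y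
  proof (induction rule: AU.tensor_induct)
    case (tensor b w)
    then have "b \<in> H" "w \<in> carrier U" by simp_all
    then show ?case using av
      by (simp add: middle smap smap_inner H_sub \<gamma>_mult[symmetric] g.B.m_assoc)
  next
    case (add Y Z)
    then show ?case using av by (simp add: middle smap g.B.r_distr H_sub)
  qed
  then show ?case using av Y by (simp add: smash_mult smap)
next
  case (add Q Z)
  then show ?case using Y by (simp add: smash_mult smap g.B.l_distr)
qed

text \<open>Since \<open>smap\<close> respects products, its image is a subalgebra; it contains
  \<open>H\<close> and the image of \<gamma>, so generation gives surjectivity. A trivial kernel
  gives injectivity.\<close>

theorem smash_iso:
  assumes inj: "\<And>Q. Q \<in> carrier AU.T \<Longrightarrow> smap Q = \<zero>\<^bsub>B\<^esub> \<Longrightarrow> Q = \<zero>\<^bsub>AU.T\<^esub>"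
    and surj: "\<And>K. is_subalg base_field B K \<Longrightarrow> H \<subseteq> K \<Longrightarrow> \<gamma> ` carrier U \<subseteq> K \<Longrightarrow> carrier B \<subseteq> K"
  shows "assoc_algebra base_field W" and "smap \<in> alg_iso base_field W B"
proof -
  have one: "smap \<one>\<^bsub>W\<^esub> = \<one>\<^bsub>B\<^esub>" by (simp add: smash_simps smap H_closed)
  have sub: "is_subalg base_field B (smap ` carrier W)"
    unfolding is_subalg_def
  proof (intro conjI ballI)
    show "smap ` carrier W \<subseteq> carrier B" by (auto simp: smash_simps smap)
    show "\<one>\<^bsub>B\<^esub> \<in> smap ` carrier W" using one by (auto simp: smash_simps H_closed intro!: image_eqI[of _ _ "\<one>\<^bsub>W\<^esub>"])
  next
    fix x y assume "x \<in> smap ` carrier W" "y \<in> smap ` carrier W"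
    then obtain Q Y where *: "x = smap Q" "y = smap Y" "Q \<in> carrier AU.T" "Y \<in> carrier AU.T"
      by (auto simp: smash_simps)
    show "x \<oplus>\<^bsub>B\<^esub> y \<in> smap ` carrier W"
      using * by (auto simp: smash_simps smap intro!: image_eqI[of _ _ "Q \<oplus>\<^bsub>AU.T\<^esub> Y"])
    show "x \<otimes>\<^bsub>B\<^esub> y \<in> smap ` carrier W"
      using * smash_mult(1)[of Q Y] by (auto simp: smash_simps(1) smap_mult intro!: image_eqI[of _ _ "Q \<otimes>\<^bsub>W\<^esub> Y"])
  next
    fix r x assume "x \<in> smap ` carrier W"
    then obtain Q where *: "x = smap Q" "Q \<in> carrier AU.T"
      by (auto simp: smash_simps)
    then show "r \<odot>\<^bsub>B\<^esub> x \<in> smap ` carrier W"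
      using AU.tensor_smult(1)[of r Q] by (auto simp: smash_simps smap intro!: image_eqI[of _ _ "r \<odot>\<^bsub>AU.T\<^esub> Q"])
  qed
  have onto: "smap ` carrier W = carrier B"
  proof
    show "smap ` carrier W \<subseteq> carrier B" by (auto simp: smash_simps smap)
    show "carrier B \<subseteq> smap ` carrier W"
    proof (rule surj[OF sub])
      show "H \<subseteq> smap ` carrier W"
      proof
        fix x assume "x \<in> H"
        then show "x \<in> smap ` carrier W"
          by (intro image_eqI[of _ _ "AU.t x \<one>\<^bsub>U\<^esub>"]) (simp_all add: smash_simps smap H_sub)
      qed
      show "\<gamma> ` carrier U \<subseteq> smap ` carrier W"
      proof
        fix x assume "x \<in> \<gamma> ` carrier U"
        then obtain v where "v \<in> carrier U" "x = \<gamma> v" by blast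
        then show "x \<in> smap ` carrier W"
          by (intro image_eqI[of _ _ "AU.t \<one>\<^bsub>B\<^esub> v"]) (simp_all add: smash_simps smap H_closed)
      qed
    qed
  qed
  have inj_on: "inj_on smap (carrier W)"
  proof (rule inj_onI)
    fix Q Y assume *: "Q \<in> carrier W" "Y \<in> carrier W" "smap Q = smap Y"
    have neg: "(- 1) \<odot>\<^bsub>AU.T\<^esub> Y \<in> carrier AU.T" using * AU.tensor_smult(1)[of "-1" Y] by (simp add: smash_simps)
    have "smap (Q \<oplus>\<^bsub>AU.T\<^esub> (- 1) \<odot>\<^bsub>AU.T\<^esub> Y) = smap Q \<oplus>\<^bsub>B\<^esub> (- 1) \<odot>\<^bsub>B\<^esub> smap Q"
      using * neg by (simp add: smash_simps smap)
    also have "\<dots> = (1 + - 1) \<odot>\<^bsub>B\<^esub> smap Q"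
      using g.B.smult_l_distr[of 1 "- 1" "smap Q"] g.B.smult_one[of "smap Q"] * smap(1)[of Q] by (simp add: smash_simps)
    also have "\<dots> = \<zero>\<^bsub>B\<^esub>"
      using g.B.smult_l_null[of "smap Q"] * smap(1)[of Q] by (simp add: smash_simps)
    finally have "Q \<oplus>\<^bsub>AU.T\<^esub> (- 1) \<odot>\<^bsub>AU.T\<^esub> Y = \<zero>\<^bsub>AU.T\<^esub>"
      using * neg by (intro inj) (simp_all add: smash_simps)
    moreover have "(- 1) \<odot>\<^bsub>AU.T\<^esub> Y \<oplus>\<^bsub>AU.T\<^esub> Y = \<zero>\<^bsub>AU.T\<^esub>"
      using AU.T.smult_l_distr[of "- 1" 1 Y] AU.T.smult_one[of Y] AU.T.smult_l_null[of Y] * by (simp add: smash_simps)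
    ultimately show "Q = Y"
      using * neg by (metis AU.T.add.inv_unique' AU.T.a_comm AU.T.minus_equality AU.T.minus_minus smash_simps(1))
  qed
  show iso: "smap \<in> alg_iso base_field W B"
  proof -
    have "smap \<in> alg_hom base_field W B"
      by (rule alg_homI) (simp_all only: one smap_mult, simp_all add: smash_simps(1-5) smap smap_mult)
    then show ?thesis using onto inj_on by (simp add: alg_iso_def bij_betw_def)
  qed
  \<comment> \<open>The smash product is not yet known to satisfy the algebra laws; they are
    imported from \<open>B\<close> along the inverse bijection.\<close>
  let ?f = "inv_into (carrier W) smap"
  have f: "?f x \<in> carrier W" "smap (?f x) = x" if "x \<in> carrier B" for x
    using that onto by (simp_all add: inv_into_into f_inv_into_f)
  have eq: "?f x = Q" if "Q \<in> carrier W" "smap Q = x" for x Q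
    using that inj_on by (auto intro: inv_into_f_f)
  show "assoc_algebra base_field W"
  proof (rule assoc_algebra_of_image[OF g.B.assoc_algebra_axioms, of ?f])
    show "?f ` carrier B = carrier W" using onto inj_on by (metis inj_on_imp_bij_betw bij_betw_inv_into bij_betw_imp_surj_on)
    show "?f \<one>\<^bsub>B\<^esub> = \<one>\<^bsub>W\<^esub>" by (rule eq) (simp_all add: one, simp add: smash_simps H_closed)
    show "?f \<zero>\<^bsub>B\<^esub> = \<zero>\<^bsub>W\<^esub>"
      using smap(4)[of "\<zero>\<^bsub>AU.T\<^esub>" 0] AU.T.smult_l_null[of "\<zero>\<^bsub>AU.T\<^esub>"] g.B.smult_l_null[of "smap \<zero>\<^bsub>AU.T\<^esub>"] smap(1)[of "\<zero>\<^bsub>AU.T\<^esub>"]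
      by (intro eq) (simp_all add: smash_simps)
  next
    fix x y assume xy: "x \<in> carrier B" "y \<in> carrier B"
    note fx = f[OF xy(1)] and fy = f[OF xy(2)]
    show "?f (x \<oplus>\<^bsub>B\<^esub> y) = ?f x \<oplus>\<^bsub>W\<^esub> ?f y"
      using fx fy by (intro eq) (simp_all add: smash_simps smap)
    show "?f (x \<otimes>\<^bsub>B\<^esub> y) = ?f x \<otimes>\<^bsub>W\<^esub> ?f y"
      using fx fy smash_mult(1)[of "?f x" "?f y"] by (intro eq) (simp_all add: smash_simps(1) smap_mult)
  next
    fix r x assume x: "x \<in> carrier B"
    note fx = f[OF x]
    show "?f (r \<odot>\<^bsub>B\<^esub> x) = r \<odot>\<^bsub>W\<^esub> ?f x"
      using fx AU.tensor_smult(1)[of r "?f x"] by (intro eq) (simp_all add: smash_simps smap)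
  qed
qed

end

section \<open>Gaussian binomial coefficients\<close>

definition qnum :: "'a::field \<Rightarrow> int \<Rightarrow> 'a" where
  "qnum x n = (x powi n - x powi (- n)) / (x - inverse x)"

definition qnum_fact :: "'a::field \<Rightarrow> nat \<Rightarrow> 'a" where
  "qnum_fact x n = (\<Prod>s<n. qnum x (int s + 1))"

definition qfalling :: "'a::field \<Rightarrow> int \<Rightarrow> nat \<Rightarrow> 'a" where
  "qfalling x n t = (\<Prod>s<t. qnum x (n - int s))"

text \<open>The Gaussian binomial with an arbitrary integer on top. At \<zeta> the denominator
  vanishes from t = l on, and the value is then merely the default of division by zero;
  \<open>zbin\<close> takes over there.\<close>

definition qbin :: "'a::field \<Rightarrow> int \<Rightarrow> nat \<Rightarrow> 'a" where
  "qbin x n t = qfalling x n t / qnum_fact x t"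

locale qnumber =
  fixes x :: "'a::field"
  assumes nz: "x \<noteq> 0" and sq: "x * x \<noteq> 1"
begin

lemma denom: "x - inverse x \<noteq> 0"
  using nz sq by (metis eq_iff_diff_eq_0 right_inverse)

lemma qnum_0 [simp]: "qnum x 0 = 0"
  by (simp add: qnum_def)

lemma qnum_1 [simp]: "qnum x 1 = 1"
  using denom by (simp add: qnum_def power_int_minus)

lemma qnum_minus: "qnum x (- n) = - qnum x n"
  by (simp add: qnum_def minus_divide_left)

text \<open>The deformation of a b = (a - c)(b - c) + c (a + b - c); with denominators cleared both
  sides are the same combination of powers of x.\<close>

lemma qnum_exchange: "qnum x a * qnum x b = qnum x (a - c) * qnum x (b - c) + qnum x c * qnum x (a + b - c)"
proof -
  have "(x powi a - x powi (- a)) * (x powi b - x powi (- b)) =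
    (x powi (a - c) - x powi (- (a - c))) * (x powi (b - c) - x powi (- (b - c))) +
    (x powi c - x powi (- c)) * (x powi (a + b - c) - x powi (- (a + b - c)))"
    using nz by (simp add: power_int_add power_int_diff power_int_minus field_simps)
  then show ?thesis by (simp add: qnum_def add_divide_distrib[symmetric])
qed

text \<open>The addition formula for n + 1 = c + (n + 1 - c). Pascal's rule and the commutators of
  powers of E and F rest on instances of it.\<close>

lemma qnum_step: "qnum x (n + 1) = x powi c * qnum x (n + 1 - c) + x powi (- (n + 1 - c)) * qnum x c"
proof -
  have "x powi (n + 1) - x powi (- (n + 1)) =
    x powi c * (x powi (n + 1 - c) - x powi (- (n + 1 - c))) + x powi (- (n + 1 - c)) * (x powi c - x powi (- c))"
    using nz by (simp add: power_int_add power_int_diff power_int_minus field_simps)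
  then show ?thesis by (simp add: qnum_def add_divide_distrib[symmetric])
qed

lemma qnum_fact_Suc: "qnum_fact x (Suc t) = qnum x (int t + 1) * qnum_fact x t"
  by (simp add: qnum_fact_def mult.commute)

lemma qnum_fact_0 [simp]: "qnum_fact x 0 = 1"
  by (simp add: qnum_fact_def)

lemma qfalling_0 [simp]: "qfalling x n 0 = 1"
  by (simp add: qfalling_def)

lemma qfalling_Suc: "qfalling x n (Suc t) = qfalling x n t * qnum x (n - int t)"
  by (simp add: qfalling_def)

lemma qfalling_Suc': "qfalling x (n + 1) (Suc t) = qnum x (n + 1) * qfalling x n t"
  unfolding qfalling_def by (subst prod.lessThan_Suc_shift) (simp add: algebra_simps)

lemma qbin_0 [simp]: "qbin x n 0 = 1"
  by (simp add: qbin_def)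

lemma qbin_0_Suc: "t > 0 \<Longrightarrow> qbin x 0 t = 0"
  by (cases t) (simp_all add: qbin_def qfalling_def prod.lessThan_Suc_shift del: prod.lessThan_Suc)

lemma qbin_1: "qbin x n (Suc 0) = qnum x n"
  by (simp add: qbin_def qfalling_Suc qnum_fact_Suc)

lemma qbin_small: "n < t \<Longrightarrow> qbin x (int n) t = 0"
  by (auto simp: qbin_def qfalling_def intro!: bexI[of _ n])

text \<open>The factor [n + 1] of the numerator is split by \<open>qnum_step\<close> with c = t + 1.
  All coefficients are powers of x, which makes this rule the source of both integrality and the
  values at \<zeta>.\<close>

lemma qbin_pascal:
  assumes "qnum_fact x (Suc t) \<noteq> 0"
  shows "qbin x (n + 1) (Suc t) = x powi (int t + 1) * qbin x n (Suc t) + x powi (int t - n) * qbin x n t"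
proof -
  have "qbin x (n + 1) (Suc t) = qfalling x n t * qnum x (n + 1) / qnum_fact x (Suc t)"
    by (simp add: qbin_def qfalling_Suc')
  also have "qnum x (n + 1) = x powi (int t + 1) * qnum x (n - int t) + x powi (int t - n) * qnum x (int t + 1)"
    using qnum_step[of n "int t + 1"] by (simp add: algebra_simps)
  also have "qfalling x n t * \<dots> / qnum_fact x (Suc t)
      = x powi (int t + 1) * qbin x n (Suc t) + x powi (int t - n) * qbin x n t"
    using assms by (simp add: qbin_def qfalling_Suc qnum_fact_Suc field_simps)
  finally show ?thesis .
qed

text \<open>The identity behind the formula for the divided powers of \<open>E\<close> on a Verma-type module.\<close>

lemma qbin_exchange:
  assumes "qnum_fact x (Suc t) \<noteq> 0"
  shows "qnum x (n + 1) * qbin x (m + 1) (Suc t) =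
    qnum x (n - int t) * qbin x m (Suc t) + qnum x (m + n + 1 - int t) * qbin x m t"
proof -
  have "qnum x (n + 1) * qbin x (m + 1) (Suc t) = qfalling x m t * (qnum x (n + 1) * qnum x (m + 1)) / qnum_fact x (Suc t)"
    by (simp add: qbin_def qfalling_Suc')
  also have "qnum x (n + 1) * qnum x (m + 1) =
      qnum x (n - int t) * qnum x (m - int t) + qnum x (int t + 1) * qnum x (m + n + 1 - int t)"
    using qnum_exchange[of "n + 1" "m + 1" "int t + 1"] by (simp add: algebra_simps)
  also have "qfalling x m t * \<dots> / qnum_fact x (Suc t) =
      qnum x (n - int t) * qbin x m (Suc t) + qnum x (m + n + 1 - int t) * qbin x m t"
    using assms by (simp add: qbin_def qfalling_Suc qnum_fact_Suc field_simps)
  finally show ?thesis .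
qed

end

section \<open>Specialization of Laurent polynomials\<close>

lemma laurent_eval_superset:
  assumes "finite K" "Poly_Mapping.keys p \<subseteq> K"
  shows "laurent_eval x p = (\<Sum>i\<in>K. of_int (Poly_Mapping.lookup p i) * x powi i)"
  unfolding laurent_eval_def
  by (rule sum.mono_neutral_left) (use assms in \<open>auto simp: in_keys_iff\<close>)

lemma laurent_eval_single: "laurent_eval x (Poly_Mapping.single i c) = of_int c * x powi i"
  by (subst laurent_eval_superset[of "{i}"]) auto

lemma laurent_eval_add: "laurent_eval x (p + p') = laurent_eval x p + laurent_eval x p'"
proof -
  let ?K = "Poly_Mapping.keys p \<union> Poly_Mapping.keys p'"
  have "Poly_Mapping.keys (p + p') \<subseteq> ?K" by (rule Poly_Mapping.keys_add)
  then show ?thesis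
    by (simp add: laurent_eval_superset[of ?K] lookup_add sum.distrib distrib_right)
qed

lemma laurent_eval_mult: "x \<noteq> 0 \<Longrightarrow> laurent_eval x (p * p') = laurent_eval x p * laurent_eval x p'"
proof (induction p rule: poly_mapping_single_induct)
  case (1 i c)
  then show ?case
    by (induction p' rule: poly_mapping_single_induct)
      (simp_all add: mult_single laurent_eval_single power_int_add distrib_left laurent_eval_add)
qed (simp add: distrib_right laurent_eval_add)

lemma laurent_eval_1: "laurent_eval x 1 = 1"
  using laurent_eval_single[of x 0 1] by simp

lemma laurent_eval_0: "laurent_eval x 0 = 0"
  by (simp add: laurent_eval_def)

lemma laurent_eval_uminus: "laurent_eval x (- p) = - laurent_eval x p"
  using laurent_eval_add[of x p "- p"] by (simp add: laurent_eval_0 eq_neg_iff_add_eq_0 add.commute)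

lemma laurent_eval_hom: "x \<noteq> 0 \<Longrightarrow> laurent_eval x \<in> ring_hom laurent_ring base_field"
  by (rule ring_hom_memI) (simp_all add: laurent_eval_mult laurent_eval_add laurent_eval_1)

lemma q_nz: "q \<noteq> 0"
  by (simp add: q_def Zero_fract_def eq_fract)

lemma q_power: "q ^ n = Fract (Polynomial.monom 1 n) 1"
proof (induction n)
  case 0
  then show ?case by (simp add: One_fract_def)
next
  case (Suc n)
  have "[:0, 1:] * Polynomial.monom (1::rat) n = Polynomial.monom 1 (Suc n)" by (simp add: monom_Suc)
  with Suc show ?case by (simp add: q_def)
qed

lemma of_int_Fract: "(of_int c :: ratfun) = Fract [:of_int c:] 1"
proof -
  have nat: "(of_nat n :: ratfun) = Fract [:of_nat n:] 1" for n
    by (induction n) (simp_all add: Zero_fract_def One_fract_def one_pCons)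
  show ?thesis by (cases c rule: int_cases2) (simp_all add: nat)
qed

lemma sum_Fract: "(\<Sum>i\<in>K. Fract (f i) 1) = (Fract (\<Sum>i\<in>K. f i) 1 :: ratfun)"
  by (induction K rule: infinite_finite_induct) (simp_all add: Zero_fract_def)

text \<open>q is transcendental: after multiplication by a power of q the value is an ordinary
  polynomial embedded in its fraction field, and the coefficients of that polynomial are those of
  \<open>p\<close>.\<close>

lemma laurent_eval_q_inj:
  assumes "laurent_eval q p = 0" shows "p = 0"
proof (rule poly_mapping_eqI)
  fix i0
  let ?K = "Poly_Mapping.keys p"
  \<comment> \<open>A bound on the absolute values of the exponents clears the negative powers;
    \<open>insert 0\<close> keeps the maximum meaningful for \<open>p = 0\<close>.\<close>
  obtain N :: nat where N: "\<forall>i\<in>?K. 0 \<le> i + int N"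
  proof
    show "\<forall>i\<in>?K. 0 \<le> i + int (nat (Max ((\<lambda>i. \<bar>i\<bar>) ` insert 0 ?K)))"
    proof
      fix i assume "i \<in> ?K"
      then have "\<bar>i\<bar> \<le> Max ((\<lambda>i. \<bar>i\<bar>) ` insert 0 ?K)" by (intro Max_ge) auto
      then show "0 \<le> i + int (nat (Max ((\<lambda>i. \<bar>i\<bar>) ` insert 0 ?K)))" by linarith
    qed
  qed
  define P where "P = (\<Sum>i\<in>?K. Polynomial.monom (of_int (Poly_Mapping.lookup p i) :: rat) (nat (i + int N)))"
  have "0 = q ^ N * laurent_eval q p" using assms by simp
  also have "\<dots> = (\<Sum>i\<in>?K. of_int (Poly_Mapping.lookup p i) * q ^ nat (i + int N))"
    unfolding laurent_eval_def sum_distrib_left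
  proof (rule sum.cong[OF refl])
    fix i assume "i \<in> ?K"
    then have "q powi (i + int N) = q ^ nat (i + int N)" using N by (simp add: power_int_def)
    moreover have "q powi (i + int N) = q powi i * q ^ N" using q_nz by (simp add: power_int_add)
    ultimately show "q ^ N * (of_int (Poly_Mapping.lookup p i) * q powi i)
        = of_int (Poly_Mapping.lookup p i) * q ^ nat (i + int N)"
      by (simp add: mult_ac)
  qed
  also have "\<dots> = (\<Sum>i\<in>?K. Fract (Polynomial.monom (of_int (Poly_Mapping.lookup p i)) (nat (i + int N))) 1)"
    by (rule sum.cong) (simp_all add: of_int_Fract q_power smult_monom)
  also have "\<dots> = Fract P 1" by (simp add: sum_Fract P_def)
  finally have P: "P = 0" by (simp add: Zero_fract_def eq_fract)
  show "Poly_Mapping.lookup p i0 = Poly_Mapping.lookup 0 i0"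
  proof (cases "i0 \<in> ?K")
    case True
    have "poly.coeff P (nat (i0 + int N)) = (\<Sum>i\<in>?K. if i = i0 then of_int (Poly_Mapping.lookup p i) else 0)"
      unfolding P_def coeff_sum coeff_monom
      using N True by (intro sum.cong) (auto simp: nat_eq_iff2)
    then show ?thesis using P True by (simp add: sum.delta)
  qed (simp add: in_keys_iff)
qed

text \<open>Specialization as a partial map from Q(q) to the field, defined on the image of the
  Laurent polynomials. As a relation it states integrality and the value at \<zeta> at once; it is
  single-valued because q is transcendental.\<close>

definition spec :: "'k::field \<Rightarrow> ratfun \<Rightarrow> 'k \<Rightarrow> bool" where
  "spec \<zeta> a c \<longleftrightarrow> (\<exists>p. laurent_eval q p = a \<and> laurent_eval \<zeta> p = c)"

lemma spec_unique:
  assumes "spec \<zeta> a c" "spec \<zeta> a c'" shows "c = c'"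
proof -
  obtain p p' where p: "laurent_eval q p = a" "laurent_eval \<zeta> p = c" "laurent_eval q p' = a" "laurent_eval \<zeta> p' = c'"
    using assms by (auto simp: spec_def)
  then have "laurent_eval q (p - p') = 0"
    using laurent_eval_add[of q p "- p'"] by (simp add: laurent_eval_uminus)
  then have "p = p'" using laurent_eval_q_inj by fastforce
  then show ?thesis using p by simp
qed

lemma spec_0: "spec \<zeta> 0 0" and spec_1: "spec \<zeta> 1 1"
  by (auto simp: spec_def intro: laurent_eval_0 laurent_eval_1)

lemma spec_add: "spec \<zeta> a c \<Longrightarrow> spec \<zeta> b d \<Longrightarrow> spec \<zeta> (a + b) (c + d)"
  by (auto simp: spec_def intro: laurent_eval_add)

lemma spec_uminus: "spec \<zeta> a c \<Longrightarrow> spec \<zeta> (- a) (- c)"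
  by (auto simp: spec_def intro: laurent_eval_uminus)

lemma spec_diff: "spec \<zeta> a c \<Longrightarrow> spec \<zeta> b d \<Longrightarrow> spec \<zeta> (a - b) (c - d)"
  using spec_add[of \<zeta> a c "- b" "- d"] spec_uminus[of \<zeta> b d] by simp

lemma spec_mult: "\<zeta> \<noteq> 0 \<Longrightarrow> spec \<zeta> a c \<Longrightarrow> spec \<zeta> b d \<Longrightarrow> spec \<zeta> (a * b) (c * d)"
  using q_nz by (auto simp: spec_def intro: laurent_eval_mult)

lemma spec_powi: "spec \<zeta> (q powi n) (\<zeta> powi n)"
  unfolding spec_def
  by (rule exI[of _ "Poly_Mapping.single n 1"]) (simp add: laurent_eval_single)

lemma spec_sum: "(\<And>i. i \<in> K \<Longrightarrow> spec \<zeta> (f i) (g i)) \<Longrightarrow> spec \<zeta> (\<Sum>i\<in>K. f i) (\<Sum>i\<in>K. g i)"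
  by (induction K rule: infinite_finite_induct) (simp_all add: spec_0 spec_add)

lemma spec_prod: "\<zeta> \<noteq> 0 \<Longrightarrow> (\<And>i. i \<in> K \<Longrightarrow> spec \<zeta> (f i) (g i)) \<Longrightarrow> spec \<zeta> (\<Prod>i\<in>K. f i) (\<Prod>i\<in>K. g i)"
  by (induction K rule: infinite_finite_induct) (simp_all add: spec_1 spec_mult)

lemma q_power_neq_1: "n > 0 \<Longrightarrow> q ^ n \<noteq> 1"
  by (auto simp: q_power One_fract_def eq_fract monom_eq_1_iff)

interpretation q: qnumber q
  by unfold_locales (use q_nz q_power_neq_1[of 2] in \<open>simp_all add: power2_eq_square\<close>)

lemma qnum_q_nz: "n \<noteq> 0 \<Longrightarrow> qnum q n \<noteq> 0"
proof -
  have pos: "qnum q (int n) \<noteq> 0" if "n > 0" for n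
  proof -
    have "q ^ n * q ^ n \<noteq> 1" using q_power_neq_1[of "n + n"] that by (simp add: power_add)
    then have "q powi int n \<noteq> q powi (- int n)" using q_nz
      by (metis power_int_minus power_int_of_nat power_not_zero right_inverse)
    then show ?thesis using q.denom by (simp add: qnum_def)
  qed
  assume "n \<noteq> 0"
  then show ?thesis
    using pos[of "nat n"] pos[of "nat (- n)"] q.qnum_minus[of n] by (cases "n > 0") auto
qed

lemma qnum_fact_q_nz: "qnum_fact q n \<noteq> 0"
  by (auto simp: qnum_fact_def qnum_q_nz)

lemma qint_qnum: "qint n = qnum q (int n)"
  by (simp add: qint_def qnum_def power_int_minus power_inverse)

lemma qfact_qnum: "qfact n = qnum_fact q n"
  unfolding qfact_def qnum_fact_def
  by (rule prod.reindex_bij_witness[of _ Suc "\<lambda>i. i - 1"]) (auto simp: qint_qnum of_nat_diff add.commute)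

section \<open>Quantum integers and Gaussian binomials at a root of unity\<close>

locale root_of_unity =
  fixes l :: nat and \<zeta> :: "'k::field_char_0"
  assumes odd_l: "odd l" and l_gt_1: "l > 1" and prim: "primitive_root_of_unity l \<zeta>"
begin

lemma zeta_l: "\<zeta> ^ l = 1"
  using prim by (simp add: primitive_root_of_unity_def)

lemma zeta_nz: "\<zeta> \<noteq> 0"
  using zeta_l l_gt_1 by (auto simp: power_0_left)

lemma zeta_power_mod: "\<zeta> ^ n = \<zeta> ^ (n mod l)"
proof -
  have "\<zeta> ^ (l * (n div l) + n mod l) = \<zeta> ^ (n mod l)"
    unfolding power_add power_mult zeta_l by simp
  then show ?thesis by simp
qed

lemma zeta_power_eq_1: "\<zeta> ^ n = 1 \<longleftrightarrow> l dvd n"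
proof
  assume "\<zeta> ^ n = 1"
  then have "\<zeta> ^ (n mod l) = 1" using zeta_power_mod[of n] by simp
  moreover have "n mod l < l" using l_gt_1 by simp
  ultimately have "n mod l = 0" using prim unfolding primitive_root_of_unity_def by (metis neq0_conv)
  then show "l dvd n" by auto
next
  assume "l dvd n"
  then show "\<zeta> ^ n = 1" using zeta_power_mod[of n] by (simp add: dvd_eq_mod_eq_0)
qed

lemma zeta_powi_eq_1: "\<zeta> powi n = 1 \<longleftrightarrow> int l dvd n"
proof (cases "n \<ge> 0")
  case True
  then show ?thesis using zeta_power_eq_1[of "nat n"] by (simp add: power_int_def int_dvd_int_iff[symmetric] del: int_dvd_int_iff)
next
  case False
  then show ?thesis using zeta_power_eq_1[of "nat (- n)"]
    by (simp add: power_int_def int_dvd_int_iff[symmetric] power_inverse del: int_dvd_int_iff)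
qed

lemma zeta_powi_cong:
  assumes "m mod int l = n mod int l" shows "\<zeta> powi m = \<zeta> powi n"
proof -
  have "int l dvd m - n" using assms by (simp add: mod_eq_dvd_iff)
  then have "\<zeta> powi (m - n) = 1" by (simp add: zeta_powi_eq_1)
  then show ?thesis using zeta_nz by (simp add: power_int_diff)
qed

text \<open>Oddness of l enters here: the square of \<zeta> has again order l, so that [n] vanishes
  at \<zeta> exactly when l divides n.\<close>

lemma dvd_double: "int l dvd 2 * n \<longleftrightarrow> int l dvd n"
  using odd_l coprime_dvd_mult_right_iff[of "int l" 2 n] by (simp add: coprime_commute)

sublocale Z: qnumber \<zeta>
proof
  show "\<zeta> \<noteq> 0" by (rule zeta_nz)
  have "\<not> int l dvd 2 * 1" unfolding dvd_double using l_gt_1 by simp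
  then show "\<zeta> * \<zeta> \<noteq> 1"
    using zeta_powi_eq_1[of 2] by (simp add: power2_eq_square)
qed

lemma qnum_zeta_eq_0: "qnum \<zeta> n = 0 \<longleftrightarrow> int l dvd n"
proof -
  have "qnum \<zeta> n = 0 \<longleftrightarrow> \<zeta> powi n = \<zeta> powi (- n)" using Z.denom by (simp add: qnum_def)
  also have "\<dots> \<longleftrightarrow> \<zeta> powi (2 * n) = 1"
  proof -
    have "\<zeta> powi (2 * n) = \<zeta> powi n * \<zeta> powi n" 
      using power_int_add[of \<zeta> n n] zeta_nz by (simp only: mult_2 simp_thms)
    moreover have "\<zeta> powi (- n) * \<zeta> powi n = 1" using zeta_nz by (simp add: power_int_minus)
    moreover have "\<zeta> powi n \<noteq> 0" using zeta_nz by simp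
    ultimately show ?thesis by (metis mult_right_cancel)
  qed
  finally show ?thesis by (simp add: zeta_powi_eq_1 dvd_double)
qed

lemma qnum_zeta_cong: "m mod int l = n mod int l \<Longrightarrow> qnum \<zeta> m = qnum \<zeta> n"
  using zeta_powi_cong[of m n] zeta_powi_cong[OF mod_minus_cong, of m n] by (simp only: qnum_def)

lemma qbin_zeta_cong: "m mod int l = n mod int l \<Longrightarrow> qbin \<zeta> m t = qbin \<zeta> n t"
  by (auto simp: qbin_def qfalling_def intro!: prod.cong qnum_zeta_cong arg_cong2[of _ _ _ _ "(/)"] mod_diff_cong)

lemma qnum_zeta_nz: "0 < n \<Longrightarrow> n < int l \<Longrightarrow> qnum \<zeta> n \<noteq> 0"
  by (auto simp: qnum_zeta_eq_0 dest: zdvd_imp_le)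

lemma qnum_fact_zeta_nz: "n < l \<Longrightarrow> qnum_fact \<zeta> n \<noteq> 0"
proof -
  assume n: "n < l"
  have "qnum \<zeta> (int s + 1) \<noteq> 0" if "s < n" for s
    by (rule qnum_zeta_nz) (use that n in auto)
  then show ?thesis by (simp add: qnum_fact_def)
qed

lemma spec_qnum: "spec \<zeta> (qnum q n) (qnum \<zeta> n)"
proof (induction n rule: int_induct[where k = 0])
  case base
  then show ?case by (simp add: spec_0)
next
  case (step1 n)
  have e: "qnum x (n + 1) = x powi 1 * qnum x n + x powi (- n)" if "qnumber x" for x :: "'b::field"
    using qnumber.qnum_step[OF that, of n 1] qnumber.qnum_1[OF that] by simp
  show ?case
    unfolding e[OF q.qnumber_axioms] e[OF Z.qnumber_axioms]
    by (intro spec_add spec_mult zeta_nz spec_powi step1)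
next
  case (step2 n)
  have e: "qnum x (n - 1) = x powi (-1) * (qnum x n - x powi (1 - n))" if "qnumber x" for x :: "'b::field"
  proof -
    interpret qnumber x by (fact that)
    have "qnum x n = x powi 1 * qnum x (n - 1) + x powi (1 - n)"
      using qnum_step[of "n - 1" 1] by simp
    then show ?thesis using nz by (simp add: power_int_minus)
  qed
  show ?case
    unfolding e[OF q.qnumber_axioms] e[OF Z.qnumber_axioms]
    by (intro spec_mult zeta_nz spec_powi spec_diff step2)
qed

text \<open>Integrality of the Gaussian binomials: induction on t, and for each t from n = 0 in both
  directions by Pascal's rule, which can be solved for the smaller n because its coefficient there
  is a power of q.\<close>

lemma spec_qbin_ex: "\<exists>c. spec \<zeta> (qbin q n t) c"
proof (induction t arbitrary: n)
  case 0
  then show ?case using spec_1 by (auto intro!: exI[of _ 1])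
next
  case (Suc t)
  show ?case
  proof (induction n rule: int_induct[where k = 0])
    case base
    then show ?case using spec_0 by (auto simp: q.qbin_0_Suc intro!: exI[of _ 0])
  next
    case (step1 n)
    then obtain c where c: "spec \<zeta> (qbin q n (Suc t)) c" by blast
    obtain d where d: "spec \<zeta> (qbin q n t) d" using Suc by blast
    show ?case
      unfolding q.qbin_pascal[OF qnum_fact_q_nz]
      by (rule exI, rule spec_add[OF spec_mult[OF zeta_nz spec_powi c] spec_mult[OF zeta_nz spec_powi d]])
  next
    case (step2 n)
    then obtain c where c: "spec \<zeta> (qbin q n (Suc t)) c" by blast
    obtain d where d: "spec \<zeta> (qbin q (n - 1) t) d" using Suc by blast
    have "qbin q n (Suc t) = q powi (int t + 1) * qbin q (n - 1) (Suc t) + q powi (int t - (n - 1)) * qbin q (n - 1) t"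
      using q.qbin_pascal[OF qnum_fact_q_nz, of "n - 1" t] by simp
    then have "qbin q (n - 1) (Suc t) = q powi (- (int t + 1)) * (qbin q n (Suc t) - q powi (int t - (n - 1)) * qbin q (n - 1) t)"
      using q_nz power_int_minus[of q "int t + 1"] by (simp only:) simp
    then show ?case using c d
      by (auto intro!: exI spec_mult zeta_nz spec_powi spec_diff)
  qed
qed

text \<open>The value at \<zeta> of the Laurent polynomial that the Gaussian binomial is; it makes
  sense also for t \<ge> l, where the quotient formula becomes 0 / 0.\<close>

definition zbin :: "int \<Rightarrow> nat \<Rightarrow> 'k" where
  "zbin n t = (SOME c. spec \<zeta> (qbin q n t) c)"

lemma spec_zbin: "spec \<zeta> (qbin q n t) (zbin n t)"
  unfolding zbin_def by (rule someI_ex[OF spec_qbin_ex])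

lemma spec_qnum_fact: "spec \<zeta> (qnum_fact q t) (qnum_fact \<zeta> t)"
  unfolding qnum_fact_def by (intro spec_prod zeta_nz spec_qnum)

lemma spec_qfalling: "spec \<zeta> (qfalling q n t) (qfalling \<zeta> n t)"
  unfolding qfalling_def by (intro spec_prod zeta_nz spec_qnum)

text \<open>Both sides are compared after multiplication by [t]!, which is nonzero at \<zeta> for t
  < l.\<close>

lemma zbin_small: "t < l \<Longrightarrow> zbin n t = qbin \<zeta> n t"
proof -
  assume t: "t < l"
  have "spec \<zeta> (qnum_fact q t * qbin q n t) (qnum_fact \<zeta> t * zbin n t)"
    by (intro spec_mult zeta_nz spec_qnum_fact spec_zbin)
  moreover have "qnum_fact q t * qbin q n t = qfalling q n t"
    using qnum_fact_q_nz by (simp add: qbin_def)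
  ultimately have "qnum_fact \<zeta> t * zbin n t = qfalling \<zeta> n t"
    using spec_unique spec_qfalling by metis
  then show ?thesis using qnum_fact_zeta_nz[OF t] by (simp add: qbin_def field_simps)
qed

text \<open>The numerator runs through the l - 1 consecutive integers n, ..., n - l + 2. It misses
  just the residue class of n + 1 modulo l, so a factor vanishes unless that class is 0; in the
  remaining case periodicity reduces n to l - 1.\<close>

lemma qbin_zeta_top: "qbin \<zeta> n (l - 1) = (if int l dvd n + 1 then 1 else 0)"
proof (cases "int l dvd n + 1")
  case True
  have "int l dvd (n + 1) - int l" using True by (rule dvd_diff) simp
  moreover have "(n + 1) - int l = n - (int l - 1)" by simp
  ultimately have "n mod int l = (int l - 1) mod int l" by (metis mod_eq_dvd_iff)
  then have "qbin \<zeta> n (l - 1) = qbin \<zeta> (int l - 1) (l - 1)" by (rule qbin_zeta_cong)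
  \<comment> \<open>The same l - 1 factors in reverse order.\<close>
  also have "qfalling \<zeta> (int l - 1) (l - 1) = qnum_fact \<zeta> (l - 1)"
    unfolding qfalling_def qnum_fact_def
    by (rule prod.reindex_bij_witness[of _ "\<lambda>s. l - 2 - s" "\<lambda>s. l - 2 - s"]) (use l_gt_1 in \<open>auto simp: of_nat_diff algebra_simps\<close>)
  then have "qbin \<zeta> (int l - 1) (l - 1) = 1"
    using qnum_fact_zeta_nz[of "l - 1"] l_gt_1 by (simp add: qbin_def)
  finally show ?thesis using True by simp
next
  case False
  let ?s = "nat (n mod int l)"
  have "n mod int l < int l" "n mod int l \<ge> 0" using l_gt_1 by simp_all
  moreover have "n mod int l \<noteq> int l - 1"
    using False by (metis add.commute add_diff_cancel_left' diff_add_cancel dvd_refl dvd_add_left_iff mod_mod_trivial mod_add_left_eq dvd_eq_mod_eq_0)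
  ultimately have s: "?s \<in> {..<l - 1}" by auto
  have "int l dvd n - int ?s" using l_gt_1 by (simp add: minus_mod_eq_mult_div)
  then have "qfalling \<zeta> n (l - 1) = 0"
    unfolding qfalling_def using s by (intro prod_zero finite_lessThan bexI[OF _ s]) (simp add: qnum_zeta_eq_0)
  then show ?thesis using False by (simp add: qbin_def)
qed

text \<open>At \<zeta>, Pascal's rule for the lower entry l increases the binomial by 1 when l
  divides n + 1 and leaves it unchanged otherwise. This is the recursion of the floor of n / l, and
  both vanish at n = 0. Ordinary integers enter the action at this point.\<close>

lemma spec_qbin_l: "spec \<zeta> (qbin q n l) (of_int (n div int l))"
proof -
  have l: "Suc (l - 1) = l" using l_gt_1 by simp
  have pascal: "qbin q (n + 1) l = q powi int l * qbin q n l + q powi (int l - 1 - n) * qbin q n (l - 1)" for n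
    using q.qbin_pascal[OF qnum_fact_q_nz, of n "l - 1"] l l_gt_1 by (simp add: of_nat_diff)
  have div: "(n + 1) div int l = n div int l + (if int l dvd n + 1 then 1 else 0)" for n
  proof -
    have "(n + 1) div int l = n div int l + (n mod int l + 1) div int l"
      by (subst div_mult_mod_eq[of n "int l", symmetric], subst add.assoc, subst div_mult_self3) (use l_gt_1 in auto)
    moreover have "(n mod int l + 1) div int l = (if int l dvd n + 1 then 1 else 0)"
    proof (cases "n mod int l = int l - 1")
      case True
      then have "int l dvd n + 1" by (metis diff_add_cancel dvd_eq_mod_eq_0 mod_add_left_eq mod_self)
      then show ?thesis using True l_gt_1 by simp
    next
      case False
      moreover have "n mod int l < int l" "n mod int l \<ge> 0" using l_gt_1 by simp_all
      ultimately have "n mod int l + 1 < int l" "n mod int l + 1 > 0" by auto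
      then have "(n mod int l + 1) mod int l \<noteq> 0" "(n mod int l + 1) div int l = 0" by auto
      then show ?thesis by (simp add: dvd_eq_mod_eq_0 mod_add_left_eq)
    qed
    ultimately show ?thesis by simp
  qed
  \<comment> \<open>Where the binomial is nonzero, l - 1 - n is a multiple of l, so the power in
    front of it is 1.\<close>
  have z: "\<zeta> powi (int l - 1 - n) * zbin n (l - 1) = (if int l dvd n + 1 then 1 else 0)" for n
  proof (cases "int l dvd n + 1")
    case True
    then have "int l dvd int l - 1 - n" by (metis diff_diff_eq add.commute dvd_diff dvd_refl)
    then have "\<zeta> powi (int l - 1 - n) = 1" by (simp add: zeta_powi_eq_1)
    then show ?thesis using True l_gt_1 by (simp add: zbin_small qbin_zeta_top[unfolded One_nat_def])
  next
    case False
    then show ?thesis using l_gt_1 by (simp add: zbin_small qbin_zeta_top[unfolded One_nat_def])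
  qed
  have zl: "\<zeta> powi int l = 1" by (simp add: zeta_l)
  show ?thesis
  proof (induction n rule: int_induct[where k = 0])
    case base
    then show ?case using l_gt_1 by (simp add: q.qbin_0_Suc spec_0)
  next
    case (step1 n)
    have "spec \<zeta> (qbin q (n + 1) l) (\<zeta> powi int l * of_int (n div int l) + \<zeta> powi (int l - 1 - n) * zbin n (l - 1))"
      unfolding pascal by (intro spec_add spec_mult zeta_nz spec_powi step1 spec_zbin)
    then show ?case unfolding z zl div by (simp split: if_splits)
  next
    case (step2 n)
    have "qbin q n l = q powi int l * qbin q (n - 1) l + q powi (int l - n) * qbin q (n - 1) (l - 1)"
      using pascal[of "n - 1"] by simp
    then have "qbin q (n - 1) l = q powi (- int l) * (qbin q n l - q powi (int l - n) * qbin q (n - 1) (l - 1))"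
      using q_nz by (simp add: power_int_minus)
    then have "spec \<zeta> (qbin q (n - 1) l) (\<zeta> powi (- int l) * (of_int (n div int l) - \<zeta> powi (int l - n) * zbin (n - 1) (l - 1)))"
      by (auto intro!: spec_mult zeta_nz spec_powi spec_diff step2 spec_zbin)
    moreover have "n div int l = (n - 1) div int l + (if int l dvd n then 1 else 0)" using div[of "n - 1"] by simp
    ultimately show ?case using z[of "n - 1"] by (simp add: power_int_minus zl zeta_l split: if_splits)
  qed
qed

lemma zbin_l: "zbin n l = of_int (n div int l)"
  by (rule spec_unique[OF spec_zbin spec_qbin_l])

end

section \<open>Linear spans\<close>

inductive_set (in module) lin_span :: "'c set \<Rightarrow> 'c set" for S where
  zero: "\<zero>\<^bsub>M\<^esub> \<in> lin_span S"
| incl: "x \<in> S \<Longrightarrow> x \<in> lin_span S"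
| add: "\<lbrakk>x \<in> lin_span S; y \<in> lin_span S\<rbrakk> \<Longrightarrow> x \<oplus>\<^bsub>M\<^esub> y \<in> lin_span S"
| smult: "\<lbrakk>r \<in> carrier R; x \<in> lin_span S\<rbrakk> \<Longrightarrow> r \<odot>\<^bsub>M\<^esub> x \<in> lin_span S"

context module
begin

lemma lin_span_closed: "S \<subseteq> carrier M \<Longrightarrow> x \<in> lin_span S \<Longrightarrow> x \<in> carrier M"
proof -
  assume S: "S \<subseteq> carrier M" and "x \<in> lin_span S"
  from this(2) show "x \<in> carrier M" by induction (use S in auto)
qed

lemma lin_span_finite:
  assumes I: "finite I" and f: "f \<in> I \<rightarrow> carrier M" and x: "x \<in> lin_span (f ` I)"
  shows "\<exists>c. c \<in> I \<rightarrow> carrier R \<and> x = (\<Oplus>\<^bsub>M\<^esub>i\<in>I. c i \<odot>\<^bsub>M\<^esub> f i)"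
  using x
proof induction
  case zero
  have "(\<Oplus>\<^bsub>M\<^esub>i\<in>I. \<zero> \<odot>\<^bsub>M\<^esub> f i) = (\<Oplus>\<^bsub>M\<^esub>i\<in>I. \<zero>\<^bsub>M\<^esub>)"
    using f by (intro M.finsum_cong') (auto simp: Pi_iff)
  then show ?case by (intro exI[of _ "\<lambda>_. \<zero>"]) auto
next
  case (incl y)
  then obtain j where j: "j \<in> I" "y = f j" by blast
  have "(\<Oplus>\<^bsub>M\<^esub>i\<in>I. (if i = j then \<one> else \<zero>) \<odot>\<^bsub>M\<^esub> f i) = (\<Oplus>\<^bsub>M\<^esub>i\<in>I. if j = i then f i else \<zero>\<^bsub>M\<^esub>)"
    using f by (intro M.finsum_cong') (auto simp: Pi_iff)
  also have "\<dots> = y" using M.finsum_singleton[OF j(1) I f] j by simp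
  finally show ?case by (intro exI[of _ "\<lambda>i. if i = j then \<one> else \<zero>"]) auto
next
  case (add y z)
  then obtain c d where c: "c \<in> I \<rightarrow> carrier R" "y = (\<Oplus>\<^bsub>M\<^esub>i\<in>I. c i \<odot>\<^bsub>M\<^esub> f i)"
    and d: "d \<in> I \<rightarrow> carrier R" "z = (\<Oplus>\<^bsub>M\<^esub>i\<in>I. d i \<odot>\<^bsub>M\<^esub> f i)" by blast
  have "(\<Oplus>\<^bsub>M\<^esub>i\<in>I. (c i \<oplus> d i) \<odot>\<^bsub>M\<^esub> f i) = (\<Oplus>\<^bsub>M\<^esub>i\<in>I. c i \<odot>\<^bsub>M\<^esub> f i \<oplus>\<^bsub>M\<^esub> d i \<odot>\<^bsub>M\<^esub> f i)"
    using c d f by (intro M.finsum_cong') (auto simp: smult_l_distr Pi_iff)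
  also have "\<dots> = y \<oplus>\<^bsub>M\<^esub> z"
    unfolding c d using c d f by (intro M.finsum_addf) auto
  finally show ?case using c d by (intro exI[of _ "\<lambda>i. c i \<oplus> d i"]) auto
next
  case (smult r y)
  then obtain c where c: "c \<in> I \<rightarrow> carrier R" "y = (\<Oplus>\<^bsub>M\<^esub>i\<in>I. c i \<odot>\<^bsub>M\<^esub> f i)" by blast
  have "(\<Oplus>\<^bsub>M\<^esub>i\<in>I. (r \<otimes> c i) \<odot>\<^bsub>M\<^esub> f i) = (\<Oplus>\<^bsub>M\<^esub>i\<in>I. r \<odot>\<^bsub>M\<^esub> (c i \<odot>\<^bsub>M\<^esub> f i))"
    using c smult f by (intro M.finsum_cong') (auto simp: smult_assoc1 Pi_iff)
  also have "\<dots> = r \<odot>\<^bsub>M\<^esub> y"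
    unfolding c using c smult f I by (intro finsum_smult_ldistr[symmetric]) auto
  finally show ?case using c smult by (intro exI[of _ "\<lambda>i. r \<otimes> c i"]) auto
qed

end

lemma (in assoc_algebra) lin_span_mult_left:
  assumes S: "S \<subseteq> carrier A" and y: "y \<in> carrier A" and m: "\<And>s. s \<in> S \<Longrightarrow> y \<otimes>\<^bsub>A\<^esub> s \<in> lin_span S'"
    and x: "x \<in> lin_span S"
  shows "y \<otimes>\<^bsub>A\<^esub> x \<in> lin_span S'"
  using x
proof induction
  case zero
  then show ?case using y lin_span.zero by simp
next
  case (add x x')
  then show ?case using y lin_span_closed[OF S] lin_span.add by (simp add: r_distr)
next
  case (smult r x)
  then show ?case using y lin_span_closed[OF S] lin_span.smult by (simp add: smult_mult_right)
qed (use m in auto)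

section \<open>A spanning set of the enveloping algebra of sl2\<close>

text \<open>The relations are oriented as rewriting rules that move f to the left and e to the
  right.\<close>

locale sl2_triple = assoc_algebra base_field A
  for A :: "('k::field, 'a) module" +
  fixes e h f :: 'a
  assumes e_closed [simp, intro]: "e \<in> carrier A" and h_closed [simp, intro]: "h \<in> carrier A"
    and f_closed [simp, intro]: "f \<in> carrier A"
    and h_f: "h \<otimes>\<^bsub>A\<^esub> f = f \<otimes>\<^bsub>A\<^esub> h \<oplus>\<^bsub>A\<^esub> (- 2) \<odot>\<^bsub>A\<^esub> f"
    and e_f: "e \<otimes>\<^bsub>A\<^esub> f = f \<otimes>\<^bsub>A\<^esub> e \<oplus>\<^bsub>A\<^esub> h"
    and e_h: "e \<otimes>\<^bsub>A\<^esub> h = h \<otimes>\<^bsub>A\<^esub> e \<oplus>\<^bsub>A\<^esub> (- 2) \<odot>\<^bsub>A\<^esub> e"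
begin

lemmas sl2_rels = h_f e_f e_h

definition sl2_mono :: "nat \<times> nat \<times> nat \<Rightarrow> 'a" where
  "sl2_mono = (\<lambda>(a, b, c). f [^]\<^bsub>A\<^esub> a \<otimes>\<^bsub>A\<^esub> h [^]\<^bsub>A\<^esub> b \<otimes>\<^bsub>A\<^esub> e [^]\<^bsub>A\<^esub> c)"

lemma sl2_mono_closed [simp]: "sl2_mono m \<in> carrier A"
  by (cases m) (simp add: sl2_mono_def)

lemma smult_simps:
  "x \<in> carrier A \<Longrightarrow> 0 \<odot>\<^bsub>A\<^esub> x = \<zero>\<^bsub>A\<^esub>" "x \<in> carrier A \<Longrightarrow> 1 \<odot>\<^bsub>A\<^esub> x = x"
  using smult_l_null[of x] smult_one[of x] by simp_all

lemma h_f_pow: "h \<otimes>\<^bsub>A\<^esub> f [^]\<^bsub>A\<^esub> a = f [^]\<^bsub>A\<^esub> a \<otimes>\<^bsub>A\<^esub> h \<oplus>\<^bsub>A\<^esub> (- 2 * of_nat a) \<odot>\<^bsub>A\<^esub> f [^]\<^bsub>A\<^esub> (a::nat)"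
proof (induction a)
  case 0
  show ?case by (simp add: smult_simps)
next
  case (Suc a)
  have "h \<otimes>\<^bsub>A\<^esub> f [^]\<^bsub>A\<^esub> Suc a = (h \<otimes>\<^bsub>A\<^esub> f [^]\<^bsub>A\<^esub> a) \<otimes>\<^bsub>A\<^esub> f" by (simp add: m_assoc)
  also have "\<dots> = f [^]\<^bsub>A\<^esub> Suc a \<otimes>\<^bsub>A\<^esub> h \<oplus>\<^bsub>A\<^esub> ((- 2) \<odot>\<^bsub>A\<^esub> f [^]\<^bsub>A\<^esub> Suc a
      \<oplus>\<^bsub>A\<^esub> (- 2 * of_nat a) \<odot>\<^bsub>A\<^esub> f [^]\<^bsub>A\<^esub> Suc a)"
    unfolding Suc by (simp add: l_distr r_distr m_assoc sl2_rels(1) smult_mult_left smult_mult_right a_assoc)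
  also have "(- 2) \<odot>\<^bsub>A\<^esub> f [^]\<^bsub>A\<^esub> Suc a \<oplus>\<^bsub>A\<^esub> (- 2 * of_nat a) \<odot>\<^bsub>A\<^esub> f [^]\<^bsub>A\<^esub> Suc a
      = (- 2 * of_nat (Suc a)) \<odot>\<^bsub>A\<^esub> f [^]\<^bsub>A\<^esub> Suc a"
    using smult_l_distr[of "- 2" "- 2 * of_nat a" "f [^]\<^bsub>A\<^esub> Suc a"] by (simp add: algebra_simps)
  finally show ?case .
qed

text \<open>The right side is f^(a+1) e + (a + 1) f^a (h - a): each of the a + 1 replacements of e f
  by f e + h leaves an h, and moving these past the remaining factors f costs -2 per factor, in
  total -a (a + 1).\<close>

lemma e_f_pow: "e \<otimes>\<^bsub>A\<^esub> f [^]\<^bsub>A\<^esub> Suc a = f [^]\<^bsub>A\<^esub> Suc a \<otimes>\<^bsub>A\<^esub> e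
    \<oplus>\<^bsub>A\<^esub> (of_nat (Suc a) \<odot>\<^bsub>A\<^esub> (f [^]\<^bsub>A\<^esub> a \<otimes>\<^bsub>A\<^esub> h) \<oplus>\<^bsub>A\<^esub> (- of_nat (a * Suc a)) \<odot>\<^bsub>A\<^esub> f [^]\<^bsub>A\<^esub> a)"
proof (induction a)
  case 0
  show ?case by (simp add: sl2_rels smult_simps)
next
  case (Suc a)
  let ?F = "f [^]\<^bsub>A\<^esub> Suc a"
  have comb: "c \<odot>\<^bsub>A\<^esub> x \<oplus>\<^bsub>A\<^esub> d \<odot>\<^bsub>A\<^esub> x = (c + d) \<odot>\<^bsub>A\<^esub> x" if "x \<in> carrier A" for c d x
    using smult_l_distr[of c d x] that by simp
  have ass: "c \<odot>\<^bsub>A\<^esub> (d \<odot>\<^bsub>A\<^esub> x) = (c * d) \<odot>\<^bsub>A\<^esub> x" if "x \<in> carrier A" for c d x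
    using smult_assoc1[of c d x] that by simp
  have one: "1 \<odot>\<^bsub>A\<^esub> x = x" if "x \<in> carrier A" for x using smult_one[of x] that by simp
  have hf: "f [^]\<^bsub>A\<^esub> a \<otimes>\<^bsub>A\<^esub> h \<otimes>\<^bsub>A\<^esub> f = ?F \<otimes>\<^bsub>A\<^esub> h \<oplus>\<^bsub>A\<^esub> (- 2) \<odot>\<^bsub>A\<^esub> ?F"
    by (simp add: m_assoc sl2_rels r_distr smult_mult_right)
  have "e \<otimes>\<^bsub>A\<^esub> f [^]\<^bsub>A\<^esub> Suc (Suc a) = (e \<otimes>\<^bsub>A\<^esub> ?F) \<otimes>\<^bsub>A\<^esub> f" by (simp add: m_assoc)
  also have "\<dots> = ?F \<otimes>\<^bsub>A\<^esub> (e \<otimes>\<^bsub>A\<^esub> f) \<oplus>\<^bsub>A\<^esub>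
     (of_nat (Suc a) \<odot>\<^bsub>A\<^esub> (f [^]\<^bsub>A\<^esub> a \<otimes>\<^bsub>A\<^esub> h \<otimes>\<^bsub>A\<^esub> f) \<oplus>\<^bsub>A\<^esub> (- of_nat (a * Suc a)) \<odot>\<^bsub>A\<^esub> ?F)"
    unfolding Suc by (simp add: l_distr smult_mult_left m_assoc)
  also have "?F \<otimes>\<^bsub>A\<^esub> (e \<otimes>\<^bsub>A\<^esub> f) = f [^]\<^bsub>A\<^esub> Suc (Suc a) \<otimes>\<^bsub>A\<^esub> e \<oplus>\<^bsub>A\<^esub> 1 \<odot>\<^bsub>A\<^esub> (?F \<otimes>\<^bsub>A\<^esub> h)"
    by (simp add: sl2_rels r_distr m_assoc one)
  also have "f [^]\<^bsub>A\<^esub> Suc (Suc a) \<otimes>\<^bsub>A\<^esub> e \<oplus>\<^bsub>A\<^esub> 1 \<odot>\<^bsub>A\<^esub> (?F \<otimes>\<^bsub>A\<^esub> h) \<oplus>\<^bsub>A\<^esub>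
     (of_nat (Suc a) \<odot>\<^bsub>A\<^esub> (f [^]\<^bsub>A\<^esub> a \<otimes>\<^bsub>A\<^esub> h \<otimes>\<^bsub>A\<^esub> f) \<oplus>\<^bsub>A\<^esub> (- of_nat (a * Suc a)) \<odot>\<^bsub>A\<^esub> ?F)
     = f [^]\<^bsub>A\<^esub> Suc (Suc a) \<otimes>\<^bsub>A\<^esub> e \<oplus>\<^bsub>A\<^esub>
     ((1 \<odot>\<^bsub>A\<^esub> (?F \<otimes>\<^bsub>A\<^esub> h) \<oplus>\<^bsub>A\<^esub> of_nat (Suc a) \<odot>\<^bsub>A\<^esub> (?F \<otimes>\<^bsub>A\<^esub> h))
      \<oplus>\<^bsub>A\<^esub> ((of_nat (Suc a) * - 2) \<odot>\<^bsub>A\<^esub> ?F \<oplus>\<^bsub>A\<^esub> (- of_nat (a * Suc a)) \<odot>\<^bsub>A\<^esub> ?F))"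
    unfolding hf by (simp add: smult_r_distr a_assoc ass del: nat_pow_Suc Group.nat_pow_Suc)
  also have "\<dots> = f [^]\<^bsub>A\<^esub> Suc (Suc a) \<otimes>\<^bsub>A\<^esub> e \<oplus>\<^bsub>A\<^esub> (of_nat (Suc (Suc a)) \<odot>\<^bsub>A\<^esub> (?F \<otimes>\<^bsub>A\<^esub> h)
      \<oplus>\<^bsub>A\<^esub> (- of_nat (Suc a * Suc (Suc a))) \<odot>\<^bsub>A\<^esub> ?F)"
    by (simp add: comb algebra_simps del: nat_pow_Suc Group.nat_pow_Suc)
  finally show ?case .
qed

text \<open>The core of the spanning half of the Poincare-Birkhoff-Witt theorem: a subspace that
  contains 1 and is stable under left multiplication by the generators is the whole enveloping
  algebra.\<close>

lemma lin_span_sl2_mono: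
  assumes x: "x \<in> lin_span (range sl2_mono)" and g: "g \<in> {e, h, f}"
  shows "g \<otimes>\<^bsub>A\<^esub> x \<in> lin_span (range sl2_mono)"
proof -
  let ?S = "lin_span (range sl2_mono)"
  have sub: "range sl2_mono \<subseteq> carrier A" by auto
  have mono: "f [^]\<^bsub>A\<^esub> a \<otimes>\<^bsub>A\<^esub> h [^]\<^bsub>A\<^esub> b \<otimes>\<^bsub>A\<^esub> e [^]\<^bsub>A\<^esub> c \<in> ?S" for a b c :: nat
    by (rule lin_span.incl) (auto simp: sl2_mono_def intro: image_eqI[of _ _ "(a, b, c)"])
  have add: "x \<in> ?S \<Longrightarrow> y \<in> ?S \<Longrightarrow> x \<oplus>\<^bsub>A\<^esub> y \<in> ?S" for x y by (rule lin_span.add)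
  have sm: "x \<in> ?S \<Longrightarrow> c \<odot>\<^bsub>A\<^esub> x \<in> ?S" for c x by (rule lin_span.smult) auto
  have F: "f \<otimes>\<^bsub>A\<^esub> sl2_mono m \<in> ?S" for m
  proof -
    obtain a b c where m: "m = (a, b, c)" by (cases m)
    have "f \<otimes>\<^bsub>A\<^esub> sl2_mono m = f [^]\<^bsub>A\<^esub> Suc a \<otimes>\<^bsub>A\<^esub> h [^]\<^bsub>A\<^esub> b \<otimes>\<^bsub>A\<^esub> e [^]\<^bsub>A\<^esub> c"
      using nat_pow_Suc2[OF f_closed, of a] by (simp add: m sl2_mono_def m_assoc[symmetric])
    then show ?thesis using mono[of "Suc a" b c] by simp
  qed
  have Hh: "h \<otimes>\<^bsub>A\<^esub> sl2_mono m \<in> ?S" for m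
  proof -
    obtain a b c where m: "m = (a, b, c)" by (cases m)
    have "h \<otimes>\<^bsub>A\<^esub> sl2_mono m = (h \<otimes>\<^bsub>A\<^esub> f [^]\<^bsub>A\<^esub> a) \<otimes>\<^bsub>A\<^esub> (h [^]\<^bsub>A\<^esub> b \<otimes>\<^bsub>A\<^esub> e [^]\<^bsub>A\<^esub> c)"
      by (simp add: m sl2_mono_def m_assoc)
    also have "\<dots> = f [^]\<^bsub>A\<^esub> a \<otimes>\<^bsub>A\<^esub> h [^]\<^bsub>A\<^esub> Suc b \<otimes>\<^bsub>A\<^esub> e [^]\<^bsub>A\<^esub> c
       \<oplus>\<^bsub>A\<^esub> (- 2 * of_nat a) \<odot>\<^bsub>A\<^esub> (f [^]\<^bsub>A\<^esub> a \<otimes>\<^bsub>A\<^esub> h [^]\<^bsub>A\<^esub> b \<otimes>\<^bsub>A\<^esub> e [^]\<^bsub>A\<^esub> c)"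
      unfolding h_f_pow nat_pow_Suc2[OF h_closed, of b] by (simp add: l_distr m_assoc smult_mult_left)
    finally show ?thesis using mono[of a "Suc b" c] mono[of a b c] add sm by simp
  qed
  \<comment> \<open>e h^b equals (h - 2)^b e; only its membership in the span of the elements h^i e
    is kept, which avoids binomial coefficients.\<close>
  have eh: "f [^]\<^bsub>A\<^esub> a \<otimes>\<^bsub>A\<^esub> (e \<otimes>\<^bsub>A\<^esub> h [^]\<^bsub>A\<^esub> b) \<otimes>\<^bsub>A\<^esub> e [^]\<^bsub>A\<^esub> c \<in> ?S" for a b c :: nat
  proof -
    let ?T = "lin_span (range (\<lambda>i::nat. h [^]\<^bsub>A\<^esub> i \<otimes>\<^bsub>A\<^esub> e))"
    have Tsub: "range (\<lambda>i::nat. h [^]\<^bsub>A\<^esub> i \<otimes>\<^bsub>A\<^esub> e) \<subseteq> carrier A" by auto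
    have "e \<otimes>\<^bsub>A\<^esub> h [^]\<^bsub>A\<^esub> b \<in> ?T" for b :: nat
    proof (induction b)
      case 0
      have "h [^]\<^bsub>A\<^esub> (0::nat) \<otimes>\<^bsub>A\<^esub> e \<in> ?T" by (rule lin_span.incl) blast
      then show ?case by simp
    next
      case (Suc b)
      have "e \<otimes>\<^bsub>A\<^esub> h [^]\<^bsub>A\<^esub> Suc b = (e \<otimes>\<^bsub>A\<^esub> h) \<otimes>\<^bsub>A\<^esub> h [^]\<^bsub>A\<^esub> b"
        by (simp add: nat_pow_Suc2 m_assoc del: nat_pow_Suc Group.nat_pow_Suc)
      also have "\<dots> = h \<otimes>\<^bsub>A\<^esub> (e \<otimes>\<^bsub>A\<^esub> h [^]\<^bsub>A\<^esub> b) \<oplus>\<^bsub>A\<^esub> (- 2) \<odot>\<^bsub>A\<^esub> (e \<otimes>\<^bsub>A\<^esub> h [^]\<^bsub>A\<^esub> b)"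
        by (simp add: sl2_rels(3) l_distr smult_mult_left m_assoc)
      also have "\<dots> \<in> ?T"
      proof (intro lin_span.add lin_span.smult Suc)
        show "h \<otimes>\<^bsub>A\<^esub> (e \<otimes>\<^bsub>A\<^esub> h [^]\<^bsub>A\<^esub> b) \<in> ?T"
        proof (rule lin_span_mult_left[OF Tsub _ _ Suc])
          fix s assume "s \<in> range (\<lambda>i::nat. h [^]\<^bsub>A\<^esub> i \<otimes>\<^bsub>A\<^esub> e)"
          then obtain i :: nat where "s = h [^]\<^bsub>A\<^esub> i \<otimes>\<^bsub>A\<^esub> e" by blast
          then have "h \<otimes>\<^bsub>A\<^esub> s = h [^]\<^bsub>A\<^esub> Suc i \<otimes>\<^bsub>A\<^esub> e"
            by (simp add: nat_pow_Suc2 m_assoc del: nat_pow_Suc Group.nat_pow_Suc)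
          then show "h \<otimes>\<^bsub>A\<^esub> s \<in> ?T" by (auto intro: lin_span.incl simp del: nat_pow_Suc Group.nat_pow_Suc)
        qed simp
      qed simp
      finally show ?case .
    qed
    from this[of b] have "f [^]\<^bsub>A\<^esub> a \<otimes>\<^bsub>A\<^esub> x \<otimes>\<^bsub>A\<^esub> e [^]\<^bsub>A\<^esub> c \<in> ?S \<and> x \<in> carrier A"
      if "x = e \<otimes>\<^bsub>A\<^esub> h [^]\<^bsub>A\<^esub> b" for x
      unfolding that[symmetric]
    proof induction
      case zero
      then show ?case using lin_span.zero by simp
    next
      case (incl x)
      then obtain i :: nat where "x = h [^]\<^bsub>A\<^esub> i \<otimes>\<^bsub>A\<^esub> e" by blast
      then have "f [^]\<^bsub>A\<^esub> a \<otimes>\<^bsub>A\<^esub> x \<otimes>\<^bsub>A\<^esub> e [^]\<^bsub>A\<^esub> c = f [^]\<^bsub>A\<^esub> a \<otimes>\<^bsub>A\<^esub> h [^]\<^bsub>A\<^esub> i \<otimes>\<^bsub>A\<^esub> e [^]\<^bsub>A\<^esub> Suc c"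
        and "x \<in> carrier A"
        by (simp_all add: nat_pow_Suc2 m_assoc del: nat_pow_Suc Group.nat_pow_Suc)
      then show ?case using mono[of a i "Suc c"] by simp
    qed (simp_all add: l_distr r_distr smult_mult_left smult_mult_right add sm)
    then show ?thesis by blast
  qed
  have Ee: "e \<otimes>\<^bsub>A\<^esub> sl2_mono m \<in> ?S" for m
  proof -
    obtain a b c where m: "m = (a, b, c)" by (cases m)
    show ?thesis
    proof (cases a)
      case 0
      then show ?thesis using eh[of 0 b c] by (simp add: m sl2_mono_def m_assoc)
    next
      case (Suc a')
      have "e \<otimes>\<^bsub>A\<^esub> sl2_mono m = (e \<otimes>\<^bsub>A\<^esub> f [^]\<^bsub>A\<^esub> Suc a') \<otimes>\<^bsub>A\<^esub> (h [^]\<^bsub>A\<^esub> b \<otimes>\<^bsub>A\<^esub> e [^]\<^bsub>A\<^esub> c)"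
        by (simp add: m Suc sl2_mono_def m_assoc)
      also have "\<dots> = f [^]\<^bsub>A\<^esub> Suc a' \<otimes>\<^bsub>A\<^esub> (e \<otimes>\<^bsub>A\<^esub> h [^]\<^bsub>A\<^esub> b) \<otimes>\<^bsub>A\<^esub> e [^]\<^bsub>A\<^esub> c
        \<oplus>\<^bsub>A\<^esub> (of_nat (Suc a') \<odot>\<^bsub>A\<^esub> (f [^]\<^bsub>A\<^esub> a' \<otimes>\<^bsub>A\<^esub> h [^]\<^bsub>A\<^esub> Suc b \<otimes>\<^bsub>A\<^esub> e [^]\<^bsub>A\<^esub> c)
        \<oplus>\<^bsub>A\<^esub> (- of_nat (a' * Suc a')) \<odot>\<^bsub>A\<^esub> (f [^]\<^bsub>A\<^esub> a' \<otimes>\<^bsub>A\<^esub> h [^]\<^bsub>A\<^esub> b \<otimes>\<^bsub>A\<^esub> e [^]\<^bsub>A\<^esub> c))"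
        unfolding e_f_pow nat_pow_Suc2[OF h_closed, of b]
        by (simp add: l_distr m_assoc smult_mult_left)
      finally show ?thesis using mono[of a' "Suc b" c] mono[of a' b c] eh[of "Suc a'" b c] add sm by simp
    qed
  qed
  show ?thesis
    by (rule lin_span_mult_left[OF sub _ _ x]) (use g F Hh Ee in auto)
qed

end

definition Usl2_mono :: "nat \<times> nat \<times> nat \<Rightarrow> 'k::field usl2" where
  "Usl2_mono = (\<lambda>(a, b, c). Usl2_gen f_sl2 [^]\<^bsub>Usl2\<^esub> a \<otimes>\<^bsub>Usl2\<^esub> Usl2_gen h_sl2 [^]\<^bsub>Usl2\<^esub> b \<otimes>\<^bsub>Usl2\<^esub> Usl2_gen e_sl2 [^]\<^bsub>Usl2\<^esub> c)"

lemma sl2_triple_Usl2: "sl2_triple Usl2 (Usl2_gen e_sl2) (Usl2_gen h_sl2) (Usl2_gen f_sl2 :: 'k::field usl2)"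
proof -
  have z: "0 \<odot>\<^bsub>Usl2\<^esub> Usl2_gen x = (\<zero>\<^bsub>Usl2\<^esub> :: 'k usl2)" "1 \<odot>\<^bsub>Usl2\<^esub> Usl2_gen x = (Usl2_gen x :: 'k usl2)" for x
    using U.smult_l_null[OF Usl2_gen_closed, of x] U.smult_one[OF Usl2_gen_closed, of x] by simp_all
  show ?thesis
    by unfold_locales (simp_all add: Usl2_gen_comm[of h_sl2 f_sl2] Usl2_gen_comm[of e_sl2 f_sl2]
        Usl2_gen_comm[of e_sl2 h_sl2] sl2_comb_def z)
qed

lemma Usl2_span:
  assumes x: "(x :: 'k::field usl2) \<in> carrier Usl2"
  shows "x \<in> module.lin_span base_field Usl2 (range Usl2_mono)"
proof -
  interpret sl2_triple Usl2 "Usl2_gen e_sl2" "Usl2_gen h_sl2" "Usl2_gen f_sl2 :: 'k usl2"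
    by (rule sl2_triple_Usl2)
  have m: "Usl2_mono = sl2_mono" by (simp add: Usl2_mono_def sl2_mono_def)
  show ?thesis
    unfolding m using x
  proof (induction rule: Usl2_induct)
    case one
    have "sl2_mono (0, 0, 0) = \<one>\<^bsub>Usl2\<^esub>" by (simp add: sl2_mono_def)
    then show ?case by (metis U.lin_span.incl rangeI)
  next
    case (mult g x)
    then show ?case by (intro lin_span_sl2_mono) (cases g; simp)+
  qed (auto intro: U.lin_span.add U.lin_span.smult)
qed

section \<open>Commutation relations in quantum sl2\<close>

lemma field_smult:
  assumes "assoc_algebra base_field (A :: ('k::field, 'a) module)" "x \<in> carrier A"
  shows "a \<odot>\<^bsub>A\<^esub> x \<in> carrier A" "(a + b) \<odot>\<^bsub>A\<^esub> x = a \<odot>\<^bsub>A\<^esub> x \<oplus>\<^bsub>A\<^esub> b \<odot>\<^bsub>A\<^esub> x"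
    "a \<odot>\<^bsub>A\<^esub> (b \<odot>\<^bsub>A\<^esub> x) = (a * b) \<odot>\<^bsub>A\<^esub> x"
    "0 \<odot>\<^bsub>A\<^esub> x = \<zero>\<^bsub>A\<^esub>" "1 \<odot>\<^bsub>A\<^esub> x = x" "(- a) \<odot>\<^bsub>A\<^esub> x = \<ominus>\<^bsub>A\<^esub> (a \<odot>\<^bsub>A\<^esub> x)"
proof -
  interpret assoc_algebra base_field A by (fact assms)
  show "a \<odot>\<^bsub>A\<^esub> x \<in> carrier A" "(a + b) \<odot>\<^bsub>A\<^esub> x = a \<odot>\<^bsub>A\<^esub> x \<oplus>\<^bsub>A\<^esub> b \<odot>\<^bsub>A\<^esub> x"
    "a \<odot>\<^bsub>A\<^esub> (b \<odot>\<^bsub>A\<^esub> x) = (a * b) \<odot>\<^bsub>A\<^esub> x"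
    "0 \<odot>\<^bsub>A\<^esub> x = \<zero>\<^bsub>A\<^esub>" "1 \<odot>\<^bsub>A\<^esub> x = x"
    using assms(2) smult_l_distr[of a b x] smult_assoc1[of a b x] smult_l_null[of x] smult_one[of x] by simp_all
  have "(- a) \<odot>\<^bsub>A\<^esub> x \<oplus>\<^bsub>A\<^esub> a \<odot>\<^bsub>A\<^esub> x = \<zero>\<^bsub>A\<^esub>"
    using assms(2) smult_l_distr[of "- a" a x] smult_l_null[of x] by simp
  then show "(- a) \<odot>\<^bsub>A\<^esub> x = \<ominus>\<^bsub>A\<^esub> (a \<odot>\<^bsub>A\<^esub> x)"
    using assms(2) by (intro minus_equality[symmetric]) auto
qed

text \<open>Instantiated twice, with parameter q in \<open>Uq\<close> and with \<zeta> in
  \<open>Uzeta\<close>, so that each commutation rule is derived once for both.\<close>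

locale quantum_sl2 = assoc_algebra base_field A + qnumber x
  for A :: "('k::field, 'a) module" and x :: 'k +
  fixes E F K K' :: 'a
  assumes E_closed [simp, intro]: "E \<in> carrier A" and F_closed [simp, intro]: "F \<in> carrier A"
    and K_closed [simp, intro]: "K \<in> carrier A" and K'_closed [simp, intro]: "K' \<in> carrier A"
    and KK': "K \<otimes>\<^bsub>A\<^esub> K' = \<one>\<^bsub>A\<^esub>" and K'K: "K' \<otimes>\<^bsub>A\<^esub> K = \<one>\<^bsub>A\<^esub>"
    and KE: "K \<otimes>\<^bsub>A\<^esub> E = x\<^sup>2 \<odot>\<^bsub>A\<^esub> (E \<otimes>\<^bsub>A\<^esub> K)"
    and KF: "K \<otimes>\<^bsub>A\<^esub> F = (inverse x)\<^sup>2 \<odot>\<^bsub>A\<^esub> (F \<otimes>\<^bsub>A\<^esub> K)"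
    and EF: "E \<otimes>\<^bsub>A\<^esub> F = F \<otimes>\<^bsub>A\<^esub> E \<oplus>\<^bsub>A\<^esub> inverse (x - inverse x) \<odot>\<^bsub>A\<^esub> (K \<ominus>\<^bsub>A\<^esub> K')"
begin

lemmas sm = field_smult[OF assoc_algebra_axioms]

definition "d = inverse (x - inverse x)"

text \<open>The torus parts of all commutators have this form. Moving E or F across only rescales a
  and b by the square of x or of its inverse, so every computation reduces to two scalar
  identities.\<close>

definition "kk a b = a \<odot>\<^bsub>A\<^esub> K \<oplus>\<^bsub>A\<^esub> b \<odot>\<^bsub>A\<^esub> K'"

lemma kk_closed [simp, intro]: "kk a b \<in> carrier A"
  by (simp add: kk_def sm)

lemma kk_add: "kk a b \<oplus>\<^bsub>A\<^esub> kk a' b' = kk (a + a') (b + b')"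
  by (simp add: kk_def sm a_ac)

lemma kk_smult: "c \<odot>\<^bsub>A\<^esub> kk a b = kk (c * a) (c * b)"
  using smult_r_distr[of c "a \<odot>\<^bsub>A\<^esub> K" "b \<odot>\<^bsub>A\<^esub> K'"] by (simp add: kk_def sm)

lemma K'E: "K' \<otimes>\<^bsub>A\<^esub> E = (inverse x)\<^sup>2 \<odot>\<^bsub>A\<^esub> (E \<otimes>\<^bsub>A\<^esub> K')"
proof -
  have "E \<otimes>\<^bsub>A\<^esub> K' = K' \<otimes>\<^bsub>A\<^esub> (K \<otimes>\<^bsub>A\<^esub> E) \<otimes>\<^bsub>A\<^esub> K'"
    by (simp add: m_assoc[symmetric] K'K)
  also have "\<dots> = x\<^sup>2 \<odot>\<^bsub>A\<^esub> (K' \<otimes>\<^bsub>A\<^esub> E \<otimes>\<^bsub>A\<^esub> (K \<otimes>\<^bsub>A\<^esub> K'))"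
    by (simp add: KE smult_mult_left smult_mult_right m_assoc)
  finally have "(inverse x)\<^sup>2 \<odot>\<^bsub>A\<^esub> (E \<otimes>\<^bsub>A\<^esub> K') = (inverse x)\<^sup>2 \<odot>\<^bsub>A\<^esub> (x\<^sup>2 \<odot>\<^bsub>A\<^esub> (K' \<otimes>\<^bsub>A\<^esub> E))"
    by (simp add: KK')
  then show ?thesis using nz by (simp add: sm power_mult_distrib[symmetric])
qed

lemma K'F: "K' \<otimes>\<^bsub>A\<^esub> F = x\<^sup>2 \<odot>\<^bsub>A\<^esub> (F \<otimes>\<^bsub>A\<^esub> K')"
proof -
  have "F \<otimes>\<^bsub>A\<^esub> K' = K' \<otimes>\<^bsub>A\<^esub> (K \<otimes>\<^bsub>A\<^esub> F) \<otimes>\<^bsub>A\<^esub> K'"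
    by (simp add: m_assoc[symmetric] K'K)
  also have "\<dots> = (inverse x)\<^sup>2 \<odot>\<^bsub>A\<^esub> (K' \<otimes>\<^bsub>A\<^esub> F \<otimes>\<^bsub>A\<^esub> (K \<otimes>\<^bsub>A\<^esub> K'))"
    by (simp add: KF smult_mult_left smult_mult_right m_assoc)
  finally have "x\<^sup>2 \<odot>\<^bsub>A\<^esub> (F \<otimes>\<^bsub>A\<^esub> K') = x\<^sup>2 \<odot>\<^bsub>A\<^esub> ((inverse x)\<^sup>2 \<odot>\<^bsub>A\<^esub> (K' \<otimes>\<^bsub>A\<^esub> F))"
    by (simp add: KK')
  then show ?thesis using nz by (simp add: sm power_mult_distrib[symmetric])
qed

lemma kk_E: "kk a b \<otimes>\<^bsub>A\<^esub> E = E \<otimes>\<^bsub>A\<^esub> kk (x\<^sup>2 * a) ((inverse x)\<^sup>2 * b)"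
  by (simp add: kk_def l_distr r_distr smult_mult_left smult_mult_right KE K'E sm mult.commute)

lemma kk_F: "kk a b \<otimes>\<^bsub>A\<^esub> F = F \<otimes>\<^bsub>A\<^esub> kk ((inverse x)\<^sup>2 * a) (x\<^sup>2 * b)"
  by (simp add: kk_def l_distr r_distr smult_mult_left smult_mult_right KF K'F sm mult.commute)

lemma kk_E_pow: "kk a b \<otimes>\<^bsub>A\<^esub> E [^]\<^bsub>A\<^esub> (n::nat) = E [^]\<^bsub>A\<^esub> n \<otimes>\<^bsub>A\<^esub> kk (x ^ (2 * n) * a) (inverse x ^ (2 * n) * b)"
proof (induction n)
  case (Suc n)
  have "kk a b \<otimes>\<^bsub>A\<^esub> E [^]\<^bsub>A\<^esub> Suc n = (kk a b \<otimes>\<^bsub>A\<^esub> E [^]\<^bsub>A\<^esub> n) \<otimes>\<^bsub>A\<^esub> E" by (simp add: m_assoc)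
  also have "\<dots> = E [^]\<^bsub>A\<^esub> n \<otimes>\<^bsub>A\<^esub> (kk (x ^ (2 * n) * a) (inverse x ^ (2 * n) * b) \<otimes>\<^bsub>A\<^esub> E)"
    unfolding Suc by (simp add: m_assoc)
  also have "\<dots> = E [^]\<^bsub>A\<^esub> Suc n \<otimes>\<^bsub>A\<^esub> kk (x ^ (2 * Suc n) * a) (inverse x ^ (2 * Suc n) * b)"
    unfolding kk_E by (simp add: m_assoc power2_eq_square mult_ac)
  finally show ?case .
qed simp

lemma EF': "E \<otimes>\<^bsub>A\<^esub> F = F \<otimes>\<^bsub>A\<^esub> E \<oplus>\<^bsub>A\<^esub> kk d (- d)"
proof -
  have "d \<odot>\<^bsub>A\<^esub> (K \<ominus>\<^bsub>A\<^esub> K') = kk d (- d)"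
    using smult_r_distr[of d K "\<ominus>\<^bsub>A\<^esub> K'"] smult_r_minus[of d K'] by (simp add: minus_eq kk_def sm)
  then show ?thesis using EF by (simp add: d_def)
qed

text \<open>The torus factor is (x^n K - x^(-n) K') / (x - 1/x). In the induction the coefficients
  of K and of K' have to add up separately; these are \<open>q1\<close> and \<open>q2\<close>, both
  instances of \<open>qnum_step\<close>.\<close>

lemma E_pow_F:
  "E [^]\<^bsub>A\<^esub> Suc n \<otimes>\<^bsub>A\<^esub> F = F \<otimes>\<^bsub>A\<^esub> E [^]\<^bsub>A\<^esub> Suc n \<oplus>\<^bsub>A\<^esub>
     qnum x (int n + 1) \<odot>\<^bsub>A\<^esub> (E [^]\<^bsub>A\<^esub> n \<otimes>\<^bsub>A\<^esub> kk (d * x ^ n) (- (d * inverse x ^ n)))"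
proof (induction n)
  case 0
  show ?case by (simp add: EF' sm)
next
  case (Suc n)
  let ?Q = "qnum x (int n + 1)" and ?Q' = "qnum x (int (Suc n) + 1)"
  have q1: "x ^ (2 * Suc n) + ?Q * x ^ n = ?Q' * x ^ Suc n"
  proof -
    have "?Q' = x ^ Suc n + inverse x * ?Q"
      using qnum_step[of "int n + 1" "int n + 1"] power_int_of_nat[of x "Suc n"]
      by (simp add: power_int_minus add.commute)
    then have "?Q' * x ^ Suc n = x ^ Suc n * x ^ Suc n + ?Q * (inverse x * x ^ Suc n)" by (simp only: algebra_simps)
    moreover have "inverse x * x ^ Suc n = x ^ n" using nz by simp
    ultimately show ?thesis by (simp only: power_add[symmetric] mult_2)
  qed
  have q2: "inverse x ^ (2 * Suc n) + ?Q * inverse x ^ n = ?Q' * inverse x ^ Suc n"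
  proof -
    have "?Q' = x * ?Q + inverse x ^ Suc n"
      using qnum_step[of "int n + 1" 1] power_int_minus[of x "int (Suc n)"] power_int_of_nat[of x "Suc n"]
      by (simp add: power_inverse add.commute)
    then have "?Q' * inverse x ^ Suc n = inverse x ^ Suc n * inverse x ^ Suc n + ?Q * (x * inverse x ^ Suc n)"
      by (simp only: algebra_simps)
    moreover have "x * inverse x ^ Suc n = inverse x ^ n" using nz by simp
    ultimately show ?thesis by (simp only: power_add[symmetric] mult_2)
  qed
  have "E [^]\<^bsub>A\<^esub> Suc (Suc n) \<otimes>\<^bsub>A\<^esub> F = E \<otimes>\<^bsub>A\<^esub> (E [^]\<^bsub>A\<^esub> Suc n \<otimes>\<^bsub>A\<^esub> F)"
    unfolding nat_pow_Suc2[OF E_closed, of "Suc n"] by (simp add: m_assoc del: nat_pow_Suc Group.nat_pow_Suc)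
  also have "\<dots> = (E \<otimes>\<^bsub>A\<^esub> F) \<otimes>\<^bsub>A\<^esub> E [^]\<^bsub>A\<^esub> Suc n \<oplus>\<^bsub>A\<^esub>
     ?Q \<odot>\<^bsub>A\<^esub> ((E \<otimes>\<^bsub>A\<^esub> E [^]\<^bsub>A\<^esub> n) \<otimes>\<^bsub>A\<^esub> kk (d * x ^ n) (- (d * inverse x ^ n)))"
    unfolding Suc by (simp add: r_distr m_assoc smult_mult_right del: nat_pow_Suc Group.nat_pow_Suc)
  also have "E \<otimes>\<^bsub>A\<^esub> E [^]\<^bsub>A\<^esub> n = E [^]\<^bsub>A\<^esub> Suc n" by (simp add: nat_pow_Suc2 del: nat_pow_Suc Group.nat_pow_Suc)
  also have "(E \<otimes>\<^bsub>A\<^esub> F) \<otimes>\<^bsub>A\<^esub> E [^]\<^bsub>A\<^esub> Suc n = F \<otimes>\<^bsub>A\<^esub> (E \<otimes>\<^bsub>A\<^esub> E [^]\<^bsub>A\<^esub> Suc n)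
      \<oplus>\<^bsub>A\<^esub> E [^]\<^bsub>A\<^esub> Suc n \<otimes>\<^bsub>A\<^esub> kk (x ^ (2 * Suc n) * d) (inverse x ^ (2 * Suc n) * - d)"
    unfolding EF' by (simp add: l_distr m_assoc kk_E_pow del: nat_pow_Suc Group.nat_pow_Suc)
  also have "E \<otimes>\<^bsub>A\<^esub> E [^]\<^bsub>A\<^esub> Suc n = E [^]\<^bsub>A\<^esub> Suc (Suc n)"
    by (rule nat_pow_Suc2[symmetric]) simp
  also have "F \<otimes>\<^bsub>A\<^esub> E [^]\<^bsub>A\<^esub> Suc (Suc n)
      \<oplus>\<^bsub>A\<^esub> E [^]\<^bsub>A\<^esub> Suc n \<otimes>\<^bsub>A\<^esub> kk (x ^ (2 * Suc n) * d) (inverse x ^ (2 * Suc n) * - d)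
      \<oplus>\<^bsub>A\<^esub> ?Q \<odot>\<^bsub>A\<^esub> (E [^]\<^bsub>A\<^esub> Suc n \<otimes>\<^bsub>A\<^esub> kk (d * x ^ n) (- (d * inverse x ^ n)))
    = F \<otimes>\<^bsub>A\<^esub> E [^]\<^bsub>A\<^esub> Suc (Suc n) \<oplus>\<^bsub>A\<^esub> E [^]\<^bsub>A\<^esub> Suc n \<otimes>\<^bsub>A\<^esub>
       kk (x ^ (2 * Suc n) * d + ?Q * (d * x ^ n)) (inverse x ^ (2 * Suc n) * - d + ?Q * - (d * inverse x ^ n))"
    unfolding kk_add[symmetric] kk_smult[symmetric]
    by (simp add: r_distr a_assoc smult_mult_right del: nat_pow_Suc Group.nat_pow_Suc)
  also have "x ^ (2 * Suc n) * d + ?Q * (d * x ^ n) = ?Q' * (d * x ^ Suc n)"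
    using arg_cong[OF q1, of "\<lambda>y. d * y"] by (simp add: algebra_simps)
  also have "inverse x ^ (2 * Suc n) * - d + ?Q * - (d * inverse x ^ n) = ?Q' * - (d * inverse x ^ Suc n)"
    using arg_cong[OF q2, of "\<lambda>y. - d * y"] by (simp add: algebra_simps)
  finally show ?case
    unfolding kk_smult[symmetric] by (simp add: smult_mult_right del: nat_pow_Suc Group.nat_pow_Suc)
qed

text \<open>Mirror image of \<open>E_pow_F\<close>. The new F is peeled off on the right, and the
  torus part has to be moved across it, whence the exponent n + 2 in \<open>q1\<close> and
  \<open>q2\<close>.\<close>

lemma E_F_pow:
  "E \<otimes>\<^bsub>A\<^esub> F [^]\<^bsub>A\<^esub> Suc n = F [^]\<^bsub>A\<^esub> Suc n \<otimes>\<^bsub>A\<^esub> E \<oplus>\<^bsub>A\<^esub>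
     qnum x (int n + 1) \<odot>\<^bsub>A\<^esub> (F [^]\<^bsub>A\<^esub> n \<otimes>\<^bsub>A\<^esub> kk (d * inverse x ^ n) (- (d * x ^ n)))"
proof (induction n)
  case 0
  show ?case by (simp add: EF' sm)
next
  case (Suc n)
  let ?Q = "qnum x (int n + 1)" and ?Q' = "qnum x (int (Suc n) + 1)"
  have q1: "1 + ?Q * (inverse x) ^ (n + 2) = ?Q' * inverse x ^ Suc n"
  proof -
    have "?Q' = x ^ Suc n + inverse x * ?Q"
      using qnum_step[of "int n + 1" "int n + 1"] power_int_of_nat[of x "Suc n"]
      by (simp add: power_int_minus add.commute)
    then have "?Q' * inverse x ^ Suc n = x ^ Suc n * inverse x ^ Suc n + ?Q * (inverse x * inverse x ^ Suc n)"
      by (simp only: algebra_simps)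
    moreover have "x ^ Suc n * inverse x ^ Suc n = 1"
      unfolding power_mult_distrib[symmetric] using nz by simp
    ultimately show ?thesis by (simp only: power_Suc[symmetric]) simp
  qed
  have q2: "1 + ?Q * x ^ (n + 2) = ?Q' * x ^ Suc n"
  proof -
    have "?Q' = x * ?Q + inverse x ^ Suc n"
      using qnum_step[of "int n + 1" 1] power_int_minus[of x "int (Suc n)"] power_int_of_nat[of x "Suc n"]
      by (simp add: power_inverse add.commute)
    then have "?Q' * x ^ Suc n = x ^ Suc n * inverse x ^ Suc n + ?Q * (x * x ^ Suc n)"
      by (simp only: algebra_simps)
    moreover have "x ^ Suc n * inverse x ^ Suc n = 1"
      unfolding power_mult_distrib[symmetric] using nz by simp
    ultimately show ?thesis by (simp only: power_Suc[symmetric]) simp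
  qed
  have "E \<otimes>\<^bsub>A\<^esub> F [^]\<^bsub>A\<^esub> Suc (Suc n) = (E \<otimes>\<^bsub>A\<^esub> F [^]\<^bsub>A\<^esub> Suc n) \<otimes>\<^bsub>A\<^esub> F"
    by (simp add: m_assoc)
  also have "\<dots> = F [^]\<^bsub>A\<^esub> Suc n \<otimes>\<^bsub>A\<^esub> (E \<otimes>\<^bsub>A\<^esub> F) \<oplus>\<^bsub>A\<^esub>
     ?Q \<odot>\<^bsub>A\<^esub> (F [^]\<^bsub>A\<^esub> n \<otimes>\<^bsub>A\<^esub> (kk (d * inverse x ^ n) (- (d * x ^ n)) \<otimes>\<^bsub>A\<^esub> F))"
    unfolding Suc by (simp add: l_distr m_assoc smult_mult_left del: nat_pow_Suc Group.nat_pow_Suc)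
  also have "F [^]\<^bsub>A\<^esub> n \<otimes>\<^bsub>A\<^esub> (kk (d * inverse x ^ n) (- (d * x ^ n)) \<otimes>\<^bsub>A\<^esub> F)
     = F [^]\<^bsub>A\<^esub> Suc n \<otimes>\<^bsub>A\<^esub> kk (d * inverse x ^ (n + 2)) (- (d * x ^ (n + 2)))"
    unfolding kk_F by (simp add: m_assoc power2_eq_square mult_ac)
  also have "F [^]\<^bsub>A\<^esub> Suc n \<otimes>\<^bsub>A\<^esub> (E \<otimes>\<^bsub>A\<^esub> F) = F [^]\<^bsub>A\<^esub> Suc (Suc n) \<otimes>\<^bsub>A\<^esub> E \<oplus>\<^bsub>A\<^esub> F [^]\<^bsub>A\<^esub> Suc n \<otimes>\<^bsub>A\<^esub> kk d (- d)"
    unfolding EF' by (simp add: r_distr m_assoc)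
  also have "F [^]\<^bsub>A\<^esub> Suc (Suc n) \<otimes>\<^bsub>A\<^esub> E \<oplus>\<^bsub>A\<^esub> F [^]\<^bsub>A\<^esub> Suc n \<otimes>\<^bsub>A\<^esub> kk d (- d)
      \<oplus>\<^bsub>A\<^esub> ?Q \<odot>\<^bsub>A\<^esub> (F [^]\<^bsub>A\<^esub> Suc n \<otimes>\<^bsub>A\<^esub> kk (d * inverse x ^ (n + 2)) (- (d * x ^ (n + 2))))
    = F [^]\<^bsub>A\<^esub> Suc (Suc n) \<otimes>\<^bsub>A\<^esub> E \<oplus>\<^bsub>A\<^esub> F [^]\<^bsub>A\<^esub> Suc n \<otimes>\<^bsub>A\<^esub>
       kk (d + ?Q * (d * inverse x ^ (n + 2))) (- d + ?Q * - (d * x ^ (n + 2)))"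
    unfolding kk_add[symmetric] kk_smult[symmetric]
    by (simp add: r_distr a_assoc smult_mult_right del: nat_pow_Suc Group.nat_pow_Suc)
  also have "d + ?Q * (d * inverse x ^ (n + 2)) = ?Q' * (d * inverse x ^ Suc n)"
    using arg_cong[OF q1, of "\<lambda>y. d * y"] by (simp add: algebra_simps)
  also have "- d + ?Q * - (d * x ^ (n + 2)) = ?Q' * - (d * x ^ Suc n)"
    using arg_cong[OF q2, of "\<lambda>y. - d * y"] by (simp add: algebra_simps)
  finally show ?case
    unfolding kk_smult[symmetric] by (simp add: smult_mult_right del: nat_pow_Suc Group.nat_pow_Suc)
qed

lemma K_E_pow: "K \<otimes>\<^bsub>A\<^esub> E [^]\<^bsub>A\<^esub> (n::nat) = x ^ (2 * n) \<odot>\<^bsub>A\<^esub> (E [^]\<^bsub>A\<^esub> n \<otimes>\<^bsub>A\<^esub> K)"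
  using kk_E_pow[of 1 0 n] by (simp add: kk_def sm smult_mult_right)

lemma K_F_pow: "K \<otimes>\<^bsub>A\<^esub> F [^]\<^bsub>A\<^esub> (n::nat) = inverse x ^ (2 * n) \<odot>\<^bsub>A\<^esub> (F [^]\<^bsub>A\<^esub> n \<otimes>\<^bsub>A\<^esub> K)"
proof (induction n)
  case 0
  show ?case by (simp add: sm)
next
  case (Suc n)
  have "K \<otimes>\<^bsub>A\<^esub> F [^]\<^bsub>A\<^esub> Suc n = (K \<otimes>\<^bsub>A\<^esub> F [^]\<^bsub>A\<^esub> n) \<otimes>\<^bsub>A\<^esub> F" by (simp add: m_assoc)
  also have "\<dots> = inverse x ^ (2 * Suc n) \<odot>\<^bsub>A\<^esub> (F [^]\<^bsub>A\<^esub> Suc n \<otimes>\<^bsub>A\<^esub> K)"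
    unfolding Suc by (simp add: smult_mult_left smult_mult_right m_assoc KF sm power2_eq_square mult_ac)
  finally show ?case .
qed

lemma E_K_pow: "E \<otimes>\<^bsub>A\<^esub> K [^]\<^bsub>A\<^esub> (n::nat) = inverse x ^ (2 * n) \<odot>\<^bsub>A\<^esub> (K [^]\<^bsub>A\<^esub> n \<otimes>\<^bsub>A\<^esub> E)"
proof (induction n)
  case 0
  show ?case by (simp add: sm)
next
  case (Suc n)
  have EK: "E \<otimes>\<^bsub>A\<^esub> K = (inverse x)\<^sup>2 \<odot>\<^bsub>A\<^esub> (K \<otimes>\<^bsub>A\<^esub> E)"
    using nz by (simp add: KE sm power_mult_distrib[symmetric])
  have "E \<otimes>\<^bsub>A\<^esub> K [^]\<^bsub>A\<^esub> Suc n = (E \<otimes>\<^bsub>A\<^esub> K [^]\<^bsub>A\<^esub> n) \<otimes>\<^bsub>A\<^esub> K" by (simp add: m_assoc)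
  also have "\<dots> = inverse x ^ (2 * Suc n) \<odot>\<^bsub>A\<^esub> (K [^]\<^bsub>A\<^esub> Suc n \<otimes>\<^bsub>A\<^esub> E)"
    unfolding Suc by (simp add: smult_mult_left smult_mult_right m_assoc EK sm power2_eq_square mult_ac)
  finally show ?case .
qed

definition qmono :: "nat \<times> nat \<times> nat \<Rightarrow> 'a" where
  "qmono = (\<lambda>(i, j, k). F [^]\<^bsub>A\<^esub> i \<otimes>\<^bsub>A\<^esub> K [^]\<^bsub>A\<^esub> j \<otimes>\<^bsub>A\<^esub> E [^]\<^bsub>A\<^esub> k)"

lemma qmono_closed [simp]: "qmono m \<in> carrier A"
  by (cases m) (simp add: qmono_def)

text \<open>The span of these monomials contains 1 and is stable under left multiplication by E, F
  and K: exponents of K count modulo l, the powers of E and F vanish from l on, and K' is a power of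
  K.\<close>

lemma small_span:
  fixes l :: nat
  assumes l: "l > 0" and Kl: "K [^]\<^bsub>A\<^esub> l = \<one>\<^bsub>A\<^esub>" and El: "E [^]\<^bsub>A\<^esub> l = \<zero>\<^bsub>A\<^esub>" and Fl: "F [^]\<^bsub>A\<^esub> l = \<zero>\<^bsub>A\<^esub>"
    and y: "y \<in> subalg_gen base_field A {E, F, K}"
  shows "y \<in> lin_span (qmono ` ({..<l} \<times> {..<l} \<times> {..<l}))"
proof -
  let ?S = "lin_span (qmono ` ({..<l} \<times> {..<l} \<times> {..<l}))"
  have sub: "qmono ` ({..<l} \<times> {..<l} \<times> {..<l}) \<subseteq> carrier A" by auto
  have Kmod: "K [^]\<^bsub>A\<^esub> j = K [^]\<^bsub>A\<^esub> (j mod l)" for j :: nat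
  proof -
    have "K [^]\<^bsub>A\<^esub> (l * (j div l) + j mod l) = K [^]\<^bsub>A\<^esub> (j mod l)"
      using nat_pow_mult[OF K_closed, of "l * (j div l)" "j mod l"] nat_pow_pow[OF K_closed, of l "j div l"]
      by (metis K_closed Kl l_one nat_pow_closed nat_pow_one)
    then show ?thesis by simp
  qed
  have z: "y [^]\<^bsub>A\<^esub> i = \<zero>\<^bsub>A\<^esub>" if "y \<in> carrier A" "y [^]\<^bsub>A\<^esub> l = \<zero>\<^bsub>A\<^esub>" "l \<le> i" for y and i :: nat
  proof -
    show ?thesis using nat_pow_mult[of y l "i - l"] that by simp
  qed
  have mono: "F [^]\<^bsub>A\<^esub> i \<otimes>\<^bsub>A\<^esub> (K [^]\<^bsub>A\<^esub> j \<otimes>\<^bsub>A\<^esub> E [^]\<^bsub>A\<^esub> k) \<in> ?S" for i j k :: nat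
  proof (cases "i < l \<and> k < l")
    case True
    have "qmono (i, j mod l, k) \<in> ?S" using True l by (intro lin_span.incl imageI) auto
    then show ?thesis by (simp add: qmono_def Kmod[of j] m_assoc)
  next
    case False
    then have "F [^]\<^bsub>A\<^esub> i \<otimes>\<^bsub>A\<^esub> (K [^]\<^bsub>A\<^esub> j \<otimes>\<^bsub>A\<^esub> E [^]\<^bsub>A\<^esub> k) = \<zero>\<^bsub>A\<^esub>"
      using z[OF F_closed Fl, of i] z[OF E_closed El, of k] by (auto simp: not_less)
    then show ?thesis using lin_span.zero by simp
  qed
  have K'_eq: "K' = K [^]\<^bsub>A\<^esub> (l - 1)"
  proof -
    have "K [^]\<^bsub>A\<^esub> (l - 1) = K [^]\<^bsub>A\<^esub> (l - 1) \<otimes>\<^bsub>A\<^esub> (K \<otimes>\<^bsub>A\<^esub> K')" by (simp add: KK')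
    also have "\<dots> = K [^]\<^bsub>A\<^esub> Suc (l - 1) \<otimes>\<^bsub>A\<^esub> K'" by (simp add: m_assoc)
    also have "\<dots> = K'" using l Kl by (simp del: nat_pow_Suc Group.nat_pow_Suc)
    finally show ?thesis by simp
  qed
  have sm_S: "z \<in> ?S \<Longrightarrow> c \<odot>\<^bsub>A\<^esub> z \<in> ?S" for z c by (rule lin_span.smult) auto
  have F: "F \<otimes>\<^bsub>A\<^esub> qmono m \<in> ?S" for m
  proof -
    obtain i j k where m: "m = (i, j, k)" by (cases m)
    have "F \<otimes>\<^bsub>A\<^esub> qmono m = F [^]\<^bsub>A\<^esub> Suc i \<otimes>\<^bsub>A\<^esub> (K [^]\<^bsub>A\<^esub> j \<otimes>\<^bsub>A\<^esub> E [^]\<^bsub>A\<^esub> k)"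
      unfolding nat_pow_Suc2[OF F_closed] by (simp add: m qmono_def m_assoc)
    then show ?thesis using mono[of "Suc i" j k] by (simp del: nat_pow_Suc Group.nat_pow_Suc)
  qed
  have K: "K \<otimes>\<^bsub>A\<^esub> qmono m \<in> ?S" for m
  proof -
    obtain i j k where m: "m = (i, j, k)" by (cases m)
    have "K \<otimes>\<^bsub>A\<^esub> qmono m = (K \<otimes>\<^bsub>A\<^esub> F [^]\<^bsub>A\<^esub> i) \<otimes>\<^bsub>A\<^esub> (K [^]\<^bsub>A\<^esub> j \<otimes>\<^bsub>A\<^esub> E [^]\<^bsub>A\<^esub> k)"
      by (simp add: m qmono_def m_assoc)
    also have "\<dots> = inverse x ^ (2 * i) \<odot>\<^bsub>A\<^esub> (F [^]\<^bsub>A\<^esub> i \<otimes>\<^bsub>A\<^esub> (K [^]\<^bsub>A\<^esub> Suc j \<otimes>\<^bsub>A\<^esub> E [^]\<^bsub>A\<^esub> k))"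
      unfolding K_F_pow nat_pow_Suc2[OF K_closed] by (simp add: smult_mult_left m_assoc)
    finally show ?thesis using mono[of i "Suc j" k] sm_S by (simp del: nat_pow_Suc Group.nat_pow_Suc)
  qed
  have kkS: "F [^]\<^bsub>A\<^esub> i \<otimes>\<^bsub>A\<^esub> (kk a b \<otimes>\<^bsub>A\<^esub> (K [^]\<^bsub>A\<^esub> j \<otimes>\<^bsub>A\<^esub> E [^]\<^bsub>A\<^esub> k)) \<in> ?S" for i j k :: nat and a b
  proof -
    have "F [^]\<^bsub>A\<^esub> i \<otimes>\<^bsub>A\<^esub> (kk a b \<otimes>\<^bsub>A\<^esub> (K [^]\<^bsub>A\<^esub> j \<otimes>\<^bsub>A\<^esub> E [^]\<^bsub>A\<^esub> k))
      = a \<odot>\<^bsub>A\<^esub> (F [^]\<^bsub>A\<^esub> i \<otimes>\<^bsub>A\<^esub> (K [^]\<^bsub>A\<^esub> Suc j \<otimes>\<^bsub>A\<^esub> E [^]\<^bsub>A\<^esub> k))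
       \<oplus>\<^bsub>A\<^esub> b \<odot>\<^bsub>A\<^esub> (F [^]\<^bsub>A\<^esub> i \<otimes>\<^bsub>A\<^esub> (K [^]\<^bsub>A\<^esub> (l - 1 + j) \<otimes>\<^bsub>A\<^esub> E [^]\<^bsub>A\<^esub> k))"
      unfolding nat_pow_Suc2[OF K_closed] nat_pow_mult[OF K_closed, symmetric] K'_eq[symmetric] kk_def
      by (simp add: l_distr r_distr smult_mult_left smult_mult_right m_assoc)
    then show ?thesis using mono[of i "Suc j" k] mono[of i "l - 1 + j" k] sm_S lin_span.add by (simp del: One_nat_def)
  qed
  have E: "E \<otimes>\<^bsub>A\<^esub> qmono m \<in> ?S" for m
  proof -
    obtain i j k where m: "m = (i, j, k)" by (cases m)
    have EK: "F [^]\<^bsub>A\<^esub> i \<otimes>\<^bsub>A\<^esub> (E \<otimes>\<^bsub>A\<^esub> (K [^]\<^bsub>A\<^esub> j \<otimes>\<^bsub>A\<^esub> E [^]\<^bsub>A\<^esub> k)) \<in> ?S" for i j k :: nat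
    proof -
      have "F [^]\<^bsub>A\<^esub> i \<otimes>\<^bsub>A\<^esub> (E \<otimes>\<^bsub>A\<^esub> (K [^]\<^bsub>A\<^esub> j \<otimes>\<^bsub>A\<^esub> E [^]\<^bsub>A\<^esub> k))
        = F [^]\<^bsub>A\<^esub> i \<otimes>\<^bsub>A\<^esub> ((E \<otimes>\<^bsub>A\<^esub> K [^]\<^bsub>A\<^esub> j) \<otimes>\<^bsub>A\<^esub> E [^]\<^bsub>A\<^esub> k)"
        by (simp add: m_assoc)
      also have "\<dots> = inverse x ^ (2 * j) \<odot>\<^bsub>A\<^esub> (F [^]\<^bsub>A\<^esub> i \<otimes>\<^bsub>A\<^esub> (K [^]\<^bsub>A\<^esub> j \<otimes>\<^bsub>A\<^esub> E [^]\<^bsub>A\<^esub> Suc k))"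
        unfolding E_K_pow nat_pow_Suc2[OF E_closed] by (simp add: smult_mult_left smult_mult_right m_assoc)
      finally show ?thesis using mono[of i j "Suc k"] sm_S by (simp del: nat_pow_Suc Group.nat_pow_Suc)
    qed
    show ?thesis
    proof (cases i)
      case 0
      then show ?thesis using EK[of 0 j k] by (simp add: m qmono_def m_assoc)
    next
      case (Suc i')
      have "E \<otimes>\<^bsub>A\<^esub> qmono m = (E \<otimes>\<^bsub>A\<^esub> F [^]\<^bsub>A\<^esub> Suc i') \<otimes>\<^bsub>A\<^esub> (K [^]\<^bsub>A\<^esub> j \<otimes>\<^bsub>A\<^esub> E [^]\<^bsub>A\<^esub> k)"
        by (simp add: m Suc qmono_def m_assoc del: nat_pow_Suc Group.nat_pow_Suc)
      also have "\<dots> = F [^]\<^bsub>A\<^esub> Suc i' \<otimes>\<^bsub>A\<^esub> (E \<otimes>\<^bsub>A\<^esub> (K [^]\<^bsub>A\<^esub> j \<otimes>\<^bsub>A\<^esub> E [^]\<^bsub>A\<^esub> k)) \<oplus>\<^bsub>A\<^esub>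
        qnum x (int i' + 1) \<odot>\<^bsub>A\<^esub> (F [^]\<^bsub>A\<^esub> i' \<otimes>\<^bsub>A\<^esub> (kk (d * inverse x ^ i') (- (d * x ^ i')) \<otimes>\<^bsub>A\<^esub> (K [^]\<^bsub>A\<^esub> j \<otimes>\<^bsub>A\<^esub> E [^]\<^bsub>A\<^esub> k)))"
        unfolding E_F_pow by (simp add: l_distr m_assoc smult_mult_left del: nat_pow_Suc Group.nat_pow_Suc)
      finally show ?thesis using EK[of "Suc i'" j k] kkS sm_S lin_span.add by (simp del: nat_pow_Suc Group.nat_pow_Suc)
    qed
  qed
  have one: "\<one>\<^bsub>A\<^esub> \<in> ?S" using mono[of 0 0 0] by simp
  \<comment> \<open>The elements whose left multiplication preserves the span form a subalgebra;
    applying y to 1 then puts y into the span.\<close>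
  have "y \<in> carrier A \<and> (\<forall>s\<in>?S. y \<otimes>\<^bsub>A\<^esub> s \<in> ?S)"
    using y
  proof induction
    case one
    then show ?case using lin_span_closed[OF sub] by auto
  next
    case (incl y)
    have "y \<otimes>\<^bsub>A\<^esub> s \<in> ?S" if "s \<in> ?S" for s
      by (rule lin_span_mult_left[OF sub _ _ that]) (use incl E F K in auto)
    then show ?case using incl by auto
  next
    case (smult r y)
    then show ?case using lin_span_closed[OF sub] sm_S by (simp add: smult_mult_left)
  next
    case (add y z)
    then show ?case using lin_span_closed[OF sub] lin_span.add by (simp add: l_distr)
  next
    case (mult y z)
    then show ?case using lin_span_closed[OF sub] by (simp add: m_assoc)
  qed
  then show ?thesis using one by force
qed

end

section \<open>The generic quantum algebra\<close>

lemma assoc_algebra_Uq: "assoc_algebra base_field Uq"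
  unfolding Uq_def by (rule assoc_algebra_presented)

interpretation Uq: assoc_algebra base_field Uq by (rule assoc_algebra_Uq)

lemma Uq_gen_closed [simp, intro]: "Uq_gen x \<in> carrier Uq"
  by (simp add: Uq_def Uq_gen_def presented_class_simps)

lemma Uq_quantum: "quantum_sl2 Uq q (Uq_gen gE) (Uq_gen gF) (Uq_gen gK) (Uq_gen gKinv)"
proof -
  let ?c = "presented_class Uq_rels"
  have c: "?c p \<in> carrier Uq" "?c (p + p') = ?c p \<oplus>\<^bsub>Uq\<^esub> ?c p'" "?c (p * p') = ?c p \<otimes>\<^bsub>Uq\<^esub> ?c p'"
    "?c (p - p') = ?c p \<ominus>\<^bsub>Uq\<^esub> ?c p'" "?c 1 = \<one>\<^bsub>Uq\<^esub>" "?c (scal a * p) = a \<odot>\<^bsub>Uq\<^esub> ?c p" for p p' a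
    unfolding Uq_def by (rule presented_class_simps)+
  have rel: "?c p = ?c p'" if "p - p' \<in> Uq_rels" for p p'
    using presented_class_rel[OF that] c(1,4) by (metis Uq.r_right_minus_eq Uq_def)
  have m: "gen gK * gen gKinv - 1 \<in> Uq_rels" "gen gKinv * gen gK - 1 \<in> Uq_rels"
    "gen gK * gen gE * gen gKinv - scal (q ^ 2) * gen gE \<in> Uq_rels"
    "gen gK * gen gF * gen gKinv - scal (inverse q ^ 2) * gen gF \<in> Uq_rels"
    "gen gE * gen gF - gen gF * gen gE - scal (inverse (q - inverse q)) * (gen gK - gen gKinv) \<in> Uq_rels"
    by (simp_all add: Uq_rels_def)
  have 1: "Uq_gen gK \<otimes>\<^bsub>Uq\<^esub> Uq_gen gKinv = \<one>\<^bsub>Uq\<^esub>" "Uq_gen gKinv \<otimes>\<^bsub>Uq\<^esub> Uq_gen gK = \<one>\<^bsub>Uq\<^esub>"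
    using rel[OF m(1)] rel[OF m(2)] by (simp_all add: c Uq_gen_def)
  have 2: "Uq_gen gK \<otimes>\<^bsub>Uq\<^esub> Uq_gen g \<otimes>\<^bsub>Uq\<^esub> Uq_gen gKinv = a \<odot>\<^bsub>Uq\<^esub> Uq_gen g"
    if "(g, a) \<in> {(gE, q ^ 2), (gF, inverse q ^ 2)}" for g a
    using rel[OF m(3), unfolded c(6), unfolded c(3)] rel[OF m(4), unfolded c(6), unfolded c(3)] that
    by (auto simp: Uq_gen_def)
  have 3: "Uq_gen gK \<otimes>\<^bsub>Uq\<^esub> Uq_gen g = a \<odot>\<^bsub>Uq\<^esub> (Uq_gen g \<otimes>\<^bsub>Uq\<^esub> Uq_gen gK)"
    if "(g, a) \<in> {(gE, q ^ 2), (gF, inverse q ^ 2)}" for g a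
  proof -
    have "Uq_gen gK \<otimes>\<^bsub>Uq\<^esub> Uq_gen g = Uq_gen gK \<otimes>\<^bsub>Uq\<^esub> Uq_gen g \<otimes>\<^bsub>Uq\<^esub> (Uq_gen gKinv \<otimes>\<^bsub>Uq\<^esub> Uq_gen gK)"
      by (simp add: 1)
    also have "\<dots> = (Uq_gen gK \<otimes>\<^bsub>Uq\<^esub> Uq_gen g \<otimes>\<^bsub>Uq\<^esub> Uq_gen gKinv) \<otimes>\<^bsub>Uq\<^esub> Uq_gen gK"
      by (simp add: Uq.m_assoc)
    finally show ?thesis using 2[OF that] by (simp add: Uq.smult_mult_left)
  qed
  have 4: "Uq_gen gE \<otimes>\<^bsub>Uq\<^esub> Uq_gen gF \<ominus>\<^bsub>Uq\<^esub> Uq_gen gF \<otimes>\<^bsub>Uq\<^esub> Uq_gen gE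
    = inverse (q - inverse q) \<odot>\<^bsub>Uq\<^esub> (Uq_gen gK \<ominus>\<^bsub>Uq\<^esub> Uq_gen gKinv)"
    using rel[OF m(5)] by (simp only: Uq_gen_def c(4,6)) (simp only: c(3))
  have 5: "Uq_gen gE \<otimes>\<^bsub>Uq\<^esub> Uq_gen gF = Uq_gen gF \<otimes>\<^bsub>Uq\<^esub> Uq_gen gE \<oplus>\<^bsub>Uq\<^esub>
    inverse (q - inverse q) \<odot>\<^bsub>Uq\<^esub> (Uq_gen gK \<ominus>\<^bsub>Uq\<^esub> Uq_gen gKinv)"
    unfolding 4[symmetric] by (simp add: Uq.minus_eq Uq.a_comm Uq.a_lcomm Uq.r_neg1 Uq.r_neg Uq.r_neg2)
  show ?thesis
    by (intro quantum_sl2.intro quantum_sl2_axioms.intro assoc_algebra_Uq)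
      (use 1 3 5 q_nz q_power_neq_1[of 2] in \<open>auto simp: qnumber_def power2_eq_square\<close>)
qed

interpretation Uq: quantum_sl2 Uq q "Uq_gen gE" "Uq_gen gF" "Uq_gen gK" "Uq_gen gKinv"
  by (rule Uq_quantum)

section \<open>Lusztig's integral form and its specialization\<close>

lemma (in qnumber) qfalling_fact: "qfalling x (int (a + b)) a * qnum_fact x b = qnum_fact x (a + b)"
proof (induction a)
  case (Suc a)
  have "qfalling x (int (Suc a + b)) (Suc a) = qnum x (int (a + b) + 1) * qfalling x (int (a + b)) a"
    using qfalling_Suc'[of "int (a + b)" a] by (simp add: algebra_simps)
  then show ?case using Suc by (simp add: qnum_fact_Suc mult.assoc)
qed simp

lemma divpow_closed [simp, intro]: "divpow g n \<in> carrier Uq"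
  unfolding divpow_def using Uq.smult_closed[of "inverse (qfact n)"] by simp

lemma divpow_0: "divpow g 0 = \<one>\<^bsub>Uq\<^esub>"
  by (simp add: divpow_def qfact_def Uq.sm)

lemma divpow_1: "divpow g (Suc 0) = Uq_gen g"
  by (simp add: divpow_def qfact_qnum q.qnum_fact_Suc Uq.sm)

lemma divpow_mult: "divpow g a \<otimes>\<^bsub>Uq\<^esub> divpow g b = qbin q (int (a + b)) a \<odot>\<^bsub>Uq\<^esub> divpow g (a + b)"
proof -
  have "qfalling q (int (a + b)) a * qnum_fact q b = qnum_fact q (a + b)" by (rule q.qfalling_fact)
  then have "qbin q (int (a + b)) a * inverse (qnum_fact q (a + b)) = inverse (qnum_fact q a) * inverse (qnum_fact q b)"
    using qnum_fact_q_nz[of a] qnum_fact_q_nz[of b] qnum_fact_q_nz[of "a + b"] by (simp add: qbin_def field_simps)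
  then show ?thesis
    by (simp add: divpow_def qfact_qnum Uq.smult_mult_left Uq.smult_mult_right Uq.sm Uq.nat_pow_mult
        mult.commute[of "inverse (qnum_fact q b)"])
qed

lemma gen_divpow: "Uq_gen g \<otimes>\<^bsub>Uq\<^esub> divpow g n = qnum q (int n + 1) \<odot>\<^bsub>Uq\<^esub> divpow g (Suc n)"
  using divpow_mult[of g "Suc 0" n] by (simp add: divpow_1 q.qbin_1 add.commute)

lemma gen_divpow_commute: "divpow g n \<otimes>\<^bsub>Uq\<^esub> Uq_gen g = Uq_gen g \<otimes>\<^bsub>Uq\<^esub> divpow g n"
  using Uq.nat_pow_Suc2[of "Uq_gen g" n] by (simp add: divpow_def Uq.smult_mult_left Uq.smult_mult_right)

lemma K_divpow:
  "Uq_gen gK \<otimes>\<^bsub>Uq\<^esub> divpow gE n = q ^ (2 * n) \<odot>\<^bsub>Uq\<^esub> (divpow gE n \<otimes>\<^bsub>Uq\<^esub> Uq_gen gK)"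
  "Uq_gen gK \<otimes>\<^bsub>Uq\<^esub> divpow gF n = inverse q ^ (2 * n) \<odot>\<^bsub>Uq\<^esub> (divpow gF n \<otimes>\<^bsub>Uq\<^esub> Uq_gen gK)"
  by (simp_all add: divpow_def Uq.smult_mult_left Uq.smult_mult_right Uq.sm Uq.K_E_pow Uq.K_F_pow mult.commute)

text \<open>Lusztig's [K; n] = (q^n K - q^(-n) K') / (q - 1/q). The quotient form hides that this
  element lies in \<open>U_A\<close>; written through the commutator of E and F it visibly
  does.\<close>

definition Kbr :: "int \<Rightarrow> uq" where
  "Kbr n = q powi n \<odot>\<^bsub>Uq\<^esub> (Uq_gen gE \<otimes>\<^bsub>Uq\<^esub> Uq_gen gF \<ominus>\<^bsub>Uq\<^esub> Uq_gen gF \<otimes>\<^bsub>Uq\<^esub> Uq_gen gE) \<oplus>\<^bsub>Uq\<^esub> qnum q n \<odot>\<^bsub>Uq\<^esub> Uq_gen gKinv"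

lemma EF_comm: "Uq_gen gE \<otimes>\<^bsub>Uq\<^esub> Uq_gen gF \<ominus>\<^bsub>Uq\<^esub> Uq_gen gF \<otimes>\<^bsub>Uq\<^esub> Uq_gen gE = Uq.kk Uq.d (- Uq.d)"
  unfolding Uq.EF'
  by (simp add: Uq.minus_eq Uq.a_comm Uq.a_lcomm Uq.r_neg1 Uq.r_neg Uq.r_neg2)

lemma Kbr_kk: "Kbr n = Uq.kk (Uq.d * q powi n) (- (Uq.d * q powi (- n)))"
proof -
  have K: "qnum q n \<odot>\<^bsub>Uq\<^esub> Uq_gen gKinv = Uq.kk 0 (qnum q n)"
    by (simp add: Uq.kk_def Uq.sm)
  have "q powi n * - Uq.d + qnum q n = - (Uq.d * q powi (- n))"
    by (simp add: Uq.d_def qnum_def divide_inverse algebra_simps)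
  then show ?thesis
    unfolding Kbr_def EF_comm K Uq.kk_smult Uq.kk_add by (simp add: mult.commute)
qed

text \<open>Passing to divided powers cancels the quantum integer of \<open>E_pow_F\<close>, and
  only elements of the integral form are left.\<close>

lemma Ed_F: "divpow gE (Suc n) \<otimes>\<^bsub>Uq\<^esub> Uq_gen gF = Uq_gen gF \<otimes>\<^bsub>Uq\<^esub> divpow gE (Suc n) \<oplus>\<^bsub>Uq\<^esub> divpow gE n \<otimes>\<^bsub>Uq\<^esub> Kbr (int n)"
proof -
  have "inverse (qfact (Suc n)) * qnum q (int n + 1) = inverse (qfact n)"
    using qnum_q_nz[of "int n + 1"] by (simp add: qfact_qnum q.qnum_fact_Suc)
  moreover have "Kbr (int n) = Uq.kk (Uq.d * q ^ n) (- (Uq.d * inverse q ^ n))"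
    by (simp add: Kbr_kk power_int_minus power_inverse)
  ultimately show ?thesis
    using Uq.E_pow_F[of n] Uq.smult_r_distr[of "inverse (qfact (Suc n))"]
    by (simp add: divpow_def Uq.smult_mult_left Uq.smult_mult_right Uq.sm del: Uq.nat_pow_Suc Group.nat_pow_Suc)
qed

lemma E_Fd: "Uq_gen gE \<otimes>\<^bsub>Uq\<^esub> divpow gF (Suc n) = divpow gF (Suc n) \<otimes>\<^bsub>Uq\<^esub> Uq_gen gE \<oplus>\<^bsub>Uq\<^esub> divpow gF n \<otimes>\<^bsub>Uq\<^esub> Kbr (- int n)"
proof -
  have "inverse (qfact (Suc n)) * qnum q (int n + 1) = inverse (qfact n)"
    using qnum_q_nz[of "int n + 1"] by (simp add: qfact_qnum q.qnum_fact_Suc)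
  moreover have "Kbr (- int n) = Uq.kk (Uq.d * inverse q ^ n) (- (Uq.d * q ^ n))"
    by (simp add: Kbr_kk power_int_minus power_inverse)
  ultimately show ?thesis
    using Uq.E_F_pow[of n] Uq.smult_r_distr[of "inverse (qfact (Suc n))"]
    by (simp add: divpow_def Uq.smult_mult_left Uq.smult_mult_right Uq.sm del: Uq.nat_pow_Suc Group.nat_pow_Suc)
qed

abbreviation "UA \<equiv> carrier U_A"
abbreviation "UA_gens \<equiv> range (divpow gE) \<union> range (divpow gF) \<union> {Uq_gen gK, Uq_gen gKinv}"

lemma assoc_algebra_Uq_over_A: "assoc_algebra laurent_ring Uq_over_A"
  unfolding Uq_over_A_def
  by (rule Uq.restrict_scalars[OF cring_ring_of_type laurent_eval_hom[OF q_nz]]) simp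

interpretation UqA: assoc_algebra laurent_ring Uq_over_A by (rule assoc_algebra_Uq_over_A)

lemma Uq_over_A_simps [simp]:
  "carrier Uq_over_A = carrier Uq" "monoid.mult Uq_over_A = monoid.mult Uq" "one Uq_over_A = one Uq"
  "ring.zero Uq_over_A = ring.zero Uq" "add Uq_over_A = add Uq"
  "module.smult Uq_over_A p u = laurent_eval q p \<odot>\<^bsub>Uq\<^esub> u"
  by (simp_all add: Uq_over_A_def)

lemmas subalg_gen_minimal_Uq = UqA.subalg_gen_minimal

lemma UA_eq: "UA = subalg_gen laurent_ring Uq_over_A UA_gens"
  by (simp add: U_A_def)

lemma U_A_simps [simp]:
  "monoid.mult U_A = monoid.mult Uq" "one U_A = one Uq"
  "ring.zero U_A = ring.zero Uq" "add U_A = add Uq"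
  "module.smult U_A p u = laurent_eval q p \<odot>\<^bsub>Uq\<^esub> u"
  by (simp_all add: U_A_def)

lemma UA_subalg: "is_subalg laurent_ring Uq_over_A UA"
  unfolding UA_eq by (rule UqA.subalg_gen_is_subalg) auto

lemma assoc_algebra_UA: "assoc_algebra laurent_ring U_A"
proof -
  have "U_A = Uq_over_A\<lparr>carrier := UA\<rparr>" by (simp add: U_A_def)
  then show ?thesis using UqA.subalg_assoc_algebra[OF UA_subalg] by simp
qed

lemma UA_closed:
  "u \<in> UA \<Longrightarrow> u \<in> carrier Uq" "u \<in> UA \<Longrightarrow> v \<in> UA \<Longrightarrow> u \<oplus>\<^bsub>Uq\<^esub> v \<in> UA"
  "u \<in> UA \<Longrightarrow> v \<in> UA \<Longrightarrow> u \<otimes>\<^bsub>Uq\<^esub> v \<in> UA" "\<one>\<^bsub>Uq\<^esub> \<in> UA" "u \<in> UA \<Longrightarrow> laurent_eval q p \<odot>\<^bsub>Uq\<^esub> u \<in> UA"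
  using UA_subalg by (auto simp: is_subalg_def)

lemma UA_spec: "spec \<zeta> a c \<Longrightarrow> u \<in> UA \<Longrightarrow> a \<odot>\<^bsub>Uq\<^esub> u \<in> UA"
  by (auto simp: spec_def UA_closed)

lemma UA_minus: "u \<in> UA \<Longrightarrow> v \<in> UA \<Longrightarrow> u \<ominus>\<^bsub>Uq\<^esub> v \<in> UA"
proof -
  assume uv: "u \<in> UA" "v \<in> UA"
  have "laurent_eval q (- 1) = - 1" using laurent_eval_uminus[of q 1] by (simp add: laurent_eval_1)
  then have "u \<ominus>\<^bsub>Uq\<^esub> v = u \<oplus>\<^bsub>Uq\<^esub> laurent_eval q (- 1) \<odot>\<^bsub>Uq\<^esub> v"
    using UA_closed(1)[OF uv(2)] Uq.sm(5,6)[of v] by (simp add: Uq.minus_eq)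
  then show ?thesis using UA_closed(2)[OF uv(1) UA_closed(5)[OF uv(2)]] by metis
qed

lemma UA_divpow: "divpow gE n \<in> UA" "divpow gF n \<in> UA" "Uq_gen g \<in> UA"
proof -
  show 1: "divpow gE n \<in> UA" "divpow gF n \<in> UA" for n unfolding UA_eq by (auto intro: subalg_gen.incl)
  have "Uq_gen gK \<in> UA" "Uq_gen gKinv \<in> UA" unfolding UA_eq by (auto intro: subalg_gen.incl)
  then show "Uq_gen g \<in> UA" using 1[of "Suc 0"] by (cases g) (simp_all add: divpow_1)
qed

text \<open>Multiplication by central elements serves as a new scalar action. With c \<mapsto> 1
  \<otimes> c for \<iota> this is the scalar action in \<open>base_change\<close>.\<close>

lemma assoc_algebra_central:
  fixes A :: "('r, 'a) module" and \<iota> :: "'k::field \<Rightarrow> 'a"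
  assumes A: "assoc_algebra R A"
    and \<iota>: "\<And>c. \<iota> c \<in> carrier A" "\<And>c c'. \<iota> (c + c') = \<iota> c \<oplus>\<^bsub>A\<^esub> \<iota> c'" "\<And>c c'. \<iota> (c * c') = \<iota> c \<otimes>\<^bsub>A\<^esub> \<iota> c'"
      "\<iota> 1 = \<one>\<^bsub>A\<^esub>" "\<And>c u. u \<in> carrier A \<Longrightarrow> u \<otimes>\<^bsub>A\<^esub> \<iota> c = \<iota> c \<otimes>\<^bsub>A\<^esub> u"
  shows "assoc_algebra base_field (with_smult A (\<lambda>c u. \<iota> c \<otimes>\<^bsub>A\<^esub> u))"
proof -
  interpret A: assoc_algebra R A by (fact A)
  have ab: "abelian_group (with_smult A (\<lambda>c u. \<iota> c \<otimes>\<^bsub>A\<^esub> u))"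
    by (rule abelian_groupI) (auto simp: A.a_ac A.r_neg intro!: bexI[where x = "\<ominus>\<^bsub>A\<^esub> _"])
  have mon: "Group.monoid (with_smult A (\<lambda>c u. \<iota> c \<otimes>\<^bsub>A\<^esub> u))"
    by (rule monoidI) (auto simp: A.m_assoc)
  have lcomm: "u \<otimes>\<^bsub>A\<^esub> (\<iota> c \<otimes>\<^bsub>A\<^esub> v) = \<iota> c \<otimes>\<^bsub>A\<^esub> (u \<otimes>\<^bsub>A\<^esub> v)" if "u \<in> carrier A" "v \<in> carrier A" for c u v
    using that \<iota>(1)[of c] \<iota>(5)[of u c] by (simp add: A.m_assoc[symmetric])
  show ?thesis
    by (intro assoc_algebraI moduleI ringI ab mon cring_ring_of_type)
      (simp_all add: A.l_distr A.r_distr \<iota>(1-4) A.m_assoc, simp only: lcomm)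
qed

section \<open>The algebra at the root of unity and its generators\<close>

context root_of_unity
begin

lemma assoc_algebra_field_at: "assoc_algebra laurent_ring (field_at \<zeta>)"
proof -
  interpret B: assoc_algebra base_field "with_smult base_field (*) :: ('k, 'k) module" by (rule assoc_algebra_base)
  have "assoc_algebra laurent_ring (with_smult (with_smult base_field (*) :: ('k, 'k) module) (\<lambda>p c. laurent_eval \<zeta> p * c))"
    by (rule B.restrict_scalars[OF cring_ring_of_type laurent_eval_hom[OF zeta_nz]]) simp
  then show ?thesis by (simp add: field_at_def with_smult_def)
qed

lemma field_at_simps [simp]:
  "carrier (field_at \<zeta>) = UNIV" "monoid.mult (field_at \<zeta>) = (*)" "one (field_at \<zeta>) = 1"
  "ring.zero (field_at \<zeta>) = 0" "add (field_at \<zeta>) = (+)" "module.smult (field_at \<zeta>) p c = laurent_eval \<zeta> p * c"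
  by (simp_all add: field_at_def)

sublocale H: tensor_algebras laurent_ring U_A "field_at \<zeta>"
  by (intro tensor_algebras.intro assoc_algebra_UA assoc_algebra_field_at)

abbreviation "hat \<equiv> Uhat \<zeta>"
abbreviation "ho \<equiv> Uhat_of \<zeta>"

lemma Uhat_eq: "hat = with_smult H.T (\<lambda>c X'. H.t \<one>\<^bsub>Uq\<^esub> c \<otimes>\<^bsub>H.T\<^esub> X')"
  by (simp add: Uhat_def base_change_def)

lemma assoc_algebra_Uhat: "assoc_algebra base_field hat"
  unfolding Uhat_eq
proof (rule assoc_algebra_central[OF H.assoc_algebra_tensor])
  fix c c' :: 'k
  show "H.t \<one>\<^bsub>Uq\<^esub> (c + c') = H.t \<one>\<^bsub>Uq\<^esub> c \<oplus>\<^bsub>H.T\<^esub> H.t \<one>\<^bsub>Uq\<^esub> c'"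
    using H.tensor_add_right[of "\<one>\<^bsub>Uq\<^esub>" c c'] by (simp add: UA_closed)
  show "H.t \<one>\<^bsub>Uq\<^esub> (c * c') = H.t \<one>\<^bsub>Uq\<^esub> c \<otimes>\<^bsub>H.T\<^esub> H.t \<one>\<^bsub>Uq\<^esub> c'"
    by (simp add: H.tensor_mult UA_closed)
  fix u assume "u \<in> carrier H.T"
  then show "u \<otimes>\<^bsub>H.T\<^esub> H.t \<one>\<^bsub>Uq\<^esub> c = H.t \<one>\<^bsub>Uq\<^esub> c \<otimes>\<^bsub>H.T\<^esub> u"
    by (induction rule: H.tensor_induct)
      (simp_all add: H.tensor_mult UA_closed mult.commute)
qed (simp_all add: UA_closed H.one_tensor)

sublocale hat: assoc_algebra base_field hat by (rule assoc_algebra_Uhat)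

lemma hat_simps [simp]:
  "carrier hat = carrier H.T" "monoid.mult hat = monoid.mult H.T" "one hat = one H.T"
  "ring.zero hat = ring.zero H.T" "add hat = add H.T"
  by (simp_all add: Uhat_eq)

lemma hat_smult: "c \<odot>\<^bsub>hat\<^esub> X' = H.t \<one>\<^bsub>Uq\<^esub> c \<otimes>\<^bsub>H.T\<^esub> X'"
  by (simp add: Uhat_eq)

lemma ho_def: "ho u = H.t u 1"
  by (simp add: Uhat_of_def)

lemma ho_smult: "u \<in> UA \<Longrightarrow> c \<odot>\<^bsub>hat\<^esub> ho u = H.t u c"
  by (simp add: hat_smult ho_def H.tensor_mult UA_closed)

lemma ho_closed [simp]: "u \<in> UA \<Longrightarrow> ho u \<in> carrier H.T"
  by (simp add: ho_def)

lemma ho_add: "u \<in> UA \<Longrightarrow> v \<in> UA \<Longrightarrow> ho (u \<oplus>\<^bsub>Uq\<^esub> v) = ho u \<oplus>\<^bsub>hat\<^esub> ho v"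
  using H.tensor_add_left[of u v 1] by (simp add: ho_def)

lemma ho_mult: "u \<in> UA \<Longrightarrow> v \<in> UA \<Longrightarrow> ho (u \<otimes>\<^bsub>Uq\<^esub> v) = ho u \<otimes>\<^bsub>hat\<^esub> ho v"
  by (simp add: ho_def H.tensor_mult)

lemma ho_one: "ho \<one>\<^bsub>Uq\<^esub> = \<one>\<^bsub>hat\<^esub>"
  by (simp add: ho_def H.one_tensor)

lemma ho_spec: "spec \<zeta> a c \<Longrightarrow> u \<in> UA \<Longrightarrow> ho (a \<odot>\<^bsub>Uq\<^esub> u) = c \<odot>\<^bsub>hat\<^esub> ho u"
  using H.tensor_balanced[of _ u 1] by (auto simp: spec_def ho_smult) (auto simp: ho_def)

text \<open>u \<otimes> c is c times the image of u, so the scalar extension is spanned over the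
  field by the image of \<open>U_A\<close>.\<close>

lemma hat_induct [consumes 1, case_names of add smult]:
  assumes "Y \<in> carrier H.T" and "\<And>u. u \<in> UA \<Longrightarrow> P (ho u)"
    and add: "\<And>U V. \<lbrakk>U \<in> carrier H.T; V \<in> carrier H.T; P U; P V\<rbrakk> \<Longrightarrow> P (U \<oplus>\<^bsub>hat\<^esub> V)"
    and "\<And>c U. \<lbrakk>U \<in> carrier H.T; P U\<rbrakk> \<Longrightarrow> P (c \<odot>\<^bsub>hat\<^esub> U)"
  shows "P Y"
  using assms(1)
proof (induction rule: H.tensor_induct)
  case (tensor u c)
  then have "P (c \<odot>\<^bsub>hat\<^esub> ho u)" using assms(2,4) by simp
  then show ?case using tensor by (simp add: ho_smult)
qed (use add in simp)

lemma Uzeta_ideal: "ideal (Uzeta_ideal l \<zeta>) hat"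
proof -
  have "ho (Uq_gen gK) \<in> carrier hat" by (simp add: UA_divpow)
  then have "ho (Uq_gen gK) [^]\<^bsub>hat\<^esub> l \<ominus>\<^bsub>hat\<^esub> \<one>\<^bsub>hat\<^esub> \<in> carrier hat"
    by (intro hat.minus_closed hat.nat_pow_closed hat.one_closed)
  then show ?thesis unfolding Uzeta_ideal_def by (intro hat.genideal_ideal) auto
qed

abbreviation "Z \<equiv> Uzeta l \<zeta>"
abbreviation "zo \<equiv> Uzeta_of l \<zeta>"
abbreviation "\<pi> \<equiv> a_r_coset hat (Uzeta_ideal l \<zeta>)"

lemma assoc_algebra_Uzeta: "assoc_algebra base_field Z"
  unfolding Uzeta_def by (rule alg_quot(1)[OF assoc_algebra_Uhat Uzeta_ideal])

sublocale Z: assoc_algebra base_field Z by (rule assoc_algebra_Uzeta)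

sublocale \<pi>: alg_morphism base_field hat Z \<pi>
  by (intro alg_morphism.intro assoc_algebra_Uhat assoc_algebra_Uzeta alg_morphism_axioms.intro)
    (unfold Uzeta_def, rule alg_quot(2)[OF assoc_algebra_Uhat Uzeta_ideal])

lemma carrier_Z: "carrier Z = \<pi> ` carrier H.T"
  unfolding Uzeta_def using alg_quot(3)[OF assoc_algebra_Uhat Uzeta_ideal] by simp

lemma zo_\<pi>: "zo u = \<pi> (ho u)"
  by (simp add: Uzeta_of_def)

lemma zo_closed [simp, intro]: "u \<in> UA \<Longrightarrow> zo u \<in> carrier Z"
  by (simp add: zo_\<pi> carrier_Z)

lemma zo_add: "u \<in> UA \<Longrightarrow> v \<in> UA \<Longrightarrow> zo (u \<oplus>\<^bsub>Uq\<^esub> v) = zo u \<oplus>\<^bsub>Z\<^esub> zo v"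
  using \<pi>.add[of "ho u" "ho v"] by (simp add: zo_\<pi> ho_add)

lemma zo_mult: "u \<in> UA \<Longrightarrow> v \<in> UA \<Longrightarrow> zo (u \<otimes>\<^bsub>Uq\<^esub> v) = zo u \<otimes>\<^bsub>Z\<^esub> zo v"
  using \<pi>.mult[of "ho u" "ho v"] by (simp add: zo_\<pi> ho_mult)

lemma zo_one: "zo \<one>\<^bsub>Uq\<^esub> = \<one>\<^bsub>Z\<^esub>"
  using \<pi>.one by (simp add: zo_\<pi> ho_one)

lemma zo_spec: "spec \<zeta> a c \<Longrightarrow> u \<in> UA \<Longrightarrow> zo (a \<odot>\<^bsub>Uq\<^esub> u) = c \<odot>\<^bsub>Z\<^esub> zo u"
  using \<pi>.smult[of c "ho u"] by (simp add: zo_\<pi> ho_spec)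

lemma zo_minus: "u \<in> UA \<Longrightarrow> v \<in> UA \<Longrightarrow> zo (u \<ominus>\<^bsub>Uq\<^esub> v) = zo u \<ominus>\<^bsub>Z\<^esub> zo v"
proof -
  assume uv: "u \<in> UA" "v \<in> UA"
  then have "u = (u \<ominus>\<^bsub>Uq\<^esub> v) \<oplus>\<^bsub>Uq\<^esub> v"
    using UA_closed(1) by (simp add: Uq.minus_eq Uq.a_assoc Uq.l_neg)
  then have "zo u = zo (u \<ominus>\<^bsub>Uq\<^esub> v) \<oplus>\<^bsub>Z\<^esub> zo v"
    using zo_add[OF UA_minus[OF uv] uv(2)] by simp
  then show ?thesis
    using uv UA_minus[OF uv] by (simp add: Z.minus_eq Z.a_assoc Z.r_neg)
qed

text \<open>The elements of \<open>U_A\<close> that are sent into \<open>K\<close> form a subalgebra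
  over the Laurent polynomials with all of Lusztig's generators in it; so it is \<open>U_A\<close>,
  whose image spans \<open>Uzeta\<close>.\<close>

lemma Z_subalg_eq:
  assumes sub: "is_subalg base_field Z K" and gens: "zo ` UA_gens \<subseteq> K"
  shows "carrier Z \<subseteq> K"
proof
  have cl: "x \<oplus>\<^bsub>Z\<^esub> y \<in> K" "x \<otimes>\<^bsub>Z\<^esub> y \<in> K" "c \<odot>\<^bsub>Z\<^esub> x \<in> K" "\<one>\<^bsub>Z\<^esub> \<in> K" if "x \<in> K" "y \<in> K" for x y c
    using sub that by (auto simp: is_subalg_def)
  have one: "\<one>\<^bsub>Z\<^esub> \<in> K" using sub by (auto simp: is_subalg_def)
  have zoK: "zo u \<in> K" if "u \<in> UA" for u
  proof -
    have "is_subalg laurent_ring Uq_over_A {u \<in> UA. zo u \<in> K}"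
      unfolding is_subalg_def
    proof (intro conjI ballI)
      fix r x assume "x \<in> {u \<in> UA. zo u \<in> K}"
      moreover have "spec \<zeta> (laurent_eval q r) (laurent_eval \<zeta> r)" by (auto simp: spec_def)
      ultimately show "r \<odot>\<^bsub>Uq_over_A\<^esub> x \<in> {u \<in> UA. zo u \<in> K}"
        using cl(3)[of "zo x" "zo x"] by (simp add: UA_closed zo_spec)
    qed (use one cl in \<open>auto simp: UA_closed zo_one zo_add zo_mult\<close>)
    then have "subalg_gen laurent_ring Uq_over_A UA_gens \<subseteq> {u \<in> UA. zo u \<in> K}"
      by (rule UqA.subalg_gen_minimal) (use gens in \<open>auto simp: UA_divpow\<close>)
    then show ?thesis using that unfolding UA_eq by blast
  qed
  fix x assume "x \<in> carrier Z"
  then obtain Y where Y: "Y \<in> carrier H.T" "x = \<pi> Y" by (auto simp: carrier_Z)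
  have "\<pi> Y \<in> K" using Y(1)
  proof (induction rule: hat_induct)
    case (of u)
    then show ?case using zoK by (simp add: zo_\<pi>)
  next
    case (add U V)
    then show ?case using \<pi>.add[of U V] cl by simp
  next
    case (smult c U)
    then show ?case using \<pi>.smult[of c U] cl by simp
  qed
  then show "x \<in> K" using Y by simp
qed

abbreviation "zE \<equiv> zo (Uq_gen gE)"
abbreviation "zF \<equiv> zo (Uq_gen gF)"
abbreviation "zK \<equiv> zo (Uq_gen gK)"
abbreviation "zK' \<equiv> zo (Uq_gen gKinv)"

lemmas UA_simps = UA_closed UA_divpow UA_minus

lemma Z_quantum: "quantum_sl2 Z \<zeta> zE zF zK zK'"
proof (intro quantum_sl2.intro quantum_sl2_axioms.intro assoc_algebra_Uzeta Z.qnumber_axioms)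
  have s2: "spec \<zeta> (q\<^sup>2) (\<zeta>\<^sup>2)" using spec_powi[of \<zeta> 2] by simp
  have s2': "spec \<zeta> ((inverse q)\<^sup>2) ((inverse \<zeta>)\<^sup>2)"
    using spec_powi[of \<zeta> "-2"] by (simp add: power_int_minus power_inverse)
  have sd: "spec \<zeta> (q - inverse q) (\<zeta> - inverse \<zeta>)"
    using spec_diff[OF spec_powi[of \<zeta> 1] spec_powi[of \<zeta> "-1"]] by (simp add: power_int_minus)
  show "zK \<otimes>\<^bsub>Z\<^esub> zK' = \<one>\<^bsub>Z\<^esub>" "zK' \<otimes>\<^bsub>Z\<^esub> zK = \<one>\<^bsub>Z\<^esub>"
    by (simp_all add: zo_mult[symmetric] UA_simps Uq.KK' Uq.K'K zo_one)
  show "zK \<otimes>\<^bsub>Z\<^esub> zE = \<zeta>\<^sup>2 \<odot>\<^bsub>Z\<^esub> (zE \<otimes>\<^bsub>Z\<^esub> zK)"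
    by (simp add: zo_mult[symmetric] UA_simps Uq.KE zo_spec[OF s2])
  show "zK \<otimes>\<^bsub>Z\<^esub> zF = (inverse \<zeta>)\<^sup>2 \<odot>\<^bsub>Z\<^esub> (zF \<otimes>\<^bsub>Z\<^esub> zK)"
    by (simp add: zo_mult[symmetric] UA_simps Uq.KF zo_spec[OF s2'])
  \<comment> \<open>q - 1/q is not invertible in the Laurent polynomials. The relation is therefore
    specialized with the denominator cleared, and divided afterwards by \<zeta> - 1/\<zeta>, which
    is nonzero.\<close>
  have qd: "(q - inverse q) \<odot>\<^bsub>Uq\<^esub> (Uq_gen gE \<otimes>\<^bsub>Uq\<^esub> Uq_gen gF \<ominus>\<^bsub>Uq\<^esub> Uq_gen gF \<otimes>\<^bsub>Uq\<^esub> Uq_gen gE) = Uq_gen gK \<ominus>\<^bsub>Uq\<^esub> Uq_gen gKinv"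
    unfolding EF_comm Uq.kk_smult using q.denom by (simp add: Uq.d_def Uq.kk_def Uq.sm Uq.minus_eq)
  have "(\<zeta> - inverse \<zeta>) \<odot>\<^bsub>Z\<^esub> (zE \<otimes>\<^bsub>Z\<^esub> zF \<ominus>\<^bsub>Z\<^esub> zF \<otimes>\<^bsub>Z\<^esub> zE) = zK \<ominus>\<^bsub>Z\<^esub> zK'"
    using arg_cong[OF qd, of zo] by (simp add: zo_spec[OF sd] UA_simps zo_minus zo_mult)
  then have "inverse (\<zeta> - inverse \<zeta>) \<odot>\<^bsub>Z\<^esub> (zK \<ominus>\<^bsub>Z\<^esub> zK') = zE \<otimes>\<^bsub>Z\<^esub> zF \<ominus>\<^bsub>Z\<^esub> zF \<otimes>\<^bsub>Z\<^esub> zE"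
    using Z.denom by (simp add: field_smult[OF assoc_algebra_Uzeta] UA_simps flip: \<open>_ = zK \<ominus>\<^bsub>Z\<^esub> zK'\<close>)
  then show "zE \<otimes>\<^bsub>Z\<^esub> zF = zF \<otimes>\<^bsub>Z\<^esub> zE \<oplus>\<^bsub>Z\<^esub> inverse (\<zeta> - inverse \<zeta>) \<odot>\<^bsub>Z\<^esub> (zK \<ominus>\<^bsub>Z\<^esub> zK')"
    by (simp add: Z.minus_eq Z.a_lcomm[of _ "zE \<otimes>\<^bsub>Z\<^esub> zF"] Z.r_neg UA_simps)
qed (simp_all add: UA_simps)

sublocale Zq: quantum_sl2 Z \<zeta> zE zF zK zK'
  by (rule Z_quantum)

lemma zK_l: "zK [^]\<^bsub>Z\<^esub> l = \<one>\<^bsub>Z\<^esub>"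
proof -
  have K: "ho (Uq_gen gK) \<in> carrier hat" by (simp add: UA_divpow)
  then have "ho (Uq_gen gK) [^]\<^bsub>hat\<^esub> l \<in> carrier hat" by (rule hat.nat_pow_closed)
  moreover have "ho (Uq_gen gK) [^]\<^bsub>hat\<^esub> l \<ominus>\<^bsub>hat\<^esub> \<one>\<^bsub>hat\<^esub> \<in> Uzeta_ideal l \<zeta>"
    unfolding Uzeta_ideal_def
    using hat.genideal_self[of "{ho (Uq_gen gK) [^]\<^bsub>hat\<^esub> l \<ominus>\<^bsub>hat\<^esub> \<one>\<^bsub>hat\<^esub>}"] calculation hat.minus_closed[OF _ hat.one_closed]
    by blast
  ultimately have "\<pi> (ho (Uq_gen gK) [^]\<^bsub>hat\<^esub> l) = \<pi> \<one>\<^bsub>hat\<^esub>"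
    using hat.quotient_eq_iff_same_a_r_cos[OF Uzeta_ideal _ hat.one_closed] by blast
  then show ?thesis using \<pi>.pow[OF K, of l] \<pi>.one by (simp add: zo_\<pi>)
qed

lemma zo_gen_pow:
  assumes g: "g \<in> {gE, gF}"
  shows "zo (Uq_gen g) [^]\<^bsub>Z\<^esub> n = qnum_fact \<zeta> n \<odot>\<^bsub>Z\<^esub> zo (divpow g n)"
proof (induction n)
  case 0
  then show ?case by (simp add: divpow_0 zo_one Zq.sm)
next
  case (Suc n)
  have d: "divpow g n \<in> UA" for n using g UA_divpow by auto
  have "zo (Uq_gen g) [^]\<^bsub>Z\<^esub> Suc n = zo (Uq_gen g) \<otimes>\<^bsub>Z\<^esub> zo (Uq_gen g) [^]\<^bsub>Z\<^esub> n"
    by (rule Z.nat_pow_Suc2) (simp add: UA_divpow)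
  also have "\<dots> = qnum_fact \<zeta> n \<odot>\<^bsub>Z\<^esub> zo (Uq_gen g \<otimes>\<^bsub>Uq\<^esub> divpow g n)"
    using d by (simp add: Suc zo_mult UA_divpow Z.smult_mult_right)
  also have "zo (Uq_gen g \<otimes>\<^bsub>Uq\<^esub> divpow g n) = qnum \<zeta> (int n + 1) \<odot>\<^bsub>Z\<^esub> zo (divpow g (Suc n))"
    unfolding gen_divpow using d by (intro zo_spec spec_qnum)
  finally show ?case using d by (simp add: Zq.sm Z.qnum_fact_Suc mult.commute)
qed

text \<open>E^l = [l]! E^(l), and the factor [l] vanishes at \<zeta>; likewise for F.\<close>

lemma zo_gen_l:
  assumes g: "g \<in> {gE, gF}" shows "zo (Uq_gen g) [^]\<^bsub>Z\<^esub> l = \<zero>\<^bsub>Z\<^esub>"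
proof -
  have l1: "Suc (l - 1) = l" using l_gt_1 by simp
  have "qnum \<zeta> (int (l - 1) + 1) = 0" using l_gt_1 by (simp add: qnum_zeta_eq_0)
  then have "qnum_fact \<zeta> (Suc (l - 1)) = 0" by (simp only: Z.qnum_fact_Suc mult_zero_left)
  then have "qnum_fact \<zeta> l = 0" unfolding l1 .
  then show ?thesis using g UA_divpow by (auto simp: zo_gen_pow Zq.sm)
qed

abbreviation "small \<equiv> subalg_gen base_field Z {zE, zF, zK}"

lemma small_subalg: "is_subalg base_field Z small"
  by (rule Z.subalg_gen_is_subalg) (auto simp: UA_divpow)

lemma small_closed:
  "a \<in> small \<Longrightarrow> a \<in> carrier Z" "a \<in> small \<Longrightarrow> b \<in> small \<Longrightarrow> a \<oplus>\<^bsub>Z\<^esub> b \<in> small"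
  "a \<in> small \<Longrightarrow> b \<in> small \<Longrightarrow> a \<otimes>\<^bsub>Z\<^esub> b \<in> small" "a \<in> small \<Longrightarrow> c \<odot>\<^bsub>Z\<^esub> a \<in> small" "\<one>\<^bsub>Z\<^esub> \<in> small"
  "zE \<in> small" "zF \<in> small" "zK \<in> small" "\<zero>\<^bsub>Z\<^esub> \<in> small"
  using small_subalg Z.is_subalg_zero[OF small_subalg] by (auto simp: is_subalg_def intro: subalg_gen.incl)

lemmas small_minus = Z.is_subalg_minus[OF small_subalg] and small_a_inv = Z.is_subalg_a_inv[OF small_subalg]

lemma small_pow: "a \<in> small \<Longrightarrow> a [^]\<^bsub>Z\<^esub> (n::nat) \<in> small"
  by (induction n) (simp_all add: small_closed)

lemma zK'_small: "zK' \<in> small"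
proof -
  have "zK [^]\<^bsub>Z\<^esub> (l - 1) = zK [^]\<^bsub>Z\<^esub> (l - 1) \<otimes>\<^bsub>Z\<^esub> (zK \<otimes>\<^bsub>Z\<^esub> zK')" by (simp add: Zq.KK')
  also have "\<dots> = zK [^]\<^bsub>Z\<^esub> Suc (l - 1) \<otimes>\<^bsub>Z\<^esub> zK'" by (simp add: Z.m_assoc)
  also have "\<dots> = zK'" using l_gt_1 zK_l by (simp del: Z.nat_pow_Suc Group.nat_pow_Suc)
  finally show ?thesis using small_pow[OF small_closed(8), of "l - 1"] by simp
qed

lemma small_divpow:
  assumes g: "g \<in> {gE, gF}" and n: "n < l" shows "zo (divpow g n) \<in> small"
proof -
  have d: "divpow g n \<in> UA" using g UA_divpow by auto
  have "zo (divpow g n) = inverse (qnum_fact \<zeta> n) \<odot>\<^bsub>Z\<^esub> (zo (Uq_gen g) [^]\<^bsub>Z\<^esub> n)"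
    using qnum_fact_zeta_nz[OF n] d by (simp add: zo_gen_pow[OF g] Zq.sm)
  then show ?thesis using g small_pow[of "zo (Uq_gen g)" n] small_closed by auto
qed

lemma zo_Kbr: "Kbr n \<in> UA" "zo (Kbr n) \<in> small"
proof -
  have eq: "zo (Kbr n) = \<zeta> powi n \<odot>\<^bsub>Z\<^esub> (zE \<otimes>\<^bsub>Z\<^esub> zF \<ominus>\<^bsub>Z\<^esub> zF \<otimes>\<^bsub>Z\<^esub> zE) \<oplus>\<^bsub>Z\<^esub> qnum \<zeta> n \<odot>\<^bsub>Z\<^esub> zK'"
    unfolding Kbr_def
    by (simp add: zo_add zo_mult zo_minus UA_simps UA_spec[OF spec_powi[of \<zeta>]] UA_spec[OF spec_qnum]
        zo_spec[OF spec_powi] zo_spec[OF spec_qnum])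
  show "Kbr n \<in> UA"
    unfolding Kbr_def by (simp add: UA_simps UA_spec[OF spec_powi[of \<zeta>]] UA_spec[OF spec_qnum])
  show "zo (Kbr n) \<in> small"
    unfolding eq by (intro small_closed small_minus zK'_small)
qed

text \<open>E^(l) commutes with E, and with K because the commutation factor is \<zeta>^(2l) = 1.
  Its commutator with F is E^(l-1) [K; l-1], where E^(l-1) is a power of E divided by the nonzero
  [l-1]!. The commutator with a fixed element is a derivation, so the generators suffice.\<close>

lemma divpow_l_comm:
  assumes g: "g \<in> {gE, gF}" and a: "a \<in> small"
  shows "zo (divpow g l) \<otimes>\<^bsub>Z\<^esub> a \<ominus>\<^bsub>Z\<^esub> a \<otimes>\<^bsub>Z\<^esub> zo (divpow g l) \<in> small"
proof -
  define D where "D = zo (divpow g l)"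
  have d: "divpow g n \<in> UA" for n using g UA_divpow by auto
  have D: "D \<in> carrier Z" unfolding D_def using d by simp
  have l1: "Suc (l - 1) = l" using l_gt_1 by simp
  have com: "D \<otimes>\<^bsub>Z\<^esub> b \<ominus>\<^bsub>Z\<^esub> b \<otimes>\<^bsub>Z\<^esub> D \<in> small" if "D \<otimes>\<^bsub>Z\<^esub> b = b \<otimes>\<^bsub>Z\<^esub> D \<oplus>\<^bsub>Z\<^esub> s" "b \<in> carrier Z" "s \<in> small" for b s
    using that D small_closed(1)[of s] by (simp add: Z.minus_eq Z.a_comm[of _ s] Z.a_assoc Z.r_neg)
  \<comment> \<open>\<open>Ed_F\<close> and \<open>E_Fd\<close> have E on the left in both cases, so
    for F^(l) in the role of \<open>D\<close> the correction term stands on the other side and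
    enters with a sign.\<close>
  have com': "D \<otimes>\<^bsub>Z\<^esub> b \<ominus>\<^bsub>Z\<^esub> b \<otimes>\<^bsub>Z\<^esub> D \<in> small" if "b \<otimes>\<^bsub>Z\<^esub> D = D \<otimes>\<^bsub>Z\<^esub> b \<oplus>\<^bsub>Z\<^esub> s" "b \<in> carrier Z" "s \<in> small" for b s
  proof -
    have "D \<otimes>\<^bsub>Z\<^esub> b \<ominus>\<^bsub>Z\<^esub> b \<otimes>\<^bsub>Z\<^esub> D = \<ominus>\<^bsub>Z\<^esub> s"
      using that D small_closed(1)[of s] by (simp add: Z.minus_eq Z.minus_add Z.r_neg1 Z.a_assoc[symmetric] Z.r_neg)
    then show ?thesis using that small_a_inv by simp
  qed
  have same: "D \<otimes>\<^bsub>Z\<^esub> zo (Uq_gen g) \<ominus>\<^bsub>Z\<^esub> zo (Uq_gen g) \<otimes>\<^bsub>Z\<^esub> D \<in> small"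
    using arg_cong[OF gen_divpow_commute[of g l], of zo] small_closed
    by (intro com[of _ "\<zero>\<^bsub>Z\<^esub>"]) (simp_all add: zo_mult UA_divpow d D_def)
  have K: "D \<otimes>\<^bsub>Z\<^esub> zK \<ominus>\<^bsub>Z\<^esub> zK \<otimes>\<^bsub>Z\<^esub> D \<in> small"
  proof (rule com'[of _ "\<zero>\<^bsub>Z\<^esub>"])
    have s: "spec \<zeta> (q ^ (2 * l)) 1" "spec \<zeta> (inverse q ^ (2 * l)) 1"
      using spec_powi[of \<zeta> "int (2 * l)"] spec_powi[of \<zeta> "- int (2 * l)"] zeta_power_eq_1[of "2 * l"]
      by (simp_all only: power_int_minus power_int_of_nat power_inverse dvd_triv_right inverse_1 simp_thms)
    have "zo (Uq_gen gK \<otimes>\<^bsub>Uq\<^esub> divpow g l) = 1 \<odot>\<^bsub>Z\<^esub> zo (divpow g l \<otimes>\<^bsub>Uq\<^esub> Uq_gen gK)"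
      using g zo_spec[OF s(1), of "divpow gE l \<otimes>\<^bsub>Uq\<^esub> Uq_gen gK"] zo_spec[OF s(2), of "divpow gF l \<otimes>\<^bsub>Uq\<^esub> Uq_gen gK"]
      by (auto simp: K_divpow UA_simps)
    then show "zK \<otimes>\<^bsub>Z\<^esub> D = D \<otimes>\<^bsub>Z\<^esub> zK \<oplus>\<^bsub>Z\<^esub> \<zero>\<^bsub>Z\<^esub>"
      using D by (simp add: zo_mult UA_divpow d D_def[symmetric] Zq.sm)
  qed (simp_all add: small_closed)
  have other: "D \<otimes>\<^bsub>Z\<^esub> zo (Uq_gen g') \<ominus>\<^bsub>Z\<^esub> zo (Uq_gen g') \<otimes>\<^bsub>Z\<^esub> D \<in> small" if g': "g' \<in> {gE, gF}" "g' \<noteq> g" for g'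
  proof (cases "g = gE")
    case True
    then have "g' = gF" using g' by auto
    have "zo (divpow gE l \<otimes>\<^bsub>Uq\<^esub> Uq_gen gF) = zo (Uq_gen gF \<otimes>\<^bsub>Uq\<^esub> divpow gE l \<oplus>\<^bsub>Uq\<^esub> divpow gE (l - 1) \<otimes>\<^bsub>Uq\<^esub> Kbr (int (l - 1)))"
      using Ed_F[of "l - 1"] unfolding l1 by simp
    then have "D \<otimes>\<^bsub>Z\<^esub> zF = zF \<otimes>\<^bsub>Z\<^esub> D \<oplus>\<^bsub>Z\<^esub> zo (divpow gE (l - 1)) \<otimes>\<^bsub>Z\<^esub> zo (Kbr (int (l - 1)))"
      by (simp add: zo_add zo_mult UA_simps zo_Kbr D_def True)
    moreover have "zo (divpow gE (l - 1)) \<otimes>\<^bsub>Z\<^esub> zo (Kbr (int (l - 1))) \<in> small"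
      using small_divpow[of gE "l - 1"] l_gt_1 by (simp add: small_closed zo_Kbr)
    ultimately show ?thesis
      unfolding \<open>g' = gF\<close> using UA_divpow by (intro com) auto
  next
    case False
    then have gg: "g = gF" "g' = gE" using g g' by auto
    have "zo (Uq_gen gE \<otimes>\<^bsub>Uq\<^esub> divpow gF l) = zo (divpow gF l \<otimes>\<^bsub>Uq\<^esub> Uq_gen gE \<oplus>\<^bsub>Uq\<^esub> divpow gF (l - 1) \<otimes>\<^bsub>Uq\<^esub> Kbr (- int (l - 1)))"
      using E_Fd[of "l - 1"] unfolding l1 by simp
    then have "zE \<otimes>\<^bsub>Z\<^esub> D = D \<otimes>\<^bsub>Z\<^esub> zE \<oplus>\<^bsub>Z\<^esub> zo (divpow gF (l - 1)) \<otimes>\<^bsub>Z\<^esub> zo (Kbr (- int (l - 1)))"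
      by (simp add: zo_add zo_mult UA_simps zo_Kbr D_def gg)
    moreover have "zo (divpow gF (l - 1)) \<otimes>\<^bsub>Z\<^esub> zo (Kbr (- int (l - 1))) \<in> small"
      using small_divpow[of gF "l - 1"] l_gt_1 by (simp add: small_closed zo_Kbr)
    ultimately show ?thesis
      unfolding gg(2) using UA_divpow by (intro com') auto
  qed
  have "D \<otimes>\<^bsub>Z\<^esub> a \<ominus>\<^bsub>Z\<^esub> a \<otimes>\<^bsub>Z\<^esub> D \<in> small" using a
  proof induction
    case one
    show ?case using D small_closed(9) by (simp add: Z.minus_eq Z.r_neg)
  next
    case (incl x)
    then show ?case using K same other[of gE] other[of gF] g by auto
  next
    case (smult c x)
    have "D \<otimes>\<^bsub>Z\<^esub> (c \<odot>\<^bsub>Z\<^esub> x) \<ominus>\<^bsub>Z\<^esub> (c \<odot>\<^bsub>Z\<^esub> x) \<otimes>\<^bsub>Z\<^esub> D = c \<odot>\<^bsub>Z\<^esub> (D \<otimes>\<^bsub>Z\<^esub> x \<ominus>\<^bsub>Z\<^esub> x \<otimes>\<^bsub>Z\<^esub> D)"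
      using D small_closed(1)[OF smult(2)]
      by (simp add: Z.smult_mult_left Z.smult_mult_right Z.minus_eq Z.smult_r_distr Z.smult_r_minus)
    then show ?case using smult small_closed by simp
  next
    case (add x y)
    have "D \<otimes>\<^bsub>Z\<^esub> (x \<oplus>\<^bsub>Z\<^esub> y) \<ominus>\<^bsub>Z\<^esub> (x \<oplus>\<^bsub>Z\<^esub> y) \<otimes>\<^bsub>Z\<^esub> D = (D \<otimes>\<^bsub>Z\<^esub> x \<ominus>\<^bsub>Z\<^esub> x \<otimes>\<^bsub>Z\<^esub> D) \<oplus>\<^bsub>Z\<^esub> (D \<otimes>\<^bsub>Z\<^esub> y \<ominus>\<^bsub>Z\<^esub> y \<otimes>\<^bsub>Z\<^esub> D)"
      using D small_closed(1)[OF add(1)] small_closed(1)[OF add(2)]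
      by (simp add: Z.l_distr Z.r_distr Z.minus_eq Z.minus_add Z.a_ac)
    then show ?case using add small_closed by simp
  next
    case (mult x y)
    have x: "x \<in> carrier Z" and y: "y \<in> carrier Z" using mult small_closed by auto
    have "u \<oplus>\<^bsub>Z\<^esub> \<ominus>\<^bsub>Z\<^esub> v \<oplus>\<^bsub>Z\<^esub> (v \<oplus>\<^bsub>Z\<^esub> \<ominus>\<^bsub>Z\<^esub> w) = u \<oplus>\<^bsub>Z\<^esub> \<ominus>\<^bsub>Z\<^esub> w" if "u \<in> carrier Z" "v \<in> carrier Z" "w \<in> carrier Z" for u v w
      using that by (simp add: Z.a_assoc Z.r_neg1)
    then have "D \<otimes>\<^bsub>Z\<^esub> (x \<otimes>\<^bsub>Z\<^esub> y) \<ominus>\<^bsub>Z\<^esub> x \<otimes>\<^bsub>Z\<^esub> y \<otimes>\<^bsub>Z\<^esub> D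
      = (D \<otimes>\<^bsub>Z\<^esub> x \<ominus>\<^bsub>Z\<^esub> x \<otimes>\<^bsub>Z\<^esub> D) \<otimes>\<^bsub>Z\<^esub> y \<oplus>\<^bsub>Z\<^esub> x \<otimes>\<^bsub>Z\<^esub> (D \<otimes>\<^bsub>Z\<^esub> y \<ominus>\<^bsub>Z\<^esub> y \<otimes>\<^bsub>Z\<^esub> D)"
      using x y D by (simp add: Z.minus_eq Z.l_distr Z.r_distr Z.l_minus Z.r_minus Z.m_assoc)
    then show ?case using mult small_closed by simp
  qed
  then show ?thesis by (simp add: D_def)
qed

text \<open>E^(a) E^(b) is E^(a+b) times a Gaussian binomial, by which one divides when it is
  nonzero at \<zeta>. Below l take a = 1, with binomial [n]; above l take a = l, with the floor of n
  / l, nonzero in characteristic 0.\<close>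

lemma divpow_from_l:
  assumes sub: "is_subalg base_field Z K" and g: "g \<in> {gE, gF}"
    and 1: "zo (Uq_gen g) \<in> K" and l: "zo (divpow g l) \<in> K"
  shows "zo (divpow g n) \<in> K"
proof (induction n rule: less_induct)
  case (less n)
  have d: "divpow g n \<in> UA" for n using g UA_divpow by auto
  have K: "x \<in> K \<Longrightarrow> y \<in> K \<Longrightarrow> x \<otimes>\<^bsub>Z\<^esub> y \<in> K" "x \<in> K \<Longrightarrow> c \<odot>\<^bsub>Z\<^esub> x \<in> K" "\<one>\<^bsub>Z\<^esub> \<in> K" for x y c
    using sub by (auto simp: is_subalg_def)
  have step: "zo (divpow g (a + b)) \<in> K" if "zo (divpow g a) \<in> K" "zo (divpow g b) \<in> K" "zbin (int (a + b)) a \<noteq> 0" for a b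
  proof -
    have "zo (divpow g a \<otimes>\<^bsub>Uq\<^esub> divpow g b) = zbin (int (a + b)) a \<odot>\<^bsub>Z\<^esub> zo (divpow g (a + b))"
      unfolding divpow_mult by (rule zo_spec[OF spec_zbin d])
    then have "zo (divpow g (a + b)) = inverse (zbin (int (a + b)) a) \<odot>\<^bsub>Z\<^esub> (zo (divpow g a) \<otimes>\<^bsub>Z\<^esub> zo (divpow g b))"
      using d that(3) by (simp add: zo_mult Zq.sm)
    then show ?thesis using K that by simp
  qed
  consider "n = 0" | "n = l" | "0 < n" "n < l" | "l < n" by linarith
  then show ?case
  proof cases
    case 1
    then show ?thesis using K by (simp add: divpow_0 zo_one)
  next
    case 2
    then show ?thesis using l by simp
  next
    case 3
    have "zbin (int (Suc 0 + (n - 1))) (Suc 0) = qnum \<zeta> (int n)"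
      using 3 l_gt_1 by (simp add: zbin_small Z.qbin_1)
    then have "zbin (int (Suc 0 + (n - 1))) (Suc 0) \<noteq> 0" using qnum_zeta_nz[of "int n"] 3 by simp
    then have "zo (divpow g (Suc 0 + (n - 1))) \<in> K"
      using less[of "n - 1"] 3 1 by (intro step) (simp_all add: divpow_1)
    then show ?thesis using 3 by simp
  next
    case 4
    have "int n div int l > 0" using 4 l_gt_1 by (simp add: zdiv_int[symmetric] div_greater_zero_iff)
    then have "zbin (int (l + (n - l))) l \<noteq> 0"
      using 4 l_gt_1 by (simp add: zbin_l)
    then have "zo (divpow g (l + (n - l))) \<in> K"
      using less[of "n - l"] 4 l l_gt_1 by (intro step) simp_all
    then show ?thesis using 4 by simp
  qed
qed

lemma Z_generated:
  assumes sub: "is_subalg base_field Z K" and small: "small \<subseteq> K"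
    and l: "zo (divpow gE l) \<in> K" "zo (divpow gF l) \<in> K"
  shows "carrier Z \<subseteq> K"
proof (rule Z_subalg_eq[OF sub])
  show "zo ` UA_gens \<subseteq> K"
    using divpow_from_l[OF sub, of gE] divpow_from_l[OF sub, of gF] l small small_closed(6-8) zK'_small by auto
qed

lemma small_uzeta_eq: "small_uzeta l \<zeta> = Z\<lparr>carrier := small\<rparr>"
  by (simp add: small_uzeta_def)

end

section \<open>Algebras of operators on function spaces\<close>

text \<open>Operators on all functions, without restriction on the support, because the vectors of
  all weights m are treated as one family.\<close>

definition end_alg :: "('k::field, ('i \<Rightarrow> 'k) \<Rightarrow> 'i \<Rightarrow> 'k) module" where
  "end_alg = \<lparr>carrier = {T. (\<forall>g h. T (\<lambda>x. g x + h x) = (\<lambda>x. T g x + T h x)) \<and> (\<forall>c g. T (\<lambda>x. c * g x) = (\<lambda>x. c * T g x))},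
     monoid.mult = (\<lambda>S T g. S (T g)), one = (\<lambda>g. g), ring.zero = (\<lambda>g x. 0),
     add = (\<lambda>S T g x. S g x + T g x), module.smult = (\<lambda>c T g x. c * T g x)\<rparr>"

lemma end_alg_simps [simp]:
  "monoid.mult end_alg = (\<lambda>S T g. S (T g))" "one end_alg = (\<lambda>g. g)" "ring.zero end_alg = (\<lambda>g x. 0)"
  "add end_alg = (\<lambda>S T g x. S g x + T g x)" "module.smult end_alg = (\<lambda>c T g x. c * T g x)"
  by (simp_all add: end_alg_def)

lemma end_algI:
  "(\<And>g h. T (\<lambda>x. g x + h x) = (\<lambda>x. T g x + T h x)) \<Longrightarrow> (\<And>c g. T (\<lambda>x. c * g x) = (\<lambda>x. c * T g x)) \<Longrightarrow>
    T \<in> carrier end_alg"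
  by (simp add: end_alg_def)

lemma end_algD:
  "T \<in> carrier end_alg \<Longrightarrow> T (\<lambda>x. g x + h x) = (\<lambda>x. T g x + T h x)"
  "T \<in> carrier end_alg \<Longrightarrow> T (\<lambda>x. c * g x) = (\<lambda>x. c * T g x)"
  by (simp_all add: end_alg_def)

lemma assoc_algebra_end_alg: "assoc_algebra base_field (end_alg :: ('k::field, ('i \<Rightarrow> 'k) \<Rightarrow> 'i \<Rightarrow> 'k) module)"
proof -
  have ab: "abelian_group (end_alg :: ('k::field, ('i \<Rightarrow> 'k) \<Rightarrow> 'i \<Rightarrow> 'k) module)"
  proof (rule abelian_groupI)
    fix T :: "('i \<Rightarrow> 'k) \<Rightarrow> 'i \<Rightarrow> 'k" assume "T \<in> carrier end_alg"
    then have "(\<lambda>g x. - T g x) \<in> carrier end_alg"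
      by (intro end_algI) (simp_all add: end_algD)
    then show "\<exists>S\<in>carrier end_alg. S \<oplus>\<^bsub>end_alg\<^esub> T = \<zero>\<^bsub>end_alg\<^esub>"
      by (rule bexI[rotated]) simp
  qed (auto intro!: end_algI simp: end_algD algebra_simps)
  have mon: "Group.monoid (end_alg :: ('k::field, ('i \<Rightarrow> 'k) \<Rightarrow> 'i \<Rightarrow> 'k) module)"
    by (rule monoidI) (auto intro!: end_algI simp: end_algD)
  show ?thesis
    by (intro assoc_algebraI moduleI ringI ab mon cring_ring_of_type)
      (auto intro!: end_algI simp: end_algD algebra_simps)
qed

definition fun_space :: "('k::field, 'i \<Rightarrow> 'k) module" where
  "fun_space = \<lparr>carrier = UNIV, monoid.mult = (\<lambda>f g x. f x * g x), one = (\<lambda>x. 1), ring.zero = (\<lambda>x. 0),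
     add = (\<lambda>f g x. f x + g x), module.smult = (\<lambda>c g x. c * g x)\<rparr>"

lemma fun_space_simps [simp]:
  "carrier fun_space = UNIV" "ring.zero fun_space = (\<lambda>x. 0)"
  "add fun_space = (\<lambda>f g x. f x + g x)" "module.smult fun_space = (\<lambda>c g x. c * g x)"
  by (simp_all add: fun_space_def)

lemma module_fun_space: "module base_field (fun_space :: ('k::field, 'i \<Rightarrow> 'k) module)"
proof -
  have "abelian_group (fun_space :: ('k::field, 'i \<Rightarrow> 'k) module)"
  proof (rule abelian_groupI)
    show "\<exists>g\<in>carrier fun_space. g \<oplus>\<^bsub>fun_space\<^esub> f = \<zero>\<^bsub>fun_space\<^esub>" for f :: "'i \<Rightarrow> 'k"
      by (rule bexI[of _ "\<lambda>x. - f x"]) simp_all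
  qed (auto simp: algebra_simps)
  then show ?thesis
    by (intro moduleI cring_ring_of_type) (auto simp: algebra_simps)
qed

section \<open>The modules induced from the torus\<close>

text \<open>
  A function \<open>g\<close> stands for the family, indexed by the weight \<open>m\<close>, of the vectors
  \<open>\<Sum> g (m, i, j) F\<^sup>(\<^sup>i\<^sup>) E\<^sup>(\<^sup>j\<^sup>) 1\<^sub>m\<close> of the modules \<open>U 1\<^sub>m\<close> induced from the characters \<open>K \<mapsto> x\<^sup>m\<close>.
  Where the subtraction below truncates, the coefficient in front of \<open>g\<close> is zero.
\<close>

type_synonym 'a vec = "int \<times> nat \<times> nat \<Rightarrow> 'a"

definition op_E :: "'a::field \<Rightarrow> 'a vec \<Rightarrow> 'a vec" where
  "op_E x g = (\<lambda>(m, i, j). qnum x (int j) * g (m, i, j - 1) + qnum x (m + 2 * int j - int i) * g (m, i + 1, j))"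

definition op_F :: "'a::field \<Rightarrow> 'a vec \<Rightarrow> 'a vec" where
  "op_F x g = (\<lambda>(m, i, j). qnum x (int i) * g (m, i - 1, j))"

definition op_K :: "'a::field \<Rightarrow> int \<Rightarrow> 'a vec \<Rightarrow> 'a vec" where
  "op_K x s g = (\<lambda>(m, i, j). x powi (s * (m + 2 * int j - 2 * int i)) * g (m, i, j))"

text \<open>The formula E^(n) F^(r) = sum over t of F^(r-t) [K; 2t-n-r over t] E^(n-t), applied to
  F^(r) E^(s) 1_m and read off at r - t = i, s + n - t = j. The binomials are a parameter:
  \<open>qbin q\<close> over Q(q), \<open>zbin\<close> at \<zeta>.\<close>

definition op_Ed :: "(int \<Rightarrow> nat \<Rightarrow> 'a::field) \<Rightarrow> nat \<Rightarrow> 'a vec \<Rightarrow> 'a vec" where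
  "op_Ed \<beta> n g = (\<lambda>(m, i, j). \<Sum>t\<le>n. \<beta> (m + 2 * int j - int i - int n + int t) t * \<beta> (int j) (n - t) * g (m, i + t, j + t - n))"

definition op_Fd :: "(int \<Rightarrow> nat \<Rightarrow> 'a::field) \<Rightarrow> nat \<Rightarrow> 'a vec \<Rightarrow> 'a vec" where
  "op_Fd \<beta> n g = (\<lambda>(m, i, j). \<beta> (int i) n * g (m, i - n, j))"

lemmas op_defs = op_E_def op_F_def op_K_def op_Ed_def op_Fd_def

lemma op_end:
  "op_E x \<in> carrier end_alg" "op_F x \<in> carrier end_alg" "op_K x s \<in> carrier end_alg"
  "op_Ed \<beta> n \<in> carrier end_alg" "op_Fd \<beta> n \<in> carrier end_alg"
  by (intro end_algI ext; simp add: op_defs algebra_simps sum.distrib sum_distrib_left split: prod.splits)+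

context qnumber
begin

lemma op_EF_aux: "qnum x (L + 1 - 1) * qnum x (a + 1) - qnum x a * qnum x (L + 1) = qnum x (L - a)"
  using qnum_exchange[of "a + 1" L a] by (simp add: algebra_simps)

text \<open>The diagonal terms differ by [L] [i+1] - [i] [L+1] = [L - i] with L = m + 2j - i, and L
  - i is the weight of F^(i) E^(j) 1_m.\<close>

lemma op_EF: "op_E x (op_F x g) y = op_F x (op_E x g) y + (op_K x 1 g y - op_K x (- 1) g y) / (x - inverse x)"
proof -
  obtain m i j where y: "y = (m, i, j)" by (cases y)
  let ?L = "m + 2 * int j - int i"
  have "op_E x (op_F x g) y = qnum x (int j) * qnum x (int i) * g (m, i - 1, j - 1) + qnum x ?L * qnum x (int i + 1) * g (m, i, j)"
    by (simp add: y op_defs add.commute)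
  moreover have "op_F x (op_E x g) y = qnum x (int i) * qnum x (int j) * g (m, i - 1, j - 1) + qnum x (int i) * qnum x (?L + 1) * g (m, i, j)"
    by (cases i) (simp_all add: y op_defs algebra_simps)
  moreover have "(op_K x 1 g y - op_K x (- 1) g y) / (x - inverse x) = qnum x (?L - int i) * g (m, i, j)"
  proof -
    have e: "m + 2 * int j - 2 * int i = ?L - int i" by simp
    show ?thesis
      by (simp only: y op_K_def prod.case e qnum_def mult_1 mult_minus_left left_diff_distrib diff_divide_distrib times_divide_eq_left)
  qed
  moreover have "qnum x ?L * qnum x (int i + 1) - qnum x (int i) * qnum x (?L + 1) = qnum x (?L - int i)"
    using op_EF_aux[of ?L "int i"] by simp
  then have "qnum x ?L * qnum x (int i + 1) * g (m, i, j) = (qnum x (int i) * qnum x (?L + 1) + qnum x (?L - int i)) * g (m, i, j)"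
    by (simp add: algebra_simps)
  ultimately show ?thesis by (simp add: distrib_right)
qed

lemma op_KK: "op_K x s (op_K x (- s) g) = g"
proof (rule ext)
  fix y :: "int \<times> nat \<times> nat"
  obtain m i j where y: "y = (m, i, j)" by (cases y)
  show "op_K x s (op_K x (- s) g) y = g y"
    using nz by (simp add: y op_K_def power_int_minus)
qed

lemma op_KEK: "op_K x 1 (op_E x (op_K x (- 1) g)) = (\<lambda>y. x\<^sup>2 * op_E x g y)"
proof (rule ext)
  fix y :: "int \<times> nat \<times> nat"
  obtain m i j where y: "y = (m, i, j)" by (cases y)
  have p: "x powi (m + 2 * int j - 2 * int i) * x powi (- (m + 2 * int j - 2 * int i - 2)) = x\<^sup>2"
    using nz power_int_add[of x "m + 2 * int j - 2 * int i" "- (m + 2 * int j - 2 * int i - 2)"] by simp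
  have 1: "qnum x (int j) * x powi (- (m + 2 * int (j - 1) - 2 * int i)) = qnum x (int j) * x powi (- (m + 2 * int j - 2 * int i - 2))"
    by (cases j) (simp_all add: algebra_simps)
  have 2: "m + 2 * int j - 2 * int (i + 1) = m + 2 * int j - 2 * int i - 2" by simp
  have "op_K x 1 (op_E x (op_K x (- 1) g)) y = x powi (m + 2 * int j - 2 * int i) *
    (qnum x (int j) * x powi (- (m + 2 * int (j - 1) - 2 * int i)) * g (m, i, j - 1)
     + qnum x (m + 2 * int j - int i) * x powi (- (m + 2 * int j - 2 * int (i + 1))) * g (m, i + 1, j))"
    by (simp only: y op_K_def op_E_def prod.case mult_1 mult_minus_left mult.assoc)
  also have "\<dots> = (x powi (m + 2 * int j - 2 * int i) * x powi (- (m + 2 * int j - 2 * int i - 2))) * op_E x g y"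
    unfolding 1 2 by (simp only: y op_E_def prod.case) (simp only: algebra_simps)
  finally show "op_K x 1 (op_E x (op_K x (- 1) g)) y = x\<^sup>2 * op_E x g y"
    unfolding p .
qed

lemma op_KFK: "op_K x 1 (op_F x (op_K x (- 1) g)) = (\<lambda>y. (inverse x)\<^sup>2 * op_F x g y)"
proof (rule ext)
  fix y :: "int \<times> nat \<times> nat"
  obtain m i j where y: "y = (m, i, j)" by (cases y)
  have p: "x powi (m + 2 * int j - 2 * int i) * x powi (- (m + 2 * int j - 2 * int i + 2)) = (inverse x)\<^sup>2"
    using nz power_int_add[of x "m + 2 * int j - 2 * int i" "- (m + 2 * int j - 2 * int i + 2)"] power_int_minus[of x 2]
    by (simp add: power_inverse)
  have 1: "qnum x (int i) * x powi (- (m + 2 * int j - 2 * int (i - 1))) = qnum x (int i) * x powi (- (m + 2 * int j - 2 * int i + 2))"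
    by (cases i) (simp_all add: algebra_simps)
  have "op_K x 1 (op_F x (op_K x (- 1) g)) y = x powi (m + 2 * int j - 2 * int i) *
    (qnum x (int i) * x powi (- (m + 2 * int j - 2 * int (i - 1))) * g (m, i - 1, j))"
    by (simp only: y op_K_def op_F_def prod.case mult_1 mult_minus_left mult.assoc)
  also have "\<dots> = (x powi (m + 2 * int j - 2 * int i) * x powi (- (m + 2 * int j - 2 * int i + 2))) * op_F x g y"
    unfolding 1 by (simp only: y op_F_def prod.case) (simp only: algebra_simps)
  finally show "op_K x 1 (op_F x (op_K x (- 1) g)) y = (inverse x)\<^sup>2 * op_F x g y"
    unfolding p .
qed

lemma qnum_qbin_pred:
  assumes "qnum x (int n + 1) \<noteq> 0" "j > 0"
  shows "qnum x (int j) * qbin x (int (j - 1)) n = qnum x (int n + 1) * qbin x (int j) (Suc n)"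
  using assms qfalling_Suc'[of "int (j - 1)" n] by (simp add: qbin_def qnum_fact_Suc of_nat_diff)

lemma op_F_Fd:
  assumes "qnum x (int n + 1) \<noteq> 0"
  shows "op_F x (op_Fd (qbin x) n g) y = qnum x (int n + 1) * op_Fd (qbin x) (Suc n) g y"
proof -
  obtain m i j where y: "y = (m, i, j)" by (cases y)
  show ?thesis
  proof (cases "i = 0")
    case True
    then show ?thesis by (simp add: y op_defs qbin_0_Suc)
  next
    case False
    then show ?thesis
      using qnum_qbin_pred[OF assms, of i] by (simp add: y op_defs mult.assoc[symmetric])
  qed
qed

text \<open>The counterpart of E E^(n) = [n+1] E^(n+1). The two terms of \<open>op_E\<close> feed
  the indices t and t + 1 of the sum; once they are aligned, the coefficients agree term by term
  through \<open>qbin_exchange\<close>.\<close>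

lemma op_E_Ed:
  assumes nz': "\<And>n. qnum_fact x n \<noteq> 0"
  shows "op_E x (op_Ed (qbin x) n g) y = qnum x (int n + 1) * op_Ed (qbin x) (Suc n) g y"
proof -
  obtain m i j where y: "y = (m, i, j)" by (cases y)
  have nzq: "qnum x (int s + 1) \<noteq> 0" for s using nz'[of "Suc s"] by (simp add: qnum_fact_Suc)
  let ?L = "m + 2 * int j - int i"
  \<comment> \<open>The factor common to both sides; it is 0 where the subtraction in its last
    argument truncates.\<close>
  define B where "B t = qbin x (int j) (Suc n - t) * g (m, i + t, j + t - Suc n)" for t
  \<comment> \<open>The range is extended to t = Suc n, where the factor [Suc n - t] is 0.\<close>
  have 1: "qnum x (int j) * op_Ed (qbin x) n g (m, i, j - 1)
    = (\<Sum>t\<le>Suc n. qnum x (int (Suc n) - int t) * qbin x (?L - 2 - int n + int t) t * B t)"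
  proof (cases "j = 0")
    case True
    have "B t = 0" if "t \<le> n" for t using True that by (simp add: B_def qbin_0_Suc)
    then show ?thesis using True by simp
  next
    case False
    have "qnum x (int j) * (qbin x (m + 2 * int (j - 1) - int i - int n + int t) t * qbin x (int (j - 1)) (n - t) * g (m, i + t, j - 1 + t - n))
      = qnum x (int (Suc n) - int t) * qbin x (?L - 2 - int n + int t) t * B t" if "t \<le> n" for t
    proof -
      have "qnum x (int j) * (qbin x (int (j - 1)) (n - t) * c) = qnum x (int (Suc n) - int t) * (qbin x (int j) (Suc n - t) * c)" for c
        using qnum_qbin_pred[OF nzq[of "n - t"], of j] False that
        by (simp add: of_nat_diff Suc_diff_le mult.assoc[symmetric]) (simp add: algebra_simps)
      moreover have "m + 2 * int (j - 1) - int i - int n + int t = ?L - 2 - int n + int t"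
        using False by (simp add: of_nat_diff)
      moreover have "j - 1 + t - n = j + t - Suc n" using False by simp
      ultimately show ?thesis unfolding B_def
        by (simp only: mult.assoc mult.left_commute[of "qnum x (int j)"])
          (simp only: mult_ac)
    qed
    then show ?thesis by (simp add: op_Ed_def sum_distrib_left)
  qed
  have 2: "qnum x ?L * op_Ed (qbin x) n g (m, i + 1, j)
    = (\<Sum>t\<le>n. qnum x ?L * qbin x (?L - 1 - int n + int t) t * B (Suc t))"
    unfolding op_Ed_def B_def by (simp add: sum_distrib_left algebra_simps)
  have "qnum x (int n + 1) * op_Ed (qbin x) (Suc n) g y
    = (\<Sum>t\<le>Suc n. qnum x (int n + 1) * qbin x (?L - 1 - int n + int t) t * B t)"
    by (simp add: y op_Ed_def B_def sum_distrib_left algebra_simps)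
  also have "\<dots> = qnum x (int n + 1) * B 0 + (\<Sum>s\<le>n. qnum x (int n + 1) * qbin x (?L - int n + int s) (Suc s) * B (Suc s))"
    by (subst sum.atMost_Suc_shift) (simp add: algebra_simps)
  also have "\<dots> = qnum x (int n + 1) * B 0 + (\<Sum>s\<le>n. (qnum x (int n - int s) * qbin x (?L - 1 - int n + int s) (Suc s)
      + qnum x ?L * qbin x (?L - 1 - int n + int s) s) * B (Suc s))"
  proof -
    have "qnum x (int n + 1) * qbin x (?L - int n + int s) (Suc s) = qnum x (int n - int s) * qbin x (?L - 1 - int n + int s) (Suc s)
      + qnum x ?L * qbin x (?L - 1 - int n + int s) s" for s
      using qbin_exchange[OF nz', of "int n" "?L - 1 - int n + int s" s] by (simp add: algebra_simps)
    then show ?thesis by simp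
  qed
  also have "\<dots> = (\<Sum>t\<le>Suc n. qnum x (int (Suc n) - int t) * qbin x (?L - 2 - int n + int t) t * B t)
      + (\<Sum>t\<le>n. qnum x ?L * qbin x (?L - 1 - int n + int t) t * B (Suc t))"
    by (subst sum.atMost_Suc_shift) (simp add: algebra_simps sum.distrib)
  also have "\<dots> = op_E x (op_Ed (qbin x) n g) y"
    unfolding 1[symmetric] 2[symmetric] by (simp add: y op_E_def)
  finally show ?thesis by simp
qed

end

lemma op_Ed_0: "(\<And>n. \<beta> n 0 = 1) \<Longrightarrow> op_Ed \<beta> 0 g = g"
  by (auto simp: op_Ed_def)

lemma op_Fd_0: "(\<And>n. \<beta> n 0 = 1) \<Longrightarrow> op_Fd \<beta> 0 g = g"
  by (auto simp: op_Fd_def)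

definition rho_gen :: "uq_gen \<Rightarrow> ratfun vec \<Rightarrow> ratfun vec" where
  "rho_gen g = (case g of gE \<Rightarrow> op_E q | gF \<Rightarrow> op_F q | gK \<Rightarrow> op_K q 1 | gKinv \<Rightarrow> op_K q (- 1))"

lemma rho_gen_simps [simp]:
  "rho_gen gE = op_E q" "rho_gen gF = op_F q" "rho_gen gK = op_K q 1" "rho_gen gKinv = op_K q (- 1)"
  by (simp_all add: rho_gen_def)

definition rho :: "uq \<Rightarrow> ratfun vec \<Rightarrow> ratfun vec" where
  "rho = presented_lift end_alg rho_gen"

interpretation R: free_evaluation "end_alg :: (ratfun, ratfun vec \<Rightarrow> ratfun vec) module" rho_gen
proof (intro free_evaluation.intro assoc_algebra_end_alg free_evaluation_axioms.intro)
  show "rho_gen g \<in> carrier end_alg" for g by (cases g) (simp_all add: op_end)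
qed

lemma rho_rels: "p \<in> Uq_rels \<Longrightarrow> free_eval end_alg rho_gen p = \<zero>\<^bsub>end_alg\<^esub>"
proof -
  assume p: "p \<in> Uq_rels"
  have d: "free_eval end_alg rho_gen (u - v) = \<zero>\<^bsub>end_alg\<^esub>"
    if "free_eval end_alg rho_gen u = free_eval end_alg rho_gen v" for u v
    unfolding R.ev_diff that by (simp only: R.r_right_minus_eq R.ev_closed)
  have m: "free_eval end_alg rho_gen (u * v) = (\<lambda>g. free_eval end_alg rho_gen u (free_eval end_alg rho_gen v g))" for u v
    by (simp add: R.ev_mult)
  have s: "free_eval end_alg rho_gen (scal c) = (\<lambda>g y. c * g y)" for c
    by (simp add: R.ev_scal)
  have sub: "free_eval end_alg rho_gen (u - v) = (\<lambda>g y. free_eval end_alg rho_gen u g y - free_eval end_alg rho_gen v g y)" for u v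
  proof -
    have "free_eval end_alg rho_gen u = free_eval end_alg rho_gen ((u - v) + v)" by simp
    also have "\<dots> = (\<lambda>g y. free_eval end_alg rho_gen (u - v) g y + free_eval end_alg rho_gen v g y)"
      unfolding R.ev_add by simp
    finally show ?thesis by simp
  qed
  note e = m s sub R.ev_gen R.ev_one
  show ?thesis
    using p unfolding Uq_rels_def
  proof (elim insertE emptyE)
    assume "p = gen gK * gen gKinv - 1" then show ?thesis
      using q.op_KK[of 1] by (auto intro!: d simp: e)
  next
    assume "p = gen gKinv * gen gK - 1" then show ?thesis
      using q.op_KK[of "- 1"] by (auto intro!: d simp: e)
  next
    assume "p = gen gK * gen gE * gen gKinv - scal (q\<^sup>2) * gen gE" then show ?thesis
      by (auto intro!: d simp: e q.op_KEK)
  next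
    assume "p = gen gK * gen gF * gen gKinv - scal ((inverse q)\<^sup>2) * gen gF" then show ?thesis
      by (auto intro!: d simp: e q.op_KFK)
  next
    assume "p = gen gE * gen gF - gen gF * gen gE - scal (inverse (q - inverse q)) * (gen gK - gen gKinv)"
    then show ?thesis
      by (auto intro!: d ext simp: e q.op_EF divide_inverse)
  qed
qed

lemma rho_hom: "rho \<in> alg_hom base_field Uq end_alg"
  unfolding Uq_def rho_def by (rule presented_lift_hom[OF assoc_algebra_end_alg R.gens_closed rho_rels])

lemma rho_Uq_gen: "rho (Uq_gen g) = rho_gen g"
  unfolding Uq_def rho_def Uq_gen_def by (rule presented_lift_gen[OF assoc_algebra_end_alg R.gens_closed rho_rels])

interpretation rho: alg_morphism base_field Uq "end_alg :: (ratfun, ratfun vec \<Rightarrow> ratfun vec) module" rho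
  by (intro alg_morphism.intro assoc_algebra_Uq assoc_algebra_end_alg alg_morphism_axioms.intro rho_hom)

lemma rho_simps:
  "u \<in> carrier Uq \<Longrightarrow> v \<in> carrier Uq \<Longrightarrow> rho (u \<otimes>\<^bsub>Uq\<^esub> v) g = rho u (rho v g)"
  "u \<in> carrier Uq \<Longrightarrow> v \<in> carrier Uq \<Longrightarrow> rho (u \<oplus>\<^bsub>Uq\<^esub> v) g = (\<lambda>y. rho u g y + rho v g y)"
  "u \<in> carrier Uq \<Longrightarrow> rho (c \<odot>\<^bsub>Uq\<^esub> u) g = (\<lambda>y. c * rho u g y)"
  "rho \<one>\<^bsub>Uq\<^esub> g = g"
  using rho.mult[of u v] rho.add[of u v] rho.smult[of c u] rho.one by simp_all

text \<open>The recursion for divided powers holds on both sides and can be divided by [n+1], which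
  is nonzero at q. The resulting matrix entries are products of Gaussian binomials, hence
  integral.\<close>

lemma rho_divpow: "rho (divpow gE n) g = op_Ed (qbin q) n g" "rho (divpow gF n) g = op_Fd (qbin q) n g"
proof -
  have step: "rho (divpow u (Suc n)) g y = inverse (qnum q (int n + 1)) * rho_gen u (rho (divpow u n) g) y" for u n y
  proof -
    have "rho (Uq_gen u \<otimes>\<^bsub>Uq\<^esub> divpow u n) g y = qnum q (int n + 1) * rho (divpow u (Suc n)) g y"
      unfolding gen_divpow by (simp add: rho_simps)
    then show ?thesis using qnum_q_nz[of "int n + 1"] by (simp add: rho_simps rho_Uq_gen)
  qed
  show "rho (divpow gE n) g = op_Ed (qbin q) n g"
  proof (induction n)
    case 0
    then show ?case by (simp add: divpow_0 rho_simps op_Ed_0)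
  next
    case (Suc n)
    show ?case
      using qnum_q_nz[of "int n + 1"] by (intro ext) (simp add: step Suc q.op_E_Ed[OF qnum_fact_q_nz])
  qed
  show "rho (divpow gF n) g = op_Fd (qbin q) n g"
  proof (induction n)
    case 0
    then show ?case by (simp add: divpow_0 rho_simps op_Fd_0)
  next
    case (Suc n)
    show ?case
      using qnum_q_nz[of "int n + 1"] by (intro ext) (simp add: step Suc q.op_F_Fd)
  qed
qed

section \<open>Specialization of the induced modules\<close>

text \<open>The cyclic vectors 1_m of all weights m simultaneously.\<close>

definition vac :: "'a::field vec" where
  "vac = (\<lambda>(m, i, j). if i = 0 \<and> j = 0 then 1 else 0)"

context root_of_unity
begin

definition spec_vec :: "ratfun vec \<Rightarrow> 'k vec \<Rightarrow> bool" where
  "spec_vec g g' \<longleftrightarrow> (\<forall>y. spec \<zeta> (g y) (g' y))"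

text \<open>The action of u transferred to the field. \<open>T'\<close> is not claimed to be
  determined by u, since specialized vectors are only some of the vectors over the field; therefore
  only the orbit of \<open>vac\<close> is carried over below.\<close>

definition companion :: "uq \<Rightarrow> ('k vec \<Rightarrow> 'k vec) \<Rightarrow> bool" where
  "companion u T' \<longleftrightarrow> T' \<in> carrier end_alg \<and> (\<forall>g g'. spec_vec g g' \<longrightarrow> spec_vec (rho u g) (T' g'))"

lemma companion_gens:
  "companion (Uq_gen gE) (op_E \<zeta>)" "companion (Uq_gen gF) (op_F \<zeta>)"
  "companion (Uq_gen gK) (op_K \<zeta> 1)" "companion (Uq_gen gKinv) (op_K \<zeta> (- 1))"
  "companion (divpow gE n) (op_Ed zbin n)" "companion (divpow gF n) (op_Fd zbin n)"
  unfolding companion_def spec_vec_def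
  by (auto simp: op_end rho_Uq_gen rho_divpow op_defs
      intro!: spec_add spec_mult spec_sum zeta_nz spec_qnum spec_powi spec_zbin)

text \<open>The elements with a companion form a subalgebra over the Laurent polynomials, and for
  Lusztig's generators the integral matrix entries give one.\<close>

lemma companion_ex: "u \<in> UA \<Longrightarrow> \<exists>T'. companion u T'"
proof -
  interpret e: assoc_algebra base_field "end_alg :: ('k, 'k vec \<Rightarrow> 'k vec) module" by (rule assoc_algebra_end_alg)
  let ?S = "{u \<in> carrier Uq. \<exists>T'. companion u T'}"
  have "is_subalg laurent_ring Uq_over_A ?S"
    unfolding is_subalg_def
  proof (intro conjI ballI)
    have "companion \<one>\<^bsub>Uq\<^esub> \<one>\<^bsub>end_alg\<^esub>"
      using e.one_closed unfolding companion_def by (simp add: rho_simps)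
    then show "\<one>\<^bsub>Uq_over_A\<^esub> \<in> ?S" by auto
  next
    fix u v assume "u \<in> ?S" "v \<in> ?S"
    then obtain T1 T2 where uv: "u \<in> carrier Uq" "v \<in> carrier Uq" "companion u T1" "companion v T2" by auto
    have "companion (u \<oplus>\<^bsub>Uq\<^esub> v) (T1 \<oplus>\<^bsub>end_alg\<^esub> T2)"
      using uv e.a_closed[of T1 T2] unfolding companion_def
      by (auto simp: rho_simps spec_vec_def intro!: spec_add)
    then show "u \<oplus>\<^bsub>Uq_over_A\<^esub> v \<in> ?S" using uv by auto
    have "companion (u \<otimes>\<^bsub>Uq\<^esub> v) (T1 \<otimes>\<^bsub>end_alg\<^esub> T2)"
      using uv e.m_closed[of T1 T2] unfolding companion_def
      by (auto simp: rho_simps)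
    then show "u \<otimes>\<^bsub>Uq_over_A\<^esub> v \<in> ?S" using uv by auto
  next
    fix p u assume "u \<in> ?S"
    then obtain T1 where u: "u \<in> carrier Uq" "companion u T1" by auto
    have "spec \<zeta> (laurent_eval q p) (laurent_eval \<zeta> p)" by (auto simp: spec_def)
    then have "companion (laurent_eval q p \<odot>\<^bsub>Uq\<^esub> u) (laurent_eval \<zeta> p \<odot>\<^bsub>end_alg\<^esub> T1)"
      using u e.smult_closed[of "laurent_eval \<zeta> p" T1] unfolding companion_def
      by (auto simp: rho_simps spec_vec_def intro!: spec_mult zeta_nz)
    then show "p \<odot>\<^bsub>Uq_over_A\<^esub> u \<in> ?S" using u Uq.sm(1) by auto
  qed auto
  then have "subalg_gen laurent_ring Uq_over_A UA_gens \<subseteq> ?S"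
  proof (rule subalg_gen_minimal_Uq)
    show "UA_gens \<subseteq> ?S" using companion_gens by blast
  qed
  then show "u \<in> UA \<Longrightarrow> \<exists>T'. companion u T'" unfolding UA_eq by blast
qed

text \<open>u applied to \<open>vac\<close> and then specialized. It is unique and linear over the
  Laurent polynomials, so it descends to the scalar extension as \<open>hat_vec\<close>.\<close>

definition vac_image :: "uq \<Rightarrow> 'k vec" where
  "vac_image u = (SOME g. spec_vec (rho u vac) g)"

lemma spec_vac: "spec_vec vac vac"
  by (auto simp: spec_vec_def vac_def spec_0 spec_1)

lemma spec_vec_unique: "spec_vec g h \<Longrightarrow> spec_vec g h' \<Longrightarrow> h = h'"
  by (rule ext) (unfold spec_vec_def, blast intro: spec_unique)

lemma spec_vac_image: "u \<in> UA \<Longrightarrow> spec_vec (rho u vac) (vac_image u)"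
proof -
  assume "u \<in> UA"
  then obtain T' where "companion u T'" using companion_ex by blast
  then have "spec_vec (rho u vac) (T' vac)" using spec_vac by (auto simp: companion_def)
  then show ?thesis unfolding vac_image_def by (rule someI[of "spec_vec (rho u vac)"])
qed

lemma vac_image:
  assumes "u \<in> UA" "v \<in> UA"
  shows "vac_image (u \<oplus>\<^bsub>Uq\<^esub> v) = (\<lambda>y. vac_image u y + vac_image v y)"
    and "vac_image (laurent_eval q p \<odot>\<^bsub>Uq\<^esub> u) = (\<lambda>y. laurent_eval \<zeta> p * vac_image u y)"
    and "companion u T' \<Longrightarrow> vac_image (u \<otimes>\<^bsub>Uq\<^esub> v) = T' (vac_image v)"
    and "vac_image \<one>\<^bsub>Uq\<^esub> = vac"
proof -
  note s = spec_vac_image[OF assms(1)] spec_vac_image[OF assms(2)]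
  have "spec_vec (rho (u \<oplus>\<^bsub>Uq\<^esub> v) vac) (\<lambda>y. vac_image u y + vac_image v y)"
    using s assms by (auto simp: spec_vec_def rho_simps UA_closed intro: spec_add)
  then show "vac_image (u \<oplus>\<^bsub>Uq\<^esub> v) = (\<lambda>y. vac_image u y + vac_image v y)"
    using spec_vec_unique spec_vac_image[of "u \<oplus>\<^bsub>Uq\<^esub> v"] assms UA_closed by blast
  have "spec \<zeta> (laurent_eval q p) (laurent_eval \<zeta> p)" by (auto simp: spec_def)
  then have "spec_vec (rho (laurent_eval q p \<odot>\<^bsub>Uq\<^esub> u) vac) (\<lambda>y. laurent_eval \<zeta> p * vac_image u y)"
    using s assms by (auto simp: spec_vec_def rho_simps UA_closed intro!: spec_mult zeta_nz)
  then show "vac_image (laurent_eval q p \<odot>\<^bsub>Uq\<^esub> u) = (\<lambda>y. laurent_eval \<zeta> p * vac_image u y)"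
    using spec_vec_unique spec_vac_image[OF UA_closed(5)[OF assms(1)]] by blast
  show "vac_image (u \<otimes>\<^bsub>Uq\<^esub> v) = T' (vac_image v)" if "companion u T'"
  proof -
    have "spec_vec (rho (u \<otimes>\<^bsub>Uq\<^esub> v) vac) (T' (vac_image v))"
      using s that assms by (simp add: companion_def rho_simps UA_closed)
    then show ?thesis using spec_vec_unique spec_vac_image[of "u \<otimes>\<^bsub>Uq\<^esub> v"] assms UA_closed by blast
  qed
  have "spec_vec (rho \<one>\<^bsub>Uq\<^esub> vac) vac" using spec_vac by (simp add: rho_simps)
  then show "vac_image \<one>\<^bsub>Uq\<^esub> = vac"
    using spec_vec_unique spec_vac_image[of "\<one>\<^bsub>Uq\<^esub>"] UA_closed by blast
qed

definition hat_vec :: "'k uhat \<Rightarrow> 'k vec" where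
  "hat_vec = tensor_lift (add_monoid fun_space) (\<lambda>u c y. c * vac_image u y)"

lemma hat_vec_balanced: "balanced laurent_ring U_A (field_at \<zeta>) fun_space (\<lambda>u c y. c * vac_image u y)"
  by (rule balancedI) (auto simp: vac_image algebra_simps)

lemma hat_vec:
  shows "Y \<in> carrier H.T \<Longrightarrow> Y' \<in> carrier H.T \<Longrightarrow> hat_vec (Y \<oplus>\<^bsub>hat\<^esub> Y') = (\<lambda>y. hat_vec Y y + hat_vec Y' y)"
    and "u \<in> UA \<Longrightarrow> hat_vec (H.t u c) = (\<lambda>y. c * vac_image u y)"
    and "u \<in> UA \<Longrightarrow> hat_vec (ho u) = vac_image u"
proof -
  interpret F: module base_field "fun_space :: ('k, int \<times> nat \<times> nat \<Rightarrow> 'k) module" by (rule module_fun_space)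
  note * = F.abelian_group_axioms hat_vec_balanced
  show "Y \<in> carrier H.T \<Longrightarrow> Y' \<in> carrier H.T \<Longrightarrow> hat_vec (Y \<oplus>\<^bsub>hat\<^esub> Y') = (\<lambda>y. hat_vec Y y + hat_vec Y' y)"
    unfolding hat_vec_def using H.tensor_lift_add[OF *, of Y Y'] by simp
  show 1: "u \<in> UA \<Longrightarrow> hat_vec (H.t u c) = (\<lambda>y. c * vac_image u y)" for u c
    unfolding hat_vec_def using H.tensor_lift_tensor[OF *, of u c] by simp
  show "u \<in> UA \<Longrightarrow> hat_vec (ho u) = vac_image u"
    using 1[of u 1] by (simp add: ho_def)
qed

lemma hat_vec_smult: "Y \<in> carrier H.T \<Longrightarrow> hat_vec (c \<odot>\<^bsub>hat\<^esub> Y) = (\<lambda>y. c * hat_vec Y y)"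
proof (induction rule: H.tensor_induct)
  case (tensor u c')
  then show ?case by (simp add: hat_smult H.tensor_mult UA_closed hat_vec mult.assoc)
next
  case (add U V)
  then have "c \<odot>\<^bsub>hat\<^esub> U \<in> carrier H.T" "c \<odot>\<^bsub>hat\<^esub> V \<in> carrier H.T"
    using hat.smult_closed[of c U] hat.smult_closed[of c V] by simp_all
  with add show ?case
    using hat.smult_r_distr[of c U V] hat_vec(1)[of U V] hat_vec(1)[of "c \<odot>\<^bsub>hat\<^esub> U" "c \<odot>\<^bsub>hat\<^esub> V"]
    by (simp add: algebra_simps)
qed

text \<open>\<open>hat_vec\<close> is the orbit map of \<open>vac\<close>, and this is its
  equivariance. It stands in for an action of the scalar extension on vectors, which companions
  alone would not define.\<close>

lemma hat_vec_companion:
  assumes Y: "Y \<in> carrier H.T" and u: "u \<in> UA" and T': "companion u T'"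
  shows "hat_vec (ho u \<otimes>\<^bsub>hat\<^esub> Y) = T' (hat_vec Y)"
proof -
  have T: "T' \<in> carrier end_alg" using T' by (simp add: companion_def)
  show ?thesis using Y
proof (induction rule: H.tensor_induct)
  case (tensor v c)
  then show ?case
    using u T' by (simp add: ho_def H.tensor_mult hat_vec UA_closed vac_image(3)[OF u _ T'])
      (simp add: end_algD[OF T])
next
  case (add U V)
  then have "ho u \<otimes>\<^bsub>hat\<^esub> U \<in> carrier H.T" "ho u \<otimes>\<^bsub>hat\<^esub> V \<in> carrier H.T"
    using u hat.m_closed[of "ho u" U] hat.m_closed[of "ho u" V] by simp_all
  with add show ?case
    using hat.r_distr[of U V "ho u"] u T' hat_vec(1)[of U V] hat_vec(1)[of "ho u \<otimes>\<^bsub>hat\<^esub> U" "ho u \<otimes>\<^bsub>hat\<^esub> V"]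
    by (simp add: end_algD[OF T])
qed
qed

lemma hat_vec_zero: "hat_vec \<zero>\<^bsub>hat\<^esub> = (\<lambda>y. 0)"
proof -
  have "hat_vec (0 \<odot>\<^bsub>hat\<^esub> \<one>\<^bsub>hat\<^esub>) = (\<lambda>y. 0 * hat_vec \<one>\<^bsub>hat\<^esub> y)"
    using hat.one_closed by (intro hat_vec_smult) simp
  then show ?thesis using hat.smult_l_null[OF hat.one_closed] by simp
qed

text \<open>The annihilator of the image of the induced modules is an ideal which contains \<open>K\<^sup>l - 1\<close>.\<close>

lemma hat_vec_ideal:
  assumes "Y \<in> Uzeta_ideal l \<zeta>" shows "hat_vec Y = (\<lambda>y. 0)"
proof -
  \<comment> \<open>The kernel of the orbit map is in general only a left ideal; demanding zero
    after right multiplication by every \<open>V\<close> makes it two-sided.\<close>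
  let ?N = "{Y \<in> carrier hat. \<forall>V \<in> carrier hat. hat_vec (Y \<otimes>\<^bsub>hat\<^esub> V) = (\<lambda>y. 0)}"
  have lin: "hat_vec (R' \<otimes>\<^bsub>hat\<^esub> V) = (\<lambda>y. 0)" if R: "R' \<in> carrier H.T" and V: "V \<in> carrier hat" "hat_vec V = (\<lambda>y. 0)" for R' V
    using R
  proof (induction rule: hat_induct)
    case (of u)
    obtain T' where T': "companion u T'" using companion_ex[OF of] by blast
    have "T' (\<lambda>y. 0) = (\<lambda>y. 0)" using end_algD(2)[of T' 0 "\<lambda>y. 0"] T' by (simp add: companion_def)
    then show ?case using hat_vec_companion[OF _ of T', of V] V by simp
  next
    case (add U U')
    then show ?case
      using V hat.l_distr[of U U' V] hat_vec(1)[of "U \<otimes>\<^bsub>hat\<^esub> V" "U' \<otimes>\<^bsub>hat\<^esub> V"] hat.m_closed[of _ V] by simp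
  next
    case (smult c U)
    then show ?case
      using V hat.smult_mult_left[of c U V] hat_vec_smult[of "U \<otimes>\<^bsub>hat\<^esub> V" c] hat.m_closed[of U V] by simp
  qed
  have N: "ideal ?N hat"
  proof (rule idealI[OF hat.ring_axioms])
    show "subgroup ?N (add_monoid hat)"
    proof (rule group.subgroupI[OF hat.a_group])
      show "?N \<subseteq> carrier (add_monoid hat)" by auto
      have "\<zero>\<^bsub>hat\<^esub> \<in> ?N" using hat_vec_zero hat.l_null hat.zero_closed by (simp del: hat_simps)
      then show "?N \<noteq> {}" by blast
    next
      fix Y assume Y: "Y \<in> ?N"
      have "\<ominus>\<^bsub>hat\<^esub> Y \<in> ?N"
      proof -
        have "hat_vec (\<ominus>\<^bsub>hat\<^esub> Y \<otimes>\<^bsub>hat\<^esub> V) = (\<lambda>y. 0)" if V: "V \<in> carrier hat" for V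
        proof -
          have YV: "Y \<otimes>\<^bsub>hat\<^esub> V \<in> carrier hat" "Y \<in> carrier hat" using Y V hat.m_closed[of Y V] by simp_all
          have "\<ominus>\<^bsub>hat\<^esub> Y \<otimes>\<^bsub>hat\<^esub> V = (- 1) \<odot>\<^bsub>hat\<^esub> (Y \<otimes>\<^bsub>hat\<^esub> V)"
            using hat.l_minus[OF YV(2) V] field_smult(5,6)[OF assoc_algebra_Uhat YV(1)] by metis
          then show ?thesis using hat_vec_smult[of "Y \<otimes>\<^bsub>hat\<^esub> V" "- 1"] YV Y V by simp
        qed
        then show ?thesis using Y hat.a_inv_closed[of Y] by (simp del: hat_simps)
      qed
      then show "inv\<^bsub>add_monoid hat\<^esub> Y \<in> ?N" by (simp add: a_inv_def)
    next
      fix Y Y' assume "Y \<in> ?N" "Y' \<in> ?N"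
      then show "Y \<otimes>\<^bsub>add_monoid hat\<^esub> Y' \<in> ?N"
        using hat.l_distr[of Y Y'] hat_vec(1) hat.m_closed hat.a_closed[of Y Y'] by simp
    qed
  next
    fix Y R' assume Y: "Y \<in> ?N" and R: "R' \<in> carrier hat"
    show "R' \<otimes>\<^bsub>hat\<^esub> Y \<in> ?N"
    proof -
      have "hat_vec (R' \<otimes>\<^bsub>hat\<^esub> Y \<otimes>\<^bsub>hat\<^esub> V) = (\<lambda>y. 0)" if V: "V \<in> carrier hat" for V
        using lin[of R' "Y \<otimes>\<^bsub>hat\<^esub> V"] Y R V hat.m_assoc[of R' Y V] hat.m_closed[of Y V] by simp
      then show ?thesis using Y R hat.m_closed[of R' Y] by simp
    qed
    show "Y \<otimes>\<^bsub>hat\<^esub> R' \<in> ?N"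
    proof -
      have "hat_vec (Y \<otimes>\<^bsub>hat\<^esub> R' \<otimes>\<^bsub>hat\<^esub> V) = (\<lambda>y. 0)" if V: "V \<in> carrier hat" for V
        using Y R V hat.m_assoc[of Y R' V] hat.m_closed[of R' V] by simp
      then show ?thesis using Y R hat.m_closed[of Y R'] by simp
    qed
  qed
  let ?k = "ho (Uq_gen gK)"
  have k: "?k \<in> carrier hat" by (simp add: UA_divpow)
  \<comment> \<open>K is diagonal and its eigenvalues are integral powers of \<zeta>, so K^l acts as
    the identity.\<close>
  have kn: "hat_vec (?k [^]\<^bsub>hat\<^esub> n \<otimes>\<^bsub>hat\<^esub> V) (m, i, j) = (\<zeta> powi (m + 2 * int j - 2 * int i)) ^ n * hat_vec V (m, i, j)"
    if V: "V \<in> carrier hat" for n :: nat and V m i j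
  proof (induction n)
    case 0
    then show ?case using V hat.l_one[of V] by simp
  next
    case (Suc n)
    have knV: "?k [^]\<^bsub>hat\<^esub> n \<otimes>\<^bsub>hat\<^esub> V \<in> carrier hat"
      by (intro hat.m_closed hat.nat_pow_closed k V)
    have "?k [^]\<^bsub>hat\<^esub> Suc n \<otimes>\<^bsub>hat\<^esub> V = ?k \<otimes>\<^bsub>hat\<^esub> (?k [^]\<^bsub>hat\<^esub> n \<otimes>\<^bsub>hat\<^esub> V)"
      unfolding hat.nat_pow_Suc2[OF k] by (rule hat.m_assoc[OF k hat.nat_pow_closed[OF k] V])
    then have "hat_vec (?k [^]\<^bsub>hat\<^esub> Suc n \<otimes>\<^bsub>hat\<^esub> V) = op_K \<zeta> 1 (hat_vec (?k [^]\<^bsub>hat\<^esub> n \<otimes>\<^bsub>hat\<^esub> V))"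
      using hat_vec_companion[OF _ UA_divpow(3) companion_gens(3), of "?k [^]\<^bsub>hat\<^esub> n \<otimes>\<^bsub>hat\<^esub> V"] knV
      by (simp only: hat_simps(1))
    then show ?case using Suc by (simp add: op_K_def)
  qed
  have kl: "?k [^]\<^bsub>hat\<^esub> l \<ominus>\<^bsub>hat\<^esub> \<one>\<^bsub>hat\<^esub> \<in> ?N"
  proof -
    have kc: "?k [^]\<^bsub>hat\<^esub> l \<in> carrier hat" by (rule hat.nat_pow_closed[OF k])
    have "hat_vec ((?k [^]\<^bsub>hat\<^esub> l \<ominus>\<^bsub>hat\<^esub> \<one>\<^bsub>hat\<^esub>) \<otimes>\<^bsub>hat\<^esub> V) = (\<lambda>y. 0)" if V: "V \<in> carrier hat" for V
    proof -
      have m1: "(- 1) \<odot>\<^bsub>hat\<^esub> V \<in> carrier hat" by (rule field_smult(1)[OF assoc_algebra_Uhat V])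
      have "(?k [^]\<^bsub>hat\<^esub> l \<ominus>\<^bsub>hat\<^esub> \<one>\<^bsub>hat\<^esub>) \<otimes>\<^bsub>hat\<^esub> V = ?k [^]\<^bsub>hat\<^esub> l \<otimes>\<^bsub>hat\<^esub> V \<oplus>\<^bsub>hat\<^esub> (- 1) \<odot>\<^bsub>hat\<^esub> V"
        using kc V field_smult(5,6)[OF assoc_algebra_Uhat V]
        by (simp add: hat.minus_eq hat.l_distr hat.l_minus del: hat_simps)
      then have "hat_vec ((?k [^]\<^bsub>hat\<^esub> l \<ominus>\<^bsub>hat\<^esub> \<one>\<^bsub>hat\<^esub>) \<otimes>\<^bsub>hat\<^esub> V) = (\<lambda>y. hat_vec (?k [^]\<^bsub>hat\<^esub> l \<otimes>\<^bsub>hat\<^esub> V) y + (- 1) * hat_vec V y)"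
        using hat_vec(1)[of "?k [^]\<^bsub>hat\<^esub> l \<otimes>\<^bsub>hat\<^esub> V" "(- 1) \<odot>\<^bsub>hat\<^esub> V"] hat_vec_smult[of V "- 1"] m1 V hat.m_closed[OF kc V]
        by (simp only: hat_simps(1))
      moreover have "hat_vec (?k [^]\<^bsub>hat\<^esub> l \<otimes>\<^bsub>hat\<^esub> V) y = hat_vec V y" for y
      proof -
        obtain m i j where y: "y = (m, i, j)" by (cases y)
        have "(\<zeta> powi (m + 2 * int j - 2 * int i)) ^ l = (\<zeta> ^ l) powi (m + 2 * int j - 2 * int i)"
          by (simp add: power_int_mult[symmetric] mult.commute flip: power_int_of_nat)
        then show ?thesis unfolding y kn[OF V] by (simp add: zeta_l)
      qed
      ultimately show ?thesis by simp
    qed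
    then show ?thesis using hat.minus_closed[OF kc hat.one_closed] by blast
  qed
  have "Uzeta_ideal l \<zeta> \<subseteq> ?N"
    unfolding Uzeta_ideal_def by (rule hat.genideal_minimal[OF N]) (use kl in blast)
  then have "Y \<in> carrier hat" "hat_vec (Y \<otimes>\<^bsub>hat\<^esub> \<one>\<^bsub>hat\<^esub>) = (\<lambda>y. 0)"
    using assms hat.one_closed by blast+
  then show ?thesis using hat.r_one[of Y] by metis
qed

text \<open>The orbit map of \<open>vac\<close> on \<open>Uzeta\<close>; by
  \<open>hat_vec_ideal\<close> the choice of the preimage has no influence.\<close>

definition Z_vec :: "'k uzeta \<Rightarrow> 'k vec" where
  "Z_vec z = hat_vec (SOME Y. Y \<in> carrier hat \<and> \<pi> Y = z)"

lemma Z_vec_\<pi>: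
  assumes Y: "Y \<in> carrier hat" shows "Z_vec (\<pi> Y) = hat_vec Y"
proof -
  define Y' where "Y' = (SOME Y'. Y' \<in> carrier hat \<and> \<pi> Y' = \<pi> Y)"
  have Y': "Y' \<in> carrier hat" "\<pi> Y' = \<pi> Y"
    using someI[of "\<lambda>Y'. Y' \<in> carrier hat \<and> \<pi> Y' = \<pi> Y" Y] Y by (simp_all add: Y'_def)
  then have "Y' \<ominus>\<^bsub>hat\<^esub> Y \<in> Uzeta_ideal l \<zeta>"
    using hat.quotient_eq_iff_same_a_r_cos[OF Uzeta_ideal Y'(1) Y] by simp
  then have "hat_vec (Y' \<ominus>\<^bsub>hat\<^esub> Y) = (\<lambda>y. 0)" by (rule hat_vec_ideal)
  moreover have "Y' = (Y' \<ominus>\<^bsub>hat\<^esub> Y) \<oplus>\<^bsub>hat\<^esub> Y"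
    using Y Y' by (simp add: hat.minus_eq hat.a_assoc hat.l_neg del: hat_simps)
  moreover have "Y' \<ominus>\<^bsub>hat\<^esub> Y \<in> carrier hat" by (rule hat.minus_closed[OF Y'(1) Y])
  ultimately have "hat_vec Y' = hat_vec Y"
    using hat_vec(1)[of "Y' \<ominus>\<^bsub>hat\<^esub> Y" Y] Y by (metis (no_types, lifting) add_0 hat_simps(1) ext)
  then show ?thesis by (simp add: Z_vec_def Y'_def)
qed

lemma Z_vec:
  assumes "z \<in> carrier Z"
  shows "z' \<in> carrier Z \<Longrightarrow> Z_vec (z \<oplus>\<^bsub>Z\<^esub> z') = (\<lambda>y. Z_vec z y + Z_vec z' y)"
    and "Z_vec (c \<odot>\<^bsub>Z\<^esub> z) = (\<lambda>y. c * Z_vec z y)"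
    and "u \<in> UA \<Longrightarrow> companion u T' \<Longrightarrow> Z_vec (zo u \<otimes>\<^bsub>Z\<^esub> z) = T' (Z_vec z)"
proof -
  obtain Y where Y: "Y \<in> carrier hat" "z = \<pi> Y" using assms by (auto simp: carrier_Z)
  show "Z_vec (z \<oplus>\<^bsub>Z\<^esub> z') = (\<lambda>y. Z_vec z y + Z_vec z' y)" if z': "z' \<in> carrier Z"
  proof -
    obtain Y' where Y': "Y' \<in> carrier hat" "z' = \<pi> Y'" using z' by (auto simp: carrier_Z)
    have "z \<oplus>\<^bsub>Z\<^esub> z' = \<pi> (Y \<oplus>\<^bsub>hat\<^esub> Y')" using \<pi>.add[OF Y(1) Y'(1)] Y Y' by simp
    then show ?thesis using Y Y' hat.a_closed[OF Y(1) Y'(1)] hat_vec(1)[of Y Y'] by (simp add: Z_vec_\<pi>)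
  qed
  show "Z_vec (c \<odot>\<^bsub>Z\<^esub> z) = (\<lambda>y. c * Z_vec z y)"
  proof -
    have "c \<odot>\<^bsub>Z\<^esub> z = \<pi> (c \<odot>\<^bsub>hat\<^esub> Y)" using \<pi>.smult[of c Y] Y by simp
    then show ?thesis using Y hat.smult_closed[of c Y] hat_vec_smult[of Y c] by (simp add: Z_vec_\<pi>)
  qed
  show "Z_vec (zo u \<otimes>\<^bsub>Z\<^esub> z) = T' (Z_vec z)" if u: "u \<in> UA" "companion u T'"
  proof -
    have hu: "ho u \<in> carrier hat" using u by simp
    have "zo u \<otimes>\<^bsub>Z\<^esub> z = \<pi> (ho u \<otimes>\<^bsub>hat\<^esub> Y)" using \<pi>.mult[OF hu Y(1)] Y by (simp add: zo_\<pi>)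
    then show ?thesis using Y hat.m_closed[OF hu Y(1)] hat_vec_companion[OF _ u, of Y] by (simp add: Z_vec_\<pi>)
  qed
qed

lemma Z_vec_one: "Z_vec \<one>\<^bsub>Z\<^esub> = vac"
  using Z_vec_\<pi>[of "ho \<one>\<^bsub>Uq\<^esub>"] vac_image(4)[OF UA_closed(4) UA_closed(4)]
  by (simp add: zo_one[symmetric] zo_\<pi> hat_vec UA_closed)

lemma Z_vec_zero: "Z_vec \<zero>\<^bsub>Z\<^esub> = (\<lambda>y. 0)"
  using Z_vec(2)[OF Z.one_closed, of 0] Zq.sm(4)[OF Z.one_closed] by simp

end

section \<open>Leading symbols\<close>

text \<open>The degree bound is \<open>d - k\<close> in the integers: for \<open>k > d\<close> the function \<open>f\<close> vanishes.\<close>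

definition lead :: "nat \<Rightarrow> nat \<Rightarrow> (int \<Rightarrow> 'k::field_char_0) \<Rightarrow> 'k \<Rightarrow> bool" where
  "lead d k f c \<longleftrightarrow> (\<exists>P. (\<forall>n. f n = poly P (of_int n)) \<and> (\<forall>r. poly.coeff P r \<noteq> 0 \<longrightarrow> r + k \<le> d) \<and>
     c = (if k \<le> d then poly.coeff P (d - k) else 0))"

lemma lead_zero: "lead d k (\<lambda>n. 0) 0"
  unfolding lead_def by (rule exI[of _ 0]) simp

lemma lead_const: "lead d d (\<lambda>n. c) c"
proof -
  have "\<forall>r. poly.coeff [:c:] r \<noteq> 0 \<longrightarrow> r + d \<le> d" by (auto simp: coeff_pCons split: nat.splits)
  then show ?thesis unfolding lead_def by (intro exI[of _ "[:c:]"]) simp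
qed

lemma lead_add: "lead d k f c \<Longrightarrow> lead d k g c' \<Longrightarrow> lead d k (\<lambda>n. f n + g n) (c + c')"
proof -
  assume "lead d k f c" "lead d k g c'"
  then obtain P Q where P: "\<forall>n. f n = poly P (of_int n)" "\<forall>r. poly.coeff P r \<noteq> 0 \<longrightarrow> r + k \<le> d"
      "c = (if k \<le> d then poly.coeff P (d - k) else 0)"
    and Q: "\<forall>n. g n = poly Q (of_int n)" "\<forall>r. poly.coeff Q r \<noteq> 0 \<longrightarrow> r + k \<le> d"
      "c' = (if k \<le> d then poly.coeff Q (d - k) else 0)" unfolding lead_def by blast
  have "\<forall>r. poly.coeff (P + Q) r \<noteq> 0 \<longrightarrow> r + k \<le> d" using P(2) Q(2) by (metis add_0 coeff_add)
  with P Q show ?thesis unfolding lead_def by (intro exI[of _ "P + Q"]) simp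
qed

lemma lead_cmult: "lead d k f c \<Longrightarrow> lead d k (\<lambda>n. a * f n) (a * c)"
proof -
  assume "lead d k f c"
  then obtain P where P: "\<forall>n. f n = poly P (of_int n)" "\<forall>r. poly.coeff P r \<noteq> 0 \<longrightarrow> r + k \<le> d"
      "c = (if k \<le> d then poly.coeff P (d - k) else 0)" unfolding lead_def by blast
  then show ?thesis unfolding lead_def by (intro exI[of _ "Polynomial.smult a P"]) simp
qed

lemma lead_up: "lead d k f c \<Longrightarrow> lead (Suc d) k f 0"
proof -
  assume "lead d k f c"
  then obtain P where P: "\<forall>n. f n = poly P (of_int n)" "\<forall>r. poly.coeff P r \<noteq> 0 \<longrightarrow> r + k \<le> d"
    unfolding lead_def by blast
  have "k \<le> Suc d \<Longrightarrow> poly.coeff P (Suc d - k) = 0" using P(2)[rule_format, of "Suc d - k"] by auto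
  then show ?thesis using P unfolding lead_def by (intro exI[of _ P]) auto
qed

text \<open>The degree is at most d - k, strictly less than the bound d - k' at the smaller
  position, so the coefficient read there is 0.\<close>

lemma lead_lower: "lead d k f c \<Longrightarrow> k' < k \<Longrightarrow> lead d k' f 0"
proof -
  assume "lead d k f c" and k: "k' < k"
  then obtain P where P: "\<forall>n. f n = poly P (of_int n)" "\<forall>r. poly.coeff P r \<noteq> 0 \<longrightarrow> r + k \<le> d"
    unfolding lead_def by blast
  have "poly.coeff P (d - k') = 0" if "k' \<le> d"
  proof (rule ccontr)
    assume "poly.coeff P (d - k') \<noteq> 0"
    then have "d - k' + k \<le> d" using P(2) by blast
    then show False using k that by linarith
  qed
  moreover have "\<forall>r. poly.coeff P r \<noteq> 0 \<longrightarrow> r + k' \<le> d" using P(2) k by (meson add_left_mono le_trans less_imp_le)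
  ultimately show ?thesis using P unfolding lead_def by (intro exI[of _ P]) auto
qed

lemma lead_shift: "lead d k f c \<Longrightarrow> lead (Suc d) (Suc k) f c"
  unfolding lead_def by auto

text \<open>A monic linear factor raises the degree by one, keeps the leading coefficient and hides
  the constant a. This is how h acts to leading order.\<close>

lemma lead_linear: "lead d k f c \<Longrightarrow> lead (Suc d) k (\<lambda>n. (of_int n + a) * f n) c"
proof -
  assume "lead d k f c"
  then obtain P where P: "\<forall>n. f n = poly P (of_int n)" "\<forall>r. poly.coeff P r \<noteq> 0 \<longrightarrow> r + k \<le> d"
      "c = (if k \<le> d then poly.coeff P (d - k) else 0)" unfolding lead_def by blast
  let ?P = "[:a, 1:] * P"
  have c: "poly.coeff ?P r = a * poly.coeff P r + (case r of 0 \<Rightarrow> 0 | Suc r' \<Rightarrow> poly.coeff P r')" for r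
    by (simp add: coeff_pCons)
  have 1: "\<forall>n. (of_int n + a) * f n = poly ?P (of_int n)" using P(1) by (simp add: algebra_simps)
  have 2: "\<forall>r. poly.coeff ?P r \<noteq> 0 \<longrightarrow> r + k \<le> Suc d"
  proof (intro allI impI)
    fix r assume "poly.coeff ?P r \<noteq> 0"
    then have "poly.coeff P r \<noteq> 0 \<or> (\<exists>r'. r = Suc r' \<and> poly.coeff P r' \<noteq> 0)"
      unfolding c by (auto split: nat.splits)
    then show "r + k \<le> Suc d" using P(2) by fastforce
  qed
  have 3: "c = (if k \<le> Suc d then poly.coeff ?P (Suc d - k) else 0)"
  proof (cases "k \<le> d")
    case True
    have "poly.coeff P (Suc d - k) = 0" using P(2)[rule_format, of "Suc d - k"] True by auto
    then show ?thesis using True P(3) unfolding c by (simp add: Suc_diff_le)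
  next
    case False
    then have "poly.coeff P r = 0" for r using P(2)[rule_format, of r] by auto
    then have "P = 0" by (simp add: poly_eq_iff)
    then show ?thesis using False P(3) by simp
  qed
  show ?thesis unfolding lead_def using 1 2 3 by blast
qed

text \<open>In characteristic 0 the integers are infinitely many elements of the field, so a
  polynomial vanishing on them is zero.\<close>

lemma lead_unique: "lead d k (\<lambda>n. 0) c \<Longrightarrow> c = 0"
proof -
  assume "lead d k (\<lambda>n. 0) c"
  then obtain P :: "'a poly" where P: "\<forall>n. 0 = poly P (of_int n)" "c = (if k \<le> d then poly.coeff P (d - k) else 0)"
    unfolding lead_def by blast
  have "range (of_int :: int \<Rightarrow> 'a) \<subseteq> {x. poly P x = 0}" using P(1) by auto
  moreover have "infinite (range (of_int :: int \<Rightarrow> 'a))"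
    using finite_imageD[of "of_int :: int \<Rightarrow> 'a" UNIV] by (auto simp: inj_on_def infinite_UNIV_int)
  ultimately have "P = 0" using poly_roots_finite finite_subset by blast
  then show ?thesis using P(2) by simp
qed

lemma lead_sum: "finite I \<Longrightarrow> (\<And>i. i \<in> I \<Longrightarrow> lead d k (f i) (c i)) \<Longrightarrow> lead d k (\<lambda>n. \<Sum>i\<in>I. f i n) (\<Sum>i\<in>I. c i)"
  by (induction I rule: finite_induct) (simp_all add: lead_zero lead_add)

section \<open>The filtration by boxes: positions with equal quotients \<open>i div l\<close> and
  \<open>j div l\<close>\<close>

context root_of_unity
begin

text \<open>
  The filtration for which \<open>F\<^sup>(\<^sup>i\<^sup>) E\<^sup>(\<^sup>j\<^sup>) 1\<^sub>m\<close> has degree \<open>\<lfloor>i / l\<rfloor> + \<lfloor>j / l\<rfloor>\<close> and coefficients are measured by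
  their degree as polynomials in \<open>\<lfloor>m / l\<rfloor>\<close>; the small quantum group acts in degree 0.
\<close>

definition symb :: "nat \<Rightarrow> 'k vec \<Rightarrow> (int \<Rightarrow> nat \<Rightarrow> nat \<Rightarrow> 'k) \<Rightarrow> bool" where
  "symb d g s \<longleftrightarrow> (\<forall>m i j. lead d (i div l + j div l) (\<lambda>n. g (m + n * int l, i, j)) (s m i j))"

lemma symbD: "symb d g s \<Longrightarrow> k = i div l + j div l \<Longrightarrow> lead d k (\<lambda>n. g (m + n * int l, i, j)) (s m i j)"
  by (simp add: symb_def)

lemma symb_cong: "symb d g s \<Longrightarrow> (\<And>m i j. s m i j = s' m i j) \<Longrightarrow> symb d g s'"
  by (simp add: symb_def)

lemma symb_cmult: "symb d g s \<Longrightarrow> symb d (\<lambda>y. a * g y) (\<lambda>m i j. a * s m i j)"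
  by (simp add: symb_def lead_cmult)

lemma symb_up: "symb d g s \<Longrightarrow> symb (Suc d) g (\<lambda>m i j. 0)"
  unfolding symb_def using lead_up by blast

lemma symb_up': "symb d g s \<Longrightarrow> d < d' \<Longrightarrow> symb d' g (\<lambda>m i j. 0)"
proof (induction d')
  case (Suc d')
  then show ?case using symb_up by (cases "d = d'") fastforce+
qed simp

lemma symb_sum: "finite I \<Longrightarrow> (\<And>r. r \<in> I \<Longrightarrow> symb d (g r) (s r)) \<Longrightarrow> symb d (\<lambda>y. \<Sum>r\<in>I. g r y) (\<lambda>m i j. \<Sum>r\<in>I. s r m i j)"
  unfolding symb_def by (auto intro!: lead_sum)

lemma symb_zero: "symb d (\<lambda>y. 0) s \<Longrightarrow> s m i j = 0"
  unfolding symb_def using lead_unique by blast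

lemma qnum_period: "qnum \<zeta> (m + n * int l + c) = qnum \<zeta> (m + c)"
  by (rule qnum_zeta_cong) (simp add: mod_eq_dvd_iff)

text \<open>Going from j - 1 to j enters a new box only if l divides j, and then [j] = 0. Going from
  i + 1 to i leaves a box if l divides i + 1; the term then has too small a degree and drops out of
  the symbol.\<close>

lemma symb_E:
  assumes g: "symb d g s"
  shows "symb d (op_E \<zeta> g) (\<lambda>m i j. qnum \<zeta> (int j) * s m i (j - 1) +
    (if l dvd i + 1 then 0 else qnum \<zeta> (m + 2 * int j - int i) * s m (i + 1) j))"
  unfolding symb_def
proof (intro allI)
  fix m :: int and i j :: nat
  have 1: "lead d (i div l + j div l) (\<lambda>n. qnum \<zeta> (int j) * g (m + n * int l, i, j - 1)) (qnum \<zeta> (int j) * s m i (j - 1))"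
  proof (cases "l dvd j")
    case True
    then have "qnum \<zeta> (int j) = 0" by (simp add: qnum_zeta_eq_0)
    then show ?thesis using lead_zero by simp
  next
    case False
    then have "(j - 1) div l = j div l" using div_Suc[of "j - 1" l] by (cases j) (auto simp: dvd_eq_mod_eq_0)
    then show ?thesis by (intro lead_cmult symbD[OF g]) simp
  qed
  have 2: "lead d (i div l + j div l) (\<lambda>n. qnum \<zeta> (m + 2 * int j - int i) * g (m + n * int l, i + 1, j))
    (if l dvd i + 1 then 0 else qnum \<zeta> (m + 2 * int j - int i) * s m (i + 1) j)"
  proof (cases "l dvd i + 1")
    case True
    then have "(i + 1) div l = i div l + 1" by (simp add: div_Suc dvd_eq_mod_eq_0)
    moreover have "lead d ((i + 1) div l + j div l) (\<lambda>n. g (m + n * int l, i + 1, j)) (s m (i + 1) j)"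
      using g unfolding symb_def by blast
    ultimately have "lead d (i div l + j div l) (\<lambda>n. g (m + n * int l, i + 1, j)) 0"
      by (intro lead_lower) auto
    from lead_cmult[OF this] show ?thesis using True by (simp only: mult_zero_right if_True)
  next
    case False
    then have "(i + 1) div l = i div l" by (simp add: div_Suc dvd_eq_mod_eq_0)
    then have "lead d (i div l + j div l) (\<lambda>n. qnum \<zeta> (m + 2 * int j - int i) * g (m + n * int l, i + 1, j))
      (qnum \<zeta> (m + 2 * int j - int i) * s m (i + 1) j)"
      by (intro lead_cmult symbD[OF g]) simp
    then show ?thesis using False by simp
  qed
  have "qnum \<zeta> (m + n * int l + 2 * int j - int i) = qnum \<zeta> (m + 2 * int j - int i)" for n
    using qnum_period[of m n "2 * int j - int i"] by (simp add: algebra_simps)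
  then show "lead d (i div l + j div l) (\<lambda>n. op_E \<zeta> g (m + n * int l, i, j)) (qnum \<zeta> (int j) * s m i (j - 1) +
    (if l dvd i + 1 then 0 else qnum \<zeta> (m + 2 * int j - int i) * s m (i + 1) j))"
    using lead_add[OF 1 2] by (simp add: op_E_def)
qed

lemma symb_F:
  assumes g: "symb d g s"
  shows "symb d (op_F \<zeta> g) (\<lambda>m i j. qnum \<zeta> (int i) * s m (i - 1) j)"
  unfolding symb_def
proof (intro allI)
  fix m :: int and i j :: nat
  show "lead d (i div l + j div l) (\<lambda>n. op_F \<zeta> g (m + n * int l, i, j)) (qnum \<zeta> (int i) * s m (i - 1) j)"
  proof (cases "l dvd i")
    case True
    then have "qnum \<zeta> (int i) = 0" by (simp add: qnum_zeta_eq_0)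
    then show ?thesis using lead_zero by (simp add: op_F_def)
  next
    case False
    then have "(i - 1) div l = i div l" using div_Suc[of "i - 1" l] by (cases i) (auto simp: dvd_eq_mod_eq_0)
    then show ?thesis unfolding op_F_def prod.case by (intro lead_cmult symbD[OF g]) simp
  qed
qed

lemma symb_K:
  assumes g: "symb d g s"
  shows "symb d (op_K \<zeta> 1 g) (\<lambda>m i j. \<zeta> powi (m + 2 * int j - 2 * int i) * s m i j)"
  unfolding symb_def
proof (intro allI)
  fix m :: int and i j :: nat
  have "\<zeta> powi (m + n * int l + 2 * int j - 2 * int i) = \<zeta> powi (m + 2 * int j - 2 * int i)" for n
    by (rule zeta_powi_cong) (simp add: mod_eq_dvd_iff)
  then show "lead d (i div l + j div l) (\<lambda>n. op_K \<zeta> 1 g (m + n * int l, i, j)) (\<zeta> powi (m + 2 * int j - 2 * int i) * s m i j)"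
    by (simp add: op_K_def) (intro lead_cmult symbD[OF g] refl)
qed

text \<open>At \<zeta> the binomial of i over l is the floor of i / l, and the shift by l moves
  exactly one box further, which absorbs the increase of d.\<close>

lemma symb_Fd:
  assumes g: "symb d g s"
  shows "symb (Suc d) (op_Fd zbin l g) (\<lambda>m i j. of_nat (i div l) * s m (i - l) j)"
  unfolding symb_def
proof (intro allI)
  fix m :: int and i j :: nat
  have z: "zbin (int i) l = of_nat (i div l)" by (simp add: zbin_l zdiv_int[symmetric])
  show "lead (Suc d) (i div l + j div l) (\<lambda>n. op_Fd zbin l g (m + n * int l, i, j)) (of_nat (i div l) * s m (i - l) j)"
  proof (cases "i < l")
    case True
    then show ?thesis using lead_zero by (simp add: op_Fd_def z)
  next
    case False
    then have "i div l + j div l = Suc ((i - l) div l + j div l)" using l_gt_1 by (simp add: le_div_geq)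
    moreover have "lead d ((i - l) div l + j div l) (\<lambda>n. g (m + n * int l, i - l, j)) (s m (i - l) j)"
      using g unfolding symb_def by blast
    ultimately show ?thesis using lead_cmult[OF lead_shift] by (simp add: op_Fd_def z)
  qed
qed

definition op_h :: "'k vec \<Rightarrow> 'k vec" where
  "op_h g = (\<lambda>y. op_Ed zbin l (op_Fd zbin l g) y - op_Fd zbin l (op_Ed zbin l g) y)"

lemma zbin_period: "t < l \<Longrightarrow> m mod int l = m' mod int l \<Longrightarrow> zbin m t = zbin m' t"
  by (simp add: zbin_small qbin_zeta_cong[of m m'])

lemma zbin_0: "zbin n 0 = 1"
  using l_gt_1 by (simp add: zbin_small)

text \<open>Periodicity reduces j to its residue, and then the factor [0] occurs in the numerator:
  the carry condition of the quantum Lucas theorem.\<close>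

lemma zbin_carry:
  assumes t: "t < l" and j: "j mod l < t" shows "zbin (int j) t = 0"
proof -
  have "zbin (int j) t = qbin \<zeta> (int (j mod l)) t"
    using t by (simp add: zbin_small zmod_int qbin_zeta_cong[of "int j" "int j mod int l"])
  then show ?thesis using Z.qbin_small[OF j] by simp
qed

text \<open>In the sums over t for E^(l) F^(l) - F^(l) E^(l) only t = l reaches the new degree. At t
  = 0 the two coefficients cancel; for 0 < t < l they are independent of n, and a surviving term
  comes from the same box, so it has degree at most d; at t = l the difference is n plus a
  constant.\<close>

lemma symb_h:
  assumes g: "symb d g s"
  shows "symb (Suc d) (op_h g) s"
  unfolding symb_def
proof (intro allI)
  fix m :: int and i j :: nat
  let ?k = "i div l + j div l"
  define b where "b t = zbin (int j) (l - t)" for t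
  define \<tau> where "\<tau> t n = b t * (zbin (m + n * int l + 2 * int j - int i - int l + int t) t * of_nat ((i + t) div l)
      - of_nat (i div l) * zbin (m + n * int l + 2 * int j - int i + int t) t) * g (m + n * int l, i + t - l, j + t - l)" for t n
  have z: "zbin (int i) l = of_nat (i div l)" for i by (simp add: zbin_l zdiv_int[symmetric])
  \<comment> \<open>For i < l the terms with F^(l) on the left vanish because the binomial of i over
    l is 0; otherwise the subtraction i - l is exact and the two sums can be merged over t.\<close>
  have h: "op_h g (m + n * int l, i, j) = (\<Sum>t\<le>l. \<tau> t n)" for n
  proof (cases "i < l")
    case True
    then show ?thesis
      using z[of "i + _"] by (simp add: op_h_def op_Ed_def op_Fd_def \<tau>_def b_def z mult_ac flip: of_nat_add)
  next
    case False
    then have e: "m + n * int l + 2 * int j - int (i - l) - int l + int t = m + n * int l + 2 * int j - int i + int t"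
      "i - l + t = i + t - l" for t by (auto simp: of_nat_diff)
    show ?thesis
      unfolding op_h_def op_Ed_def op_Fd_def prod.case e z sum_distrib_left sum_subtractf[symmetric]
      by (intro sum.cong refl) (simp add: \<tau>_def b_def algebra_simps z flip: of_nat_add)
  qed
  have \<tau>: "lead (Suc d) ?k (\<tau> t) (if t = l then s m i j else 0)" if t: "t \<le> l" for t
  proof -
    consider "t = 0" | "0 < t" "t < l" | "t = l" using t by linarith
    then show ?thesis
    proof cases
      case 1
      then have "\<tau> t = (\<lambda>n. 0)" by (auto simp: \<tau>_def zbin_0)
      then show ?thesis using 1 l_gt_1 lead_zero by simp
    next
      case 2
      define a where "a = b t * zbin (m + 2 * int j - int i + int t) t * (of_nat ((i + t) div l) - of_nat (i div l))"
      \<comment> \<open>Below l the binomials only depend on the residue of the top entry, and the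
        top entries in the two products differ by l.\<close>
      have per: "zbin (m + n * int l + 2 * int j - int i - int l + int t) t = zbin (m + 2 * int j - int i + int t) t"
        "zbin (m + n * int l + 2 * int j - int i + int t) t = zbin (m + 2 * int j - int i + int t) t" for n
      proof -
        have "m + n * int l + 2 * int j - int i - int l + int t - (m + 2 * int j - int i + int t) = (n - 1) * int l"
          "m + n * int l + 2 * int j - int i + int t - (m + 2 * int j - int i + int t) = n * int l"
          by (simp_all add: algebra_simps)
        then show "zbin (m + n * int l + 2 * int j - int i - int l + int t) t = zbin (m + 2 * int j - int i + int t) t"
          "zbin (m + n * int l + 2 * int j - int i + int t) t = zbin (m + 2 * int j - int i + int t) t"
          using 2 by (auto intro!: zbin_period simp: mod_eq_dvd_iff)
      qed
      have eq: "\<tau> t = (\<lambda>n. a * g (m + n * int l, i + t - l, j + t - l))"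
        unfolding \<tau>_def per a_def by (simp add: algebra_simps)
      show ?thesis
      proof (cases "a = 0")
        case True
        then show ?thesis using eq 2 lead_zero by simp
      next
        case False
        then have "b t \<noteq> 0" "(i + t) div l \<noteq> i div l" by (auto simp: a_def)
        \<comment> \<open>A nonzero binomial means that j + t - l lies in the box of j. A change of
          box between i and i + t means that i + t - l lies in the box of i.\<close>
        have "\<not> j mod l < l - t" using zbin_carry[of "l - t" j] \<open>b t \<noteq> 0\<close> 2 by (auto simp: b_def)
        then have "(j + t - l) div l = j div l"
        proof -
          assume *: "\<not> j mod l < l - t"
          have "j mod l < l" using l_gt_1 by simp
          have "j + t - l = j div l * l + (j mod l + t - l)"
            using * 2 div_mult_mod_eq[of j l] by linarith
          moreover have "j mod l + t - l < l" using \<open>j mod l < l\<close> 2 by linarith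
          ultimately show ?thesis using l_gt_1 by simp
        qed
        moreover have "(i + t - l) div l = i div l"
        proof -
          have "i mod l < l" using l_gt_1 by simp
          have ii: "i + t = i div l * l + (i mod l + t)" using div_mult_mod_eq[of i l] by linarith
          have "\<not> i mod l + t < l"
          proof
            assume "i mod l + t < l"
            moreover have "(a * l + b) div l = a" if "b < l" for a b using that by simp
            ultimately have "(i div l * l + (i mod l + t)) div l = i div l" by blast
            then have "(i + t) div l = i div l" by (simp only: ii[symmetric])
            then show False using \<open>(i + t) div l \<noteq> i div l\<close> by simp
          qed
          then have "i + t - l = i div l * l + (i mod l + t - l)" using ii by linarith
          moreover have "i mod l + t - l < l" using \<open>i mod l < l\<close> 2 by linarith
          ultimately show ?thesis using l_gt_1 by simp
        qed
        moreover have "lead d ((i + t - l) div l + (j + t - l) div l) (\<lambda>n. g (m + n * int l, i + t - l, j + t - l)) (s m (i + t - l) (j + t - l))"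
          using g unfolding symb_def by blast
        ultimately have "lead d ?k (\<lambda>n. g (m + n * int l, i + t - l, j + t - l)) (s m (i + t - l) (j + t - l))" by simp
        then show ?thesis unfolding eq using 2 lead_up[OF lead_cmult] by fastforce
      qed
    next
      case 3
      have D: "(m + n * int l + c) div int l = n + (m + c) div int l" for n c
      proof -
        have "m + n * int l + c = (m + c) + n * int l" by simp
        moreover have "((m + c) + n * int l) div int l = n + (m + c) div int l" using l_gt_1 by (intro div_mult_self1) simp
        ultimately show ?thesis by (simp only:)
      qed
      define D0 where "D0 = (m + (2 * int j - int i)) div int l"
      have d1: "(m + n * int l + 2 * int j - int i - int l + int l) div int l = n + D0"
        "(m + n * int l + 2 * int j - int i + int l) div int l = n + D0 + 1" for n
      proof -
        have "m + n * int l + 2 * int j - int i - int l + int l = m + n * int l + (2 * int j - int i)"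
          "m + n * int l + 2 * int j - int i + int l = m + (n + 1) * int l + (2 * int j - int i)"
          by (simp_all add: algebra_simps)
        then show "(m + n * int l + 2 * int j - int i - int l + int l) div int l = n + D0"
          "(m + n * int l + 2 * int j - int i + int l) div int l = n + D0 + 1"
          by (simp_all only: D D0_def)
      qed
      have i1: "(i + l) div l = i div l + 1" using l_gt_1 by simp
      \<comment> \<open>(n + D0)(I + 1) - I (n + D0 + 1) = n + D0 - I, where I is the floor of i /
        l.\<close>
      have "\<tau> t = (\<lambda>n. (of_int n + (of_int D0 - of_nat (i div l))) * g (m + n * int l, i, j))"
        unfolding \<tau>_def 3 zbin_l d1 i1 b_def by (simp add: zbin_0 algebra_simps)
      moreover have "lead d ?k (\<lambda>n. g (m + n * int l, i, j)) (s m i j)" using g unfolding symb_def by blast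
      ultimately show ?thesis using lead_linear 3 by simp
    qed
  qed
  have "lead (Suc d) ?k (\<lambda>n. \<Sum>t\<le>l. \<tau> t n) (\<Sum>t\<le>l. if t = l then s m i j else 0)"
    by (rule lead_sum) (use \<tau> in auto)
  then show "lead (Suc d) ?k (\<lambda>n. op_h g (m + n * int l, i, j)) (s m i j)"
    unfolding h by simp
qed

text \<open>Without factors F only t = 0 survives; E^(l) E^(lc) is a binomial times E^(lc+l), and
  the binomial of l(c+1) over l is c + 1 at \<zeta>.\<close>

lemma op_Ed_vac: "op_Ed zbin l (\<lambda>(m, i, j). if i = 0 \<and> j = l * c then a else 0)
  = (\<lambda>(m, i, j). if i = 0 \<and> j = l * Suc c then of_nat (Suc c) * a else 0)"
proof (rule ext)
  fix y :: "int \<times> nat \<times> nat"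
  obtain m i j where y: "y = (m, i, j)" by (cases y)
  have z: "zbin (int j) l = of_nat (j div l)" for j by (simp add: zbin_l zdiv_int[symmetric])
  have "op_Ed zbin l (\<lambda>(m, i, j). if i = 0 \<and> j = l * c then a else 0) y
    = (\<Sum>t\<le>l. if t = 0 then (if i = 0 \<and> j - l = l * c then of_nat (j div l) * a else 0) else 0)"
    unfolding y op_Ed_def prod.case by (intro sum.cong refl) (auto simp: zbin_0 z)
  also have "\<dots> = (if i = 0 \<and> j - l = l * c then of_nat (j div l) * a else 0)" by simp
  also have "\<dots> = (if i = 0 \<and> j = l * Suc c then of_nat (Suc c) * a else 0)"
  proof (cases "j < l")
    case True
    then show ?thesis using l_gt_1 by auto
  next
    case False
    then have "j - l = l * c \<longleftrightarrow> j = l * Suc c" by auto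
    then show ?thesis using l_gt_1 by auto
  qed
  finally show "op_Ed zbin l (\<lambda>(m, i, j). if i = 0 \<and> j = l * c then a else 0) y
    = (\<lambda>(m, i, j). if i = 0 \<and> j = l * Suc c then of_nat (Suc c) * a else 0) y"
    by (simp add: y)
qed

abbreviation "ze \<equiv> zo (divpow gE l)"
abbreviation "zf \<equiv> zo (divpow gF l)"
abbreviation "zh \<equiv> ze \<otimes>\<^bsub>Z\<^esub> zf \<ominus>\<^bsub>Z\<^esub> zf \<otimes>\<^bsub>Z\<^esub> ze"

lemma z_closed [simp]: "ze \<in> carrier Z" "zf \<in> carrier Z"
  using UA_divpow by auto

lemma Z_vec_gens:
  assumes z: "z \<in> carrier Z"
  shows "Z_vec (zE \<otimes>\<^bsub>Z\<^esub> z) = op_E \<zeta> (Z_vec z)" "Z_vec (zF \<otimes>\<^bsub>Z\<^esub> z) = op_F \<zeta> (Z_vec z)"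
    "Z_vec (zK \<otimes>\<^bsub>Z\<^esub> z) = op_K \<zeta> 1 (Z_vec z)" "Z_vec (ze \<otimes>\<^bsub>Z\<^esub> z) = op_Ed zbin l (Z_vec z)"
    "Z_vec (zf \<otimes>\<^bsub>Z\<^esub> z) = op_Fd zbin l (Z_vec z)" "Z_vec (zh \<otimes>\<^bsub>Z\<^esub> z) = op_h (Z_vec z)"
proof -
  have *: "Z_vec (zE \<otimes>\<^bsub>Z\<^esub> z) = op_E \<zeta> (Z_vec z)" "Z_vec (zF \<otimes>\<^bsub>Z\<^esub> z) = op_F \<zeta> (Z_vec z)"
    "Z_vec (zK \<otimes>\<^bsub>Z\<^esub> z) = op_K \<zeta> 1 (Z_vec z)" "Z_vec (ze \<otimes>\<^bsub>Z\<^esub> z) = op_Ed zbin l (Z_vec z)"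
    "Z_vec (zf \<otimes>\<^bsub>Z\<^esub> z) = op_Fd zbin l (Z_vec z)" if z: "z \<in> carrier Z" for z
    by (rule Z_vec(3)[OF z] UA_divpow companion_gens)+
  show "Z_vec (zE \<otimes>\<^bsub>Z\<^esub> z) = op_E \<zeta> (Z_vec z)" "Z_vec (zF \<otimes>\<^bsub>Z\<^esub> z) = op_F \<zeta> (Z_vec z)"
    "Z_vec (zK \<otimes>\<^bsub>Z\<^esub> z) = op_K \<zeta> 1 (Z_vec z)" "Z_vec (ze \<otimes>\<^bsub>Z\<^esub> z) = op_Ed zbin l (Z_vec z)"
    "Z_vec (zf \<otimes>\<^bsub>Z\<^esub> z) = op_Fd zbin l (Z_vec z)"
    by (rule *[OF z])+
  have "zh \<otimes>\<^bsub>Z\<^esub> z = ze \<otimes>\<^bsub>Z\<^esub> (zf \<otimes>\<^bsub>Z\<^esub> z) \<oplus>\<^bsub>Z\<^esub> (- 1) \<odot>\<^bsub>Z\<^esub> (zf \<otimes>\<^bsub>Z\<^esub> (ze \<otimes>\<^bsub>Z\<^esub> z))"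
    using z by (simp add: Z.minus_eq Z.l_distr Z.l_minus Z.m_assoc Zq.sm)
  then show "Z_vec (zh \<otimes>\<^bsub>Z\<^esub> z) = op_h (Z_vec z)"
    using z by (simp add: Z_vec Zq.sm(1) * op_h_def)
qed

lemma Z_vec_e: "Z_vec (ze [^]\<^bsub>Z\<^esub> c) = (\<lambda>(m, i, j). if i = 0 \<and> j = l * c then fact c else 0)"
proof (induction c)
  case 0
  then show ?case by (auto simp: Z_vec_one vac_def fun_eq_iff)
next
  case (Suc c)
  have "ze [^]\<^bsub>Z\<^esub> Suc c = ze \<otimes>\<^bsub>Z\<^esub> ze [^]\<^bsub>Z\<^esub> c" by (rule Z.nat_pow_Suc2) simp
  then show ?case using Suc by (simp only: Z_vec_gens Z.nat_pow_closed z_closed op_Ed_vac fact_Suc)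
qed

text \<open>e^c gives c! E^(lc), each h raises the degree while keeping the symbol, and the factors
  f contribute a!. The exponent b does not show in the position; it is recovered from the degree a +
  b + c.\<close>

lemma symb_mono: "symb (a + b + c) (Z_vec (zf [^]\<^bsub>Z\<^esub> a \<otimes>\<^bsub>Z\<^esub> zh [^]\<^bsub>Z\<^esub> b \<otimes>\<^bsub>Z\<^esub> ze [^]\<^bsub>Z\<^esub> c))
  (\<lambda>m i j. if i = l * a \<and> j = l * c then fact a * fact c else 0)"
proof (induction a)
  case 0
  show ?case
  proof (induction b)
    case 0
    have "lead c (i div l + j div l) (\<lambda>n. if i = 0 \<and> j = l * c then fact c else 0) (if i = 0 \<and> j = l * c then fact c else 0 :: 'k)" for i j
      using lead_const[of c "fact c"] lead_zero l_gt_1 by auto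
    moreover have "zf [^]\<^bsub>Z\<^esub> (0::nat) \<otimes>\<^bsub>Z\<^esub> zh [^]\<^bsub>Z\<^esub> (0::nat) \<otimes>\<^bsub>Z\<^esub> ze [^]\<^bsub>Z\<^esub> c = ze [^]\<^bsub>Z\<^esub> c" by simp
    ultimately show ?case unfolding symb_def by (simp only: Z_vec_e prod.case mult_0_right fact_0 mult_1 add_0) blast
  next
    case (Suc b)
    have "zh [^]\<^bsub>Z\<^esub> Suc b \<otimes>\<^bsub>Z\<^esub> ze [^]\<^bsub>Z\<^esub> c = zh \<otimes>\<^bsub>Z\<^esub> (zh [^]\<^bsub>Z\<^esub> b \<otimes>\<^bsub>Z\<^esub> ze [^]\<^bsub>Z\<^esub> c)"
      by (subst Z.nat_pow_Suc2) (simp_all add: Z.m_assoc)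
    then show ?case using symb_h[OF Suc] by (simp add: Z_vec_gens del: Z.nat_pow_Suc Group.nat_pow_Suc)
  qed
next
  case (Suc a)
  have "zf [^]\<^bsub>Z\<^esub> Suc a \<otimes>\<^bsub>Z\<^esub> zh [^]\<^bsub>Z\<^esub> b \<otimes>\<^bsub>Z\<^esub> ze [^]\<^bsub>Z\<^esub> c = zf \<otimes>\<^bsub>Z\<^esub> (zf [^]\<^bsub>Z\<^esub> a \<otimes>\<^bsub>Z\<^esub> zh [^]\<^bsub>Z\<^esub> b \<otimes>\<^bsub>Z\<^esub> ze [^]\<^bsub>Z\<^esub> c)"
    by (subst Z.nat_pow_Suc2) (simp_all add: Z.m_assoc)
  then have "symb (Suc (a + b + c)) (Z_vec (zf [^]\<^bsub>Z\<^esub> Suc a \<otimes>\<^bsub>Z\<^esub> zh [^]\<^bsub>Z\<^esub> b \<otimes>\<^bsub>Z\<^esub> ze [^]\<^bsub>Z\<^esub> c))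
    (\<lambda>m i j. of_nat (i div l) * (if i - l = l * a \<and> j = l * c then fact a * fact c else 0))"
    using symb_Fd[OF Suc] by (simp add: Z_vec_gens del: Z.nat_pow_Suc Group.nat_pow_Suc)
  then have "symb (Suc (a + b + c)) (Z_vec (zf [^]\<^bsub>Z\<^esub> Suc a \<otimes>\<^bsub>Z\<^esub> zh [^]\<^bsub>Z\<^esub> b \<otimes>\<^bsub>Z\<^esub> ze [^]\<^bsub>Z\<^esub> c))
    (\<lambda>m i j. if i = l * Suc a \<and> j = l * c then fact (Suc a) * fact c else 0)"
  proof (rule symb_cong)
    fix m :: int and i j :: nat
    show "of_nat (i div l) * (if i - l = l * a \<and> j = l * c then fact a * fact c else 0 :: 'k)
      = (if i = l * Suc a \<and> j = l * c then fact (Suc a) * fact c else 0)"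
    proof (cases "i < l")
      case True
      then show ?thesis using l_gt_1 by auto
    next
      case False
      then have "i - l = l * a \<longleftrightarrow> i = l * Suc a" by auto
      then show ?thesis using l_gt_1 by (auto simp: algebra_simps)
    qed
  qed
  then show ?case by simp
qed

text \<open>By periodicity [l c + k + 1] = [k + 1], so E and F produce the quantum factorials of k0
  and i0, as they would from position 0. K contributes a power of \<zeta> that depends on m modulo
  l.\<close>

lemma symb_qmono:
  assumes z: "z \<in> carrier Z" and s: "symb d (Z_vec z) (\<lambda>m i j. if i = l * a \<and> j = l * c then \<beta> else 0)"
  shows "symb d (Z_vec (Zq.qmono (i0, j0, k0) \<otimes>\<^bsub>Z\<^esub> z)) (\<lambda>m i j. if i = l * a + i0 \<and> j = l * c + k0
    then qnum_fact \<zeta> i0 * (\<zeta> powi (m + 2 * int k0)) ^ j0 * qnum_fact \<zeta> k0 * \<beta> else 0)"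
proof -
  have Eqn: "qnum \<zeta> (int (l * c + k) + 1) = qnum \<zeta> (int k + 1)" for c k
    by (rule qnum_zeta_cong) (simp add: mod_eq_dvd_iff)
  have E: "symb d (Z_vec (zE [^]\<^bsub>Z\<^esub> k \<otimes>\<^bsub>Z\<^esub> z)) (\<lambda>m i j. if i = l * a \<and> j = l * c + k then qnum_fact \<zeta> k * \<beta> else 0)" for k :: nat
  proof (induction k)
    case 0
    have "zE [^]\<^bsub>Z\<^esub> (0::nat) \<otimes>\<^bsub>Z\<^esub> z = z" using z by simp
    then show ?case by (simp only:) (rule symb_cong[OF s], simp)
  next
    case (Suc k)
    have "zE [^]\<^bsub>Z\<^esub> Suc k \<otimes>\<^bsub>Z\<^esub> z = zE \<otimes>\<^bsub>Z\<^esub> (zE [^]\<^bsub>Z\<^esub> k \<otimes>\<^bsub>Z\<^esub> z)"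
      using z by (subst Z.nat_pow_Suc2) (simp_all add: Z.m_assoc)
    then have e: "Z_vec (zE [^]\<^bsub>Z\<^esub> Suc k \<otimes>\<^bsub>Z\<^esub> z) = op_E \<zeta> (Z_vec (zE [^]\<^bsub>Z\<^esub> k \<otimes>\<^bsub>Z\<^esub> z))"
      using z by (simp only: Z_vec_gens Z.m_closed Z.nat_pow_closed Zq.E_closed)
    show ?case unfolding e
    proof (rule symb_cong[OF symb_E[OF Suc]])
      fix m :: int and i j :: nat
      \<comment> \<open>This term would need i + 1 = l a, which is exactly the case that
        \<open>symb_E\<close> sets to 0.\<close>
      have "(if l dvd i + 1 then 0 else qnum \<zeta> (m + 2 * int j - int i) * (if i + 1 = l * a \<and> j = l * c + k then qnum_fact \<zeta> k * \<beta> else 0)) = 0"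
        by auto
      moreover have "qnum \<zeta> (int j) * (if i = l * a \<and> j - 1 = l * c + k then qnum_fact \<zeta> k * \<beta> else 0)
        = (if i = l * a \<and> j = l * c + Suc k then qnum_fact \<zeta> (Suc k) * \<beta> else 0)"
      proof (cases j)
        case 0
        then show ?thesis by simp
      next
        case (Suc j')
        then show ?thesis using Eqn[of c k] by (auto simp: Z.qnum_fact_Suc algebra_simps)
      qed
      ultimately show "qnum \<zeta> (int j) * (if i = l * a \<and> j - 1 = l * c + k then qnum_fact \<zeta> k * \<beta> else 0) +
        (if l dvd i + 1 then 0 else qnum \<zeta> (m + 2 * int j - int i) * (if i + 1 = l * a \<and> j = l * c + k then qnum_fact \<zeta> k * \<beta> else 0))
        = (if i = l * a \<and> j = l * c + Suc k then qnum_fact \<zeta> (Suc k) * \<beta> else 0)" by (simp only: add_0_right)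
    qed
  qed
  define z1 where "z1 = zE [^]\<^bsub>Z\<^esub> k0 \<otimes>\<^bsub>Z\<^esub> z"
  have z1: "z1 \<in> carrier Z" using z by (simp add: z1_def)
  have K: "symb d (Z_vec (zK [^]\<^bsub>Z\<^esub> k \<otimes>\<^bsub>Z\<^esub> z1)) (\<lambda>m i j. if i = l * a \<and> j = l * c + k0 then (\<zeta> powi (m + 2 * int k0)) ^ k * (qnum_fact \<zeta> k0 * \<beta>) else 0)" for k :: nat
  proof (induction k)
    case 0
    have "zK [^]\<^bsub>Z\<^esub> (0::nat) \<otimes>\<^bsub>Z\<^esub> z1 = z1" using z1 by simp
    then show ?case by (simp only:) (rule symb_cong[OF E[of k0, folded z1_def]], simp)
  next
    case (Suc k)
    have "zK [^]\<^bsub>Z\<^esub> Suc k \<otimes>\<^bsub>Z\<^esub> z1 = zK \<otimes>\<^bsub>Z\<^esub> (zK [^]\<^bsub>Z\<^esub> k \<otimes>\<^bsub>Z\<^esub> z1)"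
      using z1 by (subst Z.nat_pow_Suc2) (simp_all add: Z.m_assoc)
    then have e: "Z_vec (zK [^]\<^bsub>Z\<^esub> Suc k \<otimes>\<^bsub>Z\<^esub> z1) = op_K \<zeta> 1 (Z_vec (zK [^]\<^bsub>Z\<^esub> k \<otimes>\<^bsub>Z\<^esub> z1))"
      using z1 by (simp only: Z_vec_gens Z.m_closed Z.nat_pow_closed Zq.K_closed)
    show ?case unfolding e
    proof (rule symb_cong[OF symb_K[OF Suc]])
      fix m :: int and i j :: nat
      have "\<zeta> powi (m + 2 * int (l * c + k0) - 2 * int (l * a)) = \<zeta> powi (m + 2 * int k0)"
        by (rule zeta_powi_cong) (simp add: mod_eq_dvd_iff)
      then show "\<zeta> powi (m + 2 * int j - 2 * int i) * (if i = l * a \<and> j = l * c + k0 then (\<zeta> powi (m + 2 * int k0)) ^ k * (qnum_fact \<zeta> k0 * \<beta>) else 0)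
        = (if i = l * a \<and> j = l * c + k0 then (\<zeta> powi (m + 2 * int k0)) ^ Suc k * (qnum_fact \<zeta> k0 * \<beta>) else 0)"
        by auto
    qed
  qed
  define z2 where "z2 = zK [^]\<^bsub>Z\<^esub> j0 \<otimes>\<^bsub>Z\<^esub> z1"
  have z2: "z2 \<in> carrier Z" using z1 by (simp add: z2_def)
  have F: "symb d (Z_vec (zF [^]\<^bsub>Z\<^esub> k \<otimes>\<^bsub>Z\<^esub> z2)) (\<lambda>m i j. if i = l * a + k \<and> j = l * c + k0
    then qnum_fact \<zeta> k * ((\<zeta> powi (m + 2 * int k0)) ^ j0 * (qnum_fact \<zeta> k0 * \<beta>)) else 0)" for k :: nat
  proof (induction k)
    case 0
    have "zF [^]\<^bsub>Z\<^esub> (0::nat) \<otimes>\<^bsub>Z\<^esub> z2 = z2" using z2 by simp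
    then show ?case by (simp only:) (rule symb_cong[OF K[of j0, folded z2_def]], simp)
  next
    case (Suc k)
    have "zF [^]\<^bsub>Z\<^esub> Suc k \<otimes>\<^bsub>Z\<^esub> z2 = zF \<otimes>\<^bsub>Z\<^esub> (zF [^]\<^bsub>Z\<^esub> k \<otimes>\<^bsub>Z\<^esub> z2)"
      using z2 by (subst Z.nat_pow_Suc2) (simp_all add: Z.m_assoc)
    then have e: "Z_vec (zF [^]\<^bsub>Z\<^esub> Suc k \<otimes>\<^bsub>Z\<^esub> z2) = op_F \<zeta> (Z_vec (zF [^]\<^bsub>Z\<^esub> k \<otimes>\<^bsub>Z\<^esub> z2))"
      using z2 by (simp only: Z_vec_gens Z.m_closed Z.nat_pow_closed Zq.F_closed)
    show ?case unfolding e
    proof (rule symb_cong[OF symb_F[OF Suc]])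
      fix m :: int and i j :: nat
      show "qnum \<zeta> (int i) * (if i - 1 = l * a + k \<and> j = l * c + k0 then qnum_fact \<zeta> k * ((\<zeta> powi (m + 2 * int k0)) ^ j0 * (qnum_fact \<zeta> k0 * \<beta>)) else 0)
        = (if i = l * a + Suc k \<and> j = l * c + k0 then qnum_fact \<zeta> (Suc k) * ((\<zeta> powi (m + 2 * int k0)) ^ j0 * (qnum_fact \<zeta> k0 * \<beta>)) else 0)"
      proof (cases i)
        case 0
        then show ?thesis by simp
      next
        case (Suc i')
        then show ?thesis using Eqn[of a k] by (auto simp: Z.qnum_fact_Suc algebra_simps)
      qed
    qed
  qed
  have "Zq.qmono (i0, j0, k0) \<otimes>\<^bsub>Z\<^esub> z = zF [^]\<^bsub>Z\<^esub> i0 \<otimes>\<^bsub>Z\<^esub> z2"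
    using z by (simp add: Zq.qmono_def z2_def z1_def Z.m_assoc)
  then show ?thesis by (simp only:) (rule symb_cong[OF F[of i0]], simp add: mult.assoc)
qed

text \<open>As m varies, the base runs through all l distinct powers of \<zeta>, too many roots for
  a nonzero polynomial of degree below l.\<close>

lemma zeta_vandermonde:
  assumes 0: "\<And>m::int. (\<Sum>j<l. c j * (\<zeta> powi (m + a)) ^ j) = 0" and j: "j < l"
  shows "c j = 0"
proof -
  define P where "P = (\<Sum>j<l. Polynomial.monom (c j) j)"
  have coeff: "poly.coeff P r = (if r < l then c r else 0)" for r
    by (simp add: P_def coeff_sum sum.delta)
  have deg: "degree P < l"
  proof -
    have "degree P \<le> l - 1" by (rule degree_le) (use l_gt_1 in \<open>auto simp: coeff\<close>)
    then show ?thesis using l_gt_1 by simp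
  qed
  have root: "poly P (\<zeta> powi n) = 0" for n
    using 0[of "n - a"] by (simp add: P_def poly_sum poly_monom)
  have inj: "inj_on (\<lambda>n. \<zeta> ^ n) {..<l}"
  proof (rule linorder_inj_onI)
    fix x y :: nat assume xy: "x < y" "x \<in> {..<l}" "y \<in> {..<l}"
    show "\<zeta> ^ x \<noteq> \<zeta> ^ y"
    proof
      assume "\<zeta> ^ x = \<zeta> ^ y"
      then have "\<zeta> ^ x * \<zeta> ^ (y - x) = \<zeta> ^ x * 1" using xy power_add[of \<zeta> x "y - x"] by simp
      then have "\<zeta> ^ (y - x) = 1" using zeta_nz by simp
      then show False using xy by (simp add: zeta_power_eq_1 nat_dvd_not_less)
    qed
  qed auto
  have "P = 0"
  proof (rule ccontr)
    assume P: "P \<noteq> 0"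
    have "(\<lambda>n. \<zeta> ^ n) ` {..<l} \<subseteq> {x. poly P x = 0}"
      using root[of "int _"] by auto
    then have "card ((\<lambda>n. \<zeta> ^ n) ` {..<l}) \<le> card {x. poly P x = 0}"
      using poly_roots_finite[OF P] by (rule card_mono[rotated])
    also have "\<dots> \<le> degree P" by (rule card_poly_roots_bound[OF P])
    finally show False using deg card_image[OF inj] by simp
  qed
  then show ?thesis using coeff[of j] j by simp
qed

text \<open>The position (l a + i, l c + k) determines a, i, c and k by division with remainder, and
  the total degree d then determines b. What remains at a fixed position is a sum over the exponent
  j of K, separated by its dependence on the weight.\<close>

lemma top_degree_vanish:
  fixes C :: "nat \<times> nat \<times> nat \<Rightarrow> nat \<times> nat \<times> nat \<Rightarrow> 'k"
  defines "I \<equiv> {..<l} \<times> {..<l} \<times> {..<l}"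
  defines "w \<equiv> (\<lambda>(a, b, c). zf [^]\<^bsub>Z\<^esub> a \<otimes>\<^bsub>Z\<^esub> zh [^]\<^bsub>Z\<^esub> b \<otimes>\<^bsub>Z\<^esub> ze [^]\<^bsub>Z\<^esub> (c::nat))"
  assumes M: "finite M" and deg: "\<And>a b c. (a, b, c) \<in> M \<Longrightarrow> a + b + c \<le> d"
    and 0: "\<And>y. (\<Sum>m\<in>M. \<Sum>r\<in>I. C m r * Z_vec (Zq.qmono r \<otimes>\<^bsub>Z\<^esub> w m) y) = 0"
    and top: "(a0, b0, c0) \<in> M" "a0 + b0 + c0 = d" and r: "(i0, j0, k0) \<in> I"
  shows "C (a0, b0, c0) (i0, j0, k0) = 0"
proof -
  have I: "finite I" by (simp add: I_def)
  \<comment> \<open>The symbol read in degree d: monomials of smaller degree contribute 0 to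
    it.\<close>
  define S where "S = (\<lambda>(a, b, c) (i, j, k) (n::int) i' j'. if a + b + c = d \<and> i' = l * a + i \<and> j' = l * c + k
    then qnum_fact \<zeta> i * (\<zeta> powi (n + 2 * int k)) ^ j * qnum_fact \<zeta> k * (fact a * fact c) else 0 :: 'k)"
  have S: "symb d (Z_vec (Zq.qmono r \<otimes>\<^bsub>Z\<^esub> w m)) (S m r)" if "m \<in> M" for m r
  proof -
    obtain a b c i j k where mr: "m = (a, b, c)" "r = (i, j, k)" by (cases m, cases r)
    have wc: "w m \<in> carrier Z" by (simp add: w_def mr)
    have s: "symb (a + b + c) (Z_vec (Zq.qmono r \<otimes>\<^bsub>Z\<^esub> w m)) (\<lambda>n i' j'. if i' = l * a + i \<and> j' = l * c + k
      then qnum_fact \<zeta> i * (\<zeta> powi (n + 2 * int k)) ^ j * qnum_fact \<zeta> k * (fact a * fact c) else 0)"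
      unfolding mr(2) by (rule symb_qmono[OF wc]) (use symb_mono[of a b c] in \<open>simp add: w_def mr\<close>)
    show ?thesis
    proof (cases "a + b + c = d")
      case True
      then show ?thesis using s by (simp add: S_def mr)
    next
      case False
      then have "a + b + c < d" using deg that mr by fastforce
      from symb_up'[OF s this] show ?thesis using False by (simp add: S_def mr)
    qed
  qed
  have "symb d (\<lambda>y. \<Sum>m\<in>M. \<Sum>r\<in>I. C m r * Z_vec (Zq.qmono r \<otimes>\<^bsub>Z\<^esub> w m) y)
    (\<lambda>n i j. \<Sum>m\<in>M. \<Sum>r\<in>I. C m r * S m r n i j)"
    by (intro symb_sum M I symb_cmult S)
  then have sum0: "(\<Sum>m\<in>M. \<Sum>r\<in>I. C m r * S m r n i j) = 0" for n i j
    unfolding 0 by (rule symb_zero)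
  have ik: "i0 < l" "j0 < l" "k0 < l" using r by (simp_all add: I_def)
  define \<kappa> where "\<kappa> = qnum_fact \<zeta> i0 * qnum_fact \<zeta> k0 * (fact a0 * fact c0)"
  \<comment> \<open>i0 and k0 are below l, and ordinary factorials are nonzero in characteristic
    0.\<close>
  have \<kappa>: "\<kappa> \<noteq> 0" using qnum_fact_zeta_nz ik by (simp add: \<kappa>_def)
  have "(\<Sum>j<l. (C (a0, b0, c0) (i0, j, k0) * \<kappa>) * (\<zeta> powi (n + 2 * int k0)) ^ j) = 0" for n
  proof -
    let ?i = "l * a0 + i0" and ?j = "l * c0 + k0"
    have z: "S m r n ?i ?j = 0" if "m \<in> M" "r \<in> I" "m \<noteq> (a0, b0, c0) \<or> fst r \<noteq> i0 \<or> snd (snd r) \<noteq> k0" for m r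
    proof (rule ccontr)
      obtain a b c i j k where mr: "m = (a, b, c)" "r = (i, j, k)" by (cases m, cases r)
      assume "S m r n ?i ?j \<noteq> 0"
      then have *: "a + b + c = d" "?i = l * a + i" "?j = l * c + k" by (auto simp: S_def mr split: if_splits)
      have lt: "i < l" "k < l" using that mr by (simp_all add: I_def)
      have "a = a0" "i = i0" "c = c0" "k = k0"
        using arg_cong[OF *(2), of "\<lambda>x. x div l"] arg_cong[OF *(2), of "\<lambda>x. x mod l"]
          arg_cong[OF *(3), of "\<lambda>x. x div l"] arg_cong[OF *(3), of "\<lambda>x. x mod l"] lt ik by simp_all
      then show False using that(3) * top mr by auto
    qed
    have "0 = (\<Sum>m\<in>M. \<Sum>r\<in>I. C m r * S m r n ?i ?j)" using sum0 by simp
    also have "\<dots> = (\<Sum>m\<in>{(a0, b0, c0)}. \<Sum>r\<in>I. C m r * S m r n ?i ?j)"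
      using M top z by (intro sum.mono_neutral_right) (auto intro!: sum.neutral)
    also have "\<dots> = (\<Sum>r\<in>I. C (a0, b0, c0) r * S (a0, b0, c0) r n ?i ?j)" by simp
    also have "\<dots> = (\<Sum>r\<in>(\<lambda>j. (i0, j, k0)) ` {..<l}. C (a0, b0, c0) r * S (a0, b0, c0) r n ?i ?j)"
    proof (rule sum.mono_neutral_right[OF I])
      show "(\<lambda>j. (i0, j, k0)) ` {..<l} \<subseteq> I" using ik by (auto simp: I_def)
      show "\<forall>r\<in>I - (\<lambda>j. (i0, j, k0)) ` {..<l}. C (a0, b0, c0) r * S (a0, b0, c0) r n ?i ?j = 0"
      proof
        fix r assume r: "r \<in> I - (\<lambda>j. (i0, j, k0)) ` {..<l}"
        obtain i j k where rr: "r = (i, j, k)" by (cases r)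
        have "fst r \<noteq> i0 \<or> snd (snd r) \<noteq> k0" using r by (auto simp: rr I_def)
        then show "C (a0, b0, c0) r * S (a0, b0, c0) r n ?i ?j = 0" using z[OF top(1), of r] r by simp
      qed
    qed
    also have "\<dots> = (\<Sum>j<l. C (a0, b0, c0) (i0, j, k0) * S (a0, b0, c0) (i0, j, k0) n ?i ?j)"
      by (subst sum.reindex) (auto simp: inj_on_def)
    also have "\<dots> = (\<Sum>j<l. (C (a0, b0, c0) (i0, j, k0) * \<kappa>) * (\<zeta> powi (n + 2 * int k0)) ^ j)"
      by (rule sum.cong) (use top in \<open>simp_all add: S_def \<kappa>_def mult_ac\<close>)
    finally show ?thesis by simp
  qed
  from zeta_vandermonde[OF this ik(2)] show ?thesis using \<kappa> by simp
qed

end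

text \<open>Coefficients with respect to a spanning family of \<open>N\<close> are moved into the
  factor from \<open>M\<close>. That y i vanishes outside I allows two expansions to be added over
  the union of their index sets.\<close>

lemma (in tensor_modules) tensor_expansion:
  assumes g: "\<And>i. g i \<in> carrier N" and span: "\<And>n. n \<in> carrier N \<Longrightarrow> n \<in> N.lin_span (range g)"
    and Q: "Q \<in> carrier T"
  shows "\<exists>I y. finite I \<and> (\<forall>i. y i \<in> carrier M) \<and> (\<forall>i. i \<notin> I \<longrightarrow> y i = \<zero>\<^bsub>M\<^esub>) \<and> Q = (\<Oplus>\<^bsub>T\<^esub>i\<in>I. t (y i) (g i))"
    (is "?P Q")
proof -
  have sum: "?P (V \<oplus>\<^bsub>T\<^esub> W)" if V: "?P V" and W: "?P W" for V W
  proof -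
    obtain I y where y: "finite I" "\<And>i. y i \<in> carrier M" "\<And>i. i \<notin> I \<Longrightarrow> y i = \<zero>\<^bsub>M\<^esub>" "V = (\<Oplus>\<^bsub>T\<^esub>i\<in>I. t (y i) (g i))"
      using V by blast
    obtain J z where z: "finite J" "\<And>i. z i \<in> carrier M" "\<And>i. i \<notin> J \<Longrightarrow> z i = \<zero>\<^bsub>M\<^esub>" "W = (\<Oplus>\<^bsub>T\<^esub>i\<in>J. t (z i) (g i))"
      using W by blast
    have "V = (\<Oplus>\<^bsub>T\<^esub>i\<in>I \<union> J. t (y i) (g i))" "W = (\<Oplus>\<^bsub>T\<^esub>i\<in>I \<union> J. t (z i) (g i))"
      unfolding y(4) z(4) using y(1-3) z(1-3) g
      by (intro T.add.finprod_mono_neutral_cong_left; auto simp: tensor_zero_left)+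
    then have "V \<oplus>\<^bsub>T\<^esub> W = (\<Oplus>\<^bsub>T\<^esub>i\<in>I \<union> J. t (y i) (g i) \<oplus>\<^bsub>T\<^esub> t (z i) (g i))"
      using y z g by (simp add: T.finsum_addf Pi_def)
    also have "\<dots> = (\<Oplus>\<^bsub>T\<^esub>i\<in>I \<union> J. t (y i \<oplus>\<^bsub>M\<^esub> z i) (g i))"
      using y z g by (intro T.finsum_cong') (auto simp: tensor_add_left)
    finally show ?thesis using y(1-3) z(1-3)
      by (intro exI[of _ "I \<union> J"] exI[of _ "\<lambda>i. y i \<oplus>\<^bsub>M\<^esub> z i"]) auto
  qed
  have null: "?P \<zero>\<^bsub>T\<^esub>" by (intro exI[of _ "{}"] exI[of _ "\<lambda>i. \<zero>\<^bsub>M\<^esub>"]) simp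
  have pure: "n \<in> carrier N \<and> (\<forall>x \<in> carrier M. ?P (t x n))" if "n \<in> N.lin_span (range g)" for n
    using that
  proof induction
    case zero
    have z: "t x \<zero>\<^bsub>N\<^esub> = \<zero>\<^bsub>T\<^esub>" if "x \<in> carrier M" for x
      using tensor_balanced[of "\<zero>" x "\<zero>\<^bsub>N\<^esub>"] that by (simp add: tensor_zero_left)
    then show ?case using null z by simp
  next
    case (incl n)
    then obtain j where n: "n = g j" by blast
    have "?P (t x n)" if x: "x \<in> carrier M" for x
    proof (intro exI[of _ "{j}"] exI[of _ "\<lambda>i. if i = j then x else \<zero>\<^bsub>M\<^esub>"] conjI)
      show "t x n = (\<Oplus>\<^bsub>T\<^esub>i\<in>{j}. t (if i = j then x else \<zero>\<^bsub>M\<^esub>) (g i))"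
        using x g by (simp add: T.finsum_insert n)
    qed (use x in auto)
    then show ?case using g n by blast
  next
    case (add n n')
    then show ?case using sum by (simp add: tensor_add_right)
  next
    case (smult r n)
    then show ?case by (simp add: tensor_balanced[symmetric])
  qed
  show ?thesis using Q
  proof (induction rule: tensor_induct)
    case (tensor x n)
    show ?case by (rule bspec[OF conjunct2[OF pure[OF span[OF tensor(2)]]] tensor(1)])
  next
    case (add V W)
    show ?case by (rule sum[OF add(3,4)])
  qed
qed

text \<open>Meant for \<phi> that evaluates the orbit map at a single position.\<close>

lemma (in abelian_group) additive_finsum:
  fixes \<phi> :: "'a \<Rightarrow> 'k::ab_group_add"
  assumes add: "\<And>x y. x \<in> carrier G \<Longrightarrow> y \<in> carrier G \<Longrightarrow> \<phi> (x \<oplus> y) = \<phi> x + \<phi> y"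
    and f: "f \<in> I \<rightarrow> carrier G" and I: "finite I"
  shows "\<phi> (\<Oplus>i\<in>I. f i) = (\<Sum>i\<in>I. \<phi> (f i))"
  using I f
proof (induction I)
  case empty
  then show ?case using add[of \<zero> \<zero>] by simp
next
  case (insert i I)
  then show ?case by (simp add: finsum_insert Pi_def finsum_closed add)
qed

section \<open>Verification of the hypotheses of the smash product theorem\<close>

context root_of_unity
begin

lemma small_expansion:
  assumes "y \<in> small"
  shows "\<exists>c. y = (\<Oplus>\<^bsub>Z\<^esub>r\<in>{..<l} \<times> {..<l} \<times> {..<l}. c r \<odot>\<^bsub>Z\<^esub> Zq.qmono r)"
proof -
  have l: "l > 0" using l_gt_1 by simp
  have "zE [^]\<^bsub>Z\<^esub> l = \<zero>\<^bsub>Z\<^esub>" "zF [^]\<^bsub>Z\<^esub> l = \<zero>\<^bsub>Z\<^esub>" using zo_gen_l by auto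
  from Zq.small_span[OF l zK_l this assms]
  have "y \<in> Z.lin_span (Zq.qmono ` ({..<l} \<times> {..<l} \<times> {..<l}))" .
  from Z.lin_span_finite[OF _ _ this] show ?thesis by auto
qed

text \<open>The value at h is forced by h = [e, f]. Commutators with it preserve the small algebra
  by the Jacobi identity [[e, f], a] = [e, [f, a]] - [f, [e, a]].\<close>

lemma uzeta_smash:
  assumes \<gamma>: "\<gamma> \<in> alg_hom base_field Usl2 Z" and e: "\<gamma> (Usl2_gen e_sl2) = ze" and f: "\<gamma> (Usl2_gen f_sl2) = zf"
  shows "sl2_smash Z \<gamma> small" "\<gamma> (Usl2_gen h_sl2) = zh"
proof -
  interpret g: alg_morphism base_field Usl2 Z \<gamma> by unfold_locales (rule \<gamma>)
  have "Usl2_gen e_sl2 \<otimes>\<^bsub>Usl2\<^esub> Usl2_gen f_sl2 = Usl2_gen f_sl2 \<otimes>\<^bsub>Usl2\<^esub> Usl2_gen e_sl2 \<oplus>\<^bsub>Usl2\<^esub> (Usl2_gen h_sl2 :: 'k usl2)"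
    using Usl2_gen_comm[of e_sl2 f_sl2, where ?'k = 'k] U.smult_l_null[of "Usl2_gen _ :: 'k usl2"] U.smult_one[of "Usl2_gen _ :: 'k usl2"]
    by (simp add: sl2_comb_def)
  from arg_cong[OF this, of \<gamma>] have "ze \<otimes>\<^bsub>Z\<^esub> zf = zf \<otimes>\<^bsub>Z\<^esub> ze \<oplus>\<^bsub>Z\<^esub> \<gamma> (Usl2_gen h_sl2)"
    by (simp add: g.mult g.add e f)
  then show h: "\<gamma> (Usl2_gen h_sl2) = zh"
    by (simp add: Z.a_comm[of "zf \<otimes>\<^bsub>Z\<^esub> ze"] Z.minus_eq Z.a_assoc Z.r_neg)
  have comm: "ze \<otimes>\<^bsub>Z\<^esub> a \<ominus>\<^bsub>Z\<^esub> a \<otimes>\<^bsub>Z\<^esub> ze \<in> small" "zf \<otimes>\<^bsub>Z\<^esub> a \<ominus>\<^bsub>Z\<^esub> a \<otimes>\<^bsub>Z\<^esub> zf \<in> small" if "a \<in> small" for a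
    using divpow_l_comm[OF _ that] by auto
  have "zh \<otimes>\<^bsub>Z\<^esub> a \<ominus>\<^bsub>Z\<^esub> a \<otimes>\<^bsub>Z\<^esub> zh \<in> small" if a: "a \<in> small" for a
  proof -
    \<comment> \<open>The mixed terms e a f and f a e cancel in the Jacobi identity; this is the
      cancellation in the shape left by rearranging the sum.\<close>
    have cancel: "u \<oplus>\<^bsub>Z\<^esub> (x \<oplus>\<^bsub>Z\<^esub> (v \<oplus>\<^bsub>Z\<^esub> (y \<oplus>\<^bsub>Z\<^esub> (\<ominus>\<^bsub>Z\<^esub> u \<oplus>\<^bsub>Z\<^esub> (\<ominus>\<^bsub>Z\<^esub> v \<oplus>\<^bsub>Z\<^esub> z))))) = x \<oplus>\<^bsub>Z\<^esub> (y \<oplus>\<^bsub>Z\<^esub> z)"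
      if c: "u \<in> carrier Z" "v \<in> carrier Z" "x \<in> carrier Z" "y \<in> carrier Z" "z \<in> carrier Z" for u v x y z
    proof -
      have "u \<oplus>\<^bsub>Z\<^esub> (x \<oplus>\<^bsub>Z\<^esub> (v \<oplus>\<^bsub>Z\<^esub> (y \<oplus>\<^bsub>Z\<^esub> (\<ominus>\<^bsub>Z\<^esub> u \<oplus>\<^bsub>Z\<^esub> (\<ominus>\<^bsub>Z\<^esub> v \<oplus>\<^bsub>Z\<^esub> z)))))
        = (u \<oplus>\<^bsub>Z\<^esub> \<ominus>\<^bsub>Z\<^esub> u) \<oplus>\<^bsub>Z\<^esub> ((v \<oplus>\<^bsub>Z\<^esub> \<ominus>\<^bsub>Z\<^esub> v) \<oplus>\<^bsub>Z\<^esub> (x \<oplus>\<^bsub>Z\<^esub> (y \<oplus>\<^bsub>Z\<^esub> z)))"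
        using c by (simp only: Z.a_ac Z.a_inv_closed Z.a_closed)
      then show ?thesis using c by (simp add: Z.r_neg)
    qed
    let ?e = "ze \<otimes>\<^bsub>Z\<^esub> a \<ominus>\<^bsub>Z\<^esub> a \<otimes>\<^bsub>Z\<^esub> ze" and ?f = "zf \<otimes>\<^bsub>Z\<^esub> a \<ominus>\<^bsub>Z\<^esub> a \<otimes>\<^bsub>Z\<^esub> zf"
    have "zh \<otimes>\<^bsub>Z\<^esub> a \<ominus>\<^bsub>Z\<^esub> a \<otimes>\<^bsub>Z\<^esub> zh = (ze \<otimes>\<^bsub>Z\<^esub> ?f \<ominus>\<^bsub>Z\<^esub> ?f \<otimes>\<^bsub>Z\<^esub> ze) \<ominus>\<^bsub>Z\<^esub> (zf \<otimes>\<^bsub>Z\<^esub> ?e \<ominus>\<^bsub>Z\<^esub> ?e \<otimes>\<^bsub>Z\<^esub> zf)"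
      using a small_closed(1)[OF a]
      by (simp add: cancel Z.minus_eq Z.l_distr Z.r_distr Z.l_minus Z.r_minus Z.minus_add Z.m_assoc Z.a_ac Z.r_neg1 Z.r_neg2)
    then show ?thesis using small_minus comm a by simp
  qed
  then have "\<gamma> (Usl2_gen x) \<otimes>\<^bsub>Z\<^esub> a \<ominus>\<^bsub>Z\<^esub> a \<otimes>\<^bsub>Z\<^esub> \<gamma> (Usl2_gen x) \<in> small" if "a \<in> small" for x a
    using comm[OF that] that by (cases x) (simp_all add: e f h)
  then show "sl2_smash Z \<gamma> small"
    by unfold_locales (simp_all add: small_subalg)
qed

text \<open>Among the nonzero coefficients y m take one of highest degree.
  \<open>top_degree_vanish\<close> makes all its coordinates along the monomials
  \<open>qmono\<close> zero, so it was zero. Any choice of coordinates will do, because only their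
  vanishing is used.\<close>

lemma uzeta_smash_inj:
  assumes \<gamma>: "\<gamma> \<in> alg_hom base_field Usl2 Z" and e: "\<gamma> (Usl2_gen e_sl2) = ze" and f: "\<gamma> (Usl2_gen f_sl2) = zf"
    and Q: "Q \<in> carrier (tensor_alg base_field (Z\<lparr>carrier := small\<rparr>) Usl2)"
    and 0: "sl2_smash.smap Z \<gamma> Q = \<zero>\<^bsub>Z\<^esub>"
  shows "Q = \<zero>\<^bsub>tensor_alg base_field (Z\<lparr>carrier := small\<rparr>) Usl2\<^esub>"
proof -
  interpret S: sl2_smash Z \<gamma> small by (rule uzeta_smash[OF \<gamma> e f])
  note h = uzeta_smash(2)[OF \<gamma> e f]
  let ?I = "{..<l} \<times> {..<l} \<times> {..<l}"
  define w where "w = (\<lambda>(a::nat, b::nat, c). zf [^]\<^bsub>Z\<^esub> a \<otimes>\<^bsub>Z\<^esub> zh [^]\<^bsub>Z\<^esub> b \<otimes>\<^bsub>Z\<^esub> ze [^]\<^bsub>Z\<^esub> (c::nat))"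
  have \<gamma>w: "\<gamma> (Usl2_mono m) = w m" for m
    by (cases m) (simp add: Usl2_mono_def w_def S.g.mult S.g.pow e f h)
  have w: "w m \<in> carrier Z" for m by (cases m) (simp add: w_def)
  have mono: "Usl2_mono m \<in> carrier (Usl2 :: ('k, 'k usl2) module)" for m
    by (cases m) (simp add: Usl2_mono_def)
  obtain M y where M: "finite M" and y: "\<And>m. y m \<in> small"
    and y0: "\<And>m. m \<notin> M \<Longrightarrow> y m = \<zero>\<^bsub>Z\<^esub>" and Qy: "Q = (\<Oplus>\<^bsub>S.AU.T\<^esub>m\<in>M. S.AU.t (y m) (Usl2_mono m))"
    using S.AU.tensor_expansion[OF mono Usl2_span Q] by auto
  define C where "C m = (SOME c. y m = (\<Oplus>\<^bsub>Z\<^esub>r\<in>?I. c r \<odot>\<^bsub>Z\<^esub> Zq.qmono r))" for m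
  have C: "y m = (\<Oplus>\<^bsub>Z\<^esub>r\<in>?I. C m r \<odot>\<^bsub>Z\<^esub> Zq.qmono r)" for m
    unfolding C_def by (fact someI_ex[OF small_expansion[OF y[of m]]])
  have Zy: "Z_vec (y m \<otimes>\<^bsub>Z\<^esub> w m) p = (\<Sum>r\<in>?I. C m r * Z_vec (Zq.qmono r \<otimes>\<^bsub>Z\<^esub> w m) p)" for m p
  proof -
    have "Z_vec (y m \<otimes>\<^bsub>Z\<^esub> w m) p = (\<Sum>r\<in>?I. Z_vec ((C m r \<odot>\<^bsub>Z\<^esub> Zq.qmono r) \<otimes>\<^bsub>Z\<^esub> w m) p)"
      unfolding C by (rule Z.additive_finsum) (auto simp: Z.l_distr w Z_vec)
    then show ?thesis by (simp add: Z.smult_mult_left w Z_vec)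
  qed
  have sum0: "(\<Sum>m\<in>M. \<Sum>r\<in>?I. C m r * Z_vec (Zq.qmono r \<otimes>\<^bsub>Z\<^esub> w m) p) = 0" for p
  proof -
    have "0 = Z_vec (S.smap Q) p" using 0 by (simp add: Z_vec_zero)
    also have "\<dots> = (\<Sum>m\<in>M. Z_vec (S.smap (S.AU.t (y m) (Usl2_mono m))) p)"
      unfolding Qy using M y mono
      by (intro S.AU.T.additive_finsum) (auto simp: S.smap Z_vec)
    also have "\<dots> = (\<Sum>m\<in>M. \<Sum>r\<in>?I. C m r * Z_vec (Zq.qmono r \<otimes>\<^bsub>Z\<^esub> w m) p)"
      using y mono by (simp add: S.smap \<gamma>w Zy)
    finally show ?thesis by simp
  qed
  \<comment> \<open>Restricting to nonzero y m ensures that the highest degree is attained by one of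
    them, so that its vanishing is a contradiction.\<close>
  define N where "N = {m \<in> M. y m \<noteq> \<zero>\<^bsub>Z\<^esub>}"
  have "N = {}"
  proof (rule ccontr)
    assume ne: "N \<noteq> {}"
    define deg where "deg = (\<lambda>(a, b, c). a + b + c :: nat)"
    have N: "finite N" using M by (simp add: N_def)
    define d where "d = Max (deg ` N)"
    have sumN: "(\<Sum>m\<in>N. \<Sum>r\<in>?I. C m r * Z_vec (Zq.qmono r \<otimes>\<^bsub>Z\<^esub> w m) p) = 0" for p
    proof -
      have "(\<Sum>r\<in>?I. C m r * Z_vec (Zq.qmono r \<otimes>\<^bsub>Z\<^esub> w m) p) = 0" if "m \<in> M - N" for m
        using that w[of m] Zy[of m p] by (simp add: N_def Z_vec_zero)
      then have "(\<Sum>m\<in>N. \<Sum>r\<in>?I. C m r * Z_vec (Zq.qmono r \<otimes>\<^bsub>Z\<^esub> w m) p) = (\<Sum>m\<in>M. \<Sum>r\<in>?I. C m r * Z_vec (Zq.qmono r \<otimes>\<^bsub>Z\<^esub> w m) p)"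
        using M by (intro sum.mono_neutral_left) (auto simp: N_def)
      then show ?thesis using sum0 by simp
    qed
    have "d \<in> deg ` N" unfolding d_def by (rule Max_in) (use N ne in auto)
    then obtain a0 b0 c0 where top: "(a0, b0, c0) \<in> N" "a0 + b0 + c0 = d" by (auto simp: deg_def)
    have degN: "a + b + c \<le> d" if "(a, b, c) \<in> N" for a b c
    proof -
      have "deg (a, b, c) \<le> d" unfolding d_def using N that by (intro Max_ge) auto
      then show ?thesis by (simp add: deg_def)
    qed
    have "C (a0, b0, c0) r = 0" if r: "r \<in> ?I" for r
    proof -
      obtain i j k where rr: "r = (i, j, k)" by (cases r)
      show ?thesis unfolding rr
        by (rule top_degree_vanish[OF N degN sumN[unfolded w_def] top r[unfolded rr]])
    qed
    then have "y (a0, b0, c0) = (\<Oplus>\<^bsub>Z\<^esub>r\<in>?I. \<zero>\<^bsub>Z\<^esub>)"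
      unfolding C by (intro Z.finsum_cong') (auto simp: Zq.sm)
    then have "y (a0, b0, c0) = \<zero>\<^bsub>Z\<^esub>" by simp
    then show False using top by (simp add: N_def)
  qed
  then have "\<And>m. m \<in> M \<Longrightarrow> y m = \<zero>\<^bsub>Z\<^esub>" by (auto simp: N_def)
  then have "Q = (\<Oplus>\<^bsub>S.AU.T\<^esub>m\<in>M. \<zero>\<^bsub>S.AU.T\<^esub>)"
    unfolding Qy using S.AU.tensor_zero_left mono by (intro S.AU.T.finsum_cong') auto
  then show ?thesis by simp
qed

end

theorem theorem1:
  fixes \<zeta> :: "'k::field_char_0" and l :: nat and \<gamma> :: "'k usl2 \<Rightarrow> 'k uzeta"
  assumes "odd l" and "l > 1" and "primitive_root_of_unity l \<zeta>"
    and "\<gamma> \<in> alg_hom base_field Usl2 (Uzeta l \<zeta>)"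
    and "\<gamma> (Usl2_gen e_sl2) = Uzeta_of l \<zeta> (divpow gE l)"
    and "\<gamma> (Usl2_gen f_sl2) = Uzeta_of l \<zeta> (divpow gF l)"
  shows "module_algebra base_field (small_uzeta l \<zeta>) Usl2
           Usl2_comult Usl2_counit (gamma_action l \<zeta> \<gamma>)
       \<and> assoc_algebra base_field (uzeta_smash l \<zeta> \<gamma>)
       \<and> assoc_algebra base_field (Uzeta l \<zeta>)
       \<and> smash_map l \<zeta> \<gamma> \<in> alg_iso base_field (uzeta_smash l \<zeta> \<gamma>) (Uzeta l \<zeta>)
       \<and> (\<forall>a \<in> carrier (small_uzeta l \<zeta>). \<forall>v \<in> carrier Usl2.
             smash_map l \<zeta> \<gamma> (tensor base_field (small_uzeta l \<zeta>) Usl2 a v)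
               = a \<otimes>\<^bsub>Uzeta l \<zeta>\<^esub> \<gamma> v)"
proof -
  interpret root_of_unity l \<zeta> by unfold_locales (use assms in auto)
  note \<gamma> = assms(4-6)
  interpret S: sl2_smash Z \<gamma> small by (rule uzeta_smash[OF \<gamma>])
  have act: "gamma_action l \<zeta> \<gamma> = S.act" by (intro ext) (simp add: gamma_action_def adjoint_action_def)
  have W: "uzeta_smash l \<zeta> \<gamma> = S.W" by (simp add: uzeta_smash_def small_uzeta_eq act)
  have map: "smash_map l \<zeta> \<gamma> = S.smap" by (simp add: smash_map_def S.smap_def)
  \<comment> \<open>The images of e and f are E^(l) and F^(l), which generate together with the
    small algebra.\<close>
  have surj: "carrier Z \<subseteq> K" if "is_subalg base_field Z K" "small \<subseteq> K" "\<gamma> ` carrier Usl2 \<subseteq> K" for K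
  proof (rule Z_generated[OF that(1,2)])
    show "ze \<in> K" "zf \<in> K" using that(3) \<gamma>(2,3) by (metis Usl2_gen_closed image_subset_iff)+
  qed
  note iso = S.smash_iso[OF uzeta_smash_inj[OF \<gamma>] surj]
  show ?thesis
    unfolding act W map small_uzeta_eq
  proof (intro conjI ballI)
    show "module_algebra base_field S.A Usl2 Usl2_comult Usl2_counit S.act" by (rule S.module_algebra)
    show "assoc_algebra base_field S.W" "S.smap \<in> alg_iso base_field S.W Z" by (rule iso; assumption)+
    show "assoc_algebra base_field Z" by (rule assoc_algebra_Uzeta)
    show "S.smap (S.AU.t a v) = a \<otimes>\<^bsub>Z\<^esub> \<gamma> v" if "a \<in> carrier S.A" "v \<in> carrier Usl2" for a v
      using that by (intro S.smap(3)) simp_all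
  qed
qed

end
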